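(* For every $x\in X$, the function $G(z)\cdot\omega(x;z)$ is holomorphic on $\mathbb{C}^n$ and $W$-invariant; in particular it belongs to $\mathbb{C}[q^{\pm z_1},\ldots,q^{\pm z_n}]^W$, where $$G(z)=\prod_{\alpha\in\Sigma^+}\frac{1+q^{\langle\alpha,z\rangle}}{1-q^{\langle\alpha,z\rangle-1}}.$$
   Context: Let $k$ be a finite extension of $\mathbb{Q}_p$, $p$ odd, $k'$ its unramified quadratic extension, $a\mapsto a^*$ the conjugation of $k'/k$ and $a^*$ also the conjugate transpose of a matrix. Let $\pi$ be a prime of $k$, $q$ the residue field cardinality of $k$, $|\cdot|$ the absolute value on $k$ with $|\pi|=q^{-1}$. Let $n\ge1$, $j_{2n+1}$ the $(2n+1)\times(2n+1)$ matrix with anti-diagonal entries $1$ and others $0$, $G=\{g\in GL_{2n+1}(k'):g^*j_{2n+1}g=j_{2n+1}\}$, $K=G\cap M_{2n+1}(\mathcal{O}_{k'})$ with normalized Haar measure $dk$, $X=\{x\in G:x^*=x,\ \det(t-xj_{2n+1})=(t^2-1)^n(t-1)\}$, $g\cdot x=gxg^*$. For $1\le i\le n$, $d_i(y)$ is the determinant of the lower right $i\times i$ block of $y$. For $x\in X$, $s\in\mathbb{C}^n$, $\omega(x;s)=\int_K\prod_{i=1}^n|d_i(k\cdot x)|^{s_i}\,dk$ (over $k$ with all $d_i(k\cdot x)\neq0$); it converges absolutely for $\mathrm{Re}(s_i)\ge0$ and continues to a rational function of $q^{s_1},\ldots,q^{s_n}$, and $\omega(x;s)$ denotes this rational function. Variables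 $z\in\mathbb{C}^n$ are related to $s$ by $s_i=-z_i+z_{i+1}-1+\frac{\pi\sqrt{-1}}{\log q}$ ($1\le i\le n-1$), $s_n=-z_n-1+\frac{\pi\sqrt{-1}}{2\log q}$, and $\omega(x;z):=\omega(x;s)$. $W$ is the group of signed permutations of coordinates (generated by permutations and $\tau(z)=(z_1,\ldots,z_{n-1},-z_n)$), acting on $\mathbb{C}^n$, $\mathbb{Z}^n$, and on functions of $z$. $\langle t,z\rangle=\sum_it_iz_i$; $\Sigma^+=\{e_i\pm e_j:1\le i<j\le n\}\cup\{2e_i:1\le i\le n\}$ with $e_i$ the unit vectors of $\mathbb{Z}^n$. *)

theory Defs
  imports "HOL-Analysis.Analysis" "Jordan_Normal_Form.Char_Poly" "HOL-Combinatorics.Permutations"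
begin

section \<open>The fields\<close>

definition padic_abs :: "nat \<Rightarrow> rat \<Rightarrow> real" where
  "padic_abs p r = (if r = 0 then 0 else
     (let (a, b) = quotient_of r in
       real p powr (real (multiplicity (int p) b) - real (multiplicity (int p) a))))"

definition is_subfield :: "'a::field set \<Rightarrow> bool" where
  "is_subfield F \<longleftrightarrow> 0 \<in> F \<and> 1 \<in> F \<and>
     (\<forall>a\<in>F. \<forall>b\<in>F. a + b \<in> F \<and> a * b \<in> F) \<and> (\<forall>a\<in>F. - a \<in> F \<and> inverse a \<in> F)"

definition field_dist :: "('a::field \<Rightarrow> real) \<Rightarrow> 'a \<Rightarrow> 'a \<Rightarrow> real" where
  "field_dist nrm a b = nrm (a - b)"

text \<open>
  The type variable \<open>'a\<close> is the big field \<open>k'\<close>; \<open>k\<close> is a subfield of it, given as a set.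
  \<open>Qp_in nrm\<close> is the closure of the rationals in \<open>k'\<close>; since it is assumed complete, it is the completion
  of the rationals for an absolute value equivalent to the \<open>p\<close>-adic one, i.e. the field of
  \<open>p\<close>-adic numbers.  (The exponent \<open>c\<close> below is forced by the normalization.)
  The function \<open>nrm\<close> is the absolute value of \<open>k\<close>, normalized at a prime \<open>uf\<close> by \<open>nrm uf = 1 / q\<close>, in its unique
  extension to \<open>k'\<close>; it is used on \<open>k'\<close> to describe the integers and the topology.
\<close>

definition Qp_in :: "('a::field_char_0 \<Rightarrow> real) \<Rightarrow> 'a set" where
  "Qp_in nrm = Metric_space.mtopology UNIV (field_dist nrm) closure_of \<rat>"

definition integers_of :: "('a::field \<Rightarrow> real) \<Rightarrow> 'a set \<Rightarrow> 'a set" where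
  "integers_of nrm F = {a \<in> F. nrm a \<le> 1}"

definition max_ideal_of :: "('a::field \<Rightarrow> real) \<Rightarrow> 'a set \<Rightarrow> 'a set" where
  "max_ideal_of nrm F = {a \<in> F. nrm a < 1}"

definition residue_field :: "('a::field \<Rightarrow> real) \<Rightarrow> 'a set \<Rightarrow> 'a set set" where
  "residue_field nrm F = integers_of nrm F //
     {(a, b). a \<in> integers_of nrm F \<and> b \<in> integers_of nrm F \<and> a - b \<in> max_ideal_of nrm F}"

locale unramified_quadratic_extension =
  fixes p q :: nat
    and k :: "'a::field_char_0 set"
    and star :: "'a \<Rightarrow> 'a"
    and nrm :: "'a \<Rightarrow> real"
    and uf :: 'a
  assumes p: "prime p" "odd p"
    and nrm_nonneg: "\<And>a. nrm a \<ge> 0"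
    and nrm_eq_0: "\<And>a. nrm a = 0 \<longleftrightarrow> a = 0"
    and nrm_mult: "\<And>a b. nrm (a * b) = nrm a * nrm b"
    and nrm_add: "\<And>a b. nrm (a + b) \<le> max (nrm a) (nrm b)"
    and nrm_rat: "\<exists>c>0. \<forall>r. nrm (of_rat r) = padic_abs p r powr c"
    and complete: "Metric_space.mcomplete (Qp_in nrm) (field_dist nrm)"
    and k_subfield: "is_subfield k"
    and k_extends: "Qp_in nrm \<subseteq> k"
    and k_finite: "\<exists>B. finite B \<and> B \<subseteq> k \<and>
          (\<forall>a\<in>k. \<exists>c. (\<forall>b\<in>B. c b \<in> Qp_in nrm) \<and> a = (\<Sum>b\<in>B. c b * b))"
    and prime_in_k: "uf \<in> k"
    and prime_generates: "max_ideal_of nrm k = (\<lambda>a. uf * a) ` integers_of nrm k"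
    and q: "q = card (residue_field nrm k)"
    and nrm_prime: "nrm uf = 1 / real q"
    and quadratic: "\<exists>\<theta>. \<theta> \<notin> k \<and> (\<forall>a. \<exists>b\<in>k. \<exists>c\<in>k. a = b + c * \<theta>)"
    and unramified: "max_ideal_of nrm UNIV = (\<lambda>a. uf * a) ` integers_of nrm UNIV"
    and star_add: "\<And>a b. star (a + b) = star a + star b"
    and star_mult: "\<And>a b. star (a * b) = star a * star b"
    and star_fixes: "\<And>a. a \<in> k \<Longrightarrow> star a = a"
    and star_nontrivial: "\<exists>a. star a \<noteq> a"

section \<open>The unitary group and the space of hermitian matrices\<close>

definition ctrans :: "('a \<Rightarrow> 'a) \<Rightarrow> 'a mat \<Rightarrow> 'a mat" where
  "ctrans star A = map_mat star (transpose_mat A)"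

text \<open>Matrix indices start at 0, so the anti-diagonal of size \<open>2 * n + 1\<close> is \<open>i + l = 2 * n\<close>.\<close>

definition jmat :: "nat \<Rightarrow> 'a::field mat" where
  "jmat n = mat (2 * n + 1) (2 * n + 1) (\<lambda>(i, l). if i + l = 2 * n then 1 else 0)"

definition unitary_group :: "('a::field \<Rightarrow> 'a) \<Rightarrow> nat \<Rightarrow> 'a mat set" where
  "unitary_group star n = {g \<in> carrier_mat (2 * n + 1) (2 * n + 1).
     invertible_mat g \<and> ctrans star g * jmat n * g = jmat n}"

definition maxcompact :: "('a::field \<Rightarrow> real) \<Rightarrow> ('a \<Rightarrow> 'a) \<Rightarrow> nat \<Rightarrow> 'a mat set" where
  "maxcompact nrm star n = {g \<in> unitary_group star n.
     \<forall>i<2 * n + 1. \<forall>l<2 * n + 1. g $$ (i, l) \<in> integers_of nrm UNIV}"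

definition hermitian_space :: "('a::field \<Rightarrow> 'a) \<Rightarrow> nat \<Rightarrow> 'a mat set" where
  "hermitian_space star n = {x \<in> unitary_group star n. ctrans star x = x \<and>
     char_poly (x * jmat n) = [:-1, 0, 1:] ^ n * [:-1, 1:]}"

definition act :: "('a::field \<Rightarrow> 'a) \<Rightarrow> 'a mat \<Rightarrow> 'a mat \<Rightarrow> 'a mat" where
  "act star g x = g * x * ctrans star g"

definition lower_right_minor :: "nat \<Rightarrow> 'a::field mat \<Rightarrow> 'a" where
  "lower_right_minor i y = Determinant.det
     (mat i i (\<lambda>(a, b). y $$ (dim_row y - i + a, dim_col y - i + b)))"

definition mat_dist :: "('a::field \<Rightarrow> real) \<Rightarrow> nat \<Rightarrow> 'a mat \<Rightarrow> 'a mat \<Rightarrow> real" where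
  "mat_dist nrm n g h = Max ((\<lambda>(i, l). nrm (g $$ (i, l) - h $$ (i, l))) `
     ({..<2 * n + 1} \<times> {..<2 * n + 1}))"

text \<open>Regularity need not be required, as \<open>maxcompact nrm star n\<close> is a compact metric space.\<close>

definition normalized_Haar ::
  "('a::field \<Rightarrow> real) \<Rightarrow> ('a \<Rightarrow> 'a) \<Rightarrow> nat \<Rightarrow> 'a mat measure \<Rightarrow> bool" where
  "normalized_Haar nrm star n dk \<longleftrightarrow>
     (let K = maxcompact nrm star n in
       space dk = K \<and>
       sets dk = sigma_sets K {U. openin (Metric_space.mtopology K (mat_dist nrm n)) U} \<and>
       emeasure dk K = 1 \<and>
       (\<forall>g\<in>K. \<forall>A\<in>sets dk. emeasure dk ((\<lambda>h. g * h) ` A) = emeasure dk A))"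

section \<open>Functions of several complex variables\<close>

text \<open>
  Points of complex \<open>n\<close>-space are functions \<open>nat \<Rightarrow> complex\<close> of which only the
  coordinates \<open>1, \<dots>, n\<close> matter; the same convention is used for integer vectors.
\<close>

definition depends_on_first :: "nat \<Rightarrow> ((nat \<Rightarrow> complex) \<Rightarrow> complex) \<Rightarrow> bool" where
  "depends_on_first n F \<longleftrightarrow> (\<forall>z z'. (\<forall>i\<in>{1..n}. z i = z' i) \<longrightarrow> F z = F z')"

definition holomorphic_n :: "nat \<Rightarrow> ((nat \<Rightarrow> complex) \<Rightarrow> complex) \<Rightarrow> bool" where
  "holomorphic_n n F \<longleftrightarrow> depends_on_first n F \<and> continuous_on UNIV F \<and>
     (\<forall>z. \<forall>i\<in>{1..n}. (\<lambda>w. F (z(i := w))) holomorphic_on UNIV)"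

definition pairing :: "nat \<Rightarrow> (nat \<Rightarrow> int) \<Rightarrow> (nat \<Rightarrow> complex) \<Rightarrow> complex" where
  "pairing n t z = (\<Sum>i\<in>{1..n}. of_int (t i) * z i)"

text \<open>The ring of Laurent polynomials in the functions \<open>q\<close> to the power \<open>z i\<close>.\<close>

definition laurent_ring :: "nat \<Rightarrow> nat \<Rightarrow> ((nat \<Rightarrow> complex) \<Rightarrow> complex) set" where
  "laurent_ring q n = {F. \<exists>S c. finite S \<and>
     F = (\<lambda>z. \<Sum>t\<in>S. c t * (of_nat q :: complex) powr pairing n t z)}"

definition signed_perms :: "nat \<Rightarrow> ((nat \<Rightarrow> complex) \<Rightarrow> (nat \<Rightarrow> complex)) set" where
  "signed_perms n = {w. \<exists>\<sigma> (\<epsilon> :: nat \<Rightarrow> complex). \<sigma> permutes {1..n} \<and> (\<forall>i\<in>{1..n}. \<epsilon> i \<in> {1, -1}) \<and>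
     w = (\<lambda>z i. if i \<in> {1..n} then \<epsilon> i * z (\<sigma> i) else z i)}"

definition W_invariant :: "nat \<Rightarrow> ((nat \<Rightarrow> complex) \<Rightarrow> complex) \<Rightarrow> bool" where
  "W_invariant n F \<longleftrightarrow> (\<forall>w\<in>signed_perms n. \<forall>z. F (w z) = F z)"

text \<open>
  Equality of meromorphic functions: \<open>f\<close> and \<open>g\<close> agree off the zero set of some nonzero element
  of the Laurent ring, a dense open set.  The values which the total functions \<open>f\<close> and \<open>g\<close> happen
  to have at their poles play no role.
\<close>

definition generically_equal ::
  "nat \<Rightarrow> nat \<Rightarrow> ((nat \<Rightarrow> complex) \<Rightarrow> complex) \<Rightarrow> ((nat \<Rightarrow> complex) \<Rightarrow> complex) \<Rightarrow> bool" where
  "generically_equal q n f g \<longleftrightarrow>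
     (\<exists>D\<in>laurent_ring q n. (\<exists>z. D z \<noteq> 0) \<and> (\<forall>z. D z \<noteq> 0 \<longrightarrow> f z = g z))"

section \<open>The spherical function\<close>

definition spherical_integral :: "('a::field \<Rightarrow> real) \<Rightarrow> ('a \<Rightarrow> 'a) \<Rightarrow> nat \<Rightarrow> 'a mat measure \<Rightarrow>
    'a mat \<Rightarrow> (nat \<Rightarrow> complex) \<Rightarrow> complex" where
  "spherical_integral nrm star n dk x s =
     set_lebesgue_integral dk
       {g \<in> maxcompact nrm star n. \<forall>i\<in>{1..n}. lower_right_minor i (act star g x) \<noteq> 0}
       (\<lambda>g. \<Prod>i\<in>{1..n}. complex_of_real (nrm (lower_right_minor i (act star g x))) powr s i)"

text \<open>
  The quotient \<open>P / Q\<close> of two Laurent polynomials in the functions \<open>q\<close> to the power \<open>s i\<close>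
  is the rational continuation of \<open>I\<close>, given on the region where all \<open>Re (s i) \<ge> 0\<close>.
\<close>

definition continued_by :: "nat \<Rightarrow> nat \<Rightarrow> ((nat \<Rightarrow> complex) \<Rightarrow> complex) \<Rightarrow>
    ((nat \<Rightarrow> complex) \<Rightarrow> complex) \<Rightarrow> ((nat \<Rightarrow> complex) \<Rightarrow> complex) \<Rightarrow> bool" where
  "continued_by q n I P Q \<longleftrightarrow> P \<in> laurent_ring q n \<and> Q \<in> laurent_ring q n \<and> (\<exists>s. Q s \<noteq> 0) \<and>
     (\<forall>s. (\<forall>i\<in>{1..n}. Re (s i) \<ge> 0) \<longrightarrow> P s = Q s * I s)"

text \<open>
  The value at \<open>s\<close> of the continued function; it is meaningful wherever some fraction representing
  the continuation has nonvanishing denominator at \<open>s\<close>, and does not depend on the fraction.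
\<close>

definition spherical_function :: "nat \<Rightarrow> ('a::field \<Rightarrow> real) \<Rightarrow> ('a \<Rightarrow> 'a) \<Rightarrow> nat \<Rightarrow> 'a mat measure \<Rightarrow>
    'a mat \<Rightarrow> (nat \<Rightarrow> complex) \<Rightarrow> complex" where
  "spherical_function q nrm star n dk x s =
     (THE v. \<exists>P Q. continued_by q n (spherical_integral nrm star n dk x) P Q \<and>
        Q s \<noteq> 0 \<and> v = P s / Q s)"

definition s_of_z :: "nat \<Rightarrow> nat \<Rightarrow> (nat \<Rightarrow> complex) \<Rightarrow> nat \<Rightarrow> complex" where
  "s_of_z q n z i =
     (if i < n then - z i + z (i + 1) - 1 + of_real pi * \<i> / of_real (ln (real q))
      else - z i - 1 + of_real pi * \<i> / (2 * of_real (ln (real q))))"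

definition unit_vec_int :: "nat \<Rightarrow> nat \<Rightarrow> int" where
  "unit_vec_int i = (\<lambda>l. if l = i then 1 else 0)"

definition pos_roots :: "nat \<Rightarrow> (nat \<Rightarrow> int) set" where
  "pos_roots n =
     {\<lambda>l. unit_vec_int i l + unit_vec_int j l | i j. 1 \<le> i \<and> i < j \<and> j \<le> n} \<union>
     {\<lambda>l. unit_vec_int i l - unit_vec_int j l | i j. 1 \<le> i \<and> i < j \<and> j \<le> n} \<union>
     {\<lambda>l. 2 * unit_vec_int i l | i. 1 \<le> i \<and> i \<le> n}"

definition G_factor :: "nat \<Rightarrow> nat \<Rightarrow> (nat \<Rightarrow> complex) \<Rightarrow> complex" where
  "G_factor q n z = (\<Prod>\<alpha>\<in>pos_roots n.
     (1 + (of_nat q :: complex) powr pairing n \<alpha> z) /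
     (1 - (of_nat q :: complex) powr (pairing n \<alpha> z - 1)))"

end

theory Submission
  imports Defs "Jordan_Normal_Form.Gauss_Jordan_Elimination" "HOL-Complex_Analysis.Complex_Analysis"
begin

text \<open>
  Let \<open>m i\<close> be the valuation of the \<open>i\<close>-th minor of \<open>g \<cdot> x\<close> and \<open>t i = m i - m (i - 1)\<close>.  Sorting the elements \<open>g\<close>
  of \<open>K\<close> by \<open>t\<close> turns \<open>\<omega>(x; z)\<close> into a series \<open>\<Sum>t. c t * q ^ \<langle>t, z\<rangle>\<close> whose coefficients are supported in a cone.
  For a simple root \<open>\<alpha>\<close>, left invariance of the Haar measure allows \<open>c\<close> to be averaged over finitely many
  elements of \<open>K\<close> that change only one minor.  That minor is a binary hermitian form in the bottom row of the
  element, or up to a constant the norm of a linear form on isotropic vectors in dimension three when \<open>\<alpha>\<close> is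
  long.  Counting the lines modulo powers of the prime on which it has a given valuation shows
  \<open>(1 + T\<^sub>\<alpha>) c = (1 - T\<^sub>\<alpha> / q) H\<close>, where \<open>T\<^sub>\<alpha>\<close> is translation by \<open>\<alpha>\<close> and \<open>H\<close> is invariant under the
  reflection in \<open>\<alpha>\<close>.

  Let \<open>F\<close> be the solution of \<open>(\<Prod>\<beta>. 1 - T\<^sub>\<beta> / q) F = (\<Prod>\<beta>. 1 + T\<^sub>\<beta>) c\<close> with support in a cone.  A simple
  reflection permutes the positive roots other than its own, and the operators \<open>1 - T\<^sub>\<beta> / q\<close> are injective on
  functions with such support, so \<open>F\<close> is invariant under every simple reflection, hence under all signed
  permutations.  An invariant function supported in a cone has finite support.  So \<open>F\<close> is the coefficient
  function of a Laurent polynomial, which equals \<open>G(z) \<omega>(x; z)\<close> where the integral converges, and everywhere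
  by the identity theorem.
\<close>

text \<open>The symmetry rests on identities between neighbouring minors. For a short simple root
  the discriminant of the binary form is the product of the minors of orders i - 1 and i + 1; for
  the long one a Gram value of the linear form equals, up to constants, the minor of order n - 1.
  Either identity fixes \<open>2 * \<beta> + e\<close>, that is, the centre of a palindromic
  polynomial, and this centre is the wall of the reflection. The second case uses the characteristic
  polynomial of \<open>x * jmat n\<close>: the eigenspace for -1 has dimension n, which makes the
  minor of order n a norm up to a constant. The imaginary shifts in \<open>s_of_z\<close> turn the
  weights along a root into powers of -q or - q^2, the signs for which the sums of counts telescope.

  No p-adic integral is evaluated: only counts modulo a power of the prime enter, and that power is
  chosen after the exponent. The delicate comparison is the last one. F and its reflection have
  supports in different cones, and on their union the operator of the reflecting root can have a
  kernel; it is therefore cancelled before F is reflected.\<close>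

hide_const (open) Determinants.det Wellfounded.measure

context unramified_quadratic_extension begin

subsection \<open>Absolute values and conjugation\<close>

lemma nrm_0 [simp]: "nrm 0 = 0" by (simp add: nrm_eq_0)

lemma nrm_1 [simp]: "nrm 1 = 1" using nrm_mult[of 1 1] nrm_eq_0[of 1] by simp

lemma nrm_pos: "a \<noteq> 0 \<Longrightarrow> 0 < nrm a" using nrm_nonneg[of a] nrm_eq_0[of a] by linarith

lemma nrm_minus [simp]: "nrm (- a) = nrm a"
proof -
  have "nrm (-1) * nrm (-1) = 1" using nrm_mult[of "-1" "-1"] by simp
  then have "nrm (-1) = 1" using nrm_nonneg[of "-1"] by (simp add: square_eq_1_iff)
  then show ?thesis
    using nrm_mult[of "-1" a] by simp
qed

lemma nrm_minus_commute: "nrm (a - b) = nrm (b - a)" using nrm_minus[of "a - b"] by simp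

lemma nrm_inverse: "nrm (inverse a) = inverse (nrm a)"
proof (cases "a = 0")
  case False
  then have "nrm a * nrm (inverse a) = 1" using nrm_mult[of a "inverse a"] by simp
  then show ?thesis
    by (metis inverse_unique)
qed simp

lemma nrm_divide: "nrm (a / b) = nrm a / nrm b" by (simp add: divide_inverse nrm_mult nrm_inverse)

lemma nrm_power: "nrm (a ^ m) = nrm a ^ m" by (induction m) (simp_all add: nrm_mult)

lemma nrm_prod: "nrm (\<Prod>i\<in>A. f i) = (\<Prod>i\<in>A. nrm (f i))"
  by (induction A rule: infinite_finite_induct) (simp_all add: nrm_mult)

lemma nrm_add_le: "nrm a \<le> c \<Longrightarrow> nrm b \<le> c \<Longrightarrow> nrm (a + b) \<le> c"
  using nrm_add[of a b] by linarith

lemma nrm_diff_le: "nrm a \<le> c \<Longrightarrow> nrm b \<le> c \<Longrightarrow> nrm (a - b) \<le> c"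
  using nrm_add_le[of a c "- b"] by simp

lemma nrm_add_less: "nrm a < c \<Longrightarrow> nrm b < c \<Longrightarrow> nrm (a + b) < c"
  using nrm_add[of a b] by linarith

lemma nrm_diff_less: "nrm a < c \<Longrightarrow> nrm b < c \<Longrightarrow> nrm (a - b) < c"
  using nrm_add_less[of a c "- b"] by simp

lemma nrm_sum_le: "0 \<le> c \<Longrightarrow> (\<And>i. i \<in> A \<Longrightarrow> nrm (f i) \<le> c) \<Longrightarrow> nrm (\<Sum>i\<in>A. f i) \<le> c"
  by (induction A rule: infinite_finite_induct) (auto intro: nrm_add_le)

lemma nrm_add_eq: assumes "nrm b < nrm a" shows "nrm (a + b) = nrm a"
proof -
  have "nrm a \<le> max (nrm (a + b)) (nrm b)" using nrm_add[of "a + b" "- b"] by simp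
  then show ?thesis
    using nrm_add[of a b] assms by linarith
qed

lemma nrm_mult_le_1: "nrm a \<le> 1 \<Longrightarrow> nrm b \<le> 1 \<Longrightarrow> nrm (a * b) \<le> 1"
  by (simp add: nrm_mult mult_le_one nrm_nonneg)

lemma k_0: "0 \<in> k" and k_1: "1 \<in> k" and k_add: "a \<in> k \<Longrightarrow> b \<in> k \<Longrightarrow> a + b \<in> k"
  and k_mult: "a \<in> k \<Longrightarrow> b \<in> k \<Longrightarrow> a * b \<in> k" and k_minus: "a \<in> k \<Longrightarrow> - a \<in> k"
  and k_inverse: "a \<in> k \<Longrightarrow> inverse a \<in> k"
  using k_subfield by (auto simp: is_subfield_def)

lemma k_diff: "a \<in> k \<Longrightarrow> b \<in> k \<Longrightarrow> a - b \<in> k"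
  using k_add[of a "- b"] k_minus by simp

lemma k_divide: "a \<in> k \<Longrightarrow> b \<in> k \<Longrightarrow> a / b \<in> k"
  by (simp add: divide_inverse k_mult k_inverse)

lemma k_power: "a \<in> k \<Longrightarrow> a ^ m \<in> k" by (induction m) (simp_all add: k_mult k_1)

lemma k_of_nat: "of_nat m \<in> k" by (induction m) (auto intro: k_add k_0 k_1)

lemma k_numeral: "numeral m \<in> k" using k_of_nat[of "numeral m"] by simp

section \<open>Residue characteristic and value group\<close>

lemma nrm_2 [simp]: "nrm 2 = 1"
proof -
  obtain c where c: "c > 0" "\<And>r. nrm (of_rat r) = padic_abs p r powr c"
    using nrm_rat by blast
  have "multiplicity (int p) 2 = 0"
  proof (rule not_dvd_imp_multiplicity_0)
    show "\<not> int p dvd 2"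
    proof
      assume "int p dvd 2"
      then have "p dvd 2" using int_dvd_int_iff[of p 2] by simp
      then have "p = 2" using p(1) two_is_prime_nat primes_dvd_imp_eq by blast
      then show False
        using p(2) by simp
    qed
  qed
  then have "padic_abs p 2 = 1" using prime_gt_0_nat[OF p(1)] by (simp add: padic_abs_def)
  then show ?thesis
    using c(2)[of 2] by simp
qed

lemma nrm_p: "0 < nrm (of_nat p)" "nrm (of_nat p) < 1"
proof -
  obtain c where c: "c > 0" "\<And>r. nrm (of_rat r) = padic_abs p r powr c"
    using nrm_rat by blast
  have p1: "p > 1" using p(1) prime_gt_1_nat by blast
  have "multiplicity (int p) (int p) = 1" using p(1) by (intro multiplicity_self) auto
  then have "padic_abs p (of_nat p) = real p powr (- 1)"
    using p1 by (simp add: padic_abs_def quotient_of_int[of "int p", simplified])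
  then have "nrm (of_nat p) = real p powr (- c)"
    using c(2)[of "of_nat p"] p1 by (simp add: powr_minus_divide powr_divide)
  moreover have "real p powr (- c) < real p powr 0" using p1 c(1) by (intro powr_less_mono) auto
  ultimately show "0 < nrm (of_nat p)" "nrm (of_nat p) < 1" using p1 by auto
qed

lemma uf_nonzero: "uf \<noteq> 0"
proof
  assume "uf = 0"
  then have "max_ideal_of nrm k \<subseteq> {0}" using prime_generates by auto
  moreover have "of_nat p \<in> max_ideal_of nrm k" using nrm_p by (simp add: max_ideal_of_def k_of_nat)
  ultimately show False
    using nrm_p by auto
qed

lemma nrm_uf_less_1: "nrm uf < 1"
proof -
  have "uf * 1 \<in> max_ideal_of nrm k"
    unfolding prime_generates by (rule imageI) (simp add: integers_of_def k_1)
  then show ?thesis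
    by (simp add: max_ideal_of_def)
qed

lemma q_ge_2: "q \<ge> 2" using nrm_uf_less_1 nrm_pos uf_nonzero nrm_prime by force

lemma finite_residue_field: "finite (residue_field nrm k)"
  using q q_ge_2 by (metis card.infinite not_numeral_le_zero)

lemma nrm_less_1E:
  assumes "nrm a < 1" obtains b where "a = uf * b" "nrm b = real q * nrm a"
proof -
  have "a \<in> max_ideal_of nrm UNIV" using assms by (simp add: max_ideal_of_def)
  then obtain b where "a = uf * b" unfolding unramified by auto
  moreover from this have "nrm b = real q * nrm a" using q_ge_2 by (simp add: nrm_mult nrm_prime)
  ultimately show thesis
    by (rule that)
qed

text \<open>Descent: an element of absolute value less than 1 is divisible by \<open>uf\<close> in
  the big field because the extension is unramified. Each division multiplies the absolute value by
  q and keeps it at most 1, so the process stops at a unit.\<close>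

lemma nrm_le_1_cases:
  assumes "nrm a \<le> 1" "a \<noteq> 0" shows "\<exists>j::nat. nrm a = (1 / real q) ^ j"
proof -
  have q1: "0 < 1 / real q" "1 / real q < 1" using q_ge_2 by auto
  have "nrm a \<le> 1 \<Longrightarrow> (1 / real q) ^ m < nrm a \<Longrightarrow> \<exists>j::nat. nrm a = (1 / real q) ^ j" for m a
  proof (induction m arbitrary: a)
    case (Suc m)
    show ?case
    proof (cases "nrm a = 1")
      case True
      then show ?thesis
        by (intro exI[of _ 0]) simp
    next
      case False
      then have "nrm a < 1" using Suc.prems by simp
      then obtain b where b: "a = uf * b" "nrm b = real q * nrm a" by (rule nrm_less_1E)
      have ub: "nrm a = (1 / real q) * nrm b" using b q_ge_2 by simp
      have "nrm b \<le> 1"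
      proof -
        have "a \<in> max_ideal_of nrm UNIV" using \<open>nrm a < 1\<close> by (simp add: max_ideal_of_def)
        then obtain b' where "a = uf * b'" "nrm b' \<le> 1"
          unfolding unramified by (auto simp: integers_of_def)
        then show ?thesis
          using b uf_nonzero by auto
      qed
      moreover have "(1 / real q) ^ m < nrm b" using Suc.prems(2) ub q1 by (simp add: field_simps)
      ultimately obtain j where "nrm b = (1 / real q) ^ j" using Suc.IH by blast
      then have "nrm a = (1 / real q) ^ Suc j" using ub by simp
      then show ?thesis
        by blast
    qed
  qed simp
  moreover obtain m where "(1 / real q) ^ m < nrm a"
    using real_arch_pow_inv[OF nrm_pos[OF assms(2)] q1(2)] by blast
  ultimately show ?thesis
    using assms by blast
qed

lemma ex_nrm_eq:
  assumes "a \<noteq> 0" shows "\<exists>m::int. nrm a = real q powi (- m)"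
proof (cases "nrm a \<le> 1")
  case True
  then obtain j where "nrm a = (1 / real q) ^ j" using nrm_le_1_cases assms by blast
  then show ?thesis
    by (intro exI[of _ "int j"]) (simp add: power_int_minus field_simps)
next
  case False
  then have "nrm (inverse a) \<le> 1" by (simp add: nrm_inverse inverse_le_1_iff)
  then obtain j where "nrm (inverse a) = (1 / real q) ^ j" using nrm_le_1_cases[of "inverse a"] assms by auto
  then have "nrm a = real q ^ j"
    by (simp add: nrm_inverse power_one_over inverse_eq_divide[symmetric] power_inverse)
  then show ?thesis
    by (intro exI[of _ "- int j"]) simp
qed

lemma q_powi_le_iff: "real q powi a \<le> real q powi b \<longleftrightarrow> a \<le> b"
  using q_ge_2 power_int_strict_increasing[of b a "real q"] power_int_increasing[of a b "real q"]
  by (cases "a \<le> b") auto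

lemma q_powi_eq_iff: "real q powi a = real q powi b \<longleftrightarrow> a = b"
  using q_powi_le_iff[of a b] q_powi_le_iff[of b a] by force

lemma q_powi_less_iff: "real q powi a < real q powi b \<longleftrightarrow> a < b"
  using q_powi_le_iff[of b a] by linarith

lemma q_powi_add: "real q powi (a + b) = real q powi a * real q powi b"
  using q_ge_2 by (intro power_int_add) auto

text \<open>The valuation with \<open>val uf = 1\<close>. Its value at 0 is unspecified, so it is
  applied to nonzero elements.\<close>

definition val :: "'a \<Rightarrow> int" where
  "val a = (THE m. nrm a = real q powi (- m))"

lemma val_eqI: "nrm a = real q powi (- m) \<Longrightarrow> val a = m"
  unfolding val_def by (rule the_equality) (auto simp: q_powi_eq_iff)

lemma nrm_val: assumes "a \<noteq> 0" shows "nrm a = real q powi (- val a)"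
  using ex_nrm_eq[OF assms] val_eqI by metis

lemma val_mult: "a \<noteq> 0 \<Longrightarrow> b \<noteq> 0 \<Longrightarrow> val (a * b) = val a + val b"
  by (rule val_eqI) (simp add: nrm_mult nrm_val q_powi_add[symmetric])

section \<open>Completeness of k as a finite-dimensional space over the p-adic field\<close>

definition nlim :: "(nat \<Rightarrow> 'a) \<Rightarrow> 'a \<Rightarrow> bool" where
  "nlim f l \<longleftrightarrow> (\<lambda>i. nrm (f i - l)) \<longlonglongrightarrow> 0"

definition ncauchy :: "(nat \<Rightarrow> 'a) \<Rightarrow> bool" where
  "ncauchy f \<longleftrightarrow> (\<forall>e>0. \<exists>M. \<forall>i\<ge>M. \<forall>j\<ge>M. nrm (f i - f j) < e)"

definition ncomplete :: "'a set \<Rightarrow> bool" where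
  "ncomplete S \<longleftrightarrow> (\<forall>f. range f \<subseteq> S \<longrightarrow> ncauchy f \<longrightarrow> (\<exists>l\<in>S. nlim f l))"

lemma nlimI: "(\<And>e. e > 0 \<Longrightarrow> \<exists>M. \<forall>i\<ge>M. nrm (f i - l) < e) \<Longrightarrow> nlim f l"
  unfolding nlim_def LIMSEQ_iff by (simp add: nrm_nonneg)

lemma nlimD: "nlim f l \<Longrightarrow> e > 0 \<Longrightarrow> \<exists>M. \<forall>i\<ge>M. nrm (f i - l) < e"
  unfolding nlim_def LIMSEQ_iff by (simp add: nrm_nonneg)

lemma nlim_unique: assumes "nlim f l" "nlim f l'" shows "l = l'"
proof (rule ccontr)
  assume "l \<noteq> l'"
  then have e: "nrm (l - l') > 0" by (simp add: nrm_pos)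
  obtain M M' where "\<forall>i\<ge>M. nrm (f i - l) < nrm (l - l')" "\<forall>i\<ge>M'. nrm (f i - l') < nrm (l - l')"
    using nlimD[OF assms(1) e] nlimD[OF assms(2) e] by blast
  then have "nrm ((f (max M M') - l') - (f (max M M') - l)) < nrm (l - l')"
    by (intro nrm_diff_less[of "f _ - l'" _ "f _ - l"]) auto
  then show False
    by simp
qed

lemma nlim_ncauchy: assumes "nlim f l" shows "ncauchy f"
  unfolding ncauchy_def
proof (intro allI impI)
  fix e :: real assume "e > 0"
  then obtain M where M: "\<forall>i\<ge>M. nrm (f i - l) < e" using nlimD[OF assms] by blast
  have "nrm (f i - f j) < e" if "i \<ge> M" "j \<ge> M" for i j
    using nrm_diff_less[of "f i - l" e "f j - l"] M that by simp
  then show "\<exists>M. \<forall>i\<ge>M. \<forall>j\<ge>M. nrm (f i - f j) < e" by blast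
qed

lemma Metric_space_field_dist: "Metric_space S (field_dist nrm)"
proof
  show "field_dist nrm x y = field_dist nrm y x" for x y by (simp add: field_dist_def nrm_minus_commute)
  show "field_dist nrm x z \<le> field_dist nrm x y + field_dist nrm y z" for x y z
    using nrm_add[of "x - y" "y - z"] nrm_nonneg[of "x - y"] nrm_nonneg[of "y - z"]
    by (simp add: field_dist_def)
qed (auto simp: field_dist_def nrm_nonneg nrm_eq_0)

lemma mem_Qp_in_iff: "x \<in> Qp_in nrm \<longleftrightarrow> (\<forall>r>0. \<exists>y\<in>\<rat>. nrm (x - y) < r)"
proof -
  interpret Metric_space UNIV "field_dist nrm"
    by (rule Metric_space_field_dist)
  show ?thesis
    unfolding Qp_in_def metric_closure_of by (auto simp: field_dist_def)
qed

lemma ncomplete_Qp_in: "ncomplete (Qp_in nrm)"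
  unfolding ncomplete_def
proof (intro allI impI)
  interpret Metric_space "Qp_in nrm" "field_dist nrm"
    by (rule Metric_space_field_dist)
  fix f assume f: "range f \<subseteq> Qp_in nrm" "ncauchy f"
  then have "MCauchy f" unfolding MCauchy_def ncauchy_def field_dist_def by auto
  then obtain l where l: "limitin mtopology f l sequentially" using complete mcomplete_def by auto
  have "nlim f l" by (metis nlimI l limit_metric_sequentially field_dist_def)
  moreover have "l \<in> Qp_in nrm" using l unfolding limit_metric_sequentially by simp
  ultimately show "\<exists>l\<in>Qp_in nrm. nlim f l" by blast
qed

lemma Rats_subset_Qp_in: "\<rat> \<subseteq> Qp_in nrm"
proof
  fix x :: 'a assume "x \<in> \<rat>"
  then show "x \<in> Qp_in nrm" unfolding mem_Qp_in_iff by (intro allI impI bexI[of _ x]) auto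
qed

lemma Qp_in_add: assumes "a \<in> Qp_in nrm" "b \<in> Qp_in nrm" shows "a + b \<in> Qp_in nrm"
  unfolding mem_Qp_in_iff
proof (intro allI impI)
  fix r :: real assume "r > 0"
  then obtain x y where "x \<in> \<rat>" "y \<in> \<rat>" "nrm (a - x) < r" "nrm (b - y) < r"
    using assms unfolding mem_Qp_in_iff by blast
  then show "\<exists>y\<in>\<rat>. nrm (a + b - y) < r"
    by (intro bexI[of _ "x + y"]) (auto simp: add_diff_add intro: nrm_add_less)
qed

lemma Qp_in_mult: assumes "a \<in> Qp_in nrm" "b \<in> Qp_in nrm" shows "a * b \<in> Qp_in nrm"
  unfolding mem_Qp_in_iff
proof (intro allI impI)
  fix r :: real assume r: "r > 0"
  have "0 < r / (nrm b + 1)" using r nrm_nonneg[of b] by simp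
  then obtain x where x: "x \<in> \<rat>" "nrm (a - x) < r / (nrm b + 1)"
    using assms unfolding mem_Qp_in_iff by blast
  have "0 < r / (nrm x + 1)" using r nrm_nonneg[of x] by simp
  then obtain y where y: "y \<in> \<rat>" "nrm (b - y) < r / (nrm x + 1)"
    using assms unfolding mem_Qp_in_iff by blast
  have "nrm ((a - x) * b) < r" by (smt (verit) mult_left_mono nrm_nonneg x field_simps nrm_mult)
  moreover have "nrm (x * (b - y)) < r" by (smt (verit) mult_left_mono nrm_nonneg y field_simps nrm_mult)
  ultimately have "nrm ((a - x) * b + x * (b - y)) < r" by (rule nrm_add_less)
  moreover have "(a - x) * b + x * (b - y) = a * b - x * y" by (simp add: algebra_simps)
  ultimately show "\<exists>y\<in>\<rat>. nrm (a * b - y) < r"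
    using x(1) y(1) by (intro bexI[of _ "x * y"]) auto
qed

lemma Qp_in_minus: "a \<in> Qp_in nrm \<Longrightarrow> - a \<in> Qp_in nrm"
  using Qp_in_mult[of "- 1" a] subsetD[OF Rats_subset_Qp_in, of "- 1"] by simp

lemma Qp_in_inverse: assumes "a \<in> Qp_in nrm" shows "inverse a \<in> Qp_in nrm"
proof (cases "a = 0")
  case True
  then show ?thesis
    using assms by simp
next
  case a: False
  show ?thesis
    unfolding mem_Qp_in_iff
  proof (intro allI impI)
    fix r :: real assume r: "r > 0"
    have "0 < min (nrm a) (r * nrm a * nrm a)" using r nrm_pos[OF a] by simp
    then obtain x where x: "x \<in> \<rat>" "nrm (a - x) < min (nrm a) (r * nrm a * nrm a)"
      using assms unfolding mem_Qp_in_iff by blast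
    have nx: "nrm x = nrm a" using nrm_add_eq[of "x - a" a] x(2) by (simp add: nrm_minus_commute)
    then have "x \<noteq> 0" using a nrm_eq_0 by metis
    then have "inverse a - inverse x = (x - a) / (a * x)" using a by (simp add: field_simps)
    then have "nrm (inverse a - inverse x) = nrm (a - x) / (nrm a * nrm a)"
      by (simp add: nrm_divide nrm_mult nx nrm_minus_commute)
    also have "\<dots> < r" using x(2) nrm_pos[OF a] by (simp add: field_simps)
    finally show "\<exists>y\<in>\<rat>. nrm (inverse a - y) < r"
      using x(1) by (intro bexI[of _ "inverse x"]) auto
  qed
qed

definition Qp_span :: "'a set \<Rightarrow> 'a set" where
  "Qp_span B = {\<Sum>b\<in>B. c b * b | c. \<forall>b\<in>B. c b \<in> Qp_in nrm}"

lemma Qp_span_insert: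
  assumes "finite B" "b \<notin> B"
  shows "Qp_span (insert b B) = {c * b + w | c w. c \<in> Qp_in nrm \<and> w \<in> Qp_span B}"
proof (intro equalityI subsetI)
  fix x assume "x \<in> Qp_span (insert b B)"
  then obtain c where "x = (\<Sum>b\<in>insert b B. c b * b)" "\<forall>b\<in>insert b B. c b \<in> Qp_in nrm"
    unfolding Qp_span_def by blast
  then show "x \<in> {c * b + w | c w. c \<in> Qp_in nrm \<and> w \<in> Qp_span B}"
    using assms unfolding Qp_span_def by auto
next
  fix x assume "x \<in> {c * b + w | c w. c \<in> Qp_in nrm \<and> w \<in> Qp_span B}"
  then obtain c d where cd: "x = c * b + (\<Sum>b\<in>B. d b * b)" "c \<in> Qp_in nrm" "\<forall>b\<in>B. d b \<in> Qp_in nrm"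
    unfolding Qp_span_def by blast
  have "(\<Sum>b'\<in>insert b B. (d(b := c)) b' * b') = c * b + (\<Sum>b'\<in>B. (d(b := c)) b' * b')"
    using assms by simp
  also have "(\<Sum>b'\<in>B. (d(b := c)) b' * b') = (\<Sum>b\<in>B. d b * b)"
    using assms by (intro sum.cong) auto
  finally show "x \<in> Qp_span (insert b B)"
    unfolding Qp_span_def using cd assms by (intro CollectI exI[of _ "d(b := c)"]) auto
qed

lemma Qp_span_add: assumes "x \<in> Qp_span B" "y \<in> Qp_span B" shows "x + y \<in> Qp_span B"
proof -
  obtain c d where "x = (\<Sum>b\<in>B. c b * b)" "\<forall>b\<in>B. c b \<in> Qp_in nrm" "y = (\<Sum>b\<in>B. d b * b)" "\<forall>b\<in>B. d b \<in> Qp_in nrm"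
    using assms unfolding Qp_span_def by blast
  then show ?thesis
    unfolding Qp_span_def
    by (intro CollectI exI[of _ "\<lambda>b. c b + d b"]) (auto simp: sum.distrib distrib_right Qp_in_add)
qed

lemma Qp_span_scale: assumes "x \<in> Qp_span B" "a \<in> Qp_in nrm" shows "a * x \<in> Qp_span B"
proof -
  obtain c where "x = (\<Sum>b\<in>B. c b * b)" "\<forall>b\<in>B. c b \<in> Qp_in nrm"
    using assms unfolding Qp_span_def by blast
  then show ?thesis
    unfolding Qp_span_def using assms
    by (intro CollectI exI[of _ "\<lambda>b. a * c b"]) (auto simp: sum_distrib_left mult.assoc Qp_in_mult)
qed

lemma Qp_span_diff: "x \<in> Qp_span B \<Longrightarrow> y \<in> Qp_span B \<Longrightarrow> x - y \<in> Qp_span B"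
  using Qp_span_add[of x B "(-1) * y"] Qp_span_scale[of y B "-1"]
    subsetD[OF Rats_subset_Qp_in, of "- 1"] by simp

text \<open>Complete sets are closed: points of S arbitrarily close to b would form a Cauchy
  sequence, and its limit in S would have to be b.\<close>

lemma ncomplete_dist:
  assumes "ncomplete S" "b \<notin> S"
  obtains e where "e > 0" "\<And>w. w \<in> S \<Longrightarrow> e \<le> nrm (b - w)"
proof -
  have "\<exists>e>0. \<forall>w\<in>S. e \<le> nrm (b - w)"
  proof (rule ccontr)
    assume "\<not> ?thesis"
    then have *: "\<exists>w\<in>S. nrm (b - w) < e" if "e > 0" for e using that by (auto simp: not_le)
    have "\<exists>w\<in>S. nrm (b - w) < 1 / real (Suc i)" for i by (rule *) simp
    then obtain f where f: "\<And>i. f i \<in> S" "\<And>i. nrm (b - f i) < 1 / real (Suc i)" by metis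
    have "nlim f b"
    proof (rule nlimI)
      fix e :: real assume "e > 0"
      then obtain M where M: "1 / real (Suc M) < e" by (rule nat_approx_posE)
      have "nrm (f i - b) < e" if "i \<ge> M" for i
      proof -
        have "1 / real (Suc i) \<le> 1 / real (Suc M)" using that by (simp add: frac_le)
        then show ?thesis
          using f(2)[of i] M by (simp add: nrm_minus_commute)
      qed
      then show "\<exists>M. \<forall>i\<ge>M. nrm (f i - b) < e" by blast
    qed
    moreover have "range f \<subseteq> S" using f(1) by auto
    ultimately obtain l where "l \<in> S" "nlim f l"
      using assms(1) nlim_ncauchy[of f b] unfolding ncomplete_def by blast
    with \<open>nlim f b\<close> show False
      using nlim_unique assms(2) by blast
  qed
  then show thesis
    using that by blast
qed

text \<open>Induction on the spanning set. A new vector outside the old span has positive distance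
  from it, since the old span is complete. Hence the norm of a combination controls its new
  coordinate, and a Cauchy sequence splits into a Cauchy sequence of scalars and one in the old
  span.\<close>

lemma ncomplete_Qp_span: "finite B \<Longrightarrow> ncomplete (Qp_span B)"
proof (induction rule: finite_induct)
  case empty
  have "nlim (\<lambda>i. f i) 0" if "range f \<subseteq> {0}" for f
    using that by (simp add: nlim_def image_subset_iff)
  then show ?case
    by (simp add: Qp_span_def ncomplete_def)
next
  case (insert b B)
  show ?case
  proof (cases "b \<in> Qp_span B")
    case True
    have "Qp_span (insert b B) = Qp_span B"
      unfolding Qp_span_insert[OF insert(1,2)]
    proof (intro equalityI subsetI)
      fix x assume "x \<in> Qp_span B"
      then show "x \<in> {c * b + w | c w. c \<in> Qp_in nrm \<and> w \<in> Qp_span B}"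
        using Rats_subset_Qp_in by (intro CollectI exI[of _ 0] exI[of _ x]) auto
    qed (auto intro: Qp_span_add Qp_span_scale[OF True])
    then show ?thesis
      using insert by simp
  next
    case False
    obtain e where e: "e > 0" "\<And>w. w \<in> Qp_span B \<Longrightarrow> e \<le> nrm (b - w)"
      using ncomplete_dist[OF insert.IH False] by blast
    \<comment> \<open>Scaling by the inverse of c turns the distance of b from the span into a bound
      for the coordinate c.\<close>
    have bound: "e * nrm c \<le> nrm (c * b + w)" if "c \<in> Qp_in nrm" "w \<in> Qp_span B" for c w
    proof (cases "c = 0")
      case True
      then show ?thesis
        by (simp add: nrm_nonneg)
    next
      case False
      have "e \<le> nrm (b - (- inverse c) * w)" by (intro e(2) Qp_span_scale that Qp_in_minus Qp_in_inverse)
      then have "e * nrm c \<le> nrm (b - (- inverse c) * w) * nrm c"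
        by (intro mult_right_mono) (auto simp: nrm_nonneg)
      also have "\<dots> = nrm (c * b + w)"
      proof -
        have "(b - (- inverse c) * w) * c = c * b + w" using False by (simp add: field_simps)
        then show ?thesis
          by (metis nrm_mult)
      qed
      finally show ?thesis .
    qed
    show ?thesis
      unfolding ncomplete_def
    proof (intro allI impI)
      fix f assume f: "range f \<subseteq> Qp_span (insert b B)" "ncauchy f"
      have "\<forall>i. \<exists>c w. c \<in> Qp_in nrm \<and> w \<in> Qp_span B \<and> f i = c * b + w"
      proof
        fix i
        have "f i \<in> {c * b + w | c w. c \<in> Qp_in nrm \<and> w \<in> Qp_span B}"
          using f(1) unfolding Qp_span_insert[OF insert(1,2)] by (rule subsetD) simp
        then show "\<exists>c w. c \<in> Qp_in nrm \<and> w \<in> Qp_span B \<and> f i = c * b + w" by blast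
      qed
      from choice[OF this] obtain c where "\<forall>i. \<exists>w. c i \<in> Qp_in nrm \<and> w \<in> Qp_span B \<and> f i = c i * b + w"
        by blast
      from choice[OF this] obtain w where cw: "\<And>i. c i \<in> Qp_in nrm" "\<And>i. w i \<in> Qp_span B"
          "\<And>i. f i = c i * b + w i"
        by blast
      have cd: "e * nrm (c i - c j) \<le> nrm (f i - f j)" for i j
      proof -
        have "f i - f j = (c i - c j) * b + (w i - w j)" unfolding cw(3) by (simp add: algebra_simps)
        moreover have "c i - c j \<in> Qp_in nrm"
          using Qp_in_add[OF cw(1) Qp_in_minus[OF cw(1)], of i j] by simp
        moreover have "w i - w j \<in> Qp_span B" by (intro Qp_span_diff cw(2))
        ultimately show ?thesis
          using bound[of "c i - c j" "w i - w j"] by presburger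
      qed
      have "ncauchy c"
        unfolding ncauchy_def
      proof (intro allI impI)
        fix r :: real assume "r > 0"
        then have "e * r > 0" using e by simp
        then obtain M where "\<forall>i\<ge>M. \<forall>j\<ge>M. nrm (f i - f j) < e * r"
          using f(2) unfolding ncauchy_def by blast
        then have "\<forall>i\<ge>M. \<forall>j\<ge>M. e * nrm (c i - c j) < e * r"
          using order.strict_trans1[OF cd] by auto
        then show "\<exists>M. \<forall>i\<ge>M. \<forall>j\<ge>M. nrm (c i - c j) < r" using e(1) by auto
      qed
      then obtain c0 where c0: "c0 \<in> Qp_in nrm" "nlim c c0"
        using ncomplete_Qp_in cw(1) unfolding ncomplete_def by (metis image_subset_iff)
      have cb: "nlim (\<lambda>i. c i * b) (c0 * b)"
        using c0(2) unfolding nlim_def left_diff_distrib[symmetric] nrm_mult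
        by (rule tendsto_mult_left_zero)
      have "ncauchy w"
        unfolding ncauchy_def
      proof (intro allI impI)
        fix r :: real assume "r > 0"
        then obtain M where M: "\<forall>i\<ge>M. \<forall>j\<ge>M. nrm (f i - f j) < r"
          using f(2) unfolding ncauchy_def by blast
        obtain M' where "\<forall>i\<ge>M'. \<forall>j\<ge>M'. nrm (c i * b - c j * b) < r"
          using \<open>r > 0\<close> nlim_ncauchy[OF cb] unfolding ncauchy_def by blast
        note M = M this
        have "nrm ((f i - f j) - (c i * b - c j * b)) < r" if "i \<ge> max M M'" "j \<ge> max M M'" for i j
          using that M by (intro nrm_diff_less[of "f _ - f _" _ "c _ * b - c _ * b"]) auto
        moreover have "(f i - f j) - (c i * b - c j * b) = w i - w j" for i j
          unfolding cw(3) by (simp add: algebra_simps)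
        ultimately have "\<forall>i\<ge>max M M'. \<forall>j\<ge>max M M'. nrm (w i - w j) < r" by metis
        then show "\<exists>M. \<forall>i\<ge>M. \<forall>j\<ge>M. nrm (w i - w j) < r" ..
      qed
      then obtain w0 where w0: "w0 \<in> Qp_span B" "nlim w w0"
        using insert.IH cw(2) unfolding ncomplete_def by (metis image_subset_iff)
      have "nlim f (c0 * b + w0)"
      proof (rule nlimI)
        fix r :: real assume "r > 0"
        obtain M where M: "\<forall>i\<ge>M. nrm (c i * b - c0 * b) < r"
          using nlimD[OF cb \<open>r > 0\<close>] by blast
        obtain M' where "\<forall>i\<ge>M'. nrm (w i - w0) < r"
          using nlimD[OF w0(2) \<open>r > 0\<close>] by blast
        note M = M this
        have "nrm ((c i * b - c0 * b) + (w i - w0)) < r" if "i \<ge> max M M'" for i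
          using that M by (intro nrm_add_less[of "c _ * b - c0 * b" _ "w _ - w0"]) auto
        moreover have "(c i * b - c0 * b) + (w i - w0) = f i - (c0 * b + w0)" for i
          unfolding cw(3) by (simp add: algebra_simps)
        ultimately have "\<forall>i\<ge>max M M'. nrm (f i - (c0 * b + w0)) < r" by metis
        then show "\<exists>M. \<forall>i\<ge>M. nrm (f i - (c0 * b + w0)) < r" ..
      qed
      then show "\<exists>l\<in>Qp_span (insert b B). nlim f l"
        unfolding Qp_span_insert[OF insert(1,2)] using c0(1) w0(1) by blast
    qed
  qed
qed

lemma ncomplete_k: "ncomplete k"
proof -
  obtain B where B: "finite B" "B \<subseteq> k"
      "\<forall>a\<in>k. \<exists>c. (\<forall>b\<in>B. c b \<in> Qp_in nrm) \<and> a = (\<Sum>b\<in>B. c b * b)"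
    using k_finite by blast
  have "(\<Sum>b\<in>B. c b * b) \<in> k" if "\<forall>b\<in>B. c b \<in> Qp_in nrm" for c
    using B(1,2) that by (induction B rule: finite_induct) (use k_extends in \<open>auto intro!: k_0 k_add k_mult\<close>)
  then have "k = Qp_span B" using B(3) unfolding Qp_span_def by blast
  then show ?thesis
    using ncomplete_Qp_span[OF B(1)] by simp
qed


section \<open>The conjugation and integral coordinates over k\<close>

lemma star_0 [simp]: "star 0 = 0" and star_1 [simp]: "star 1 = 1" by (simp_all add: star_fixes k_0 k_1)

lemma star_minus [simp]: "star (- a) = - star a"
  using star_add[of a "- a"] by (simp add: eq_neg_iff_add_eq_0 add.commute)

lemma star_diff: "star (a - b) = star a - star b" using star_add[of a "- b"] by simp

lemma star_numeral [simp]: "star (numeral m) = numeral m" by (simp add: star_fixes k_numeral)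

text \<open>The conjugate of a generator satisfies the same quadratic equation over k and differs
  from the generator, so it is the second root \<open>c0 - \<theta>\<close>. This shows that
  \<open>star\<close> is an involution and that nothing outside k is fixed.\<close>

lemma star_fixed_iff: "star a = a \<longleftrightarrow> a \<in> k" and star_star [simp]: "star (star a) = a"
proof -
  obtain \<theta> where \<theta>: "\<theta> \<notin> k" "\<And>a. \<exists>b\<in>k. \<exists>c\<in>k. a = b + c * \<theta>"
    using quadratic by blast
  have star_lin: "star (b + c * \<theta>) = b + c * star \<theta>" if "b \<in> k" "c \<in> k" for b c
    using that by (simp add: star_add star_mult star_fixes)
  have ne: "star \<theta> \<noteq> \<theta>" using star_nontrivial \<theta>(2) star_lin by metis
  obtain b0 c0 where bc: "b0 \<in> k" "c0 \<in> k" "\<theta> * \<theta> = b0 + c0 * \<theta>"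
    using \<theta>(2) by blast
  have "star \<theta> * star \<theta> = star (\<theta> * \<theta>)" by (simp add: star_mult)
  also have "\<dots> = b0 + c0 * star \<theta>" unfolding bc(3) by (rule star_lin[OF bc(1,2)])
  finally have "star \<theta> * star \<theta> = b0 + c0 * star \<theta>" .
  then have "(star \<theta> - \<theta>) * (star \<theta> + \<theta> - c0) = 0"
    using bc(3) by (simp add: algebra_simps)
  then have st: "star \<theta> = c0 - \<theta>" using ne by (simp add: eq_diff_eq)
  show "star (star a) = a"
  proof -
    obtain b c where a: "b \<in> k" "c \<in> k" "a = b + c * \<theta>"
      using \<theta>(2) by blast
    then show ?thesis
      using bc(2) by (simp add: star_lin star_add star_mult star_fixes st star_diff)
  qed
  show "star a = a \<longleftrightarrow> a \<in> k"
  proof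
    assume fa: "star a = a"
    obtain b c where a: "b \<in> k" "c \<in> k" "a = b + c * \<theta>"
      using \<theta>(2) by blast
    then have "b + c * star \<theta> = b + c * \<theta>" using fa star_lin by metis
    then have "c * (star \<theta> - \<theta>) = 0" by (simp add: right_diff_distrib)
    then show "a \<in> k" using ne a by simp
  qed (rule star_fixes)
qed

lemma star_eq_0_iff [simp]: "star a = 0 \<longleftrightarrow> a = 0" by (metis star_0 star_star)

lemma star_inverse: "star (inverse a) = inverse (star a)"
proof (cases "a = 0")
  case False
  then have "star a * star (inverse a) = 1" using star_mult[of a "inverse a"] by simp
  then show ?thesis
    by (metis inverse_unique)
qed simp

lemma star_divide: "star (a / b) = star a / star b" by (simp add: divide_inverse star_mult star_inverse)

lemma star_sum: "star (\<Sum>i\<in>A. f i) = (\<Sum>i\<in>A. star (f i))"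
  by (induction A rule: infinite_finite_induct) (simp_all add: star_add)

text \<open>If \<open>u = a / star a\<close> had absolute value below 1, then the root \<open>u / (u + star u)\<close> of
  \<open>y = y\<^sup>2 + (u + star u)\<^sup>-\<^sup>2\<close> would be the limit of a contracting iteration in the
  complete field \<open>k\<close>, which forces \<open>u \<in> k\<close>.\<close>

lemma nrm_star_aux: assumes "a \<noteq> 0" shows "nrm (star a) \<le> nrm a"
proof (rule ccontr)
  assume "\<not> ?thesis"
  then have lt: "nrm a < nrm (star a)" by simp
  define u where "u = a / star a"
  have u0: "u \<noteq> 0" and usu: "u * star u = 1" using assms by (simp_all add: u_def star_divide)
  have su: "star u = inverse u" using usu by (metis inverse_unique)
  have u1: "nrm u < 1" using lt nrm_pos[of "star a"] assms by (simp add: u_def nrm_divide)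
  then have su1: "nrm (star u) > 1" using nrm_pos[OF u0] by (simp add: su nrm_inverse one_less_inverse_iff)
  define t where "t = u + star u"
  have tk: "t \<in> k" unfolding star_fixed_iff[symmetric] by (simp add: t_def star_add add.commute)
  have nt: "nrm t = inverse (nrm u)"
    using nrm_add_eq[of u "star u"] u1 su1 by (simp add: t_def add.commute su nrm_inverse)
  have t0: "t \<noteq> 0" using nt nrm_pos[OF u0] by auto
  define y d where "y = u / t" and "d = 1 / (t * t)"
  have "u * t = u * u + 1" using usu by (simp add: t_def algebra_simps)
  then have y: "y = y * y + d" using t0 by (simp add: y_def d_def field_simps)
  have nd: "nrm d = nrm u * nrm u" and ny: "nrm y = nrm u * nrm u"
    by (simp_all add: y_def d_def nrm_divide nrm_mult nt field_simps)
  have uu: "nrm u * nrm u < nrm u" using u1 nrm_pos[OF u0] by simp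
  define s where "s = rec_nat 0 (\<lambda>_ x. x * x + d)"
  have s0: "s 0 = 0" and sS: "\<And>i. s (Suc i) = s i * s i + d" by (simp_all add: s_def)
  have sk: "s i \<in> k" for i
    by (induction i) (auto simp: s0 sS d_def intro!: k_0 k_add k_mult k_divide k_1 tk)
  have sn: "nrm (s i) \<le> nrm u" for i
  proof (induction i)
    case (Suc i)
    have "nrm (s i) * nrm (s i) \<le> nrm u * nrm u" by (intro mult_mono Suc nrm_nonneg)
    then show ?case
      unfolding sS by (intro nrm_add_le) (use uu nd in \<open>auto simp: nrm_mult\<close>)
  qed (simp add: s0 nrm_nonneg)
  have sy: "nrm (s i - y) \<le> nrm u ^ Suc i" for i
  proof (induction i)
    case 0
    then show ?case
      using ny uu by (simp add: s0)
  next
    case (Suc i)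
    have "s (Suc i) - y = (s i - y) * (s i + y)" by (smt (verit) y sS algebra_simps)
    moreover have "nrm (s i + y) \<le> nrm u" using sn ny uu by (intro nrm_add_le) auto
    ultimately have "nrm (s (Suc i) - y) \<le> nrm u ^ Suc i * nrm u"
      using Suc by (auto simp: nrm_mult nrm_nonneg intro!: mult_mono)
    then show ?case
      by (simp add: mult.commute)
  qed
  have "(\<lambda>i. nrm u ^ Suc i) \<longlonglongrightarrow> 0"
    using LIMSEQ_power_zero[of "nrm u"] u1 nrm_nonneg[of u] by (intro LIMSEQ_Suc) auto
  then have lim: "nlim s y" unfolding nlim_def by (rule tendsto_sandwich[OF _ _ tendsto_const, rotated 2])
      (use sy in \<open>auto simp: nrm_nonneg simp del: power_Suc intro!: always_eventually\<close>)
  have "range s \<subseteq> k" using sk by auto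
  then obtain l where "l \<in> k" "nlim s l"
    using ncomplete_k nlim_ncauchy[OF lim] unfolding ncomplete_def by blast
  then have "y \<in> k" using nlim_unique[OF lim] by simp
  moreover have "u = y * t" using t0 by (simp add: y_def)
  ultimately have "u \<in> k" using tk by (simp add: k_mult)
  then have "star u = u" by (rule star_fixes)
  then show False
    using u1 su1 by simp
qed

lemma nrm_star [simp]: "nrm (star a) = nrm a"
proof (cases "a = 0")
  case False
  then show ?thesis
    using nrm_star_aux[of a] nrm_star_aux[of "star a"] by simp
qed simp

text \<open>The difference of an element and its conjugate is anti-invariant. Powers of
  \<open>uf\<close> lie in k and preserve this property, and since all values of \<open>nrm\<close>
  are powers of q, one of them scales the element to a unit.\<close>

lemma ex_theta: "\<exists>t. star t = - t \<and> nrm t = 1"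
proof -
  obtain a where "star a \<noteq> a"
    using star_nontrivial by blast
  define d where "d = a - star a"
  have d: "d \<noteq> 0" "star d = - d" using \<open>star a \<noteq> a\<close> by (auto simp: d_def star_diff)
  define m where "m = val d"
  have nd: "nrm d = real q powi (- m)" using nrm_val[OF d(1)] by (simp add: m_def)
  show ?thesis
  proof (cases "m \<ge> 0")
    case True
    have "nrm (d / uf ^ nat m) = 1"
      using q_ge_2 True by (simp add: nrm_divide nrm_power nrm_prime nd power_int_def power_one_over
        power_inverse)
    then show ?thesis
      using d(2) by (intro exI[of _ "d / uf ^ nat m"]) (simp add: star_divide star_fixes k_power prime_in_k)
  next
    case False
    have "nrm (d * uf ^ nat (- m)) = 1"
      using q_ge_2 False by (simp add: nrm_mult nrm_power nrm_prime nd power_int_def power_one_over)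
    then show ?thesis
      using d(2) by (intro exI[of _ "d * uf ^ nat (- m)"]) (simp add: star_mult star_fixes k_power prime_in_k)
  qed
qed

definition \<theta> :: 'a where "\<theta> = (SOME t. star t = - t \<and> nrm t = 1)"

lemma star_theta [simp]: "star \<theta> = - \<theta>" and nrm_theta [simp]: "nrm \<theta> = 1"
  using someI_ex[OF ex_theta] unfolding \<theta>_def by auto

lemma theta_nonzero [simp]: "\<theta> \<noteq> 0" using nrm_theta nrm_0 by fastforce

definition tr :: "'a \<Rightarrow> 'a" where "tr a = a + star a"
definition nm :: "'a \<Rightarrow> 'a" where "nm a = a * star a"

definition rea :: "'a \<Rightarrow> 'a" where "rea a = (a + star a) / 2"
definition ima :: "'a \<Rightarrow> 'a" where "ima a = (a - star a) / (2 * \<theta>)"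

lemma rea_k: "rea a \<in> k" and ima_k: "ima a \<in> k"
  unfolding star_fixed_iff[symmetric] rea_def ima_def
  by (simp_all add: star_divide star_add star_diff star_mult add.commute divide_simps)

lemma rea_ima: "a = rea a + ima a * \<theta>" by (simp add: rea_def ima_def field_simps)

lemma star_lin: "b \<in> k \<Longrightarrow> c \<in> k \<Longrightarrow> star (b + c * \<theta>) = b - c * \<theta>"
  by (simp add: star_add star_mult star_fixes)

lemma rea_lin: "b \<in> k \<Longrightarrow> c \<in> k \<Longrightarrow> rea (b + c * \<theta>) = b"
  and ima_lin: "b \<in> k \<Longrightarrow> c \<in> k \<Longrightarrow> ima (b + c * \<theta>) = c"
  by (simp_all add: rea_def ima_def star_lin)

lemma nrm_rea: "nrm (rea a) \<le> nrm a"
  using nrm_add_le[of a "nrm a" "star a"] by (simp add: rea_def nrm_divide)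

lemma nrm_ima: "nrm (ima a) \<le> nrm a"
  using nrm_diff_le[of a "nrm a" "star a"] by (simp add: ima_def nrm_divide nrm_mult)

text \<open>As 2 and \<open>\<theta>\<close> are units, passing to a coordinate does not increase
  the absolute value. Hence integrality and congruences in the big field can be tested on the two
  coordinates over k.\<close>

lemma nrm_lin: assumes "b \<in> k" "c \<in> k" shows "nrm (b + c * \<theta>) = max (nrm b) (nrm c)"
  using nrm_rea[of "b + c * \<theta>"] nrm_ima[of "b + c * \<theta>"] nrm_add[of b "c * \<theta>"] assms
  by (simp add: rea_lin ima_lin nrm_mult)

lemma nm_k: "nm a \<in> k" and tr_k: "tr a \<in> k"
  unfolding star_fixed_iff[symmetric] nm_def tr_def by (simp_all add: star_mult star_add mult.commute add.commute)

lemma nrm_nm: "nrm (nm a) = nrm a ^ 2" by (simp add: nm_def nrm_mult power2_eq_square)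

lemma nm_mult: "nm (a * b) = nm a * nm b" by (simp add: nm_def star_mult)

lemma nrm_tr: "nrm (tr a) \<le> nrm a" unfolding tr_def by (intro nrm_add_le) auto

lemma tr_lin: "b \<in> k \<Longrightarrow> c \<in> k \<Longrightarrow> tr (b + c * \<theta>) = 2 * b"
  by (simp add: tr_def star_lin)

lemma nrm_nm_diff:
  assumes "nrm a \<le> 1" "nrm b \<le> 1" shows "nrm (nm a - nm b) \<le> nrm (a - b)"
proof -
  have "nm a - nm b = a * star (a - b) + (a - b) * star b" by (simp add: nm_def star_diff algebra_simps)
  then show ?thesis
    using assms by (auto simp: nrm_mult intro!: nrm_add_le mult_left_le mult_left_le_one_le nrm_nonneg)
qed

end

subsection \<open>Counting residues of given norm\<close>

text \<open>Sets of representatives are related by congruences rather than by a natural map, so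
  cardinalities are compared through a relation that is a perfect matching.\<close>

lemma card_eq_matching:
  assumes "finite X" "finite Y" "\<And>x. x \<in> X \<Longrightarrow> \<exists>!y. y \<in> Y \<and> R x y" "\<And>y. y \<in> Y \<Longrightarrow> \<exists>!x. x \<in> X \<and> R x y"
  shows "card X = card Y"
proof (rule bij_betw_same_card)
  define f where "f x = (THE y. y \<in> Y \<and> R x y)" for x
  have f: "f x \<in> Y" "R x (f x)" if "x \<in> X" for x
    using theI'[OF assms(3)[OF that]] by (simp_all add: f_def)
  show "bij_betw f X Y"
    unfolding bij_betw_def
  proof
    show "inj_on f X" by (intro inj_onI) (metis assms(4) f)
    show "f ` X = Y"
    proof (intro equalityI subsetI)
      fix y assume y: "y \<in> Y"
      then obtain x where x: "x \<in> X" "R x y" using assms(4) by blast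
      then have "f x = y" using assms(3)[OF x(1)] f[OF x(1)] y by blast
      then show "y \<in> f ` X" using x(1) by blast
    qed (use f in auto)
  qed
qed

context unramified_quadratic_extension begin

section \<open>Congruences modulo powers of the prime and systems of representatives\<close>

definition pw :: "nat \<Rightarrow> real" where "pw N = (1 / real q) ^ N"

lemma pw_0 [simp]: "pw 0 = 1" by (simp add: pw_def)

lemma pw_add: "pw (M + N) = pw M * pw N" by (simp add: pw_def power_add)

abbreviation "Ok \<equiv> integers_of nrm k"
abbreviation "OK \<equiv> integers_of nrm UNIV"

lemma pw_pos: "0 < pw N" using q_ge_2 by (simp add: pw_def)

lemma pw_le_iff: "pw M \<le> pw N \<longleftrightarrow> N \<le> M"
  using q_ge_2 power_decreasing_iff[of "1 / real q"] by (simp add: pw_def)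

lemma pw_le_1: "pw N \<le> 1" using pw_le_iff[of N 0] by simp

lemma pw_powi: "pw N = real q powi (- int N)"
  by (simp add: pw_def power_int_minus power_one_over inverse_eq_divide)

text \<open>The value group is discrete, so a strict bound is a weak bound one step further.\<close>

lemma nrm_less_pw_iff: "nrm a < pw N \<longleftrightarrow> nrm a \<le> pw (Suc N)"
proof (cases "a = 0")
  case False
  then obtain m where "nrm a = real q powi (- m)" using ex_nrm_eq by blast
  then show ?thesis
    unfolding pw_powi by (simp only: q_powi_less_iff q_powi_le_iff) linarith
qed (use pw_pos in \<open>simp add: less_imp_le\<close>)

lemma nrm_less_1_iff: "nrm a < 1 \<longleftrightarrow> nrm a \<le> pw 1" using nrm_less_pw_iff[of a 0] by simp

lemma nrm_uf_power: "nrm (uf ^ N) = pw N" by (simp add: pw_def nrm_power nrm_prime)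

lemma nrm_uf_mult: "nrm (uf ^ N * a) = pw N * nrm a" by (simp add: nrm_mult nrm_uf_power)

lemma nrm_le_pwE:
  assumes "nrm a \<le> pw N" obtains b where "a = uf ^ N * b" "nrm b \<le> 1" "a \<in> k \<Longrightarrow> b \<in> k"
proof
  show "a = uf ^ N * (a / uf ^ N)" using uf_nonzero by simp
  show "nrm (a / uf ^ N) \<le> 1" using assms pw_pos[of N] by (simp add: nrm_divide nrm_uf_power)
  show "a / uf ^ N \<in> k" if "a \<in> k" using that by (intro k_divide k_power prime_in_k)
qed

text \<open>Congruence modulo the N-th power of the prime. Expressed through the absolute value, one
  notion serves k and the big field.\<close>

definition cong_mod :: "nat \<Rightarrow> 'a \<Rightarrow> 'a \<Rightarrow> bool" where
  "cong_mod N a b \<longleftrightarrow> nrm (a - b) \<le> pw N"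

lemma cong_refl [simp]: "cong_mod N a a" using pw_pos[of N] by (simp add: cong_mod_def less_imp_le)

lemma cong_sym: "cong_mod N a b \<longleftrightarrow> cong_mod N b a"
  by (simp add: cong_mod_def nrm_minus_commute)

lemma cong_trans: "cong_mod N a b \<Longrightarrow> cong_mod N b c \<Longrightarrow> cong_mod N a c"
  using nrm_add_le[of "a - b" "pw N" "b - c"] by (simp add: cong_mod_def)

lemma cong_trans_right: "cong_mod N a c \<Longrightarrow> cong_mod N b c \<Longrightarrow> cong_mod N a b"
  using cong_trans[of N a c b] by (simp add: cong_sym)

lemma cong_trans_left: "cong_mod N c a \<Longrightarrow> cong_mod N c b \<Longrightarrow> cong_mod N a b"
  using cong_trans[of N a c b] by (simp add: cong_sym)

lemma cong_mono: "cong_mod N a b \<Longrightarrow> M \<le> N \<Longrightarrow> cong_mod M a b"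
  using pw_le_iff[of N M] by (auto simp: cong_mod_def)

lemma cong_uf_mult: "cong_mod (M + N) (uf ^ M * a) (uf ^ M * b) \<longleftrightarrow> cong_mod N a b"
  using pw_pos[of M] by (simp add: cong_mod_def right_diff_distrib[symmetric] nrm_uf_mult pw_add)

lemma cong_mult: "nrm a \<le> 1 \<Longrightarrow> nrm b' \<le> 1 \<Longrightarrow> cong_mod N a a' \<Longrightarrow> cong_mod N b b' \<Longrightarrow> cong_mod N (a * b) (a' * b')"
proof -
  assume A: "nrm a \<le> 1" "nrm b' \<le> 1" "cong_mod N a a'" "cong_mod N b b'"
  have "a * b - a' * b' = a * (b - b') + (a - a') * b'" by (simp add: algebra_simps)
  moreover have "nrm a * nrm (b - b') \<le> 1 * pw N" "nrm (a - a') * nrm b' \<le> pw N * 1"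
    using A pw_pos[of N] unfolding cong_mod_def by (intro mult_mono; simp add: nrm_nonneg)+
  ultimately show "cong_mod N (a * b) (a' * b')"
    unfolding cong_mod_def by (auto simp: nrm_mult intro!: nrm_add_le)
qed

lemma cong_add: "cong_mod N a a' \<Longrightarrow> cong_mod N b b' \<Longrightarrow> cong_mod N (a + b) (a' + b')"
  using nrm_add_le[of "a - a'" "pw N" "b - b'"] by (simp add: cong_mod_def algebra_simps)

lemma cong_minus: "cong_mod N a a' \<Longrightarrow> cong_mod N (- a) (- a')"
  by (simp add: cong_mod_def nrm_minus_commute)

lemma cong_diff: "cong_mod N a a' \<Longrightarrow> cong_mod N b b' \<Longrightarrow> cong_mod N (a - b) (a' - b')"
  using cong_add[of N a a' "- b" "- b'"] cong_minus by simp

lemma cong_unit_cancel: "nrm u = 1 \<Longrightarrow> cong_mod N (u * a) (u * b) \<longleftrightarrow> cong_mod N a b"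
  by (simp add: cong_mod_def right_diff_distrib[symmetric] nrm_mult)

lemma cong_nrm_1: "cong_mod N a b \<Longrightarrow> nrm b = 1 \<Longrightarrow> N \<ge> 1 \<Longrightarrow> nrm a = 1"
proof -
  assume A: "cong_mod N a b" "nrm b = 1" "N \<ge> 1"
  then have "nrm (a - b) < 1" using cong_mono[of N a b 1] nrm_less_1_iff by (auto simp: cong_mod_def)
  then show "nrm a = 1" using nrm_add_eq[of "a - b" b] A by simp
qed

lemma cong_lin:
  "a \<in> k \<Longrightarrow> b \<in> k \<Longrightarrow> c \<in> k \<Longrightarrow> d \<in> k \<Longrightarrow>
    cong_mod N (a + b * \<theta>) (c + d * \<theta>) \<longleftrightarrow> cong_mod N a c \<and> cong_mod N b d"
proof -
  assume A: "a \<in> k" "b \<in> k" "c \<in> k" "d \<in> k"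
  have "(a + b * \<theta>) - (c + d * \<theta>) = (a - c) + (b - d) * \<theta>" by (simp add: algebra_simps)
  then show ?thesis
    using nrm_lin[of "a - c" "b - d"] A by (simp only: cong_mod_def k_diff max.bounded_iff)
qed

text \<open>Representatives of the ring S modulo every power of the prime. Q is the cardinality of
  the residue field, thus q for \<open>Ok\<close> and its square for \<open>OK\<close>.\<close>

definition transversals :: "'a set \<Rightarrow> nat \<Rightarrow> (nat \<Rightarrow> 'a set) \<Rightarrow> bool" where
  "transversals S Q T \<longleftrightarrow> (\<forall>N. finite (T N) \<and> T N \<subseteq> S \<and> card (T N) = Q ^ N \<and>
     (\<forall>a\<in>S. \<exists>!r. r \<in> T N \<and> cong_mod N a r))"

lemma ex_Tres: "\<exists>T. finite T \<and> T \<subseteq> Ok \<and> card T = q \<and> (\<forall>a\<in>Ok. \<exists>!r. r \<in> T \<and> cong_mod 1 a r)"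
proof -
  define R where "R = {(a, b). a \<in> Ok \<and> b \<in> Ok \<and> a - b \<in> max_ideal_of nrm k}"
  have R_iff: "(a, b) \<in> R \<longleftrightarrow> a \<in> Ok \<and> b \<in> Ok \<and> cong_mod 1 a b" for a b
    using nrm_less_1_iff[of "a - b"] by (auto simp: R_def integers_of_def max_ideal_of_def cong_mod_def k_diff)
  have equiv: "equiv Ok R"
    unfolding equiv_def refl_on_def sym_def trans_def
    using R_iff cong_sym cong_trans by (auto simp: R_def)
  have rf: "residue_field nrm k = Ok // R" by (simp add: residue_field_def R_def)
  define rep where "rep C = (SOME x. x \<in> C)" for C :: "'a set"
  have rep: "rep C \<in> C" if "C \<in> Ok // R" for C
    using in_quotient_imp_non_empty[OF equiv that] by (simp add: rep_def some_in_eq)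
  have repO: "rep C \<in> Ok" if "C \<in> Ok // R" for C
    using rep[OF that] in_quotient_imp_subset[OF equiv that] by blast
  have inj: "inj_on rep (Ok // R)" using quotient_disj[OF equiv] rep by (intro inj_onI) (metis IntI empty_iff)
  show ?thesis
  proof (intro exI[of _ "rep ` (Ok // R)"] conjI ballI)
    show "finite (rep ` (Ok // R))" using finite_residue_field rf by simp
    show "card (rep ` (Ok // R)) = q" using card_image[OF inj] q rf by simp
    show "rep ` (Ok // R) \<subseteq> Ok" using repO by blast
    fix a assume a: "a \<in> Ok"
    have C: "R `` {a} \<in> Ok // R" using a by (rule quotientI)
    show "\<exists>!r. r \<in> rep ` (Ok // R) \<and> cong_mod 1 a r"
    proof (intro ex1I[of _ "rep (R `` {a})"] conjI)
      show "cong_mod 1 a (rep (R `` {a}))" using rep[OF C] R_iff by blast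
      show "rep (R `` {a}) \<in> rep ` (Ok // R)" using C by blast
      fix r assume r: "r \<in> rep ` (Ok // R) \<and> cong_mod 1 a r"
      then obtain C' where C': "C' \<in> Ok // R" "r = rep C'" by blast
      then have "(a, r) \<in> R" using r a repO R_iff by blast
      then have "r \<in> R `` {a} \<inter> C'" using rep C' by blast
      then have "C' = R `` {a}" using quotient_disj[OF equiv C C'(1)] by blast
      then show "r = rep (R `` {a})" using C' by simp
    qed
  qed
qed

definition Tres :: "'a set" where
  "Tres = (SOME T. finite T \<and> T \<subseteq> Ok \<and> card T = q \<and> (\<forall>a\<in>Ok. \<exists>!r. r \<in> T \<and> cong_mod 1 a r))"

lemma Tres: "finite Tres" "Tres \<subseteq> Ok" "card Tres = q" "\<And>a. a \<in> Ok \<Longrightarrow> \<exists>!r. r \<in> Tres \<and> cong_mod 1 a r"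
  using someI_ex[OF ex_Tres] unfolding Tres_def[symmetric] by blast+

fun Tk :: "nat \<Rightarrow> 'a set" where
  "Tk 0 = {0}"
| "Tk (Suc N) = (\<lambda>(b, s). b + uf ^ N * s) ` (Tk N \<times> Tres)"

lemma Ok_closed: "a \<in> Ok \<Longrightarrow> b \<in> Ok \<Longrightarrow> a + b \<in> Ok" "a \<in> Ok \<Longrightarrow> b \<in> Ok \<Longrightarrow> a - b \<in> Ok"
    "a \<in> Ok \<Longrightarrow> b \<in> Ok \<Longrightarrow> a * b \<in> Ok" "uf ^ N \<in> Ok" "0 \<in> Ok" "1 \<in> Ok"
  using pw_le_1[of N] by (auto simp: integers_of_def nrm_uf_power k_0 k_1
      intro: k_add k_diff k_mult k_power prime_in_k nrm_add_le nrm_diff_le nrm_mult_le_1)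

lemma Ok_k: "a \<in> Ok \<Longrightarrow> a \<in> k" and Ok_OK: "a \<in> Ok \<Longrightarrow> a \<in> OK" and OK_iff: "a \<in> OK \<longleftrightarrow> nrm a \<le> 1"
  and Ok_nrm: "a \<in> Ok \<Longrightarrow> nrm a \<le> 1"
  by (auto simp: integers_of_def)

text \<open>\<open>Tk N\<close> consists of the expansions in powers of \<open>uf\<close> with N
  digits from \<open>Tres\<close>. Digits are determined one after the other by congruences, which
  gives both the cardinality and the unique representative.\<close>

lemma transversals_Tk: "transversals Ok q Tk"
  unfolding transversals_def
proof (rule allI)
  fix N
  show "finite (Tk N) \<and> Tk N \<subseteq> Ok \<and> card (Tk N) = q ^ N \<and> (\<forall>a\<in>Ok. \<exists>!r. r \<in> Tk N \<and> cong_mod N a r)"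
  proof (induction N)
    case 0
    then show ?case
      by (auto simp: k_0 cong_mod_def integers_of_def)
  next
    case (Suc N)
    then have fin: "finite (Tk N)" and TO: "\<And>r. r \<in> Tk N \<Longrightarrow> r \<in> Ok" and cd: "card (Tk N) = q ^ N"
      and ex1: "\<And>a. a \<in> Ok \<Longrightarrow> \<exists>!r. r \<in> Tk N \<and> cong_mod N a r"
      by auto
    have key: "r = r' \<and> s = s'" if "r \<in> Tk N" "r' \<in> Tk N" "s \<in> Tres" "s' \<in> Tres"
        "cong_mod (Suc N) (r + uf ^ N * s) (r' + uf ^ N * s')" for r r' s s'
    proof -
      have s: "s \<in> Ok" "s' \<in> Ok" and r: "r \<in> Ok" "r' \<in> Ok" using that Tres(2) TO by auto
      have "nrm (s' - s) \<le> 1" by (intro nrm_diff_le Ok_nrm s)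
      then have small: "nrm (uf ^ N * (s' - s)) \<le> pw N"
        using pw_pos[of N] by (simp add: nrm_uf_mult mult_left_le)
      have "cong_mod N (r + uf ^ N * s) (r' + uf ^ N * s')" using cong_mono[OF that(5)] by simp
      then have "nrm ((r + uf ^ N * s - (r' + uf ^ N * s')) + uf ^ N * (s' - s)) \<le> pw N"
        by (intro nrm_add_le small) (simp add: cong_mod_def)
      then have "cong_mod N r r'" by (simp add: cong_mod_def algebra_simps)
      then have rr: "r = r'" using ex1[OF r(1)] that(1,2) cong_refl by metis
      with that(5) have "cong_mod (N + 1) (uf ^ N * s) (uf ^ N * s')" by (simp add: cong_mod_def)
      then have "cong_mod 1 s s'" by (simp only: cong_uf_mult)
      then have "s = s'" using Tres(4)[OF s(1)] that(3,4) cong_refl by metis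
      with rr show ?thesis
        by simp
    qed
    have "inj_on (\<lambda>(b, s). b + uf ^ N * s) (Tk N \<times> Tres)"
    proof (rule inj_onI, clarify)
      fix r s r' s' assume "r \<in> Tk N" "s \<in> Tres" "r' \<in> Tk N" "s' \<in> Tres" "r + uf ^ N * s = r' + uf ^ N * s'"
      then show "r = r' \<and> s = s'" using key[of r r' s s'] by simp
    qed
    then have card: "card (Tk (Suc N)) = q ^ Suc N"
      using cd Tres(3) by (simp add: card_image card_cartesian_product)
    have sub: "Tk (Suc N) \<subseteq> Ok" using TO Tres Ok_closed by auto
    have "\<exists>!r. r \<in> Tk (Suc N) \<and> cong_mod (Suc N) a r" if a: "a \<in> Ok" for a
    proof -
      obtain r where r: "r \<in> Tk N" "cong_mod N a r"
        using ex1[OF a] by blast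
      have rO: "r \<in> Ok" using r TO by blast
      obtain b where b: "a - r = uf ^ N * b" "nrm b \<le> 1" "b \<in> k"
        using nrm_le_pwE[of "a - r" N] r(2) a rO by (metis Ok_k k_diff cong_mod_def)
      obtain s where s: "s \<in> Tres" "cong_mod 1 b s"
        using Tres(4)[of b] b by (auto simp: integers_of_def)
      have "cong_mod (N + 1) (uf ^ N * b) (uf ^ N * s)" using s(2) by (simp only: cong_uf_mult)
      then have ex: "cong_mod (Suc N) a (r + uf ^ N * s)"
        unfolding b(1)[symmetric] by (simp add: cong_mod_def algebra_simps)
      show ?thesis
      proof (rule ex1I[of _ "r + uf ^ N * s"])
        show "r + uf ^ N * s \<in> Tk (Suc N) \<and> cong_mod (Suc N) a (r + uf ^ N * s)" using r s ex by auto
        fix x assume x: "x \<in> Tk (Suc N) \<and> cong_mod (Suc N) a x"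
        then obtain r' s' where x': "r' \<in> Tk N" "s' \<in> Tres" "x = r' + uf ^ N * s'" by auto
        have "cong_mod (Suc N) (r' + uf ^ N * s') (r + uf ^ N * s)"
          using x x'(3) ex by (metis cong_sym cong_trans)
        then show "x = r + uf ^ N * s" using key[of r' r s' s] x' r s by simp
      qed
    qed
    then show ?case
      using card sub fin Tres(1) by auto
  qed
qed

definition TK :: "nat \<Rightarrow> 'a set" where
  "TK N = (\<lambda>(a, b). a + b * \<theta>) ` (Tk N \<times> Tk N)"

lemma rea_Ok: "nrm a \<le> 1 \<Longrightarrow> rea a \<in> Ok" and ima_Ok: "nrm a \<le> 1 \<Longrightarrow> ima a \<in> Ok"
  using nrm_rea[of a] nrm_ima[of a] by (auto simp: integers_of_def rea_k ima_k)

lemma transversals_TK: "transversals OK (q\<^sup>2) TK"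
  unfolding transversals_def
proof (intro allI conjI)
  fix N
  have T: "finite (Tk N)" "Tk N \<subseteq> Ok" "card (Tk N) = q ^ N" "\<And>a. a \<in> Ok \<Longrightarrow> \<exists>!r. r \<in> Tk N \<and> cong_mod N a r"
    using transversals_Tk unfolding transversals_def by auto
  have inj: "inj_on (\<lambda>(a, b). a + b * \<theta>) (Tk N \<times> Tk N)"
  proof (rule inj_onI, clarify)
    fix a b a' b' assume A: "a \<in> Tk N" "b \<in> Tk N" "a' \<in> Tk N" "b' \<in> Tk N" "a + b * \<theta> = a' + b' * \<theta>"
    then have "a \<in> k" "b \<in> k" "a' \<in> k" "b' \<in> k" using T(2) Ok_k by auto
    then show "a = a' \<and> b = b'" using A(5) rea_lin ima_lin by metis
  qed
  show "finite (TK N)" using T by (simp add: TK_def)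
  show "card (TK N) = (q\<^sup>2) ^ N"
    using T by (simp add: TK_def card_image[OF inj] card_cartesian_product power2_eq_square power_mult_distrib)
  show "TK N \<subseteq> OK"
  proof
    fix x assume "x \<in> TK N"
    then obtain a b where "a \<in> Ok" "b \<in> Ok" "x = a + b * \<theta>" using T by (auto simp: TK_def)
    then show "x \<in> OK" using nrm_lin[of a b] by (simp add: integers_of_def)
  qed
  show "\<forall>a\<in>OK. \<exists>!r. r \<in> TK N \<and> cong_mod N a r"
  proof
    fix a assume "a \<in> OK"
    then have ri: "rea a \<in> Ok" "ima a \<in> Ok" by (auto simp: OK_iff rea_Ok ima_Ok)
    obtain b c where bc: "b \<in> Tk N" "cong_mod N (rea a) b" "c \<in> Tk N" "cong_mod N (ima a) c"
      using T(4)[OF ri(1)] T(4)[OF ri(2)] by blast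
    have k: "b \<in> k" "c \<in> k" "rea a \<in> k" "ima a \<in> k" using bc T(2) Ok_k ri by auto
    show "\<exists>!r. r \<in> TK N \<and> cong_mod N a r"
    proof (rule ex1I[of _ "b + c * \<theta>"])
      show "b + c * \<theta> \<in> TK N \<and> cong_mod N a (b + c * \<theta>)"
        using bc cong_lin[OF k(3,4,1,2), folded rea_ima] by (auto simp: TK_def)
      fix r assume r: "r \<in> TK N \<and> cong_mod N a r"
      then obtain b' c' where r': "b' \<in> Tk N" "c' \<in> Tk N" "r = b' + c' * \<theta>"
        by (auto simp: TK_def)
      then have "b' \<in> k" "c' \<in> k" using T(2) Ok_k by auto
      then have "cong_mod N (rea a) b'" "cong_mod N (ima a) c'"
        using cong_lin[OF k(3,4), of b' c' N, folded rea_ima] r r'(3) by simp_all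
      then show "r = b + c * \<theta>" using T(4)[OF ri(1)] T(4)[OF ri(2)] bc r' by blast
    qed
  qed
qed

lemmas Tk = transversals_Tk[unfolded transversals_def, rule_format]
lemmas TK = transversals_TK[unfolded transversals_def, rule_format]


declare Tk.simps [simp del]

lemma integral_closed:
  assumes "S = Ok \<or> S = OK"
  shows "a \<in> S \<Longrightarrow> b \<in> S \<Longrightarrow> a + b \<in> S" "a \<in> S \<Longrightarrow> b \<in> S \<Longrightarrow> a - b \<in> S" "a \<in> S \<Longrightarrow> uf ^ N * a \<in> S"
    "a \<in> S \<Longrightarrow> nrm a \<le> 1"
proof -
  show "a \<in> S \<Longrightarrow> b \<in> S \<Longrightarrow> a + b \<in> S" "a \<in> S \<Longrightarrow> b \<in> S \<Longrightarrow> a - b \<in> S" "a \<in> S \<Longrightarrow> nrm a \<le> 1"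
    using assms by (auto simp: integers_of_def k_add k_diff intro: nrm_add_le nrm_diff_le)
  show "a \<in> S \<Longrightarrow> uf ^ N * a \<in> S"
    using assms Ok_closed(4)[of N] Ok_closed(3)[of "uf ^ N" a]
    by (auto simp: OK_iff intro!: nrm_mult_le_1 dest: Ok_nrm)
qed

lemma integral_divE:
  assumes "S = Ok \<or> S = OK" "a \<in> S" "nrm a \<le> pw N"
  obtains b where "a = uf ^ N * b" "b \<in> S"
proof -
  obtain b where "a = uf ^ N * b" "nrm b \<le> 1" "a \<in> k \<Longrightarrow> b \<in> k"
    using nrm_le_pwE[OF assms(3)] by blast
  then show thesis
    using that[of b] assms(1,2) by (auto simp: integers_of_def)
qed

text \<open>Subtracting r and dividing by \<open>uf ^ m\<close> identifies the class of r with the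
  integers modulo the remaining power \<open>N - m\<close>.\<close>

lemma card_residue_class:
  assumes tr: "transversals S Q T" and S: "S = Ok \<or> S = OK" and r: "r \<in> S" and mN: "m \<le> N"
  shows "card {b \<in> T N. cong_mod m b r} = Q ^ (N - m)"
proof -
  note T = tr[unfolded transversals_def, rule_format]
  have eq: "cong_mod N (r + uf ^ m * c) (r + uf ^ m * s) \<longleftrightarrow> cong_mod (N - m) c s" for c s
    using cong_uf_mult[of m "N - m" c s] mN by (simp add: cong_mod_def)
  have "card {b \<in> T N. cong_mod m b r} = card (T (N - m))"
  proof (rule card_eq_matching[where R = "\<lambda>b s. cong_mod N b (r + uf ^ m * s)"])
    fix b assume b: "b \<in> {b \<in> T N. cong_mod m b r}"
    then have bS: "b \<in> S" using T[of N] by auto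
    obtain c where c: "b - r = uf ^ m * c" "c \<in> S"
      using integral_divE[OF S integral_closed(2)[OF S bS r]] b by (auto simp: cong_mod_def)
    have "b = r + uf ^ m * c" using c(1) by (simp add: algebra_simps)
    then show "\<exists>!s. s \<in> T (N - m) \<and> cong_mod N b (r + uf ^ m * s)" using T c(2) eq by simp
  next
    fix s assume s: "s \<in> T (N - m)"
    then have sS: "s \<in> S" using T by blast
    have aS: "r + uf ^ m * s \<in> S" by (intro integral_closed[OF S] r sS)
    have "cong_mod m (r + uf ^ m * s) r"
      using integral_closed(4)[OF S sS] pw_pos[of m] by (simp add: cong_mod_def nrm_uf_mult mult_left_le)
    then have "cong_mod m b r" if "cong_mod N b (r + uf ^ m * s)" for b
      using cong_mono[OF that mN] cong_trans by blast
    moreover have "\<exists>!b. b \<in> T N \<and> cong_mod N b (r + uf ^ m * s)"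
      using T[of N] aS cong_sym by metis
    ultimately show "\<exists>!b. b \<in> {b \<in> T N. cong_mod m b r} \<and> cong_mod N b (r + uf ^ m * s)"
      by blast
  qed (use T in auto)
  then show ?thesis
    using T by simp
qed

lemma transversalsD:
  assumes "transversals S Q T"
  shows "finite (T N)" "r \<in> T N \<Longrightarrow> r \<in> S" "card (T N) = Q ^ N"
    "a \<in> S \<Longrightarrow> \<exists>r\<in>T N. cong_mod N a r"
    "r \<in> T N \<Longrightarrow> r' \<in> T N \<Longrightarrow> cong_mod N r r' \<Longrightarrow> r = r'"
proof -
  note T = assms[unfolded transversals_def, rule_format, of N]
  show "finite (T N)" "card (T N) = Q ^ N" "r \<in> T N \<Longrightarrow> r \<in> S" using T by auto
  show "a \<in> S \<Longrightarrow> \<exists>r\<in>T N. cong_mod N a r" using T by blast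
  assume r: "r \<in> T N" "r' \<in> T N" "cong_mod N r r'"
  then have "\<exists>!s. s \<in> T N \<and> cong_mod N r s" using T by blast
  then show "r = r'" using r cong_refl[of N r] by (elim ex1E) (metis r)
qed

lemma card_by_residues:
  assumes tr: "transversals S Q T"
  shows "card {b \<in> T N. P b} = (\<Sum>r\<in>T m. card {b \<in> T N. cong_mod m b r \<and> P b})"
proof -
  note T = transversalsD[OF tr]
  have eq: "{b \<in> T N. P b} = (\<Union>r\<in>T m. {b \<in> T N. cong_mod m b r \<and> P b})"
    by (auto simp: T)
  show ?thesis
    unfolding eq
  proof (rule card_UN_disjoint)
    show "\<forall>i\<in>T m. \<forall>j\<in>T m. i \<noteq> j \<longrightarrow>
        {b \<in> T N. cong_mod m b i \<and> P b} \<inter> {b \<in> T N. cong_mod m b j \<and> P b} = {}"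
    proof (intro ballI impI equals0I)
      fix i j b assume ij: "i \<in> T m" "j \<in> T m" "i \<noteq> j"
        and "b \<in> {b \<in> T N. cong_mod m b i \<and> P b} \<inter> {b \<in> T N. cong_mod m b j \<and> P b}"
      then have "cong_mod m b i" "cong_mod m b j" by auto
      then have "cong_mod m i j" by (rule cong_trans_left)
      then show False
        using T(5)[OF ij(1,2)] ij(3) by simp
    qed
  qed (use T(1) in auto)
qed

text \<open>A condition that only depends on the class modulo the m-th power can be counted at that
  level, since every class has equally many lifts.\<close>

lemma card_level:
  assumes tr: "transversals S Q T" and S: "S = Ok \<or> S = OK" and mN: "m \<le> N"
    and inv: "\<And>a b. a \<in> S \<Longrightarrow> b \<in> S \<Longrightarrow> cong_mod m a b \<Longrightarrow> P a \<longleftrightarrow> P b"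
  shows "card {b \<in> T N. P b} = Q ^ (N - m) * card {b \<in> T m. P b}"
proof -
  note T = transversalsD[OF tr]
  have "card {b \<in> T N. cong_mod m b r \<and> P b} = (if P r then Q ^ (N - m) else 0)" if r: "r \<in> T m" for r
  proof -
    have rS: "r \<in> S"
      using T(2)[OF r] .
    have "{b \<in> T N. cong_mod m b r \<and> P b} = (if P r then {b \<in> T N. cong_mod m b r} else {})"
      using inv[OF T(2) rS] by auto
    then show ?thesis
      using card_residue_class[OF tr S rS mN] by simp
  qed
  then have "card {b \<in> T N. P b} = (\<Sum>r\<in>T m. if P r then Q ^ (N - m) else 0)"
    by (subst card_by_residues[OF tr, of _ _ m]) simp
  also have "\<dots> = Q ^ (N - m) * card {b \<in> T m. P b}"
    using T(1)[of m] by (simp add: sum.inter_filter[symmetric])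
  finally show ?thesis .
qed

section \<open>Solutions of norm congruences\<close>

lemma cong_nm: "nrm a \<le> 1 \<Longrightarrow> nrm b \<le> 1 \<Longrightarrow> cong_mod N a b \<Longrightarrow> cong_mod N (nm a) (nm b)"
  using nrm_nm_diff[of a b] by (simp add: cong_mod_def)

text \<open>The norm-one elements \<open>u \<noteq> -1\<close> of the residue field are determined by the ratio of the two
  coordinates of \<open>1 + u\<close>, because \<open>u (1 + star u) = 1 + u\<close>.\<close>

lemma card_residue_norm_le:
  assumes c: "nrm c = 1"
  shows "card {b \<in> TK 1. cong_mod 1 (nm b) c} \<le> q + 1"
proof (cases "{b \<in> TK 1. cong_mod 1 (nm b) c} = {}")
  case False
  define A where "A = {b \<in> TK 1. cong_mod 1 (nm b) c}"
  obtain b0 where b0: "b0 \<in> A"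
    using False by (auto simp: A_def)
  have unit: "nrm b = 1" if "b \<in> A" for b
  proof -
    have "nrm (nm b) = 1" using that c cong_nrm_1[of 1 "nm b" c] by (simp add: A_def)
    then show ?thesis
      using nrm_nonneg[of b] by (simp add: nrm_nm power2_eq_1_iff)
  qed
  have b0': "nrm b0 = 1" "b0 \<noteq> 0" using unit[OF b0] by auto
  have nu: "cong_mod 1 (nm (b / b0)) 1" if "b \<in> A" for b
  proof -
    have "cong_mod 1 (nm b) c" "cong_mod 1 (nm b0) c" using that b0 by (auto simp: A_def)
    then have "cong_mod 1 (nm b) (nm b0)" by (rule cong_trans_right)
    moreover have "nm b0 * nm (b / b0) = nm b" using b0'(2) by (simp add: nm_mult[symmetric])
    ultimately have "cong_mod 1 (nm b0 * nm (b / b0)) (nm b0 * 1)" by (simp only: mult_1_right)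
    moreover have "nrm (nm b0) = 1" using b0' by (simp add: nrm_nm)
    ultimately show ?thesis
      using cong_unit_cancel by blast
  qed
  \<comment> \<open>The slope parametrizes the conic of norm-one residues by lines through the point
    -1. That point itself is sent to \<open>None\<close>, so \<open>f\<close> takes at most q + 1
    values.\<close>
  define t where "t u = ima u / (1 + rea u)" for u
  define f where "f b = (if cong_mod 1 (b / b0) (- 1) then None
      else Some (THE r. r \<in> Tk 1 \<and> cong_mod 1 (t (b / b0)) r))" for b
  have main: "nrm (1 + rea u) = 1 \<and> t u \<in> Ok \<and> cong_mod 1 (u * (1 - t u * \<theta>)) (1 + t u * \<theta>)"
    if u: "nrm u = 1" "cong_mod 1 (nm u) 1" "\<not> cong_mod 1 u (- 1)" for u
  proof -
    define x y where "x = rea u" and "y = ima u"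
    have xy: "x \<in> k" "y \<in> k" "nrm x \<le> 1" "nrm y \<le> 1"
      using rea_k ima_k nrm_rea[of u] nrm_ima[of u] u(1) by (auto simp: x_def y_def)
    have uxy: "u = x + y * \<theta>" unfolding x_def y_def by (rule rea_ima)
    have nmu: "nm u = x * x - \<theta> * \<theta> * (y * y)"
      unfolding uxy using xy by (simp add: nm_def star_lin algebra_simps)
    \<comment> \<open>If \<open>1 + x\<close> were a nonunit, then \<open>nm u\<close> congruent to
      1 would force y to be a nonunit, and u would be congruent to the excluded point -1.\<close>
    have unit1: "nrm (1 + x) = 1"
    proof (rule ccontr)
      assume "nrm (1 + x) \<noteq> 1"
      moreover have "nrm (1 + x) \<le> 1" using xy by (intro nrm_add_le) auto
      ultimately have lt: "nrm (1 + x) < 1" by simp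
      have "nrm ((x + 1) * (x - 1)) < 1"
      proof -
        have "nrm (x - 1) \<le> 1" using xy by (intro nrm_diff_le) auto
        then have "nrm (x + 1) * nrm (x - 1) \<le> nrm (x + 1)" by (simp add: mult_left_le nrm_nonneg)
        then show ?thesis
          using lt by (simp add: nrm_mult add.commute)
      qed
      moreover have "nrm (nm u - 1) < 1" using u(2) nrm_less_1_iff by (simp add: cong_mod_def)
      ultimately have "nrm ((x + 1) * (x - 1) - (nm u - 1)) < 1" by (rule nrm_diff_less)
      moreover have "(x + 1) * (x - 1) - (nm u - 1) = \<theta> * \<theta> * (y * y)"
        by (simp add: nmu algebra_simps)
      ultimately have "nrm y * nrm y < 1" by (simp add: nrm_mult)
      then have "nrm y < 1" using xy(4) by (cases "nrm y = 1") auto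
      then have "nrm (1 + x + y * \<theta>) < 1"
        using lt by (intro nrm_add_less[of "1 + x"]) (auto simp: nrm_mult)
      then show False
        using u(3) nrm_less_1_iff[of "u + 1"] uxy by (simp add: cong_mod_def add_ac)
    qed
    then have ne: "1 + x \<noteq> 0" by auto
    have tO: "t u \<in> Ok"
      using xy unit1 by (simp add: t_def x_def[symmetric] y_def[symmetric] integers_of_def nrm_divide k_divide k_add k_1)
    have ty: "(1 + x) * t u = y" using ne by (simp add: t_def x_def[symmetric] y_def[symmetric])
    have "(1 + x) * (u * (1 - t u * \<theta>)) - (1 + x) * (1 + t u * \<theta>)
        = u * ((1 + x) - (1 + x) * t u * \<theta>) - ((1 + x) + (1 + x) * t u * \<theta>)"
      by (simp add: algebra_simps)
    moreover have "u * ((1 + x) - y * \<theta>) - ((1 + x) + y * \<theta>) = nm u - 1"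
      unfolding nmu by (simp add: uxy algebra_simps)
    ultimately have "(1 + x) * (u * (1 - t u * \<theta>)) - (1 + x) * (1 + t u * \<theta>) = nm u - 1"
      by (simp only: ty)
    then have "cong_mod 1 ((1 + x) * (u * (1 - t u * \<theta>))) ((1 + x) * (1 + t u * \<theta>))"
      using u(2) by (simp add: cong_mod_def)
    then show ?thesis
      using unit1 tO by (simp add: cong_unit_cancel x_def)
  qed
  have fSome: "\<exists>r. f b = Some r \<and> r \<in> Tk 1 \<and> cong_mod 1 (t (b / b0)) r"
    if "b \<in> A" "\<not> cong_mod 1 (b / b0) (- 1)" for b
  proof -
    have "t (b / b0) \<in> Ok" using main[of "b / b0"] nu[OF that(1)] that unit b0' by (simp add: nrm_divide)
    then have "\<exists>!r. r \<in> Tk 1 \<and> cong_mod 1 (t (b / b0)) r" using Tk by blast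
    from theI'[OF this] show ?thesis
      using that(2) by (simp add: f_def)
  qed
  have same: "b = b'" if "b \<in> A" "b' \<in> A" "cong_mod 1 (b / b0) (b' / b0)" for b b'
  proof -
    have "cong_mod 1 (b0 * (b / b0)) (b0 * (b' / b0))" using that b0' by (simp only: cong_unit_cancel)
    then have "cong_mod 1 b b'" using b0' by simp
    moreover have "b \<in> TK 1" "b' \<in> TK 1" using that by (auto simp: A_def)
    moreover from this have "\<exists>!r. r \<in> TK 1 \<and> cong_mod 1 b r" using TK[of 1] by blast
    ultimately show ?thesis
      using cong_refl[of 1 b] by blast
  qed
  have inj: "inj_on f A"
  proof (rule inj_onI)
    fix b b' assume b: "b \<in> A" "b' \<in> A" "f b = f b'"
    show "b = b'"
    proof (cases "cong_mod 1 (b / b0) (- 1)")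
      case True
      then have "f b' = None" using b(3) by (simp add: f_def)
      then have "cong_mod 1 (b' / b0) (- 1)" using fSome[OF b(2)] by auto
      then show ?thesis
        using same[OF b(1,2)] True by (blast intro: cong_trans_right)
    next
      case False
      then obtain r where r: "f b = Some r" "cong_mod 1 (t (b / b0)) r" using fSome[OF b(1)] by blast
      then have "\<not> cong_mod 1 (b' / b0) (- 1)" using b(3) by (auto simp: f_def)
      then obtain r' where r': "f b' = Some r'" "cong_mod 1 (t (b' / b0)) r'" using fSome[OF b(2)] by blast
      define u u' where "u = b / b0" and "u' = b' / b0"
      have "r = r'" using r(1) r'(1) b(3) by simp
      then have tt: "cong_mod 1 (t u) (t u')"
        using r(2) r'(2) unfolding u_def u'_def by (auto intro: cong_trans_right)
      have u: "nrm u = 1" "cong_mod 1 (nm u) 1" "\<not> cong_mod 1 u (- 1)"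
        "nrm u' = 1" "cong_mod 1 (nm u') 1" "\<not> cong_mod 1 u' (- 1)"
        using nu b(1,2) unit b0' False \<open>\<not> cong_mod 1 (b' / b0) (- 1)\<close> by (auto simp: u_def u'_def nrm_divide)
      note m = main[OF u(1) u(2) u(3)] main[OF u(4) u(5) u(6)]
      have tk: "t u \<in> k" "t u' \<in> k" "nrm (t u) \<le> 1" "nrm (t u') \<le> 1"
        using m(1) m(2) by (auto intro: Ok_k Ok_nrm)
      have t\<theta>: "cong_mod 1 (t u * \<theta>) (t u' * \<theta>)"
        using tt cong_unit_cancel[of \<theta> 1 "t u" "t u'"] by (simp add: mult.commute)
      have un: "nrm (1 - t u' * \<theta>) = 1" using nrm_lin[of 1 "- t u'"] tk by (simp add: k_1 k_minus)
      have "cong_mod 1 (u * (1 - t u' * \<theta>)) (u * (1 - t u * \<theta>))"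
        unfolding cong_unit_cancel[OF u(1)] using t\<theta> by (intro cong_diff cong_refl) (simp only: cong_sym)
      moreover have "cong_mod 1 (u * (1 - t u * \<theta>)) (1 + t u * \<theta>)" using m(1) by blast
      moreover have "cong_mod 1 (1 + t u * \<theta>) (1 + t u' * \<theta>)"
        using t\<theta> by (intro cong_add) auto
      moreover have "cong_mod 1 (1 + t u' * \<theta>) (u' * (1 - t u' * \<theta>))"
        using m(2) by (simp only: cong_sym[of 1 "1 + t u' * \<theta>"])
      ultimately have "cong_mod 1 (u * (1 - t u' * \<theta>)) (u' * (1 - t u' * \<theta>))"
        by (rule cong_trans[OF cong_trans[OF cong_trans]])
      then have "cong_mod 1 u u'" using un cong_unit_cancel[OF un, of 1 u u'] by (simp add: mult.commute)
      then show ?thesis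
        using same[OF b(1,2)] by (simp add: u_def u'_def)
    qed
  qed
  have "f ` A \<subseteq> insert None (Some ` Tk 1)" using fSome by (auto simp: f_def)
  then have "card (f ` A) \<le> card (insert None (Some ` Tk 1))" using Tk by (intro card_mono) auto
  also have "\<dots> = q + 1" using Tk[of 1] by (simp add: card_image)
  finally show ?thesis
    using card_image[OF inj] by (simp add: A_def)
next
  case True
  then show ?thesis
    by (simp only: card.empty le0)
qed

text \<open>Every unit class has at most q + 1 preimages under the norm. The q^2 - 1 unit residues
  of the big field are distributed over q - 1 classes, so the bound must be attained in each of
  them.\<close>

lemma card_residue_norm:
  assumes c: "c \<in> Ok" "nrm c = 1"
  shows "card {b \<in> TK 1. cong_mod 1 (nm b) c} = q + 1"
proof -
  define A where "A c = {b \<in> TK 1. cong_mod 1 (nm b) c}" for c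
  define U where "U = {c \<in> Tk 1. nrm c = 1}"
  have lt1: "cong_mod 1 b 0 \<longleftrightarrow> nrm b \<noteq> 1" if "nrm b \<le> 1" for b
    using that nrm_less_1_iff[of b] by (auto simp: cong_mod_def)
  have cardU: "card U = q - 1"
  proof -
    have "U = Tk 1 - {c \<in> Tk 1. cong_mod 1 c 0}" using Tk[of 1] lt1 Ok_nrm unfolding U_def by auto
    moreover have "card {c \<in> Tk 1. cong_mod 1 c 0} = 1"
      using card_residue_class[OF transversals_Tk _ Ok_closed(5), of 1 1] by simp
    moreover have "card (Tk 1 - {c \<in> Tk 1. cong_mod 1 c 0}) = card (Tk 1) - card {c \<in> Tk 1. cong_mod 1 c 0}"
      using Tk[of 1] by (intro card_Diff_subset) auto
    ultimately show ?thesis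
      using Tk[of 1] by simp
  qed
  have finA: "finite (A c)" for c using TK[of 1] by (simp add: A_def)
  have "{b \<in> TK 1. nrm b = 1} = (\<Union>c\<in>U. A c)"
  proof (intro equalityI subsetI)
    fix b assume b: "b \<in> {b \<in> TK 1. nrm b = 1}"
    then have nb: "nm b \<in> Ok" "nrm (nm b) = 1" by (auto simp: integers_of_def nm_k nrm_nm)
    then obtain c where "c \<in> Tk 1" "cong_mod 1 (nm b) c" using Tk by blast
    moreover from this have "nrm c = 1" using nb cong_nrm_1[of 1 c "nm b"] cong_sym[of 1 c] by simp
    ultimately show "b \<in> (\<Union>c\<in>U. A c)" using b by (auto simp: A_def U_def)
  next
    fix b assume "b \<in> (\<Union>c\<in>U. A c)"
    then obtain c where "b \<in> TK 1" "nrm c = 1" "cong_mod 1 (nm b) c" by (auto simp: A_def U_def)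
    moreover from this have "nrm b ^ 2 = 1" using cong_nrm_1[of 1 "nm b" c] by (simp add: nrm_nm)
    ultimately show "b \<in> {b \<in> TK 1. nrm b = 1}" using nrm_nonneg[of b] by (simp add: power2_eq_1_iff)
  qed
  then have "card {b \<in> TK 1. nrm b = 1} = (\<Sum>c\<in>U. card (A c))"
  proof (simp only:, intro card_UN_disjoint)
    show "finite U" using Tk[of 1] by (simp add: U_def)
    show "\<forall>i\<in>U. \<forall>j\<in>U. i \<noteq> j \<longrightarrow> A i \<inter> A j = {}"
    proof (intro ballI impI, rule ccontr)
      fix i j assume ij: "i \<in> U" "j \<in> U" "i \<noteq> j" "A i \<inter> A j \<noteq> {}"
      then obtain b where "cong_mod 1 (nm b) i" "cong_mod 1 (nm b) j" by (auto simp: A_def)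
      then have "cong_mod 1 i j" by (rule cong_trans_left)
      moreover have "i \<in> Tk 1" "j \<in> Tk 1" "i \<in> Ok" using ij Tk[of 1] unfolding U_def by blast+
      ultimately show False
        using ij(3) transversalsD(5)[OF transversals_Tk] by blast
    qed
  qed (use finA in auto)
  moreover have "card {b \<in> TK 1. nrm b = 1} = q\<^sup>2 - 1"
  proof -
    have "{b \<in> TK 1. nrm b = 1} = TK 1 - {b \<in> TK 1. cong_mod 1 b 0}"
      using TK[of 1] lt1 OK_iff by blast
    moreover have "card {b \<in> TK 1. cong_mod 1 b 0} = 1"
      using card_residue_class[OF transversals_TK _ _, of 0 1 1] by (simp add: OK_iff)
    ultimately show ?thesis
      using TK[of 1] by (simp add: card_Diff_subset)
  qed
  moreover have "q\<^sup>2 - 1 = (\<Sum>c\<in>U. q + 1)"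
    using q_ge_2 by (simp add: cardU power2_eq_square algebra_simps)
  ultimately have sumeq: "(\<Sum>c\<in>U. card (A c)) = (\<Sum>c\<in>U. q + 1)" by simp
  obtain c' where c': "c' \<in> Tk 1" "cong_mod 1 c c'"
    using c(1) Tk by blast
  then have "nrm c' = 1" using c cong_nrm_1[of 1 c' c] cong_sym[of 1 c'] by simp
  then have "c' \<in> U" using c' by (simp add: U_def)
  then have "card (A c') = q + 1"
    using sum_mono_inv[OF sumeq, of c'] Tk[of 1] card_residue_norm_le by (auto simp: U_def A_def)
  moreover have "A c = A c'"
  proof -
    have "cong_mod 1 (nm b) c \<longleftrightarrow> cong_mod 1 (nm b) c'" for b
      using cong_trans[of 1 "nm b" c c'] cong_trans_right[of 1 "nm b" c' c] c'(2) by blast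
    then show ?thesis
      by (simp add: A_def)
  qed
  ultimately show ?thesis
    by (simp add: A_def)
qed


lemmas TkD = transversalsD[OF transversals_Tk]
lemmas TKD = transversalsD[OF transversals_TK]

lemma card_linear_residues_aux:
  assumes "A \<in> Ok" "B \<in> Ok" "w \<in> Ok" and A1: "nrm A = 1"
  shows "card {z \<in> Tk 1 \<times> Tk 1. cong_mod 1 (A * fst z + B * snd z + w) 0} = q"
proof -
  have A0: "A \<noteq> 0" using A1 by auto
  have iff: "cong_mod 1 (A * x + B * y + w) 0 \<longleftrightarrow> cong_mod 1 (- (B * y + w) / A) x" for x y
  proof -
    have "A * x + B * y + w - 0 = A * x - A * (- (B * y + w) / A)" using A0 by simp
    then have "cong_mod 1 (A * x + B * y + w) 0 \<longleftrightarrow> cong_mod 1 (A * x) (A * (- (B * y + w) / A))"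
      by (simp only: cong_mod_def)
    then show ?thesis
      by (simp only: cong_unit_cancel[OF A1] cong_sym[of 1 x])
  qed
  have "card {z \<in> Tk 1 \<times> Tk 1. cong_mod 1 (A * fst z + B * snd z + w) 0} = card (Tk 1)"
  proof (rule card_eq_matching[where R = "\<lambda>z y. snd z = y"])
    fix y assume y: "y \<in> Tk 1"
    have "B * y + w \<in> Ok" using assms TkD(2)[OF y] by (simp add: Ok_closed)
    moreover have "- u / A \<in> Ok" if "u \<in> Ok" for u
      using that assms unfolding integers_of_def by (auto simp: nrm_divide intro: k_divide k_minus)
    ultimately have "- (B * y + w) / A \<in> Ok" by blast
    then have "\<exists>!x. x \<in> Tk 1 \<and> cong_mod 1 (- (B * y + w) / A) x" using Tk by blast
    then obtain x where x: "x \<in> Tk 1" "cong_mod 1 (- (B * y + w) / A) x"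
        "\<And>x'. x' \<in> Tk 1 \<Longrightarrow> cong_mod 1 (- (B * y + w) / A) x' \<Longrightarrow> x' = x"
      by blast
    show "\<exists>!z. z \<in> {z \<in> Tk 1 \<times> Tk 1. cong_mod 1 (A * fst z + B * snd z + w) 0} \<and> snd z = y"
    proof (rule ex1I[of _ "(x, y)"])
      show "(x, y) \<in> {z \<in> Tk 1 \<times> Tk 1. cong_mod 1 (A * fst z + B * snd z + w) 0} \<and> snd (x, y) = y"
        using x(1,2) y unfolding iff by simp
      fix z assume "z \<in> {z \<in> Tk 1 \<times> Tk 1. cong_mod 1 (A * fst z + B * snd z + w) 0} \<and> snd z = y"
      then show "z = (x, y)" using x(3)[of "fst z"] unfolding iff by (cases z) auto
    qed
  qed (use TkD(1)[of 1] in auto)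
  then show ?thesis
    using TkD(3)[of 1] by simp
qed

lemma card_linear_residues:
  assumes "A \<in> Ok" "B \<in> Ok" "w \<in> Ok" and "nrm A = 1 \<or> nrm B = 1"
  shows "card {z \<in> Tk 1 \<times> Tk 1. cong_mod 1 (A * fst z + B * snd z + w) 0} = q"
proof (cases "nrm A = 1")
  case True
  then show ?thesis
    using assms by (intro card_linear_residues_aux)
next
  case False
  have "{z \<in> Tk 1 \<times> Tk 1. cong_mod 1 (A * fst z + B * snd z + w) 0} =
      prod.swap ` {z \<in> Tk 1 \<times> Tk 1. cong_mod 1 (B * fst z + A * snd z + w) 0}"
    by (auto simp: image_iff add.commute)
  then show ?thesis
    using card_linear_residues_aux[of B A w] assms False by (simp add: card_image)
qed

text \<open>The trace form is nondegenerate modulo the prime since 2 and \<open>\<theta>\<close> are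
  units. For a unit r the condition is therefore one nontrivial affine equation in the two residue
  coordinates of s.\<close>

lemma card_trace_residues:
  assumes r: "nrm r = 1" and w: "w \<in> Ok"
  shows "card {s \<in> TK 1. cong_mod 1 (w + tr (r * star s)) 0} = q"
proof -
  define a b where "a = rea r" and "b = ima r"
  have ab: "a \<in> Ok" "b \<in> Ok" using rea_Ok[of r] ima_Ok[of r] r by (simp_all add: a_def b_def)
  have rab: "r = a + b * \<theta>" unfolding a_def b_def by (rule rea_ima)
  have max1: "max (nrm a) (nrm b) = 1" using nrm_lin[of a b] ab Ok_k r rab by metis
  have th: "\<theta> * \<theta> \<in> k" unfolding star_fixed_iff[symmetric] by (simp add: star_mult)
  have ABk: "2 * a \<in> Ok" "- (2 * b * (\<theta> * \<theta>)) \<in> Ok"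
    using ab th unfolding integers_of_def by (auto simp: nrm_mult intro!: k_mult k_minus k_numeral)
  have unit: "nrm (2 * a) = 1 \<or> nrm (- (2 * b * (\<theta> * \<theta>))) = 1"
    using max1 by (auto simp: nrm_mult max_def split: if_splits)
  have inj: "inj_on (\<lambda>(x, y). x + y * \<theta>) (Tk 1 \<times> Tk 1)"
  proof (rule inj_onI, clarify)
    fix x y x' y' assume A: "x \<in> Tk 1" "y \<in> Tk 1" "x' \<in> Tk 1" "y' \<in> Tk 1" "x + y * \<theta> = x' + y' * \<theta>"
    then have "x \<in> k" "y \<in> k" "x' \<in> k" "y' \<in> k" using TkD(2) Ok_k by blast+
    then show "x = x' \<and> y = y'" using A(5) rea_lin ima_lin by metis
  qed
  have trs: "tr (r * star (x + y * \<theta>)) = 2 * a * x + (- (2 * b * (\<theta> * \<theta>))) * y" if "x \<in> Ok" "y \<in> Ok" for x y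
  proof -
    have "tr (r * star s) = r * star s + star r * s" for s by (simp add: tr_def star_mult)
    then have "tr (r * star (x + y * \<theta>)) = r * star (x + y * \<theta>) + star r * (x + y * \<theta>)" .
    also have "\<dots> = (a + b * \<theta>) * (x - y * \<theta>) + (a - b * \<theta>) * (x + y * \<theta>)"
      unfolding rab using ab that by (simp only: star_lin Ok_k)
    finally have "tr (r * star (x + y * \<theta>)) = (a + b * \<theta>) * (x - y * \<theta>) + (a - b * \<theta>) * (x + y * \<theta>)" .
    then show ?thesis
      by (simp add: algebra_simps)
  qed
  have "{s \<in> TK 1. cong_mod 1 (w + tr (r * star s)) 0} = (\<lambda>(x, y). x + y * \<theta>) `
      {z \<in> Tk 1 \<times> Tk 1. cong_mod 1 (2 * a * fst z + (- (2 * b * (\<theta> * \<theta>))) * snd z + w) 0}"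
    (is "?L = _ ` ?R")
    by (auto simp: TK_def trs TkD add.commute)
  moreover have "inj_on (\<lambda>(x, y). x + y * \<theta>) ?R" by (rule inj_on_subset[OF inj]) auto
  ultimately have "card ?L = card ?R" by (simp only: card_image)
  then show ?thesis
    using card_linear_residues[OF ABk w unit] by simp
qed

lemma star_uf: "star (uf ^ N) = uf ^ N" by (simp add: star_fixes k_power prime_in_k)

text \<open>Hensel lifting with multiplicities: modulo the power \<open>2 * L\<close> of the prime,
  replacing r by \<open>r + uf ^ L * s\<close> changes \<open>nm r\<close> by
  \<open>uf ^ L * tr (r * star s)\<close>. Hence every solution modulo the L-th power has exactly q
  lifts among the q^2 possible ones.\<close>

lemma card_norm_unit_level:
  assumes c: "c \<in> Ok" "nrm c = 1"
  shows "card {b \<in> TK (Suc l). cong_mod (Suc l) (nm b) c} = (q + 1) * q ^ l"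
proof (induction l)
  case 0
  then show ?case
    using card_residue_norm[OF c] by simp
next
  case (Suc l)
  define L where "L = Suc l"
  have L1: "L \<ge> 1" and qL: "q ^ L = q * q ^ l" by (simp_all add: L_def)
  have step: "card {b \<in> TK (Suc L). cong_mod L b r \<and> cong_mod (Suc L) (nm b) c}
      = (if cong_mod L (nm r) c then q else 0)" if r: "r \<in> TK L" for r
  proof -
    have r1: "nrm r \<le> 1" using TKD(2)[OF r] by (simp add: OK_iff)
    show ?thesis
    proof (cases "cong_mod L (nm r) c")
      case False
      have "\<not> (cong_mod L b r \<and> cong_mod (Suc L) (nm b) c)" if b: "b \<in> TK (Suc L)" for b
      proof
        assume A: "cong_mod L b r \<and> cong_mod (Suc L) (nm b) c"
        have "nrm b \<le> 1" using TKD(2)[OF b] by (simp add: OK_iff)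
        then have "cong_mod L (nm b) (nm r)" using A r1 cong_nm by blast
        moreover have "cong_mod L (nm b) c" using A cong_mono[of "Suc L" "nm b" c L] by simp
        ultimately show False
          using False cong_trans_left by blast
      qed
      then have "{b \<in> TK (Suc L). cong_mod L b r \<and> cong_mod (Suc L) (nm b) c} = {}" by blast
      then show ?thesis
        using False by (simp only: if_False card.empty)
    next
      case True
      have "nrm (nm r) = 1"
        using cong_nrm_1[OF True c(2) L1] .
      then have ru: "nrm r = 1" using nrm_nonneg[of r] by (simp add: nrm_nm power2_eq_1_iff)
      have "nm r - c \<in> Ok" "nrm (nm r - c) \<le> pw L"
        using True c r1 by (auto simp: cong_mod_def integers_of_def nm_k nrm_nm k_diff power_le_one nrm_nonneg intro!: nrm_diff_le)
      then obtain w where w: "nm r - c = uf ^ L * w" "w \<in> Ok"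
        using integral_divE[of Ok "nm r - c" L] by blast
      have expand: "cong_mod (Suc L) (nm (r + uf ^ L * s)) c \<longleftrightarrow> cong_mod 1 (w + tr (r * star s)) 0"
        if s: "nrm s \<le> 1" for s
      proof -
        have "nm (r + uf ^ L * s) - c = uf ^ L * ((w + tr (r * star s)) + uf ^ L * nm s)"
          using w(1) by (simp add: nm_def tr_def star_add star_mult star_uf algebra_simps)
        then have "cong_mod (Suc L) (nm (r + uf ^ L * s)) c \<longleftrightarrow>
            cong_mod (L + 1) (uf ^ L * ((w + tr (r * star s)) + uf ^ L * nm s)) (uf ^ L * 0)"
          by (simp add: cong_mod_def)
        also have "\<dots> \<longleftrightarrow> cong_mod 1 ((w + tr (r * star s)) + uf ^ L * nm s) 0"
          by (rule cong_uf_mult)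
        also have "\<dots> \<longleftrightarrow> cong_mod 1 (w + tr (r * star s)) 0"
        proof -
          have "nrm (uf ^ L * nm s) \<le> pw L * 1"
            unfolding nrm_uf_mult nrm_nm using s pw_pos[of L]
            by (intro mult_left_mono) (auto simp: power_le_one nrm_nonneg)
          then have "nrm (uf ^ L * nm s) \<le> pw 1" using L1 pw_le_iff[of L 1] by simp
          then have "cong_mod 1 ((w + tr (r * star s)) + uf ^ L * nm s) (w + tr (r * star s))"
            by (simp add: cong_mod_def)
          then show ?thesis
            using cong_trans cong_trans_left by blast
        qed
        finally show ?thesis .
      qed
      have "card {b \<in> TK (Suc L). cong_mod L b r \<and> cong_mod (Suc L) (nm b) c}
          = card {s \<in> TK 1. cong_mod 1 (w + tr (r * star s)) 0}"
      proof (rule card_eq_matching[where R = "\<lambda>b s. cong_mod (Suc L) b (r + uf ^ L * s)"])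
        fix b assume b: "b \<in> {b \<in> TK (Suc L). cong_mod L b r \<and> cong_mod (Suc L) (nm b) c}"
        then have b1: "nrm b \<le> 1" using TKD(2)[of b "Suc L"] by (simp add: OK_iff)
        obtain d where d: "b - r = uf ^ L * d" "d \<in> OK"
          using integral_divE[of OK "b - r" L] b b1 r1 nrm_diff_le[of b 1 r] by (auto simp: cong_mod_def OK_iff)
        have bd: "b = r + uf ^ L * d" using d(1) by (simp add: algebra_simps)
        have eq: "cong_mod (Suc L) b (r + uf ^ L * s) \<longleftrightarrow> cong_mod 1 d s" for s
          using cong_uf_mult[of L 1 d s] by (simp add: bd cong_mod_def)
        have ex1: "\<exists>!s. s \<in> TK 1 \<and> cong_mod 1 d s" using d(2) TK by blast
        have "cong_mod 1 (w + tr (r * star s)) 0" if "s \<in> TK 1" "cong_mod (Suc L) b (r + uf ^ L * s)" for s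
        proof -
          have s1: "nrm s \<le> 1" using TKD(2)[OF that(1)] by (simp add: OK_iff)
          have "nrm (r + uf ^ L * s) \<le> 1"
            using r1 s1 integral_closed(3)[of OK s L] by (intro nrm_add_le) (auto simp: OK_iff)
          then have "cong_mod (Suc L) (nm b) (nm (r + uf ^ L * s))" using b1 that(2) cong_nm by blast
          then have "cong_mod (Suc L) (nm (r + uf ^ L * s)) c" using b cong_trans_left by blast
          then show ?thesis
            using expand[OF s1] by simp
        qed
        then show "\<exists>!s. s \<in> {s \<in> TK 1. cong_mod 1 (w + tr (r * star s)) 0} \<and> cong_mod (Suc L) b (r + uf ^ L * s)"
          using ex1 unfolding eq by blast
      next
        fix s assume s: "s \<in> {s \<in> TK 1. cong_mod 1 (w + tr (r * star s)) 0}"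
        then have s1: "nrm s \<le> 1" using TKD(2)[of s 1] by (simp add: OK_iff)
        have usm: "nrm (uf ^ L * s) \<le> pw L" using s1 pw_pos[of L] by (simp add: nrm_uf_mult mult_left_le)
        have a1: "nrm (r + uf ^ L * s) \<le> 1" using r1 usm pw_le_1[of L] by (intro nrm_add_le) auto
        then have ex1: "\<exists>!b. b \<in> TK (Suc L) \<and> cong_mod (Suc L) (r + uf ^ L * s) b"
          using TK OK_iff by blast
        have "cong_mod L b r \<and> cong_mod (Suc L) (nm b) c"
          if "b \<in> TK (Suc L)" "cong_mod (Suc L) (r + uf ^ L * s) b" for b
        proof
          have "cong_mod L (r + uf ^ L * s) b" using cong_mono[OF that(2)] by simp
          moreover have "cong_mod L (r + uf ^ L * s) r" using usm by (simp add: cong_mod_def)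
          ultimately show "cong_mod L b r" by (rule cong_trans_left)
          have "nrm b \<le> 1" using TKD(2)[OF that(1)] by (simp add: OK_iff)
          then have "cong_mod (Suc L) (nm (r + uf ^ L * s)) (nm b)" using a1 that(2) cong_nm by blast
          moreover have "cong_mod (Suc L) (nm (r + uf ^ L * s)) c" using s expand[OF s1] by simp
          ultimately show "cong_mod (Suc L) (nm b) c" by (rule cong_trans_left)
        qed
        then show "\<exists>!b. b \<in> {b \<in> TK (Suc L). cong_mod L b r \<and> cong_mod (Suc L) (nm b) c} \<and> cong_mod (Suc L) b (r + uf ^ L * s)"
          using ex1 unfolding cong_sym[of "Suc L" _ "r + uf ^ L * s"] by blast
      qed (use TKD(1) in auto)
      then show ?thesis
        using True card_trace_residues[OF ru w(2)] by simp
    qed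
  qed
  have "card {b \<in> TK (Suc L). cong_mod (Suc L) (nm b) c} = (\<Sum>r\<in>TK L. if cong_mod L (nm r) c then q else 0)"
    by (subst card_by_residues[OF transversals_TK, of _ _ L]) (simp add: step)
  also have "\<dots> = q * card {r \<in> TK L. cong_mod L (nm r) c}"
    using TKD(1)[of L] by (simp add: sum.inter_filter[symmetric])
  also have "\<dots> = (q + 1) * q ^ Suc l" using Suc.IH by (simp add: L_def algebra_simps)
  finally show ?case
    by (simp add: L_def)
qed

lemma card_norm_unit:
  assumes c: "c \<in> Ok" "nrm c = 1" and l: "1 \<le> l" "l \<le> N"
  shows "card {b \<in> TK N. cong_mod l (nm b) c} = (q + 1) * q ^ (2 * N - l - 1)"
proof -
  have "card {b \<in> TK N. cong_mod l (nm b) c} = (q\<^sup>2) ^ (N - l) * card {b \<in> TK l. cong_mod l (nm b) c}"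
  proof (rule card_level[OF transversals_TK])
    fix a b assume "a \<in> OK" "b \<in> OK" "cong_mod l a b"
    then have "cong_mod l (nm a) (nm b)" by (simp add: cong_nm OK_iff)
    then show "cong_mod l (nm a) c \<longleftrightarrow> cong_mod l (nm b) c"
      using cong_trans[of l "nm a" "nm b" c] cong_trans_left[of l "nm a" "nm b" c] by blast
  qed (use l in auto)
  also have "card {b \<in> TK l. cong_mod l (nm b) c} = (q + 1) * q ^ (l - 1)"
    using card_norm_unit_level[OF c, of "l - 1"] l by simp
  also have "(q\<^sup>2) ^ (N - l) * ((q + 1) * q ^ (l - 1)) = (q + 1) * q ^ (2 * (N - l) + (l - 1))"
    by (simp only: power_mult[symmetric] power_add mult_ac)
  also have "2 * (N - l) + (l - 1) = 2 * N - l - 1" using l by simp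
  finally show ?thesis .
qed

text \<open>For m at most e, the right-hand side is 0 modulo the m-th power and the condition says
  that the valuation of b is at least m / 2, rounded up. Beyond e the valuation of the norm must
  equal e, which is impossible for odd e.\<close>

definition norm_count :: "nat \<Rightarrow> nat \<Rightarrow> nat \<Rightarrow> nat" where
  "norm_count e N m = (if m \<le> e then q ^ (2 * (N - (m + 1) div 2))
     else if odd e then 0 else (q + 1) * q ^ (2 * N - m - 1))"

lemma card_norm:
  assumes c: "c \<in> k" "nrm c = pw e" and m: "m \<le> N"
  shows "card {b \<in> TK N. cong_mod m (nm b) c} = norm_count e N m"
proof -
  have sq_le: "nrm b ^ 2 \<le> pw m \<longleftrightarrow> nrm b \<le> pw ((m + 1) div 2)" for b m
  proof (cases "b = 0")
    case False
    then obtain i where i: "nrm b = real q powi (- i)" using ex_nrm_eq by blast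
    have "nrm b ^ 2 = real q powi (- (2 * i))" unfolding i power2_eq_square q_powi_add[symmetric] by simp
    then show ?thesis
      unfolding i pw_powi by (simp only: q_powi_le_iff) presburger
  qed (use pw_pos in \<open>simp add: less_imp_le\<close>)
  consider "m \<le> e" | "m > e" "odd e" | "m > e" "even e"
    by linarith
  then show ?thesis
  proof cases
    case 1
    have "cong_mod m (nm b) c \<longleftrightarrow> cong_mod ((m + 1) div 2) b 0" for b
    proof -
      have cm: "cong_mod m c 0" using c(2) 1 pw_le_iff by (simp add: cong_mod_def)
      have "cong_mod m (nm b) c \<longleftrightarrow> cong_mod m (nm b) 0"
        using cm cong_trans[OF _ cm] cong_trans_right[OF _ cm] by (metis cong_sym cong_trans)
      then show ?thesis
        using sq_le by (simp add: cong_mod_def nrm_nm)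
    qed
    then show ?thesis
      using 1 m card_residue_class[OF transversals_TK _ _, of 0 "(m + 1) div 2" N]
      by (simp add: norm_count_def OK_iff power_mult)
  next
    case 2
    have "\<not> cong_mod m (nm b) c" for b
    proof
      assume "cong_mod m (nm b) c"
      then have lt: "nrm (nm b - c) < nrm c"
        using c(2) 2 pw_le_iff[of e m] by (simp add: cong_mod_def not_le[symmetric])
      then have nb: "nrm b ^ 2 = pw e" using nrm_add_eq[of "nm b - c" c] c(2) by (simp add: nrm_nm)
      then have "b \<noteq> 0" using pw_pos[of e] by auto
      then obtain i where i: "nrm b = real q powi (- i)" using ex_nrm_eq by blast
      have "real q powi (- (2 * i)) = real q powi (- int e)"
        using nb unfolding i power2_eq_square q_powi_add[symmetric] pw_powi by simp
      then show False
        using 2(2) unfolding q_powi_eq_iff by presburger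
    qed
    then show ?thesis
      using 2 by (simp add: norm_count_def)
  next
    case 3
    \<comment> \<open>The absolute value of every solution is \<open>pw f\<close>; dividing by
      \<open>uf ^ f\<close> reduces the congruence to one with a unit on the right.\<close>
    then obtain f where f: "e = 2 * f" by (elim evenE)
    obtain c' where c': "c = uf ^ e * c'" "c' \<in> k"
      using nrm_le_pwE[of c e] c by auto
    have nc': "nrm c' = 1" using c(2) c'(1) pw_pos[of e] by (simp add: nrm_uf_mult)
    have P: "cong_mod m (nm (uf ^ f * s)) c \<longleftrightarrow> cong_mod (m - e) (nm s) c'" for s
    proof -
      have "nm (uf ^ f * s) = uf ^ e * nm s" by (auto simp: f mult_2 power_add nm_def star_mult star_uf)
      then show ?thesis
        using cong_uf_mult[of e "m - e" "nm s" c'] 3 c'(1) by simp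
    qed
    have fN: "f \<le> N" "m - e \<le> N - f" using 3 m f by auto
    have "card {b \<in> TK N. cong_mod m (nm b) c} = card {s \<in> TK (N - f). cong_mod (m - e) (nm s) c'}"
    proof (rule card_eq_matching[where R = "\<lambda>b s. cong_mod N b (uf ^ f * s)"])
      fix b assume b: "b \<in> {b \<in> TK N. cong_mod m (nm b) c}"
      then have b1: "nrm b \<le> 1" using TKD(2)[of b N] by (simp add: OK_iff)
      have "nrm (nm b - c) < nrm c"
        using b c(2) 3 pw_le_iff[of e m] by (simp add: cong_mod_def not_le[symmetric])
      then have "nrm b ^ 2 = pw e" using nrm_add_eq[of "nm b - c" c] c(2) by (simp add: nrm_nm)
      then have "nrm b \<le> pw f" using sq_le[of b e] f by simp
      then obtain d where d: "b = uf ^ f * d" "d \<in> OK"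
        using integral_divE[of OK b f] b1 by (auto simp: OK_iff)
      have eq: "cong_mod N b (uf ^ f * s) \<longleftrightarrow> cong_mod (N - f) d s" for s
        using cong_uf_mult[of f "N - f" d s] fN d(1) by simp
      have "cong_mod (m - e) (nm s) c'" if "s \<in> TK (N - f)" "cong_mod N b (uf ^ f * s)" for s
      proof -
        have "nrm (uf ^ f * s) \<le> 1"
          using TKD(2)[OF that(1)] integral_closed(3)[of OK s f] by (simp add: OK_iff)
        then have "cong_mod m (nm b) (nm (uf ^ f * s))" using b1 cong_nm cong_mono[OF that(2) m] by blast
        then have "cong_mod m (nm (uf ^ f * s)) c" using b cong_trans_left by blast
        then show ?thesis
          using P by simp
      qed
      moreover have "\<exists>!s. s \<in> TK (N - f) \<and> cong_mod (N - f) d s" using d(2) TK by blast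
      ultimately show "\<exists>!s. s \<in> {s \<in> TK (N - f). cong_mod (m - e) (nm s) c'} \<and> cong_mod N b (uf ^ f * s)"
        unfolding eq by blast
    next
      fix s assume s: "s \<in> {s \<in> TK (N - f). cong_mod (m - e) (nm s) c'}"
      have a1: "nrm (uf ^ f * s) \<le> 1"
        using TKD(2)[of s "N - f"] s integral_closed(3)[of OK s f] by (simp add: OK_iff)
      then have ex1: "\<exists>!b. b \<in> TK N \<and> cong_mod N (uf ^ f * s) b" using TK OK_iff by blast
      have "cong_mod m (nm b) c" if "b \<in> TK N" "cong_mod N (uf ^ f * s) b" for b
      proof -
        have "nrm b \<le> 1" using TKD(2)[OF that(1)] by (simp add: OK_iff)
        then have "cong_mod m (nm (uf ^ f * s)) (nm b)" using a1 cong_nm cong_mono[OF that(2) m] by blast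
        moreover have "cong_mod m (nm (uf ^ f * s)) c" using s P by simp
        ultimately show ?thesis
          by (rule cong_trans_left)
      qed
      then show "\<exists>!b. b \<in> {b \<in> TK N. cong_mod m (nm b) c} \<and> cong_mod N b (uf ^ f * s)"
        using ex1 unfolding cong_sym[of N _ "uf ^ f * s"] by blast
    qed (use TKD(1) in auto)
    also have "\<dots> = (q + 1) * q ^ (2 * (N - f) - (m - e) - 1)"
      using 3 fN c' nc' by (intro card_norm_unit) (auto simp: integers_of_def)
    also have "2 * (N - f) - (m - e) - 1 = 2 * N - m - 1" using 3 fN f by simp
    finally show ?thesis
      using 3 by (simp add: norm_count_def)
  qed
qed

end

text \<open>A map that is injective on classes permutes a finite system of representatives. Thus a
  change of variables preserves counts of classes even though it does not preserve the chosen
  representatives.\<close>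

lemma card_reps_invariant:
  assumes fin: "finite P" and PE: "P \<subseteq> E"
    and ex: "\<And>x. x \<in> E \<Longrightarrow> \<exists>p\<in>P. R x p" and un: "\<And>p p'. p \<in> P \<Longrightarrow> p' \<in> P \<Longrightarrow> R p p' \<Longrightarrow> p = p'"
    and sym: "\<And>x y. x \<in> E \<Longrightarrow> y \<in> E \<Longrightarrow> R x y \<Longrightarrow> R y x"
    and trans: "\<And>x y z. x \<in> E \<Longrightarrow> y \<in> E \<Longrightarrow> z \<in> E \<Longrightarrow> R x y \<Longrightarrow> R y z \<Longrightarrow> R x z"
    and \<phi>: "\<And>x. x \<in> E \<Longrightarrow> \<phi> x \<in> E" "\<And>x y. x \<in> E \<Longrightarrow> y \<in> E \<Longrightarrow> R (\<phi> x) (\<phi> y) \<Longrightarrow> R x y"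
    and f: "\<And>x y. x \<in> E \<Longrightarrow> y \<in> E \<Longrightarrow> R x y \<Longrightarrow> f x \<longleftrightarrow> f y"
  shows "card {p \<in> P. f (\<phi> p)} = card {p \<in> P. f p}"
proof -
  define g where "g p = (SOME p'. p' \<in> P \<and> R (\<phi> p) p')" for p
  have g: "g p \<in> P" "R (\<phi> p) (g p)" if "p \<in> P" for p
  proof -
    have "\<exists>p'. p' \<in> P \<and> R (\<phi> p) p'" using ex[OF \<phi>(1)] that PE by blast
    from someI_ex[OF this] show "g p \<in> P" "R (\<phi> p) (g p)" unfolding g_def by auto
  qed
  have inj: "inj_on g P"
  proof (rule inj_onI)
    fix p p' assume p: "p \<in> P" "p' \<in> P" "g p = g p'"
    have E: "p \<in> E" "p' \<in> E" "\<phi> p \<in> E" "\<phi> p' \<in> E" "g p \<in> E"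
      using p PE \<phi>(1) g(1) by auto
    have "R (g p) (\<phi> p')" using sym[OF E(4) E(5)] g(2)[OF p(2)] p(3) by simp
    then have "R (\<phi> p) (\<phi> p')" using trans[OF E(3) E(5) E(4)] g(2)[OF p(1)] by blast
    then show "p = p'" using un p(1,2) \<phi>(2)[OF E(1,2)] by blast
  qed
  have surj: "g ` P = P" using endo_inj_surj[OF fin _ inj] g(1) by blast
  have "g ` {p \<in> P. f (\<phi> p)} = {p \<in> P. f p}"
  proof (intro equalityI subsetI)
    fix x assume "x \<in> g ` {p \<in> P. f (\<phi> p)}"
    then obtain p where "p \<in> P" "f (\<phi> p)" "x = g p" by blast
    then show "x \<in> {p \<in> P. f p}" using f[of "\<phi> p" "g p"] g[of p] \<phi>(1) PE by blast
  next
    fix x assume x: "x \<in> {p \<in> P. f p}"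
    then have "x \<in> g ` P" by (simp add: surj)
    then obtain p where p: "p \<in> P" "x = g p" by (elim imageE)
    then have "f (\<phi> p)" using f[OF \<phi>(1) _ g(2)[OF p(1)]] g(1)[OF p(1)] PE p x by auto
    then show "x \<in> g ` {p \<in> P. f (\<phi> p)}" using p by simp
  qed
  moreover have "inj_on g {p \<in> P. f (\<phi> p)}" by (rule inj_on_subset[OF inj]) auto
  ultimately show ?thesis
    by (metis card_image)
qed

context unramified_quadratic_extension begin

subsection \<open>Binary hermitian forms\<close>

definition primitive2 :: "('a \<times> 'a) set" where
  "primitive2 = {(u, v). nrm u \<le> 1 \<and> nrm v \<le> 1 \<and> (nrm u = 1 \<or> nrm v = 1)}"

definition assoc2 :: "nat \<Rightarrow> 'a \<times> 'a \<Rightarrow> 'a \<times> 'a \<Rightarrow> bool" where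
  "assoc2 N x y \<longleftrightarrow> (\<exists>l. nrm l = 1 \<and> cong_mod N (l * fst x) (fst y) \<and> cong_mod N (l * snd x) (snd y))"

text \<open>The projective line modulo the N-th power of the prime: the lines whose second
  coordinate is a unit, scaled to 1, and those whose second coordinate is a nonunit, with the first
  one scaled to 1.\<close>

definition lines2 :: "nat \<Rightarrow> ('a \<times> 'a) set" where
  "lines2 N = (\<lambda>u. (u, 1)) ` TK N \<union> (\<lambda>u. (1, uf * u)) ` TK (N - 1)"

definition herm2 :: "'a \<Rightarrow> 'a \<Rightarrow> 'a \<Rightarrow> 'a \<times> 'a \<Rightarrow> 'a" where
  "herm2 a b c x = a * nm (fst x) + tr (b * fst x * star (snd x)) + c * nm (snd x)"

lemma nrm_1_nonzero: "nrm l = 1 \<Longrightarrow> l \<noteq> 0" by auto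

lemma cong_unit_move: "nrm l = 1 \<Longrightarrow> cong_mod N (l * a) b \<longleftrightarrow> cong_mod N a (inverse l * b)"
  using cong_unit_cancel[of l N a "inverse l * b"] nrm_1_nonzero[of l]
  by (simp add: mult.assoc[symmetric])

lemma assoc2_sym: "assoc2 N x y \<Longrightarrow> assoc2 N y x"
proof -
  assume "assoc2 N x y"
  then obtain l where "nrm l = 1" "cong_mod N (l * fst x) (fst y)" "cong_mod N (l * snd x) (snd y)"
    unfolding assoc2_def by blast
  then have "nrm (inverse l) = 1" "cong_mod N (inverse l * fst y) (fst x)" "cong_mod N (inverse l * snd y) (snd x)"
    by (simp_all add: nrm_inverse cong_unit_move cong_sym[of N "inverse l * _"])
  then show "assoc2 N y x" unfolding assoc2_def by blast
qed

lemma assoc2_trans: "assoc2 N x y \<Longrightarrow> assoc2 N y z \<Longrightarrow> assoc2 N x z"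
proof -
  assume "assoc2 N x y" "assoc2 N y z"
  then obtain l l' where l: "nrm l = 1" "cong_mod N (l * fst x) (fst y)" "cong_mod N (l * snd x) (snd y)"
      "nrm l' = 1" "cong_mod N (l' * fst y) (fst z)" "cong_mod N (l' * snd y) (snd z)"
    unfolding assoc2_def by blast
  have "cong_mod N (l' * (l * fst x)) (l' * fst y)" "cong_mod N (l' * (l * snd x)) (l' * snd y)"
    using l by (simp_all only: cong_unit_cancel)
  then have "cong_mod N (l' * l * fst x) (fst z)" "cong_mod N (l' * l * snd x) (snd z)"
    using l cong_trans unfolding mult.assoc by blast+
  then show "assoc2 N x z" unfolding assoc2_def using l by (intro exI[of _ "l' * l"]) (simp add: nrm_mult)
qed

lemma uf_times_TK:
  assumes "nrm a < 1" "N \<ge> 1"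
  shows "\<exists>s. s \<in> TK (N - 1) \<and> cong_mod N a (uf * s)"
    "s \<in> TK (N - 1) \<Longrightarrow> s' \<in> TK (N - 1) \<Longrightarrow> cong_mod N (uf * s) (uf * s') \<Longrightarrow> s = s'"
proof -
  have eq: "cong_mod N (uf * x) (uf * y) \<longleftrightarrow> cong_mod (N - 1) x y" for x y
    using cong_uf_mult[of 1 "N - 1" x y] assms(2) by simp
  obtain b where b: "a = uf ^ 1 * b" "nrm b \<le> 1"
    using nrm_le_pwE[of a 1] assms(1) nrm_less_1_iff by blast
  then obtain r where "r \<in> TK (N - 1)" "cong_mod (N - 1) b r"
    using TKD(4)[of b "N - 1"] by (auto simp: OK_iff)
  then show "\<exists>s. s \<in> TK (N - 1) \<and> cong_mod N a (uf * s)" using b(1) eq by auto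
  show "s \<in> TK (N - 1) \<Longrightarrow> s' \<in> TK (N - 1) \<Longrightarrow> cong_mod N (uf * s) (uf * s') \<Longrightarrow> s = s'"
    unfolding eq by (rule TKD(5))
qed

lemma nrm_uf_times_less: "nrm s \<le> 1 \<Longrightarrow> nrm (uf * s) < 1"
  by (smt (verit) mult_left_le nrm_nonneg nrm_uf_less_1 nrm_mult)

lemma TK_nrm: "u \<in> TK N \<Longrightarrow> nrm u \<le> 1" using TKD(2) OK_iff by blast

lemma Tk_nrm: "u \<in> Tk N \<Longrightarrow> nrm u \<le> 1" and Tk_k: "u \<in> Tk N \<Longrightarrow> u \<in> k"
  using TkD(2) by (auto simp: integers_of_def)

lemma lines2_primitive: "lines2 N \<subseteq> primitive2"
  using TK_nrm nrm_uf_times_less less_imp_le unfolding lines2_def primitive2_def by fastforce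

lemma finite_lines2: "finite (lines2 N)" by (simp add: lines2_def TKD)

lemma lines2_ex:
  assumes "x \<in> primitive2" "N \<ge> 1" shows "\<exists>y\<in>lines2 N. assoc2 N x y"
proof -
  obtain u v where x: "x = (u, v)" "nrm u \<le> 1" "nrm v \<le> 1" "nrm u = 1 \<or> nrm v = 1"
    using assms(1) by (auto simp: primitive2_def)
  show ?thesis
  proof (cases "nrm v = 1")
    case True
    have "inverse v * u \<in> OK" using x True by (simp add: OK_iff nrm_mult nrm_inverse)
    then obtain s where s: "s \<in> TK N" "cong_mod N (inverse v * u) s" using TKD(4) by blast
    have "assoc2 N x (s, 1)"
      unfolding assoc2_def using True s nrm_1_nonzero[OF True]
      by (intro exI[of _ "inverse v"]) (simp add: x nrm_inverse)
    then show ?thesis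
      using s by (auto simp: lines2_def)
  next
    case False
    then have u: "nrm u = 1" "nrm v < 1" using x by auto
    have "nrm (inverse u * v) < 1" using u by (simp add: nrm_mult nrm_inverse)
    then obtain s where s: "s \<in> TK (N - 1)" "cong_mod N (inverse u * v) (uf * s)"
      using uf_times_TK(1) assms(2) by blast
    have "assoc2 N x (1, uf * s)"
      unfolding assoc2_def using u s nrm_1_nonzero[OF u(1)]
      by (intro exI[of _ "inverse u"]) (simp add: x nrm_inverse)
    then show ?thesis
      using s by (auto simp: lines2_def)
  qed
qed

lemma cong_scale_1:
  assumes "nrm a \<le> 1" "cong_mod N l 1" "cong_mod N (l * a) b" shows "cong_mod N a b"
proof -
  have "nrm ((l - 1) * a) \<le> nrm (l - 1)" using assms(1) by (simp add: nrm_mult mult_left_le nrm_nonneg)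
  then have "cong_mod N (l * a) a" using assms(2) by (simp add: cong_mod_def left_diff_distrib)
  then show ?thesis
    using assms(3) by (rule cong_trans_left)
qed

lemma not_cong_unit:
  assumes "nrm u = 1" "nrm v < 1" "N \<ge> 1" shows "\<not> cong_mod N u v" "\<not> cong_mod N v u"
proof -
  show *: "\<not> cong_mod N v u" using cong_nrm_1[of N v u] assms by auto
  then show "\<not> cong_mod N u v" by (simp add: cong_sym)
qed

lemma lines2_unique:
  fixes z z' :: "'a \<times> 'a"
  assumes "z \<in> lines2 N" "z' \<in> lines2 N" "assoc2 N z z'" "N \<ge> 1" shows "z = z'"
proof -
  obtain l where l: "nrm l = 1" "cong_mod N (l * fst z) (fst z')" "cong_mod N (l * snd z) (snd z')"
    using assms(3) unfolding assoc2_def by blast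
  consider u u' where "u \<in> TK N" "u' \<in> TK N" "z = (u, 1)" "z' = (u', 1)"
    | u u' where "u \<in> TK (N - 1)" "u' \<in> TK (N - 1)" "z = (1, uf * u)" "z' = (1, uf * u')"
    | u where "u \<in> TK (N - 1)" "z = (1, uf * u)" "snd z' = 1"
    | u where "u \<in> TK (N - 1)" "snd z = 1" "z' = (1, uf * u)"
    using assms(1,2) unfolding lines2_def by auto
  then show ?thesis
  proof cases
    case 1
    then have "cong_mod N u u'" using l TK_nrm[OF 1(1)] by (intro cong_scale_1[of u N l]) auto
    then show ?thesis
      using 1 TKD(5) by blast
  next
    case 2
    then have "cong_mod N (uf * u) (uf * u')"
      using l nrm_uf_times_less[OF TK_nrm[OF 2(1)]] by (intro cong_scale_1[of "uf * u" N l]) auto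
    then show ?thesis
      using 2 uf_times_TK(2)[of 0 N u u'] assms(4) by simp
  next
    case 3
    then show ?thesis
      using l not_cong_unit(2)[of 1 "l * (uf * u)" N] nrm_uf_times_less[OF TK_nrm[OF 3(1)]] assms(4)
      by (simp add: nrm_mult)
  next
    case 4
    then show ?thesis
      using l not_cong_unit(1)[of l "uf * u" N] nrm_uf_times_less[OF TK_nrm[OF 4(1)]] assms(4) by simp
  qed
qed

lemma nrm_eq_of_close: "nrm (a - b) \<le> d \<Longrightarrow> d < r \<Longrightarrow> nrm a = r \<longleftrightarrow> nrm b = r"
  using nrm_add_eq[of "a - b" b] nrm_add_eq[of "b - a" a] nrm_minus_commute[of a b] by auto

lemma nrm_mult_le: "nrm a \<le> x \<Longrightarrow> nrm b \<le> y \<Longrightarrow> nrm (a * b) \<le> x * y"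
  unfolding nrm_mult by (intro mult_mono) (auto simp: nrm_nonneg intro: order_trans[OF nrm_nonneg])

text \<open>Multiplying the vector by a unit does not change the absolute value of the form, and
  passing to a congruent vector moves the value by at most \<open>C * pw N\<close>, which is below
  r. So a level set with level r is a union of classes modulo the N-th power.\<close>

lemma herm2_assoc:
  assumes x: "x \<in> primitive2" "y \<in> primitive2" "assoc2 N x y"
    and C: "nrm a \<le> C" "nrm b \<le> C" "nrm c \<le> C" "C * pw N < r"
  shows "nrm (herm2 a b c x) = r \<longleftrightarrow> nrm (herm2 a b c y) = r"
proof -
  obtain l where l: "nrm l = 1" "cong_mod N (l * fst x) (fst y)" "cong_mod N (l * snd x) (snd y)"
    using x(3) unfolding assoc2_def by blast
  have le1: "nrm (l * fst x) \<le> 1" "nrm (l * snd x) \<le> 1" "nrm (fst y) \<le> 1" "nrm (snd y) \<le> 1"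
    using x(1,2) l(1) by (auto simp: primitive2_def nrm_mult)
  have "herm2 a b c (l * fst x, l * snd x) = nm l * herm2 a b c x"
    by (simp add: herm2_def nm_def tr_def star_mult algebra_simps)
  then have 1: "nrm (herm2 a b c (l * fst x, l * snd x)) = nrm (herm2 a b c x)"
    using l(1) by (simp add: nrm_mult nrm_nm)
  have C0: "0 \<le> C" using C(1) nrm_nonneg[of a] by linarith
  define X where "X = (l * fst x) * star (l * snd x) - fst y * star (snd y)"
  have "cong_mod N ((l * fst x) * star (l * snd x)) (fst y * star (snd y))"
  proof (rule cong_mult)
    show "cong_mod N (star (l * snd x)) (star (snd y))"
      using l(3) by (simp add: cong_mod_def star_diff[symmetric] del: star_mult)
  qed (use le1 l in auto)
  then have X: "nrm X \<le> pw N" by (simp add: cong_mod_def X_def)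
  have n1: "nrm (nm (l * fst x) - nm (fst y)) \<le> pw N" "nrm (nm (l * snd x) - nm (snd y)) \<le> pw N"
    using cong_nm[OF le1(1,3) l(2)] cong_nm[OF le1(2,4) l(3)] by (auto simp: cong_mod_def)
  have "herm2 a b c (l * fst x, l * snd x) - herm2 a b c y =
      a * (nm (l * fst x) - nm (fst y)) + tr (b * X) + c * (nm (l * snd x) - nm (snd y))"
    by (simp add: herm2_def tr_def X_def star_mult star_diff algebra_simps)
  moreover have "nrm (tr (b * X)) \<le> C * pw N" using nrm_tr[of "b * X"] nrm_mult_le[OF C(2) X] by linarith
  ultimately have "nrm (herm2 a b c (l * fst x, l * snd x) - herm2 a b c y) \<le> C * pw N"
    using nrm_mult_le[OF C(1) n1(1)] nrm_mult_le[OF C(3) n1(2)] by (auto intro!: nrm_add_le)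
  then show ?thesis
    using nrm_eq_of_close[OF _ C(4)] 1 by metis
qed

text \<open>In the diagonal case a difference of two norm counts gives the lines
  \<open>(u, 1)\<close> on which the value has excess valuation exactly j. The lines
  \<open>(1, uf * u)\<close> always give the least valuation and enter for j = 0 alone. Integers
  avoid truncated subtraction.\<close>

definition count2 :: "nat \<Rightarrow> nat \<Rightarrow> nat \<Rightarrow> int" where
  "count2 e N j = int (norm_count e N j) - int (norm_count e N (Suc j)) + (if j = 0 then int (q ^ (2 * (N - 1))) else 0)"

text \<open>\<open>\<beta>\<close> is a lower bound for the valuations of the coefficients, and e is
  the valuation of the discriminant beyond \<open>2 * \<beta>\<close>. Bundling the counts with
  these bounds allows them to be carried through integral changes of variables that keep the
  discriminant.\<close>

definition herm2_law :: "'a \<Rightarrow> 'a \<Rightarrow> 'a \<Rightarrow> int \<Rightarrow> nat \<Rightarrow> bool" where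
  "herm2_law a b c \<beta> e \<longleftrightarrow> nrm (a * c - nm b) = real q powi (- (2 * \<beta> + int e)) \<and>
     nrm a \<le> real q powi (- \<beta>) \<and> nrm b \<le> real q powi (- \<beta>) \<and> nrm c \<le> real q powi (- \<beta>) \<and>
     (\<forall>N\<ge>1. \<forall>j<N. int (card {x \<in> lines2 N. nrm (herm2 a b c x) = real q powi (- (\<beta> + int j))}) = count2 e N j)"

lemma powi_pw_less: "j < N \<Longrightarrow> real q powi (- \<beta>) * pw N < real q powi (- (\<beta> + int j))"
  unfolding pw_powi q_powi_add[symmetric] q_powi_less_iff by simp

lemma herm2_law_transfer:
  assumes law: "herm2_law a' b' c' \<beta> e"
    and disc: "a' * c' - nm b' = a * c - nm b"
    and bound: "nrm a \<le> real q powi (- \<beta>)" "nrm b \<le> real q powi (- \<beta>)" "nrm c \<le> real q powi (- \<beta>)"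
    and \<phi>: "\<And>x. x \<in> primitive2 \<Longrightarrow> \<phi> x \<in> primitive2" "\<And>N x y. assoc2 N (\<phi> x) (\<phi> y) \<Longrightarrow> x \<in> primitive2 \<Longrightarrow> y \<in> primitive2 \<Longrightarrow> assoc2 N x y"
      "\<And>x. herm2 a b c (\<phi> x) = herm2 a' b' c' x"
  shows "herm2_law a b c \<beta> e"
  unfolding herm2_law_def
proof (intro conjI allI impI)
  show "nrm (a * c - nm b) = real q powi (- (2 * \<beta> + int e))"
    using law disc by (simp add: herm2_law_def)
  fix N j :: nat assume N: "1 \<le> N" "j < N"
  have "card {p \<in> lines2 N. nrm (herm2 a b c (\<phi> p)) = real q powi (- (\<beta> + int j))} =
      card {p \<in> lines2 N. nrm (herm2 a b c p) = real q powi (- (\<beta> + int j))}"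
  proof (rule card_reps_invariant[where E = primitive2 and R = "assoc2 N"])
    show "\<exists>y\<in>lines2 N. assoc2 N x y" if "x \<in> primitive2" for x
      using lines2_ex that N(1) .
    show "x = y" if "x \<in> lines2 N" "y \<in> lines2 N" "assoc2 N x y" for x y
      using lines2_unique that N(1) .
    show "assoc2 N y x" if "assoc2 N x y" for x y using that by (rule assoc2_sym)
    show "assoc2 N x z" if "assoc2 N x y" "assoc2 N y z" for x y z using that by (rule assoc2_trans)
    show "assoc2 N x y" if "x \<in> primitive2" "y \<in> primitive2" "assoc2 N (\<phi> x) (\<phi> y)" for x y
      using \<phi>(2)[OF that(3,1,2)] .
    show "nrm (herm2 a b c x) = real q powi (- (\<beta> + int j)) \<longleftrightarrow> nrm (herm2 a b c y) = real q powi (- (\<beta> + int j))"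
      if "x \<in> primitive2" "y \<in> primitive2" "assoc2 N x y" for x y
      using herm2_assoc[OF that bound powi_pw_less[OF N(2)]] .
  qed (fact finite_lines2 lines2_primitive \<phi>(1))+
  moreover have "int (card {p \<in> lines2 N. nrm (herm2 a' b' c' p) = real q powi (- (\<beta> + int j))}) = count2 e N j"
    using law N unfolding herm2_law_def by blast
  ultimately show "int (card {x \<in> lines2 N. nrm (herm2 a b c x) = real q powi (- (\<beta> + int j))}) = count2 e N j"
    unfolding \<phi>(3) by (simp only:)
qed (use bound in auto)

lemma herm2_law_swap:
  assumes "herm2_law c (star b) a \<beta> e" shows "herm2_law a b c \<beta> e"
proof (rule herm2_law_transfer[OF assms, where \<phi> = prod.swap])
  show "c * a - nm (star b) = a * c - nm b" by (simp add: nm_def mult.commute)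
  show "assoc2 N (prod.swap x) (prod.swap y) \<Longrightarrow> assoc2 N x y" for N x y
    unfolding assoc2_def by auto
  show "herm2 a b c (prod.swap x) = herm2 c (star b) a x" for x
    by (simp add: herm2_def tr_def star_mult algebra_simps)
qed (use assms in \<open>auto simp: herm2_law_def primitive2_def\<close>)

lemma herm2_law_shear:
  assumes law: "herm2_law a (b + a * star l) (c + a * nm l + tr (b * l)) \<beta> e" and l: "nrm l \<le> 1" and a: "a \<in> k"
  shows "herm2_law a b c \<beta> e"
proof (rule herm2_law_transfer[OF law, where \<phi> = "\<lambda>x. (fst x + l * snd x, snd x)"])
  have sa: "star a = a" using a by (rule star_fixes)
  show "a * (c + a * nm l + tr (b * l)) - nm (b + a * star l) = a * c - nm b"
    by (simp add: nm_def tr_def star_add star_mult sa algebra_simps)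
  let ?C = "real q powi (- \<beta>)"
  have C: "nrm a \<le> ?C" "nrm (b + a * star l) \<le> ?C" "nrm (c + a * nm l + tr (b * l)) \<le> ?C"
    using law by (auto simp: herm2_law_def)
  show "nrm a \<le> ?C" by fact
  have "nrm (a * star l) \<le> ?C * 1" using C l by (intro nrm_mult_le) auto
  then show b: "nrm b \<le> ?C" using nrm_diff_le[OF C(2), of "a * star l"] by simp
  have "nrm (nm l) \<le> 1" using l by (simp add: nrm_nm power_le_one nrm_nonneg)
  then have 1: "nrm (a * nm l) \<le> ?C * 1" by (intro nrm_mult_le C)
  have 2: "nrm (tr (b * l)) \<le> ?C * 1" using nrm_tr[of "b * l"] nrm_mult_le[OF b l] by linarith
  show "nrm c \<le> ?C" using nrm_diff_le[OF nrm_diff_le[OF C(3)], of "tr (b * l)" "a * nm l"] 1 2 by simp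
  show "(fst x + l * snd x, snd x) \<in> primitive2" if "x \<in> primitive2" for x
  proof -
    have x: "nrm (fst x) \<le> 1" "nrm (snd x) \<le> 1" "nrm (fst x) = 1 \<or> nrm (snd x) = 1"
      using that by (auto simp: primitive2_def)
    have le: "nrm (l * snd x) \<le> 1" using l x by (rule_tac nrm_mult_le_1)
    show ?thesis
    proof (cases "nrm (snd x) = 1")
      case True
      then show ?thesis
        using x le nrm_add_le[of "fst x" 1 "l * snd x"] by (simp add: primitive2_def)
    next
      case False
      then have s: "nrm (fst x) = 1" "nrm (snd x) < 1" using x by auto
      have "nrm l * nrm (snd x) \<le> nrm (snd x)" using l by (simp add: mult_left_le_one_le nrm_nonneg)
      then have "nrm (l * snd x) < nrm (fst x)" using s by (simp add: nrm_mult)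
      then show ?thesis
        using s nrm_add_eq[of "l * snd x" "fst x"] by (simp add: primitive2_def)
    qed
  qed
  show "herm2 a b c (fst x + l * snd x, snd x) = herm2 a (b + a * star l) (c + a * nm l + tr (b * l)) x" for x
    by (simp add: herm2_def nm_def tr_def star_add star_mult sa algebra_simps)
  show "assoc2 N x y" if A: "assoc2 N (fst x + l * snd x, snd x) (fst y + l * snd y, snd y)"
    "x \<in> primitive2" "y \<in> primitive2" for N x y
  proof -
    obtain m where m: "nrm m = 1" "cong_mod N (m * (fst x + l * snd x)) (fst y + l * snd y)" "cong_mod N (m * snd x) (snd y)"
      using A unfolding assoc2_def by auto
    have "cong_mod N (l * (m * snd x)) (l * snd y)"
      using l m A(3) by (intro cong_mult) (auto simp: primitive2_def)
    then have "cong_mod N (m * (fst x + l * snd x) - l * (m * snd x)) (fst y + l * snd y - l * snd y)"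
      using m by (intro cong_diff)
    then have "cong_mod N (m * fst x) (fst y)" by (simp add: algebra_simps)
    then show ?thesis
      unfolding assoc2_def using m by blast
  qed
qed

lemma norm_count_antimono: assumes "c \<in> k" "nrm c = pw e" "m < N"
  shows "norm_count e N (Suc m) \<le> norm_count e N m"
proof -
  have "card {b \<in> TK N. cong_mod (Suc m) (nm b) c} \<le> card {b \<in> TK N. cong_mod m (nm b) c}"
    using cong_mono[of "Suc m" _ c m] TKD(1)[of N] by (intro card_mono) auto
  then show ?thesis
    using card_norm[OF assms(1,2)] assms(3) by simp
qed

lemma nrm_eq_pw_iff: "nrm a = pw j \<longleftrightarrow> nrm a \<le> pw j \<and> \<not> nrm a \<le> pw (Suc j)"
  using nrm_less_pw_iff[of a j] by linarith

text \<open>With \<open>d = c / a\<close> integral, the value at \<open>(u, 1)\<close> is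
  \<open>a * (nm u + d)\<close>, so the counts are those of norms close to - d. At
  \<open>(1, uf * u)\<close> the value is a times a unit.\<close>

lemma herm2_law_diag:
  assumes a: "a \<in> k" "a \<noteq> 0" and c: "c \<in> k" "c \<noteq> 0" and le: "nrm c \<le> nrm a"
  shows "\<exists>\<beta> e. herm2_law a 0 c \<beta> e"
proof -
  define \<beta> where "\<beta> = val a"
  define d where "d = c / a"
  have d: "d \<in> k" "d \<noteq> 0" "nrm d \<le> 1" and c_eq: "c = a * d"
    using a c le nrm_pos[of a] by (auto simp: d_def k_divide nrm_divide)
  obtain e where e: "nrm d = pw e"
    using nrm_le_1_cases[OF d(3,2)] by (auto simp: pw_def)
  have na: "nrm a = real q powi (- \<beta>)" unfolding \<beta>_def by (rule nrm_val[OF a(2)])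
  have na0: "nrm a \<noteq> 0" using a nrm_eq_0 by blast
  have ac: "nrm (a * c) = real q powi (- (2 * \<beta> + int e))"
    unfolding c_eq nrm_mult na e pw_powi q_powi_add[symmetric] by simp
  have iff: "nrm (a * x) = real q powi (- (\<beta> + int j)) \<longleftrightarrow> nrm x = pw j" for x j
  proof -
    have "real q powi (- (\<beta> + int j)) = nrm a * pw j" unfolding na pw_powi q_powi_add[symmetric] by simp
    then show ?thesis
      using na0 by (simp add: nrm_mult)
  qed
  have count: "int (card {x \<in> lines2 N. nrm (herm2 a 0 c x) = real q powi (- (\<beta> + int j))}) = count2 e N j"
    if N: "1 \<le> N" "j < N" for N j
  proof -
    have v1: "herm2 a 0 c (u, 1) = a * (nm u - (- d))" for u
      by (simp add: herm2_def tr_def nm_def c_eq algebra_simps)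
    have v2: "nrm (herm2 a 0 c (1, uf * u)) = real q powi (- (\<beta> + int j)) \<longleftrightarrow> j = 0" if u: "u \<in> TK (N - 1)" for u
    proof -
      have "nrm (nm (uf * u)) < 1"
        using nrm_uf_times_less[OF TK_nrm[OF u]] nrm_nonneg[of "uf * u"] by (simp add: nrm_nm power_less_one_iff)
      then have "nrm d * nrm (nm (uf * u)) < 1"
        using d(3) mult_left_le_one_le[of "nrm (nm (uf * u))" "nrm d"] nrm_nonneg by (meson le_less_trans)
      then have "nrm (1 + d * nm (uf * u)) = 1"
        using nrm_add_eq[of "d * nm (uf * u)" 1] by (simp add: nrm_mult)
      moreover have "herm2 a 0 c (1, uf * u) = a * (1 + d * nm (uf * u))"
        by (simp add: herm2_def tr_def nm_def c_eq algebra_simps)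
      moreover have "(1::real) = pw j \<longleftrightarrow> j = 0"
        using pw_le_iff[of 0 j] by (metis le_0_eq order_refl pw_0)
      ultimately show ?thesis
        using iff by simp
    qed
    have split: "{x \<in> lines2 N. nrm (herm2 a 0 c x) = real q powi (- (\<beta> + int j))} =
        (\<lambda>u. (u, 1)) ` {u \<in> TK N. nrm (nm u - (- d)) = pw j} \<union>
        (\<lambda>u. (1, uf * u)) ` {u \<in> TK (N - 1). j = 0}"
      unfolding lines2_def using v1 v2 iff by auto
    have "card {x \<in> lines2 N. nrm (herm2 a 0 c x) = real q powi (- (\<beta> + int j))} =
        card ((\<lambda>u. (u, 1::'a)) ` {u \<in> TK N. nrm (nm u - (- d)) = pw j}) +
        card ((\<lambda>u. (1::'a, uf * u)) ` {u \<in> TK (N - 1). j = 0})"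
      unfolding split
    proof (rule card_Un_disjoint)
      have "(u, 1) \<noteq> (1, uf * u')" if "u' \<in> TK (N - 1)" for u u'
        using nrm_uf_times_less[OF TK_nrm[OF that]] nrm_1 by (metis less_irrefl prod.inject)
      then show "(\<lambda>u. (u, 1)) ` {u \<in> TK N. nrm (nm u - (- d)) = pw j} \<inter> (\<lambda>u. (1, uf * u)) ` {u \<in> TK (N - 1). j = 0} = {}"
        by blast
    qed (use TKD(1) in auto)
    also have "card ((\<lambda>u. (u, 1::'a)) ` {u \<in> TK N. nrm (nm u - (- d)) = pw j}) =
        card {u \<in> TK N. nrm (nm u - (- d)) = pw j}"
      by (intro card_image inj_onI) auto
    also have "card ((\<lambda>u. (1::'a, uf * u)) ` {u \<in> TK (N - 1). j = 0}) = card {u \<in> TK (N - 1). j = 0}"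
      using uf_nonzero by (intro card_image inj_onI) auto
    also have "card {u \<in> TK (N - 1). j = 0} = (if j = 0 then q ^ (2 * (N - 1)) else 0)"
      using TKD(3)[of "N - 1"] by (simp add: power_mult)
    also have "card {u \<in> TK N. nrm (nm u - (- d)) = pw j} = norm_count e N j - norm_count e N (Suc j)"
    proof -
      have nd: "- d \<in> k" "nrm (- d) = pw e" using d e by (auto simp: k_minus)
      have "{u \<in> TK N. nrm (nm u - (- d)) = pw j} =
          {u \<in> TK N. cong_mod j (nm u) (- d)} - {u \<in> TK N. cong_mod (Suc j) (nm u) (- d)}"
        unfolding nrm_eq_pw_iff cong_mod_def by blast
      moreover have "{u \<in> TK N. cong_mod (Suc j) (nm u) (- d)} \<subseteq> {u \<in> TK N. cong_mod j (nm u) (- d)}"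
        using cong_mono[of "Suc j" _ "- d" j] by auto
      ultimately show ?thesis
        using card_Diff_subset[of "{u \<in> TK N. cong_mod (Suc j) (nm u) (- d)}" "{u \<in> TK N. cong_mod j (nm u) (- d)}"]
          TKD(1)[of N] card_norm[OF nd, of j N] card_norm[OF nd, of "Suc j" N] N by simp
    qed
    finally show ?thesis
      using norm_count_antimono[OF d(1) e N(2)] by (simp add: count2_def)
  qed
  have "herm2_law a 0 c \<beta> e"
    unfolding herm2_law_def using ac na le count by (auto simp: nm_def intro: less_imp_le)
  then show ?thesis
    by blast
qed

text \<open>A form whose largest coefficient is the mixed one acquires a diagonal coefficient of the same size
  under the shear with parameter \<open>1\<close> or \<open>\<theta>\<close>.\<close>

lemma ex_herm2_law:
  assumes a: "a \<in> k" and c: "c \<in> k" and disc: "a * c - nm b \<noteq> 0"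
  shows "\<exists>\<beta> e. herm2_law a b c \<beta> e"
proof -
  have 1: "\<exists>\<beta> e. herm2_law a b c \<beta> e"
    if a: "a \<in> k" and c: "c \<in> k" and disc: "a * c - nm b \<noteq> 0" and max: "nrm b \<le> nrm a" "nrm c \<le> nrm a" for a b c
  proof -
    have a0: "a \<noteq> 0"
    proof
      assume "a = 0"
      then have "b = 0" using max(1) nrm_nonneg[of b] nrm_eq_0[of b] by simp
      then show False
        using disc \<open>a = 0\<close> by (simp add: nm_def)
    qed
    \<comment> \<open>Completing the square: when a dominates, this integral shear removes the mixed
      coefficient.\<close>
    define l where "l = - star b / a"
    have sa: "star a = a" using a by (rule star_fixes)
    have l1: "nrm l \<le> 1" using max a0 nrm_pos[of a] by (simp add: l_def nrm_divide)
    have b': "b + a * star l = 0" using a0 by (simp add: l_def star_divide sa)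
    have c': "c + a * nm l + tr (b * l) = c - nm b / a"
      using a0 by (simp add: l_def nm_def tr_def star_divide star_mult sa field_simps)
    have cc: "c - nm b / a \<in> k" "c - nm b / a \<noteq> 0"
      using a c a0 disc nm_k[of b] by (auto simp: k_diff k_divide nonzero_eq_divide_eq mult.commute)
    have "nrm (nm b / a) \<le> nrm a"
      using max(1) nrm_pos[OF a0] nrm_nonneg[of b]
      by (simp add: nrm_divide nrm_nm power2_eq_square pos_divide_le_eq mult_mono)
    then have "nrm (c - nm b / a) \<le> nrm a" using max(2) by (intro nrm_diff_le)
    then obtain \<beta> e where "herm2_law a 0 (c - nm b / a) \<beta> e"
      using herm2_law_diag[OF a a0 cc] by blast
    then have "herm2_law a b c \<beta> e" using herm2_law_shear[of a b l c \<beta> e] l1 a b' c' by simp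
    then show ?thesis
      by blast
  qed
  have 2: "\<exists>\<beta> e. herm2_law a b c \<beta> e" if "a \<in> k" "c \<in> k" "a * c - nm b \<noteq> 0" "nrm b \<le> nrm c" "nrm a \<le> nrm c" for a b c
    using 1[of c a "star b"] that herm2_law_swap by (simp add: nm_def mult.commute) blast
  show ?thesis
  proof (cases "nrm a < nrm b \<and> nrm c < nrm b")
    case False
    then have "(nrm b \<le> nrm a \<and> nrm c \<le> nrm a) \<or> (nrm b \<le> nrm c \<and> nrm a \<le> nrm c)"
      by linarith
    then show ?thesis
      using 1[OF a c disc] 2[OF a c disc] by blast
  next
    case True
    have bri: "b = rea b + ima b * \<theta>" by (rule rea_ima)
    have bmax: "nrm b = max (nrm (rea b)) (nrm (ima b))" using nrm_lin[OF rea_k ima_k, of b b] bri by metis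
    have "tr b = 2 * rea b" by (simp add: tr_def rea_def)
    then have t1: "nrm (tr (b * 1)) = nrm (rea b)" by (simp add: nrm_mult)
    have "tr (b * \<theta>) = 2 * ima b * (\<theta> * \<theta>)"
      by (simp add: tr_def ima_def star_mult field_simps)
    then have t2: "nrm (tr (b * \<theta>)) = nrm (ima b)" by (simp add: nrm_mult)
    \<comment> \<open>Up to units, the coordinates of b are the traces of b and of
      \<open>b * \<theta>\<close>; whichever coordinate is larger selects the parameter 1 or
      \<open>\<theta>\<close>.\<close>
    obtain l where l: "nrm l = 1" "nrm (tr (b * l)) = nrm b"
      using bmax t1 t2 that[of 1] nrm_theta nrm_1 by (metis max_def)
    have sa: "star a = a" using a by (rule star_fixes)
    have nml: "nrm (a * nm l) < nrm b" using True l by (simp add: nrm_mult nrm_nm)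
    have "nrm (c + a * nm l) < nrm b" using True nml by (intro nrm_add_less) auto
    then have c': "nrm (c + a * nm l + tr (b * l)) = nrm b"
      using nrm_add_eq[of "c + a * nm l" "tr (b * l)"] l by (simp add: add.commute)
    have b': "nrm (b + a * star l) = nrm b" using nrm_add_eq[of "a * star l" b] True l by (simp add: nrm_mult)
    have "a * (c + a * nm l + tr (b * l)) - nm (b + a * star l) = a * c - nm b"
      by (simp add: nm_def tr_def star_add star_mult sa algebra_simps)
    then obtain \<beta> e where "herm2_law a (b + a * star l) (c + a * nm l + tr (b * l)) \<beta> e"
      using 2[of a "c + a * nm l + tr (b * l)" "b + a * star l"] a c disc True b' c'
      by (auto simp: k_add k_mult nm_k tr_k)
    then show ?thesis
      using herm2_law_shear l a by (metis order_refl)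
  qed
qed


subsection \<open>Linear forms on isotropic vectors in dimension three\<close>

text \<open>The hermitian form with matrix \<open>jmat 1\<close>, which is the restriction of the
  big form to its three middle coordinates.\<close>

definition herm3 :: "'a \<times> 'a \<times> 'a \<Rightarrow> 'a" where
  "herm3 x = (case x of (a, b, c) \<Rightarrow> tr (a * star c) + nm b)"

definition isotropic3 :: "('a \<times> 'a \<times> 'a) set" where
  "isotropic3 = {(a, b, c). nrm a \<le> 1 \<and> nrm b \<le> 1 \<and> nrm c \<le> 1 \<and> (nrm a = 1 \<or> nrm b = 1 \<or> nrm c = 1) \<and>
     herm3 (a, b, c) = 0}"

definition assoc3 :: "nat \<Rightarrow> 'a \<times> 'a \<times> 'a \<Rightarrow> 'a \<times> 'a \<times> 'a \<Rightarrow> bool" where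
  "assoc3 N x y \<longleftrightarrow> (case x of (a, b, c) \<Rightarrow> case y of (a', b', c') \<Rightarrow>
     \<exists>l. nrm l = 1 \<and> cong_mod N (l * a) a' \<and> cong_mod N (l * b) b' \<and> cong_mod N (l * c) c')"

text \<open>The solutions t of \<open>tr t + nm b = 0\<close>, parametrized by the free
  \<open>\<theta>\<close>-coordinate r in k.\<close>

definition iso_coord :: "'a \<Rightarrow> 'a \<Rightarrow> 'a" where
  "iso_coord b r = - nm b / 2 + r * \<theta>"

text \<open>The isotropic lines modulo the N-th power of the prime. If the first coordinate of a
  primitive isotropic vector is a nonunit, then so is the middle one, because its norm is minus a
  trace divisible by the prime. Two charts therefore suffice, and in the second one the first two
  coordinates are nonunits.\<close>

definition lines3 :: "nat \<Rightarrow> ('a \<times> 'a \<times> 'a) set" where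
  "lines3 N = (\<lambda>(b, r). (1, b, iso_coord b r)) ` (TK N \<times> Tk N) \<union>
     (\<lambda>(b, r). (iso_coord (uf * b) (uf * r), uf * b, 1)) ` (TK (N - 1) \<times> Tk (N - 1))"

definition lin3 :: "'a \<times> 'a \<times> 'a \<Rightarrow> 'a \<times> 'a \<times> 'a \<Rightarrow> 'a" where
  "lin3 m x = (case m of (m1, m2, m3) \<Rightarrow> case x of (a, b, c) \<Rightarrow> a * m1 + b * m2 + c * m3)"

lemma herm3_scale: "herm3 (l * a, l * b, l * c) = nm l * herm3 (a, b, c)"
  by (simp add: herm3_def nm_def tr_def star_mult algebra_simps)

lemma herm3_swap: "herm3 (c, b, a) = herm3 (a, b, c)" by (simp add: herm3_def tr_def star_mult algebra_simps)

lemma tr_iso_coord: "r \<in> k \<Longrightarrow> tr (iso_coord b r) = - nm b"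
  using tr_lin[of "- nm b / 2" r] nm_k[of b] by (simp add: iso_coord_def k_divide k_minus k_numeral)

lemma nrm_iso_coord: "r \<in> k \<Longrightarrow> nrm (iso_coord b r) = max (nrm b ^ 2) (nrm r)"
  using nrm_lin[of "- nm b / 2" r] nm_k[of b] by (simp add: iso_coord_def k_divide k_minus k_numeral nrm_divide nrm_nm)

lemma iso_coordE:
  assumes "tr t + nm b = 0" obtains r where "r \<in> k" "t = iso_coord b r" "nrm r \<le> nrm t"
proof
  show "ima t \<in> k" "nrm (ima t) \<le> nrm t" by (rule ima_k nrm_ima)+
  have "t + star t = - nm b" using assms by (simp add: tr_def eq_neg_iff_add_eq_0)
  then have "rea t = - nm b / 2" by (simp add: rea_def)
  then show "t = iso_coord b (ima t)" unfolding iso_coord_def using rea_ima[of t] by simp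
qed

lemma cong_iso_coord:
  assumes "nrm b \<le> 1" "nrm b' \<le> 1" "cong_mod N b b'" "r \<in> k" "r' \<in> k"
  shows "cong_mod N (iso_coord b r) (iso_coord b' r') \<longleftrightarrow> cong_mod N r r'"
proof -
  have "cong_mod N (- nm b / 2) (- nm b' / 2)"
    using cong_nm[OF assms(1-3)] cong_sym[of N "nm b"]
    by (simp add: cong_mod_def diff_divide_distrib[symmetric] nrm_divide)
  then show ?thesis
    using cong_lin[of "- nm b / 2" r "- nm b' / 2" r' N] assms nm_k
    by (simp add: iso_coord_def k_divide k_minus k_numeral)
qed

lemma assoc3_sym: "assoc3 N x y \<Longrightarrow> assoc3 N y x"
proof -
  assume A: "assoc3 N x y"
  obtain a b c a' b' c' where xy: "x = (a, b, c)" "y = (a', b', c')"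
    by (cases x, cases y)
  obtain l where l: "nrm l = 1" "cong_mod N (l * a) a'" "cong_mod N (l * b) b'" "cong_mod N (l * c) c'"
    using A unfolding assoc3_def xy by auto
  then have "nrm (inverse l) = 1" "cong_mod N (inverse l * a') a" "cong_mod N (inverse l * b') b" "cong_mod N (inverse l * c') c"
    by (simp_all add: nrm_inverse cong_unit_move cong_sym[of N "inverse l * _"])
  then show "assoc3 N y x" unfolding assoc3_def xy by auto
qed

lemma assoc3_trans: "assoc3 N x y \<Longrightarrow> assoc3 N y z \<Longrightarrow> assoc3 N x z"
proof -
  assume A: "assoc3 N x y" "assoc3 N y z"
  obtain a b c a' b' c' a'' b'' c'' where xyz: "x = (a, b, c)" "y = (a', b', c')" "z = (a'', b'', c'')"
    by (cases x, cases y, cases z)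
  obtain l l' where l: "nrm l = 1" "cong_mod N (l * a) a'" "cong_mod N (l * b) b'" "cong_mod N (l * c) c'"
      "nrm l' = 1" "cong_mod N (l' * a') a''" "cong_mod N (l' * b') b''" "cong_mod N (l' * c') c''"
    using A unfolding assoc3_def xyz by auto
  have "cong_mod N (l' * (l * a)) (l' * a')" "cong_mod N (l' * (l * b)) (l' * b')" "cong_mod N (l' * (l * c)) (l' * c')"
    using l by (simp_all only: cong_unit_cancel)
  then have "cong_mod N (l' * l * a) a''" "cong_mod N (l' * l * b) b''" "cong_mod N (l' * l * c) c''"
    using l cong_trans unfolding mult.assoc by blast+
  then show "assoc3 N x z"
    unfolding assoc3_def xyz using l by (auto simp: nrm_mult intro!: exI[of _ "l' * l"])
qed

lemma finite_lines3: "finite (lines3 N)" by (simp add: lines3_def TKD TkD)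

lemma nrm_iso_coord_uf: "nrm b \<le> 1 \<Longrightarrow> r \<in> k \<Longrightarrow> nrm r \<le> 1 \<Longrightarrow> nrm (iso_coord (uf * b) (uf * r)) < 1"
  using nrm_uf_times_less[of b] nrm_uf_times_less[of r] nrm_nonneg[of "uf * b"]
  by (simp add: nrm_iso_coord k_mult prime_in_k power_less_one_iff)

lemma lines3_isotropic: "lines3 N \<subseteq> isotropic3"
proof
  fix x assume "x \<in> lines3 N"
  then consider b r where "b \<in> TK N" "r \<in> Tk N" "x = (1, b, iso_coord b r)"
    | b r where "b \<in> TK (N - 1)" "r \<in> Tk (N - 1)" "x = (iso_coord (uf * b) (uf * r), uf * b, 1)"
    by (auto simp: lines3_def)
  then show "x \<in> isotropic3"
  proof cases
    case 1
    have rk: "r \<in> k" "nrm r \<le> 1" "nrm b \<le> 1" using 1 Tk_k Tk_nrm TK_nrm by auto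
    have "tr (star (iso_coord b r)) = tr (iso_coord b r)" by (simp add: tr_def add.commute)
    then show ?thesis
      using 1 rk tr_iso_coord[OF rk(1), of b] nrm_iso_coord[OF rk(1), of b]
      by (auto simp: isotropic3_def herm3_def power_le_one nrm_nonneg)
  next
    case 2
    have rk: "r \<in> k" "nrm r \<le> 1" "nrm b \<le> 1" using 2 Tk_k Tk_nrm TK_nrm by blast+
    then have uk: "uf * r \<in> k" by (simp add: k_mult prime_in_k)
    show ?thesis
      using 2 rk tr_iso_coord[OF uk, of "uf * b"] nrm_iso_coord_uf[OF rk(3,1,2)] nrm_uf_times_less[OF rk(3)]
      by (auto simp: isotropic3_def herm3_def)
  qed
qed

lemma uf_times_Tk:
  assumes "nrm a < 1" "a \<in> k" "N \<ge> 1"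
  shows "\<exists>s. s \<in> Tk (N - 1) \<and> cong_mod N a (uf * s)"
    "s \<in> Tk (N - 1) \<Longrightarrow> s' \<in> Tk (N - 1) \<Longrightarrow> cong_mod N (uf * s) (uf * s') \<Longrightarrow> s = s'"
proof -
  have eq: "cong_mod N (uf * x) (uf * y) \<longleftrightarrow> cong_mod (N - 1) x y" for x y
    using cong_uf_mult[of 1 "N - 1" x y] assms(3) by simp
  obtain b where b: "a = uf ^ 1 * b" "nrm b \<le> 1" "b \<in> k"
    using nrm_le_pwE[of a 1] assms nrm_less_1_iff by metis
  then obtain r where "r \<in> Tk (N - 1)" "cong_mod (N - 1) b r"
    using TkD(4)[of b "N - 1"] by (auto simp: integers_of_def)
  then show "\<exists>s. s \<in> Tk (N - 1) \<and> cong_mod N a (uf * s)" using b(1) eq by auto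
  show "s \<in> Tk (N - 1) \<Longrightarrow> s' \<in> Tk (N - 1) \<Longrightarrow> cong_mod N (uf * s) (uf * s') \<Longrightarrow> s = s'"
    unfolding eq by (rule TkD(5))
qed

lemma lines3_ex:
  assumes x: "x \<in> isotropic3" and N: "N \<ge> 1" shows "\<exists>y\<in>lines3 N. assoc3 N x y"
proof -
  obtain a b c where abc: "x = (a, b, c)" "nrm a \<le> 1" "nrm b \<le> 1" "nrm c \<le> 1"
      "nrm a = 1 \<or> nrm b = 1 \<or> nrm c = 1" "herm3 (a, b, c) = 0"
    using x by (auto simp: isotropic3_def)
  show ?thesis
  proof (cases "nrm a = 1")
    case True
    define l where "l = inverse a"
    have l: "nrm l = 1" "l * a = 1" using True nrm_1_nonzero[OF True] by (simp_all add: l_def nrm_inverse)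
    define b' c' where "b' = l * b" and "c' = l * c"
    have n: "nrm b' \<le> 1" "nrm c' \<le> 1" using abc l by (simp_all add: b'_def c'_def nrm_mult)
    have "herm3 (1, b', c') = 0" using herm3_scale[of l a b c] abc l by (simp add: b'_def c'_def)
    then have "tr c' + nm b' = 0" by (simp add: herm3_def tr_def add.commute)
    then obtain r where r: "r \<in> k" "c' = iso_coord b' r" "nrm r \<le> nrm c'" by (rule iso_coordE)
    obtain b0 where b0: "b0 \<in> TK N" "cong_mod N b' b0"
      using TKD(4)[of b' N] n by (auto simp: OK_iff)
    obtain r0 where r0: "r0 \<in> Tk N" "cong_mod N r r0"
      using TkD(4)[of r N] r n by (auto simp: integers_of_def)
    have "cong_mod N c' (iso_coord b0 r0)"
      unfolding r(2) using cong_iso_coord[OF n(1) TK_nrm[OF b0(1)] b0(2) r(1) Tk_k[OF r0(1)]] r0(2) by simp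
    then have "assoc3 N x (1, b0, iso_coord b0 r0)"
      unfolding assoc3_def abc(1) using l b0(2) by (auto simp: b'_def c'_def intro!: exI[of _ l])
    moreover have "(1, b0, iso_coord b0 r0) \<in> lines3 N" using b0 r0 by (auto simp: lines3_def)
    ultimately show ?thesis
      by blast
  next
    case False
    then have a1: "nrm a < 1" using abc by simp
    have "nrm (a * star c) \<le> nrm a" using abc by (simp add: nrm_mult mult_left_le nrm_nonneg)
    then have "nrm (tr (a * star c)) < 1" using nrm_tr[of "a * star c"] a1 by linarith
    moreover have nmb: "nm b = - tr (a * star c)"
      using abc(6) by (simp add: herm3_def eq_neg_iff_add_eq_0 add.commute)
    ultimately have "nrm b ^ 2 < 1" by (simp add: nrm_nm[symmetric])
    then have b1: "nrm b < 1" using nrm_nonneg[of b] by (simp add: power_less_one_iff)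
    then have c1: "nrm c = 1" using a1 abc by auto
    define l where "l = inverse c"
    have l: "nrm l = 1" "l * c = 1" using c1 nrm_1_nonzero[OF c1] by (simp_all add: l_def nrm_inverse)
    define b' a' where "b' = l * b" and "a' = l * a"
    have n: "nrm b' < 1" "nrm a' < 1" using a1 b1 l by (simp_all add: b'_def a'_def nrm_mult)
    have "herm3 (a', b', 1) = 0" using herm3_scale[of l a b c] abc l by (simp add: b'_def a'_def)
    then have "tr a' + nm b' = 0" by (simp add: herm3_def)
    then obtain r where r: "r \<in> k" "a' = iso_coord b' r" "nrm r \<le> nrm a'" by (rule iso_coordE)
    obtain b0 where b0: "b0 \<in> TK (N - 1)" "cong_mod N b' (uf * b0)"
      using uf_times_TK(1)[OF n(1) N] by blast
    obtain r0 where r0: "r0 \<in> Tk (N - 1)" "cong_mod N r (uf * r0)"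
      using uf_times_Tk(1)[of r N] r n N by auto
    have ub: "nrm (uf * b0) \<le> 1" "nrm b' \<le> 1" using nrm_uf_times_less[OF TK_nrm[OF b0(1)]] n by auto
    have uk: "uf * r0 \<in> k" using Tk_k[OF r0(1)] by (simp add: k_mult prime_in_k)
    have "cong_mod N a' (iso_coord (uf * b0) (uf * r0))"
      unfolding r(2) using cong_iso_coord[OF ub(2,1) b0(2) r(1) uk] r0(2) by simp
    then have "assoc3 N x (iso_coord (uf * b0) (uf * r0), uf * b0, 1)"
      unfolding assoc3_def abc(1) using l b0(2) by (auto simp: b'_def a'_def intro!: exI[of _ l])
    moreover have "(iso_coord (uf * b0) (uf * r0), uf * b0, 1) \<in> lines3 N"
      using b0 r0 by (auto simp: lines3_def)
    ultimately show ?thesis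
      by blast
  qed
qed

lemma lines3_unique:
  assumes "x \<in> lines3 N" "y \<in> lines3 N" "assoc3 N x y" and N: "N \<ge> 1" shows "x = y"
proof -
  consider b r b' r' where "b \<in> TK N" "r \<in> Tk N" "x = (1, b, iso_coord b r)"
      "b' \<in> TK N" "r' \<in> Tk N" "y = (1, b', iso_coord b' r')"
    | b r b' r' where "b \<in> TK (N - 1)" "r \<in> Tk (N - 1)" "x = (iso_coord (uf * b) (uf * r), uf * b, 1)"
      "b' \<in> TK (N - 1)" "r' \<in> Tk (N - 1)" "y = (iso_coord (uf * b') (uf * r'), uf * b', 1)"
    | b r where "b \<in> TK (N - 1)" "r \<in> Tk (N - 1)" "x = (iso_coord (uf * b) (uf * r), uf * b, 1)" "fst y = 1"
    | b r where "b \<in> TK (N - 1)" "r \<in> Tk (N - 1)" "y = (iso_coord (uf * b) (uf * r), uf * b, 1)" "fst x = 1"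
    using assms(1,2) by (auto simp: lines3_def)
  then show ?thesis
  proof cases
    case 1
    then obtain l where l: "nrm l = 1" "cong_mod N l 1" "cong_mod N (l * b) b'"
        "cong_mod N (l * iso_coord b r) (iso_coord b' r')"
      using assms(3) by (auto simp: assoc3_def)
    have n: "nrm b \<le> 1" "nrm b' \<le> 1" "r \<in> k" "r' \<in> k" "nrm r \<le> 1"
      using 1 TK_nrm Tk_k Tk_nrm by blast+
    have bb: "cong_mod N b b'"
      using cong_scale_1[OF n(1) l(2,3)] .
    have "nrm (iso_coord b r) \<le> 1" using n by (simp add: nrm_iso_coord power_le_one nrm_nonneg)
    then have "cong_mod N (iso_coord b r) (iso_coord b' r')" using cong_scale_1 l(2,4) by blast
    then have "cong_mod N r r'" using cong_iso_coord[OF n(1,2) bb n(3,4)] by simp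
    then show ?thesis
      using 1 bb TKD(5)[of b N b'] TkD(5)[of r N r'] by simp
  next
    case 2
    then obtain l where l: "nrm l = 1" "cong_mod N l 1" "cong_mod N (l * (uf * b)) (uf * b')"
        "cong_mod N (l * iso_coord (uf * b) (uf * r)) (iso_coord (uf * b') (uf * r'))"
      using assms(3) by (auto simp: assoc3_def)
    have n: "nrm (uf * b) \<le> 1" "nrm (uf * b') \<le> 1" "r \<in> k" "r' \<in> k" "nrm r \<le> 1" "nrm b \<le> 1"
      using 2 TK_nrm Tk_k Tk_nrm nrm_uf_times_less less_imp_le by blast+
    have uk: "uf * r \<in> k" "uf * r' \<in> k" using n by (auto simp: k_mult prime_in_k)
    have bb: "cong_mod N (uf * b) (uf * b')"
      using cong_scale_1[OF n(1) l(2,3)] .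
    have "nrm (iso_coord (uf * b) (uf * r)) \<le> 1" using nrm_iso_coord_uf[OF n(6,3,5)] by simp
    then have "cong_mod N (iso_coord (uf * b) (uf * r)) (iso_coord (uf * b') (uf * r'))"
      using cong_scale_1 l(2,4) by blast
    then have "cong_mod N (uf * r) (uf * r')" using cong_iso_coord[OF n(1,2) bb uk] by simp
    then show ?thesis
      using 2 bb uf_times_TK(2)[of 0 N b b'] uf_times_Tk(2)[of 0 N r r'] N by (simp add: k_0)
  next
    case 3
    then obtain l where l: "nrm l = 1" "cong_mod N (l * iso_coord (uf * b) (uf * r)) 1"
      using assms(3) by (auto simp: assoc3_def)
    have "nrm (iso_coord (uf * b) (uf * r)) < 1" using 3 TK_nrm Tk_k Tk_nrm by (blast intro: nrm_iso_coord_uf)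
    then show ?thesis
      using l not_cong_unit(2)[of 1 "l * iso_coord (uf * b) (uf * r)" N] N by (simp add: nrm_mult)
  next
    case 4
    then obtain l where l: "nrm l = 1" "cong_mod N l (iso_coord (uf * b) (uf * r))"
      using assms(3) by (auto simp: assoc3_def)
    have "nrm (iso_coord (uf * b) (uf * r)) < 1" using 4 TK_nrm Tk_k Tk_nrm by (blast intro: nrm_iso_coord_uf)
    then show ?thesis
      using l not_cong_unit(1)[of l "iso_coord (uf * b) (uf * r)" N] N by simp
  qed
qed

lemma lin3_assoc:
  assumes x: "x \<in> isotropic3" "y \<in> isotropic3" "assoc3 N x y"
    and C: "nrm m1 \<le> C" "nrm m2 \<le> C" "nrm m3 \<le> C" "C * pw N < r"
  shows "nrm (lin3 (m1, m2, m3) x) = r \<longleftrightarrow> nrm (lin3 (m1, m2, m3) y) = r"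
proof -
  obtain a b c a' b' c' where xy: "x = (a, b, c)" "y = (a', b', c')"
    by (cases x, cases y)
  obtain l where l: "nrm l = 1" "cong_mod N (l * a) a'" "cong_mod N (l * b) b'" "cong_mod N (l * c) c'"
    using x(3) unfolding assoc3_def xy by auto
  have "l * lin3 (m1, m2, m3) x - lin3 (m1, m2, m3) y = m1 * (l * a - a') + m2 * (l * b - b') + m3 * (l * c - c')"
    by (simp add: lin3_def xy algebra_simps)
  moreover have "nrm (m1 * (l * a - a')) \<le> C * pw N" "nrm (m2 * (l * b - b')) \<le> C * pw N" "nrm (m3 * (l * c - c')) \<le> C * pw N"
    using l by (auto simp: cong_mod_def intro: nrm_mult_le C)
  ultimately have "nrm (l * lin3 (m1, m2, m3) x - lin3 (m1, m2, m3) y) \<le> C * pw N"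
    by (auto intro!: nrm_add_le)
  then show ?thesis
    using nrm_eq_of_close[OF _ C(4)] l(1) by (metis mult_1 nrm_mult)
qed

text \<open>For a form in normal position, the value on the first chart has excess valuation at
  least m exactly when \<open>nm b\<close> meets a fixed element modulo the m-th power and r
  vanishes modulo that power. The second condition accounts for the factors
  \<open>q ^ (N - j)\<close> and \<open>q ^ (N - Suc j)\<close>.\<close>

definition count3 :: "nat \<Rightarrow> nat \<Rightarrow> nat \<Rightarrow> int" where
  "count3 e N j = int (norm_count e N j * q ^ (N - j)) - int (norm_count e N (Suc j) * q ^ (N - Suc j)) +
     (if j = 0 then int (q ^ (3 * (N - 1))) else 0)"

definition lin3_law :: "'a \<times> 'a \<times> 'a \<Rightarrow> int \<Rightarrow> nat \<Rightarrow> bool" where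
  "lin3_law m \<beta> e \<longleftrightarrow> nrm (herm3 m) = real q powi (- (2 * \<beta> + int e)) \<and>
     (case m of (m1, m2, m3) \<Rightarrow> nrm m1 \<le> real q powi (- \<beta>) \<and> nrm m2 \<le> real q powi (- \<beta>) \<and> nrm m3 \<le> real q powi (- \<beta>)) \<and>
     (\<forall>N\<ge>1. \<forall>j<N. int (card {x \<in> lines3 N. nrm (lin3 m x) = real q powi (- (\<beta> + int j))}) = count3 e N j)"

lemma lin3_law_transfer:
  assumes law: "lin3_law m' \<beta> e"
    and disc: "herm3 m' = herm3 (m1, m2, m3)"
    and bound: "nrm m1 \<le> real q powi (- \<beta>)" "nrm m2 \<le> real q powi (- \<beta>)" "nrm m3 \<le> real q powi (- \<beta>)"
    and \<phi>: "\<And>x. x \<in> isotropic3 \<Longrightarrow> \<phi> x \<in> isotropic3"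
      "\<And>N x y. assoc3 N (\<phi> x) (\<phi> y) \<Longrightarrow> x \<in> isotropic3 \<Longrightarrow> y \<in> isotropic3 \<Longrightarrow> assoc3 N x y"
      "\<And>x. lin3 (m1, m2, m3) (\<phi> x) = lin3 m' x"
  shows "lin3_law (m1, m2, m3) \<beta> e"
  unfolding lin3_law_def
proof (intro conjI allI impI)
  show "nrm (herm3 (m1, m2, m3)) = real q powi (- (2 * \<beta> + int e))"
    using law disc by (simp add: lin3_law_def)
  fix N j :: nat assume N: "1 \<le> N" "j < N"
  have "card {p \<in> lines3 N. nrm (lin3 (m1, m2, m3) (\<phi> p)) = real q powi (- (\<beta> + int j))} =
      card {p \<in> lines3 N. nrm (lin3 (m1, m2, m3) p) = real q powi (- (\<beta> + int j))}"
  proof (rule card_reps_invariant[where E = isotropic3 and R = "assoc3 N"])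
    show "\<exists>y\<in>lines3 N. assoc3 N x y" if "x \<in> isotropic3" for x
      using lines3_ex that N(1) .
    show "x = y" if "x \<in> lines3 N" "y \<in> lines3 N" "assoc3 N x y" for x y
      using lines3_unique that N(1) .
    show "assoc3 N y x" if "assoc3 N x y" for x y using that by (rule assoc3_sym)
    show "assoc3 N x z" if "assoc3 N x y" "assoc3 N y z" for x y z using that by (rule assoc3_trans)
    show "assoc3 N x y" if "x \<in> isotropic3" "y \<in> isotropic3" "assoc3 N (\<phi> x) (\<phi> y)" for x y
      using \<phi>(2)[OF that(3,1,2)] .
    show "nrm (lin3 (m1, m2, m3) x) = real q powi (- (\<beta> + int j)) \<longleftrightarrow> nrm (lin3 (m1, m2, m3) y) = real q powi (- (\<beta> + int j))"
      if "x \<in> isotropic3" "y \<in> isotropic3" "assoc3 N x y" for x y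
      using lin3_assoc[OF that bound powi_pw_less[OF N(2)]] .
  qed (fact finite_lines3 lines3_isotropic \<phi>(1))+
  moreover have "int (card {p \<in> lines3 N. nrm (lin3 m' p) = real q powi (- (\<beta> + int j))}) = count3 e N j"
    using law N unfolding lin3_law_def by blast
  ultimately show "int (card {x \<in> lines3 N. nrm (lin3 (m1, m2, m3) x) = real q powi (- (\<beta> + int j))}) = count3 e N j"
    unfolding \<phi>(3) by (simp only:)
qed (use bound in auto)

lemma lin3_law_swap:
  assumes law: "lin3_law (m3, m2, m1) \<beta> e" shows "lin3_law (m1, m2, m3) \<beta> e"
proof (rule lin3_law_transfer[OF law, where \<phi> = "\<lambda>(a, b, c). (c, b, a)"])
  show "assoc3 N (case x of (a, b, c) \<Rightarrow> (c, b, a)) (case y of (a, b, c) \<Rightarrow> (c, b, a)) \<Longrightarrow> assoc3 N x y" for N x y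
    unfolding assoc3_def by (cases x, cases y) auto
  show "lin3 (m1, m2, m3) (case x of (a, b, c) \<Rightarrow> (c, b, a)) = lin3 (m3, m2, m1) x" for x
    by (cases x) (simp add: lin3_def)
  show "(case x of (a, b, c) \<Rightarrow> (c, b, a)) \<in> isotropic3" if "x \<in> isotropic3" for x
    using that herm3_swap by (auto simp: isotropic3_def)
qed (use law herm3_swap in \<open>auto simp: lin3_law_def\<close>)

text \<open>The substitution is a unipotent isometry of \<open>herm3\<close> that fixes the
  isotropic vector \<open>(0, 0, 1)\<close>; the relation between \<open>\<alpha>\<close> and
  \<open>\<tau>\<close> expresses that it is an isometry. The coefficients of the linear form change
  by the transposed map, which preserves \<open>herm3\<close> as well.\<close>

lemma lin3_law_shear:
  assumes law: "lin3_law (m1 + \<alpha> * m2 + \<tau> * m3, m2 - star \<alpha> * m3, m3) \<beta> e"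
    and \<alpha>: "nrm \<alpha> \<le> 1" "nrm \<tau> \<le> 1" "tr \<tau> + nm \<alpha> = 0"
  shows "lin3_law (m1, m2, m3) \<beta> e"
proof (rule lin3_law_transfer[OF law, where \<phi> = "\<lambda>(a, b, c). (a, b + \<alpha> * a, c - star \<alpha> * b + \<tau> * a)"])
  have \<tau>: "star \<tau> = - \<tau> - \<alpha> * star \<alpha>"
    using \<alpha>(3) by (simp add: tr_def nm_def algebra_simps eq_neg_iff_add_eq_0 eq_diff_eq)
  show "herm3 (m1 + \<alpha> * m2 + \<tau> * m3, m2 - star \<alpha> * m3, m3) = herm3 (m1, m2, m3)"
    by (simp add: herm3_def tr_def nm_def star_add star_diff star_mult \<tau> algebra_simps)
  let ?C = "real q powi (- \<beta>)"
  have C: "nrm (m1 + \<alpha> * m2 + \<tau> * m3) \<le> ?C" "nrm (m2 - star \<alpha> * m3) \<le> ?C" "nrm m3 \<le> ?C"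
    using law by (auto simp: lin3_law_def)
  show "nrm m3 \<le> ?C" by fact
  have "nrm (star \<alpha> * m3) \<le> 1 * ?C" "nrm (\<tau> * m3) \<le> 1 * ?C"
    using C(3) \<alpha>(1,2) by (intro nrm_mult_le; simp)+
  then have c: "nrm (star \<alpha> * m3) \<le> ?C" "nrm (\<tau> * m3) \<le> ?C" by simp_all
  show m2: "nrm m2 \<le> ?C" using nrm_add_le[OF C(2) c(1)] by simp
  have "nrm (\<alpha> * m2) \<le> 1 * ?C" using m2 \<alpha> by (intro nrm_mult_le) auto
  then show "nrm m1 \<le> ?C" using nrm_diff_le[OF nrm_diff_le[OF C(1) c(2)], of "\<alpha> * m2"] by simp
  show "lin3 (m1, m2, m3) (case x of (a, b, c) \<Rightarrow> (a, b + \<alpha> * a, c - star \<alpha> * b + \<tau> * a)) =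
      lin3 (m1 + \<alpha> * m2 + \<tau> * m3, m2 - star \<alpha> * m3, m3) x" for x
    by (cases x) (simp add: lin3_def algebra_simps)
  show "(case x of (a, b, c) \<Rightarrow> (a, b + \<alpha> * a, c - star \<alpha> * b + \<tau> * a)) \<in> isotropic3" if xi: "x \<in> isotropic3" for x
  proof -
    obtain a b c where x: "x = (a, b, c)" "nrm a \<le> 1" "nrm b \<le> 1" "nrm c \<le> 1"
        "nrm a = 1 \<or> nrm b = 1 \<or> nrm c = 1" "herm3 (a, b, c) = 0"
      using xi by (auto simp: isotropic3_def)
    define b' c' where "b' = b + \<alpha> * a" and "c' = c - star \<alpha> * b + \<tau> * a"
    have n: "nrm b' \<le> 1" "nrm c' \<le> 1"
      unfolding b'_def c'_def using x \<alpha> by (auto intro!: nrm_add_le nrm_diff_le nrm_mult_le_1)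
    have h: "herm3 (a, b', c') = herm3 (a, b, c)"
      by (simp add: b'_def c'_def herm3_def tr_def nm_def star_add star_diff star_mult \<tau> algebra_simps)
    have "nrm a = 1 \<or> nrm b' = 1 \<or> nrm c' = 1"
    proof (rule ccontr)
      assume "\<not> ?thesis"
      then have lt: "nrm a < 1" "nrm b' < 1" "nrm c' < 1" using n x by auto
      have 1: "nrm (u * v) < 1" if "nrm u \<le> 1" "nrm v < 1" for u v
        using that mult_left_le_one_le[of "nrm v" "nrm u"] nrm_nonneg by (auto simp: nrm_mult intro: le_less_trans)
      have "b = b' - \<alpha> * a" by (simp add: b'_def)
      then have b: "nrm b < 1" using nrm_diff_less[OF lt(2) 1[OF \<alpha>(1) lt(1)]] by simp
      have "c = c' + star \<alpha> * b - \<tau> * a" by (simp add: c'_def)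
      then have "nrm c < 1"
        using nrm_diff_less[OF nrm_add_less[OF lt(3) 1[of "star \<alpha>", OF _ b]] 1[OF \<alpha>(2) lt(1)]] \<alpha>(1) by simp
      then show False
        using x lt b by auto
    qed
    then show ?thesis
      using x n h by (simp add: isotropic3_def b'_def c'_def)
  qed
  show "assoc3 N x y" if A: "assoc3 N (case x of (a, b, c) \<Rightarrow> (a, b + \<alpha> * a, c - star \<alpha> * b + \<tau> * a))
      (case y of (a, b, c) \<Rightarrow> (a, b + \<alpha> * a, c - star \<alpha> * b + \<tau> * a))" "x \<in> isotropic3" "y \<in> isotropic3" for N x y
  proof -
    obtain a b c a' b' c' where xy: "x = (a, b, c)" "y = (a', b', c')"
      by (cases x, cases y)
    have n: "nrm a \<le> 1" "nrm b \<le> 1" "nrm a' \<le> 1" "nrm b' \<le> 1"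
      using A(2,3) by (auto simp: isotropic3_def xy)
    obtain l where l: "nrm l = 1" "cong_mod N (l * a) a'" "cong_mod N (l * (b + \<alpha> * a)) (b' + \<alpha> * a')"
        "cong_mod N (l * (c - star \<alpha> * b + \<tau> * a)) (c' - star \<alpha> * b' + \<tau> * a')"
      using A(1) unfolding assoc3_def xy by auto
    have ca: "cong_mod N (\<alpha> * (l * a)) (\<alpha> * a')" "cong_mod N (\<tau> * (l * a)) (\<tau> * a')"
      using l n \<alpha> by (auto intro!: cong_mult)
    have "cong_mod N (l * (b + \<alpha> * a) - \<alpha> * (l * a)) (b' + \<alpha> * a' - \<alpha> * a')"
      using l(3) ca(1) by (rule cong_diff)
    then have b: "cong_mod N (l * b) b'" by (simp add: algebra_simps)
    have "cong_mod N (star \<alpha> * (l * b)) (star \<alpha> * b')"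
      using b n \<alpha> by (auto intro!: cong_mult)
    then have "cong_mod N (l * (c - star \<alpha> * b + \<tau> * a) - \<tau> * (l * a) + star \<alpha> * (l * b))
        (c' - star \<alpha> * b' + \<tau> * a' - \<tau> * a' + star \<alpha> * b')"
      using l(4) ca(2) by (intro cong_add cong_diff)
    then have "cong_mod N (l * c) c'" by (simp add: algebra_simps)
    then show ?thesis
      unfolding assoc3_def xy using l b by auto
  qed
qed

text \<open>On \<open>(1, b, iso_coord b r)\<close> the value is \<open>\<mu>\<close> times
  \<open>(2 * c - nm b) / 2 + r * \<theta>\<close>. As c lies in k, these are the two coordinates
  over k, so the absolute value is a maximum and the conditions on b and r are independent. On the
  second chart the value is \<open>\<mu>\<close> times a unit.\<close>

lemma lin3_law_normal:
  assumes \<mu>: "\<mu> \<noteq> 0" and c: "c \<in> k" "c \<noteq> 0" "nrm c \<le> 1"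
  shows "\<exists>\<beta> e. lin3_law (\<mu> * c, 0, \<mu>) \<beta> e"
proof -
  define \<beta> where "\<beta> = val \<mu>"
  obtain e where e: "nrm c = pw e"
    using nrm_le_1_cases[OF c(3,2)] by (auto simp: pw_def)
  have n\<mu>: "nrm \<mu> = real q powi (- \<beta>)" unfolding \<beta>_def by (rule nrm_val[OF \<mu>])
  have n0: "nrm \<mu> \<noteq> 0" using \<mu> nrm_eq_0 by blast
  have h: "herm3 (\<mu> * c, 0, \<mu>) = nm \<mu> * (2 * c)"
    using c by (simp add: herm3_def tr_def nm_def star_mult star_fixes)
  have nh: "nrm (herm3 (\<mu> * c, 0, \<mu>)) = real q powi (- (2 * \<beta> + int e))"
    unfolding h nrm_mult nrm_nm n\<mu> e pw_powi power2_eq_square nrm_2 mult_1 q_powi_add[symmetric] by simp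
  have iff: "nrm (\<mu> * x) = real q powi (- (\<beta> + int j)) \<longleftrightarrow> nrm x = pw j" for x j
  proof -
    have "real q powi (- (\<beta> + int j)) = nrm \<mu> * pw j"
      unfolding n\<mu> pw_powi q_powi_add[symmetric] by simp
    then show ?thesis
      using n0 by (simp add: nrm_mult)
  qed
  define d where "d = 2 * c"
  have d: "d \<in> k" "nrm d = pw e" using c e by (auto simp: d_def k_mult k_numeral nrm_mult)
  have count: "int (card {x \<in> lines3 N. nrm (lin3 (\<mu> * c, 0, \<mu>) x) = real q powi (- (\<beta> + int j))}) = count3 e N j"
    if N: "1 \<le> N" "j < N" for N j
  proof -
    define A where "A m = {b \<in> TK N. cong_mod m (nm b) d} \<times> {r \<in> Tk N. cong_mod m r 0}" for m
    have cardA: "card (A m) = norm_count e N m * q ^ (N - m)" if "m \<le> N" for m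
      using card_norm[OF d that] card_residue_class[OF transversals_Tk _ Ok_closed(5) that]
      by (simp add: A_def card_cartesian_product)
    have A_mono: "A (Suc j) \<subseteq> A j" using cong_mono[of "Suc j" _ _ j] by (auto simp: A_def)
    have finA: "finite (A m)" for m using TKD(1) TkD(1) by (simp add: A_def)
    have v1: "nrm (lin3 (\<mu> * c, 0, \<mu>) (1, b, iso_coord b r)) = real q powi (- (\<beta> + int j)) \<longleftrightarrow> (b, r) \<in> A j - A (Suc j)"
      if "b \<in> TK N" "r \<in> Tk N" for b r
    proof -
      have rk: "r \<in> k" using that Tk_k by blast
      have "lin3 (\<mu> * c, 0, \<mu>) (1, b, iso_coord b r) = \<mu> * ((d - nm b) / 2 + r * \<theta>)"
        by (simp add: lin3_def iso_coord_def d_def field_simps)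
      moreover have "nrm ((d - nm b) / 2 + r * \<theta>) = max (nrm (nm b - d)) (nrm r)"
        using nrm_lin[of "(d - nm b) / 2" r] d rk nm_k
        by (simp add: k_divide k_diff k_numeral nrm_divide nrm_minus_commute)
      ultimately have "nrm (lin3 (\<mu> * c, 0, \<mu>) (1, b, iso_coord b r)) = real q powi (- (\<beta> + int j)) \<longleftrightarrow>
          max (nrm (nm b - d)) (nrm r) = pw j"
        using iff by simp
      also have "\<dots> \<longleftrightarrow> max (nrm (nm b - d)) (nrm r) \<le> pw j \<and> \<not> max (nrm (nm b - d)) (nrm r) \<le> pw (Suc j)"
        using nrm_eq_pw_iff[of "nm b - d" j] nrm_eq_pw_iff[of r j] by linarith
      finally show ?thesis
        using that by (auto simp: A_def cong_mod_def)
    qed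
    have v2: "nrm (lin3 (\<mu> * c, 0, \<mu>) (iso_coord (uf * b) (uf * r), uf * b, 1)) = real q powi (- (\<beta> + int j)) \<longleftrightarrow> j = 0"
      if "b \<in> TK (N - 1)" "r \<in> Tk (N - 1)" for b r
    proof -
      have "nrm (iso_coord (uf * b) (uf * r)) < 1"
        using that TK_nrm Tk_k Tk_nrm by (blast intro: nrm_iso_coord_uf)
      then have "nrm c * nrm (iso_coord (uf * b) (uf * r)) < 1"
        using c(3) mult_left_le_one_le[of "nrm (iso_coord (uf * b) (uf * r))" "nrm c"] nrm_nonneg by (meson le_less_trans)
      then have "nrm (1 + c * iso_coord (uf * b) (uf * r)) = 1"
        using nrm_add_eq[of "c * iso_coord (uf * b) (uf * r)" 1] by (simp add: nrm_mult)
      moreover have "lin3 (\<mu> * c, 0, \<mu>) (iso_coord (uf * b) (uf * r), uf * b, 1) = \<mu> * (1 + c * iso_coord (uf * b) (uf * r))"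
        by (simp add: lin3_def algebra_simps)
      moreover have "(1::real) = pw j \<longleftrightarrow> j = 0"
        using pw_le_iff[of 0 j] by (metis le_0_eq order_refl pw_0)
      ultimately show ?thesis
        using iff by simp
    qed
    define f1 f2 where "f1 = (\<lambda>(b, r). (1::'a, b, iso_coord b r))"
      and "f2 = (\<lambda>(b, r). (iso_coord (uf * b) (uf * r), uf * b, 1::'a))"
    define B where "B = (if j = 0 then TK (N - 1) \<times> Tk (N - 1) else {})"
    have split: "{x \<in> lines3 N. nrm (lin3 (\<mu> * c, 0, \<mu>) x) = real q powi (- (\<beta> + int j))} = f1 ` (A j - A (Suc j)) \<union> f2 ` B"
    proof (intro equalityI subsetI)
      fix x assume x: "x \<in> {x \<in> lines3 N. nrm (lin3 (\<mu> * c, 0, \<mu>) x) = real q powi (- (\<beta> + int j))}"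
      then consider b r where "b \<in> TK N" "r \<in> Tk N" "x = (1, b, iso_coord b r)"
        | b r where "b \<in> TK (N - 1)" "r \<in> Tk (N - 1)" "x = (iso_coord (uf * b) (uf * r), uf * b, 1)"
        by (auto simp: lines3_def)
      then show "x \<in> f1 ` (A j - A (Suc j)) \<union> f2 ` B"
      proof cases
        case 1
        then have "(b, r) \<in> A j - A (Suc j)" using x v1[OF 1(1,2)] by simp
        then show ?thesis
          using 1 by (intro UnI1 image_eqI[of _ _ "(b, r)"]) (auto simp: f1_def)
      next
        case 2
        then have "(b, r) \<in> B" using x v2[OF 2(1,2)] by (simp add: B_def)
        then show ?thesis
          using 2 by (intro UnI2 image_eqI[of _ _ "(b, r)"]) (auto simp: f2_def)
      qed
    next
      fix x assume "x \<in> f1 ` (A j - A (Suc j)) \<union> f2 ` B"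
      then consider b r where "(b, r) \<in> A j - A (Suc j)" "x = f1 (b, r)" | b r where "(b, r) \<in> B" "x = f2 (b, r)"
        by auto
      then show "x \<in> {x \<in> lines3 N. nrm (lin3 (\<mu> * c, 0, \<mu>) x) = real q powi (- (\<beta> + int j))}"
      proof cases
        case 1
        then have "b \<in> TK N" "r \<in> Tk N" by (auto simp: A_def)
        then show ?thesis
          using 1 v1[of b r] by (auto simp: f1_def lines3_def)
      next
        case 2
        then have "b \<in> TK (N - 1)" "r \<in> Tk (N - 1)" "j = 0" by (auto simp: B_def split: if_splits)
        then show ?thesis
          using 2 v2[of b r] by (auto simp: f2_def lines3_def)
      qed
    qed
    have "card (f1 ` (A j - A (Suc j)) \<union> f2 ` B) = card (f1 ` (A j - A (Suc j))) + card (f2 ` B)"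
    proof (rule card_Un_disjoint)
      have "f1 z \<noteq> f2 (b, r)" if "b \<in> TK (N - 1)" "r \<in> Tk (N - 1)" for z b r
      proof -
        have "nrm (iso_coord (uf * b) (uf * r)) < 1"
          using that TK_nrm Tk_k Tk_nrm by (blast intro: nrm_iso_coord_uf)
        then have "iso_coord (uf * b) (uf * r) \<noteq> 1" using nrm_1 by (metis less_irrefl)
        then show ?thesis
          by (cases z) (auto simp: f1_def f2_def)
      qed
      then have "f1 z \<noteq> f2 y" if "y \<in> B" for z y
        using that by (cases y) (simp add: B_def split: if_splits)
      then show "f1 ` (A j - A (Suc j)) \<inter> f2 ` B = {}" by blast
    qed (use finA TKD(1) TkD(1) in \<open>auto simp: B_def\<close>)
    also have "card (f1 ` (A j - A (Suc j))) = card (A j - A (Suc j))"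
      by (intro card_image inj_onI) (auto simp: f1_def iso_coord_def)
    also have "card (A j - A (Suc j)) = card (A j) - card (A (Suc j))"
      using finA A_mono by (intro card_Diff_subset) auto
    also have "card (f2 ` B) = card B"
      using uf_nonzero by (intro card_image inj_onI) (auto simp: f2_def iso_coord_def)
    also have "card B = (if j = 0 then q ^ (3 * (N - 1)) else 0)"
      using TKD(3)[of "N - 1"] TkD(3)[of "N - 1"]
      by (simp add: B_def card_cartesian_product power_mult[symmetric] power_add[symmetric])
    finally show ?thesis
      using card_mono[OF finA A_mono] cardA[of j] cardA[of "Suc j"] N unfolding split by (simp add: count3_def)
  qed
  have "lin3_law (\<mu> * c, 0, \<mu>) \<beta> e"
    unfolding lin3_law_def using nh n\<mu> c(3) count by (auto simp: nrm_mult mult_left_le nrm_nonneg)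
  then show ?thesis
    by blast
qed

text \<open>If an outer coefficient dominates, an isometry clears the middle one and makes the ratio
  of the outer ones an element of k. If the middle coefficient is strictly dominant, a shear with
  parameter 1 first transfers its size to an outer one.\<close>

lemma ex_lin3_law:
  assumes h: "herm3 (m1, m2, m3) \<noteq> 0"
  shows "\<exists>\<beta> e. lin3_law (m1, m2, m3) \<beta> e"
proof -
  have 1: "\<exists>\<beta> e. lin3_law (m1, m2, m3) \<beta> e"
    if h: "herm3 (m1, m2, m3) \<noteq> 0" and max: "nrm m1 \<le> nrm m3" "nrm m2 \<le> nrm m3" for m1 m2 m3
  proof -
    have m0: "m3 \<noteq> 0"
    proof
      assume "m3 = 0"
      then have "m1 = 0" "m2 = 0"
        using max nrm_nonneg[of m1] nrm_nonneg[of m2] nrm_eq_0 by (auto simp: antisym)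
      then show False
        using h by (simp add: herm3_def nm_def tr_def)
    qed
    have div1: "nrm (m1 / m3) \<le> 1" "nrm (m2 / m3) \<le> 1"
      using max nrm_pos[OF m0] by (simp_all add: nrm_divide)
    define \<alpha> where "\<alpha> = star (m2 / m3)"
    define w where "w = m1 / m3 + \<alpha> * (m2 / m3)"
    \<comment> \<open>The \<open>\<theta>\<close>-coordinate of \<open>\<tau>\<close> is still free
      and is chosen opposite to that of w, so that \<open>w + \<tau>\<close> lies in k.\<close>
    define \<tau> where "\<tau> = iso_coord \<alpha> (- ima w)"
    have ik: "- ima w \<in> k" by (intro k_minus ima_k)
    have a1: "nrm \<alpha> \<le> 1" using div1 by (simp add: \<alpha>_def)
    have w1: "nrm w \<le> 1" unfolding w_def using div1 a1 by (intro nrm_add_le nrm_mult_le_1)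
    have "nrm (ima w) \<le> 1" using nrm_ima[of w] w1 by linarith
    then have t1: "nrm \<tau> \<le> 1"
      unfolding \<tau>_def nrm_iso_coord[OF ik] using a1 by (simp add: power_le_one nrm_nonneg)
    have t2: "tr \<tau> + nm \<alpha> = 0" unfolding \<tau>_def tr_iso_coord[OF ik] by simp
    define c where "c = w + \<tau>"
    have "c = rea w - nm \<alpha> / 2"
      unfolding c_def \<tau>_def iso_coord_def using rea_ima[of w] by (simp add: algebra_simps)
    then have ck: "c \<in> k" by (simp add: k_diff k_divide rea_k nm_k k_numeral)
    have c1: "nrm c \<le> 1" unfolding c_def using w1 t1 by (rule nrm_add_le)
    have e1: "m1 + \<alpha> * m2 + \<tau> * m3 = m3 * c" using m0 by (simp add: c_def w_def field_simps)
    have e2: "m2 - star \<alpha> * m3 = 0" using m0 by (simp add: \<alpha>_def)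
    have \<tau>s: "star \<tau> = - \<tau> - \<alpha> * star \<alpha>"
      using t2 by (simp add: tr_def nm_def algebra_simps eq_neg_iff_add_eq_0 eq_diff_eq)
    have "herm3 (m1 + \<alpha> * m2 + \<tau> * m3, m2 - star \<alpha> * m3, m3) = herm3 (m1, m2, m3)"
      by (simp add: herm3_def tr_def nm_def star_add star_diff star_mult \<tau>s algebra_simps)
    then have "herm3 (m3 * c, 0, m3) \<noteq> 0" using h e1 e2 by simp
    then have "c \<noteq> 0" by (auto simp: herm3_def nm_def tr_def)
    then obtain \<beta> e where "lin3_law (m3 * c, 0, m3) \<beta> e"
      using lin3_law_normal[OF m0 ck _ c1] by blast
    then have "lin3_law (m1, m2, m3) \<beta> e"
      using lin3_law_shear[OF _ a1 t1 t2, of m1 m2 m3 \<beta> e] e1 e2 by simp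
    then show ?thesis
      by blast
  qed
  have 2: "\<exists>\<beta> e. lin3_law (m1, m2, m3) \<beta> e"
    if "herm3 (m1, m2, m3) \<noteq> 0" "nrm m3 \<le> nrm m1" "nrm m2 \<le> nrm m1" for m1 m2 m3
  proof -
    have "herm3 (m3, m2, m1) \<noteq> 0" using that(1) by (subst herm3_swap)
    from 1[OF this that(2,3)] obtain \<beta> e where "lin3_law (m3, m2, m1) \<beta> e" by blast
    then show ?thesis
      using lin3_law_swap by blast
  qed
  show ?thesis
  proof (cases "nrm m1 < nrm m2 \<and> nrm m3 < nrm m2")
    case False
    then have "(nrm m1 \<le> nrm m3 \<and> nrm m2 \<le> nrm m3) \<or> (nrm m3 \<le> nrm m1 \<and> nrm m2 \<le> nrm m1)"
      by linarith
    then show ?thesis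
      using 1[OF h] 2[OF h] by blast
  next
    case True
    \<comment> \<open>The solution of \<open>tr \<tau> + nm 1 = 0\<close> that lies in k; it is
      integral because 2 is a unit.\<close>
    define \<tau> :: 'a where "\<tau> = - 1 / 2"
    have t: "nrm \<tau> \<le> 1" "tr \<tau> + nm 1 = 0"
      by (simp_all add: \<tau>_def nrm_divide tr_def nm_def star_divide)
    have t3: "nrm (\<tau> * m3) < nrm m2" using True by (simp add: \<tau>_def nrm_mult nrm_divide)
    have "nrm (m1 + \<tau> * m3) < nrm m2" using True t3 by (intro nrm_add_less) auto
    then have "nrm (m2 + (m1 + \<tau> * m3)) = nrm m2" by (rule nrm_add_eq)
    moreover have "m2 + (m1 + \<tau> * m3) = m1 + 1 * m2 + \<tau> * m3" by simp
    ultimately have n1: "nrm (m1 + 1 * m2 + \<tau> * m3) = nrm m2" by (simp only:)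
    have n2: "nrm (m2 - star 1 * m3) = nrm m2" using nrm_add_eq[of "- m3" m2] True by simp
    have "star \<tau> = \<tau>" by (simp add: \<tau>_def star_divide)
    then have "herm3 (m1 + 1 * m2 + \<tau> * m3, m2 - star 1 * m3, m3) = herm3 (m1, m2, m3)"
      by (simp add: herm3_def tr_def nm_def star_add star_diff star_mult algebra_simps)
        (simp add: \<tau>_def algebra_simps)
    then obtain \<beta> e where "lin3_law (m1 + 1 * m2 + \<tau> * m3, m2 - star 1 * m3, m3) \<beta> e"
      using 2[of "m1 + 1 * m2 + \<tau> * m3" "m2 - star 1 * m3" m3] h True n1 n2 by auto
    then show ?thesis
      using lin3_law_shear[of m1 1 m2 \<tau> m3] t by auto
  qed
qed


section \<open>Generating functions of the counts\<close>

definition palin :: "real \<Rightarrow> nat \<Rightarrow> nat \<Rightarrow> real" where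
  "palin E e j = (if j > e then 0 else if e = 0 then E - real q else if j = 0 \<or> j = e then E else E + real q)"

lemma palin_sym: "j \<le> e \<Longrightarrow> palin E e (e - j) = palin E e j" by (auto simp: palin_def)

definition norm_dens :: "nat \<Rightarrow> nat \<Rightarrow> real" where
  "norm_dens e m = (if m \<le> e then 1 / real q ^ (2 * ((m + 1) div 2))
     else if odd e then 0 else (real q + 1) / real q ^ (m + 1))"

lemma norm_count_dens:
  assumes "m \<le> N" shows "real (norm_count e N m) = real q ^ (2 * N) * norm_dens e m"
proof -
  have q0: "real q \<noteq> 0" using q_ge_2 by simp
  have "real q ^ (2 * (N - (m + 1) div 2)) = real q ^ (2 * N) / real q ^ (2 * ((m + 1) div 2))"
    using assms q0 by (subst power_diff[symmetric]) (auto simp: diff_mult_distrib2)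
  moreover have "real q ^ (2 * N - m - 1) = real q ^ (2 * N) / real q ^ (m + 1)" if "m > 0"
    using assms q0 that by (subst power_diff[symmetric]) auto
  ultimately show ?thesis
    using q0 by (auto simp: norm_count_def norm_dens_def field_simps)
qed

text \<open>The counts, weighted by powers of -q or - q^2 and divided by a power of q independent of
  j. Both dimensions lead to the same expression, with E equal to the square of q for binary forms
  and to its cube for linear forms on isotropic vectors.\<close>

definition gen :: "real \<Rightarrow> nat \<Rightarrow> nat \<Rightarrow> real" where
  "gen E e j = (- real q) ^ j * (E * norm_dens e j - real q ^ 2 * norm_dens e (Suc j)) + (if j = 0 then 1 else 0)"

lemma count2_gen:
  assumes "j < N" shows "(- real q) ^ j * real_of_int (count2 e N j) = real q ^ (2 * (N - 1)) * gen (real q ^ 2) e j"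
proof -
  have "2 * N = 2 * (N - 1) + 2" using assms by simp
  then have "real q ^ (2 * N) = real q ^ (2 * (N - 1)) * real q ^ 2" by (metis power_add)
  then show ?thesis
    using assms norm_count_dens[of j N e] norm_count_dens[of "Suc j" N e]
    by (auto simp: count2_def gen_def algebra_simps)
qed

lemma count3_gen:
  assumes "j < N" shows "(- (real q ^ 2)) ^ j * real_of_int (count3 e N j) = real q ^ (3 * (N - 1)) * gen (real q ^ 3) e j"
proof -
  have q0: "real q \<noteq> 0" using q_ge_2 by simp
  have 1: "real q ^ (N - i) = real q ^ N / real q ^ i" if "i \<le> N" for i
    using that q0 by (simp add: power_diff)
  have "2 * N + N = 3 * (N - 1) + 3" using assms by simp
  then have 2: "real q ^ (2 * N) * real q ^ N = real q ^ (3 * (N - 1)) * real q ^ 3" by (metis power_add)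
  have 3: "real q ^ i * real (norm_count e N i * q ^ (N - i)) = real q ^ (3 * (N - 1)) * real q ^ 3 * norm_dens e i" if "i \<le> N" for i
    unfolding of_nat_mult norm_count_dens[OF that] of_nat_power 1[OF that] 2[symmetric] using q0 by simp
  have "(- (real q ^ 2)) ^ j = (- real q) ^ j * real q ^ j"
    by (simp add: power2_eq_square power_mult_distrib[symmetric])
  then have "(- (real q ^ 2)) ^ j * real_of_int (count3 e N j) = (- real q) ^ j * (real q ^ j * real (norm_count e N j * q ^ (N - j)) -
      real q ^ Suc j * real (norm_count e N (Suc j) * q ^ (N - Suc j)) / real q) + (if j = 0 then real q ^ (3 * (N - 1)) else 0)"
    using q0 by (simp add: count3_def algebra_simps)
  also have "\<dots> = real q ^ (3 * (N - 1)) * gen (real q ^ 3) e j"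
    using assms q0 by (subst (1 2) 3) (auto simp: gen_def algebra_simps power2_eq_square power3_eq_cube)
  finally show ?thesis .
qed

text \<open>The generating functions \<open>Z\<close> of the counts satisfy \<open>(1 + X) Z = (1 - X / q) F\<close> with a palindromic
  polynomial \<open>F\<close>.\<close>

lemma gen_palin:
  "gen E e 0 = palin E e 0"
  "gen E e (Suc j) + gen E e j = palin E e (Suc j) - palin E e j / real q"
proof -
  have q0: "real q \<noteq> 0" using q_ge_2 by simp
  define u where "u = 1 / real q"
  have qu: "real q * u = 1" "u * real q = 1" using q0 by (simp_all add: u_def)
  \<comment> \<open>With these signs consecutive densities nearly cancel:
    \<open>w j + w (Suc j)\<close> is constant for j below e, takes one exceptional value at e and
    is 0 beyond.\<close>
  define w where "w j = (- real q) ^ j * norm_dens e j" for j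
  have w: "w j = (if j \<le> e then if even j then 1 else - u else if odd e then 0 else if even j then 1 + u else - 1 - u)" for j
  proof (cases "even j")
    case True
    then obtain i where "j = 2 * i" by (elim evenE)
    then show ?thesis
      using q0 by (auto simp: w_def u_def norm_dens_def field_simps)
  next
    case False
    then obtain i where "j = 2 * i + 1" by (elim oddE)
    then show ?thesis
      using q0 by (auto simp: w_def u_def norm_dens_def field_simps)
  qed
  have S: "w j + w (Suc j) = (if j < e then 1 - u else if j = e then - u else 0)" for j unfolding w by auto
  have g: "gen E e j = E * w j + real q * w (Suc j) + (if j = 0 then 1 else 0)" for j
    by (simp add: gen_def w_def algebra_simps power2_eq_square)
  have "w 0 = 1" by (simp add: w)
  then have "w (Suc 0) = (if e = 0 then - u - 1 else - u)" using S[of 0] by (auto split: if_splits)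
  then show "gen E e 0 = palin E e 0"
    using \<open>w 0 = 1\<close> by (auto simp: g palin_def algebra_simps qu)
  have "gen E e (Suc j) + gen E e j = E * (w j + w (Suc j)) + real q * (w (Suc j) + w (Suc (Suc j))) + (if j = 0 then 1 else 0)"
    by (simp add: g algebra_simps)
  also have "\<dots> = palin E e (Suc j) - palin E e j * u"
  proof -
    consider "Suc j < e" | "Suc j = e" | "j = e" | "j > e"
      by linarith
    then show ?thesis
      unfolding S palin_def by cases (auto simp: algebra_simps qu)
  qed
  finally show "gen E e (Suc j) + gen E e j = palin E e (Suc j) - palin E e j / real q" by (simp add: u_def)
qed

end

subsection \<open>Minors and the maximal compact subgroup\<close>

definition block_of :: "nat \<Rightarrow> nat \<Rightarrow> nat \<Rightarrow> nat \<Rightarrow> 'b mat \<Rightarrow> 'b mat" where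
  "block_of r0 c0 r c A = mat r c (\<lambda>(a, b). A $$ (r0 + a, c0 + b))"

lemma block_of_carrier [simp]: "block_of r0 c0 r c A \<in> carrier_mat r c"
  and dim_block_of [simp]: "dim_row (block_of r0 c0 r c A) = r" "dim_col (block_of r0 c0 r c A) = c"
  and block_of_index [simp]: "a < r \<Longrightarrow> b < c \<Longrightarrow> block_of r0 c0 r c A $$ (a, b) = A $$ (r0 + a, c0 + b)"
  by (auto simp: block_of_def)

lemma lower_right_minor_block:
  "y \<in> carrier_mat N N \<Longrightarrow> lower_right_minor i y = det (block_of (N - i) (N - i) i i y)"
  by (auto simp: lower_right_minor_def block_of_def)

text \<open>The chosen rows of h vanish on the first \<open>N - k\<close> columns, so only the last
  k rows of M contribute.\<close>

lemma block_of_mult: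
  fixes h M :: "'b::semiring_0 mat"
  assumes h: "h \<in> carrier_mat N N" and M: "M \<in> carrier_mat N N'" and i: "i \<le> N" and k: "k \<le> N"
    and c: "c0 + c \<le> N'"
    and supp: "\<And>a b. a < i \<Longrightarrow> b < N - k \<Longrightarrow> h $$ (N - i + a, b) = 0"
  shows "block_of (N - i) c0 i c (h * M) = block_of (N - i) (N - k) i k h * block_of (N - k) c0 k c M"
proof (rule eq_matI)
  fix a b assume "a < dim_row (block_of (N - i) (N - k) i k h * block_of (N - k) c0 k c M)"
    "b < dim_col (block_of (N - i) (N - k) i k h * block_of (N - k) c0 k c M)"
  then have ab: "a < i" "b < c" by auto
  let ?f = "\<lambda>l. h $$ (N - i + a, l) * M $$ (l, c0 + b)"
  have "block_of (N - i) c0 i c (h * M) $$ (a, b) = (\<Sum>l\<in>{0..<N}. ?f l)"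
    using ab h M i c by (auto simp: scalar_prod_def intro!: sum.cong)
  also have "\<dots> = (\<Sum>l\<in>{N - k..<N}. ?f l)"
    using supp[OF ab(1)] by (intro sum.mono_neutral_right) auto
  also have "\<dots> = (\<Sum>l\<in>{0..<k}. ?f (N - k + l))"
    using k sum.shift_bounds_nat_ivl[of ?f 0 "N - k" k] by (simp add: add.commute)
  also have "\<dots> = (block_of (N - i) (N - k) i k h * block_of (N - k) c0 k c M) $$ (a, b)"
    using ab by (auto simp: scalar_prod_def intro!: sum.cong)
  finally show "block_of (N - i) c0 i c (h * M) $$ (a, b) =
      (block_of (N - i) (N - k) i k h * block_of (N - k) c0 k c M) $$ (a, b)" .
qed auto

lemma ctrans_carrier: "A \<in> carrier_mat r c \<Longrightarrow> ctrans s A \<in> carrier_mat c r"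
  by (auto simp: ctrans_def)

lemma dim_ctrans [simp]: "dim_row (ctrans s A) = dim_col A" "dim_col (ctrans s A) = dim_row A"
  by (auto simp: ctrans_def)

lemma ctrans_index [simp]: "a < dim_col A \<Longrightarrow> b < dim_row A \<Longrightarrow> ctrans s A $$ (a, b) = s (A $$ (b, a))"
  by (auto simp: ctrans_def)

lemma jmat_carrier: "jmat n \<in> carrier_mat (2 * n + 1) (2 * n + 1)" by (simp add: jmat_def)

lemma jmat_mult_index:
  fixes M :: "'b::field mat"
  assumes "M \<in> carrier_mat (2 * n + 1) c" "a < 2 * n + 1" "b < c"
  shows "(jmat n * M) $$ (a, b) = M $$ (2 * n - a, b)"
proof -
  have "(jmat n * M) $$ (a, b) = (\<Sum>l\<in>{0..<2 * n + 1}. (if a + l = 2 * n then 1 else 0) * M $$ (l, b))"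
    using assms by (auto simp: scalar_prod_def jmat_def intro!: sum.cong)
  also have "\<dots> = (\<Sum>l\<in>{0..<2 * n + 1}. if l = 2 * n - a then M $$ (l, b) else 0)"
    using assms(2) by (intro sum.cong) auto
  finally show ?thesis
    using assms(2) by (simp add: sum.delta')
qed

lemma jmat_jmat: "jmat n * jmat n = (1\<^sub>m (2 * n + 1) :: 'b::field mat)"
proof (rule eq_matI)
  fix a b assume ab: "a < dim_row (1\<^sub>m (2 * n + 1) :: 'b mat)" "b < dim_col (1\<^sub>m (2 * n + 1) :: 'b mat)"
  then have "(jmat n * jmat n :: 'b mat) $$ (a, b) = jmat n $$ (2 * n - a, b)"
    by (intro jmat_mult_index[OF jmat_carrier]) auto
  then show "(jmat n * jmat n :: 'b mat) $$ (a, b) = 1\<^sub>m (2 * n + 1) $$ (a, b)"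
    using ab by (auto simp: jmat_def)
qed (auto simp: jmat_def)

lemma dim_jmat [simp]: "dim_row (jmat n) = 2 * n + 1" "dim_col (jmat n) = 2 * n + 1" by (auto simp: jmat_def)

context unramified_quadratic_extension begin

lemma star_comm_ring_hom: "comm_ring_hom star" by unfold_locales (auto simp: star_add star_mult)

lemma ctrans_mult:
  "A \<in> carrier_mat r m \<Longrightarrow> B \<in> carrier_mat m c \<Longrightarrow> ctrans star (A * B) = ctrans star B * ctrans star A"
  by (rule eq_matI) (auto simp: scalar_prod_def star_sum star_mult mult.commute intro!: sum.cong)

lemma ctrans_ctrans [simp]: "ctrans star (ctrans star A) = A" by (rule eq_matI) auto

lemma ctrans_one [simp]: "ctrans star (1\<^sub>m m) = 1\<^sub>m m" by (rule eq_matI) auto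

lemma ctrans_jmat [simp]: "ctrans star (jmat n) = jmat n" by (rule eq_matI) (auto simp: jmat_def add.commute)

lemma det_ctrans: "A \<in> carrier_mat m m \<Longrightarrow> det (ctrans star A) = star (det A)"
  using comm_ring_hom.hom_det[OF star_comm_ring_hom, of "transpose_mat A"] det_transpose[of A m]
  by (simp add: ctrans_def)

lemma block_of_ctrans:
  "A \<in> carrier_mat M N \<Longrightarrow> r0 + r \<le> N \<Longrightarrow> c0 + c \<le> M \<Longrightarrow>
    block_of r0 c0 r c (ctrans star A) = ctrans star (block_of c0 r0 c r A)"
  by (rule eq_matI) auto

lemma block_of_congruence:
  fixes m :: nat
  assumes h: "h \<in> carrier_mat N N" and y: "y \<in> carrier_mat N N" and i: "i \<le> N" and m: "m \<le> N"
    and supp: "\<And>a b. a < i \<Longrightarrow> b < N - m \<Longrightarrow> h $$ (N - i + a, b) = 0"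
  shows "block_of (N - i) (N - i) i i (h * y * ctrans star h) =
    block_of (N - i) (N - m) i m h * block_of (N - m) (N - m) m m y * ctrans star (block_of (N - i) (N - m) i m h)"
proof -
  let ?H = "block_of (N - i) (N - m) i m h"
  have hc: "ctrans star h \<in> carrier_mat N N" by (rule ctrans_carrier[OF h])
  have yh: "ctrans star y * ctrans star h \<in> carrier_mat N N" "y * ctrans star h \<in> carrier_mat N N"
    using mult_carrier_mat[OF ctrans_carrier[OF y] hc] mult_carrier_mat[OF y hc] by auto
  have "block_of (N - m) (N - i) m i (y * ctrans star h) = ctrans star (block_of (N - i) (N - m) i m (h * ctrans star y))"
    using block_of_ctrans[of "h * ctrans star y" N N "N - m" m "N - i" i] h y i m
      ctrans_mult[OF h ctrans_carrier[OF y]] ctrans_carrier[OF y] by simp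
  also have "block_of (N - i) (N - m) i m (h * ctrans star y) = ?H * block_of (N - m) (N - m) m m (ctrans star y)"
    using m by (intro block_of_mult[OF h ctrans_carrier[OF y] i m] supp) auto
  also have "ctrans star \<dots> = ctrans star (block_of (N - m) (N - m) m m (ctrans star y)) * ctrans star ?H"
    by (rule ctrans_mult[of _ i m _ m]) auto
  also have "ctrans star (block_of (N - m) (N - m) m m (ctrans star y)) = block_of (N - m) (N - m) m m y"
    using block_of_ctrans[OF y, of "N - m" m "N - m" m] m by simp
  finally have 1: "block_of (N - m) (N - i) m i (y * ctrans star h) = block_of (N - m) (N - m) m m y * ctrans star ?H" .
  have "h * y * ctrans star h = h * (y * ctrans star h)" using h y hc by (simp add: assoc_mult_mat)
  then have "block_of (N - i) (N - i) i i (h * y * ctrans star h) = ?H * block_of (N - m) (N - i) m i (y * ctrans star h)"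
    using block_of_mult[OF h yh(2) i m, of "N - i" i] i supp by simp
  then show ?thesis
    unfolding 1 by (simp add: assoc_mult_mat[of _ i m _ m _ i] ctrans_carrier[OF block_of_carrier])
qed

text \<open>Since \<open>jmat n\<close> squares to the identity, the defining equation says that
  \<open>jmat n * ctrans star g * jmat n\<close> is a left inverse of g. It is then a two-sided
  inverse, which yields the dual equation and the unitarity of the inverse.\<close>

lemma unitaryI:
  assumes g: "g \<in> carrier_mat (2 * n + 1) (2 * n + 1)" and eq: "ctrans star g * jmat n * g = jmat n"
  shows "g \<in> unitary_group star n" "g * jmat n * ctrans star g = jmat n"
    "jmat n * ctrans star g * jmat n \<in> unitary_group star n"
    "(jmat n * ctrans star g * jmat n) * g = 1\<^sub>m (2 * n + 1)" "g * (jmat n * ctrans star g * jmat n) = 1\<^sub>m (2 * n + 1)"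
proof -
  define N where "N = 2 * n + 1"
  define J where "J = (jmat n :: 'a mat)"
  define h where "h = ctrans star g"
  define L where "L = J * h * J"
  have c: "g \<in> carrier_mat N N" "J \<in> carrier_mat N N" "h \<in> carrier_mat N N"
    using g jmat_carrier[of n] ctrans_carrier[OF g, of star] by (simp_all add: N_def J_def h_def)
  have JJ: "J * J = 1\<^sub>m N" using jmat_jmat[of n] by (simp add: J_def N_def)
  have eq': "h * J * g = J" using eq by (simp add: J_def h_def)
  note assoc = assoc_mult_mat[of _ N N _ N _ N]
  have L: "L \<in> carrier_mat N N" using c by (simp add: L_def)
  have "L * g = J * (h * J * g)" unfolding L_def using c by (simp add: assoc)
  then have Lg: "L * g = 1\<^sub>m N" by (simp add: eq' JJ)
  then have gL: "g * L = 1\<^sub>m N" using mat_mult_left_right_inverse[OF L c(1)] by blast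
  have "g * J * h = g * J * h * (J * J)" unfolding JJ using c by simp
  also have "\<dots> = (g * L) * J" unfolding L_def using c by (simp add: assoc)
  finally have gg: "g * J * h = J" unfolding gL using c by simp
  have "ctrans star (J * h * J) = J * (g * J)"
    using c ctrans_mult[of "J * h" N N J N] ctrans_mult[of J N N h N] by (simp add: J_def h_def)
  then have "ctrans star L * J * L = J * (g * J) * J * (J * h * J)" unfolding L_def by simp
  also have "\<dots> = J * (g * (J * J) * J * h) * J" using c by (simp add: assoc)
  also have "\<dots> = J * (g * J * h) * J" unfolding JJ using c by simp
  also have "\<dots> = J" unfolding gg JJ using c by simp
  finally have eqL: "ctrans star L * J * L = J" .
  show "g \<in> unitary_group star n"
    unfolding unitary_group_def invertible_mat_def inverts_mat_def
    using g eq Lg gL L c by (auto simp: N_def intro!: exI[of _ L])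
  show "jmat n * ctrans star g * jmat n \<in> unitary_group star n"
    unfolding unitary_group_def invertible_mat_def inverts_mat_def
    unfolding J_def[symmetric] h_def[symmetric] L_def[symmetric]
    using eqL Lg gL L c by (auto simp: N_def intro!: exI[of _ g])
  show "g * jmat n * ctrans star g = jmat n" using gg by (simp only: J_def h_def)
  show "(jmat n * ctrans star g * jmat n) * g = 1\<^sub>m (2 * n + 1)" "g * (jmat n * ctrans star g * jmat n) = 1\<^sub>m (2 * n + 1)"
    using Lg gL by (simp_all only: J_def h_def L_def N_def)
qed

lemma unitaryD:
  assumes "g \<in> unitary_group star n"
  shows "g \<in> carrier_mat (2 * n + 1) (2 * n + 1)" "ctrans star g * jmat n * g = jmat n"
  using assms by (auto simp: unitary_group_def)

lemma mem_maxcompact_iff: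
  "g \<in> maxcompact nrm star n \<longleftrightarrow> g \<in> unitary_group star n \<and> (\<forall>i<2 * n + 1. \<forall>l<2 * n + 1. nrm (g $$ (i, l)) \<le> 1)"
  by (simp add: maxcompact_def integers_of_def)

lemma maxcompactI:
  assumes "g \<in> carrier_mat (2 * n + 1) (2 * n + 1)" "ctrans star g * jmat n * g = jmat n"
    "\<And>i l. i < 2 * n + 1 \<Longrightarrow> l < 2 * n + 1 \<Longrightarrow> nrm (g $$ (i, l)) \<le> 1"
  shows "g \<in> maxcompact nrm star n"
  using unitaryI(1)[OF assms(1,2)] assms(3) by (simp add: mem_maxcompact_iff)

lemma maxcompactD:
  assumes "g \<in> maxcompact nrm star n"
  shows "g \<in> carrier_mat (2 * n + 1) (2 * n + 1)" "ctrans star g * jmat n * g = jmat n"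
    "\<And>i l. i < 2 * n + 1 \<Longrightarrow> l < 2 * n + 1 \<Longrightarrow> nrm (g $$ (i, l)) \<le> 1"
  using assms unitaryD[of g n] by (auto simp: mem_maxcompact_iff)

lemma nrm_mult_mat_le:
  assumes A: "A \<in> carrier_mat r m" and B: "B \<in> carrier_mat m c" and C: "0 \<le> C" "0 \<le> D"
    and a: "\<And>i l. i < r \<Longrightarrow> l < m \<Longrightarrow> nrm (A $$ (i, l)) \<le> C"
    and b: "\<And>i l. i < m \<Longrightarrow> l < c \<Longrightarrow> nrm (B $$ (i, l)) \<le> D"
    and i: "i < r" "l < c"
  shows "nrm ((A * B) $$ (i, l)) \<le> C * D"
proof -
  have "(A * B) $$ (i, l) = (\<Sum>x\<in>{0..<m}. A $$ (i, x) * B $$ (x, l))"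
    using A B i by (auto simp: scalar_prod_def intro!: sum.cong)
  also have "nrm \<dots> \<le> C * D" using C i by (intro nrm_sum_le nrm_mult_le a b) auto
  finally show ?thesis .
qed

lemma maxcompact_mult:
  assumes g: "g \<in> maxcompact nrm star n" and h: "h \<in> maxcompact nrm star n"
  shows "g * h \<in> maxcompact nrm star n"
proof (rule maxcompactI)
  let ?N = "2 * n + 1"
  note gD = maxcompactD[OF g] and hD = maxcompactD[OF h]
  note c = gD(1) hD(1) jmat_carrier[of n] ctrans_carrier[OF gD(1), of star] ctrans_carrier[OF hD(1), of star]
  show "g * h \<in> carrier_mat ?N ?N" using c by simp
  define N where "N = 2 * n + 1"
  have "ctrans star (g * h) * jmat n * (g * h) = ctrans star h * (ctrans star g * jmat n * g) * h"
  proof -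
    have "(jmat n :: 'a mat) \<in> carrier_mat N N" unfolding N_def by (rule jmat_carrier)
    then show ?thesis
      unfolding ctrans_mult[OF gD(1) hD(1)] using c(1,2,4,5)[folded N_def]
      by (simp add: assoc_mult_mat[of _ N N _ N _ N])
  qed
  then show "ctrans star (g * h) * jmat n * (g * h) = jmat n" by (simp only: gD(2) hD(2))
  show "nrm ((g * h) $$ (i, l)) \<le> 1" if "i < ?N" "l < ?N" for i l
    using nrm_mult_mat_le[OF gD(1) hD(1), of 1 1 i l] gD(3) hD(3) that by simp
qed

lemma maxcompact_inverse:
  assumes g: "g \<in> maxcompact nrm star n"
  shows "\<exists>g'\<in>maxcompact nrm star n. g' * g = 1\<^sub>m (2 * n + 1) \<and> g * g' = 1\<^sub>m (2 * n + 1)"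
proof (intro bexI conjI)
  let ?N = "2 * n + 1"
  note gD = maxcompactD[OF g]
  note U = unitaryI[OF gD(1,2)]
  note c = jmat_carrier[of n] ctrans_carrier[OF gD(1), of star]
  show "jmat n * ctrans star g * jmat n * g = 1\<^sub>m ?N" "g * (jmat n * ctrans star g * jmat n) = 1\<^sub>m ?N"
    by (fact U)+
  have j: "nrm ((jmat n :: 'a mat) $$ (i, l)) \<le> 1" if "i < ?N" "l < ?N" for i l
    using that by (simp add: jmat_def)
  have "nrm ((jmat n * ctrans star g) $$ (i, l)) \<le> 1 * 1" if "i < ?N" "l < ?N" for i l
    using that c gD(1,3) j by (intro nrm_mult_mat_le[of "jmat n" ?N ?N _ ?N]) auto
  then have "nrm ((jmat n * ctrans star g * jmat n) $$ (i, l)) \<le> 1 * 1" if "i < ?N" "l < ?N" for i l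
    using that c j by (intro nrm_mult_mat_le[of _ ?N ?N "jmat n" ?N]) auto
  then show "jmat n * ctrans star g * jmat n \<in> maxcompact nrm star n"
    using U(3) by (simp add: mem_maxcompact_iff)
qed

lemma act_carrier:
  "g \<in> carrier_mat N N \<Longrightarrow> x \<in> carrier_mat N N \<Longrightarrow> act star g x \<in> carrier_mat N N"
  using ctrans_carrier[of g N N star] by (simp add: act_def)

lemma act_mult:
  assumes "h \<in> carrier_mat N N" "g \<in> carrier_mat N N" "x \<in> carrier_mat N N"
  shows "act star (h * g) x = act star h (act star g x)"
  unfolding act_def ctrans_mult[OF assms(1,2)]
  using assms ctrans_carrier[OF assms(1), of star] ctrans_carrier[OF assms(2), of star]
  by (simp add: assoc_mult_mat[of _ N N _ N _ N])

lemma ctrans_act: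
  assumes "g \<in> carrier_mat N N" "x \<in> carrier_mat N N" "ctrans star x = x"
  shows "ctrans star (act star g x) = act star g x"
  unfolding act_def
  using assms ctrans_carrier[OF assms(1), of star] ctrans_mult[of "g * x" N N "ctrans star g" N] ctrans_mult[of g N N x N]
  by (simp add: assoc_mult_mat[of _ N N _ N _ N])

lemma nrm_signof [simp]: "nrm (of_int (sign f)) = 1" for f :: "nat \<Rightarrow> nat" by (simp add: sign_def)

lemma nrm_det_le:
  assumes A: "A \<in> carrier_mat m m" and C: "0 \<le> C" and a: "\<And>i l. i < m \<Longrightarrow> l < m \<Longrightarrow> nrm (A $$ (i, l)) \<le> C"
  shows "nrm (det A) \<le> C ^ m"
  unfolding det_def'[OF A]
proof (intro nrm_sum_le)
  fix p :: "nat \<Rightarrow> nat" assume "p \<in> {p. p permutes {0..<m}}"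
  then have p: "p i < m" if "i < m" for i using permutes_in_image[of p "{0..<m}" i] that by auto
  have "(\<Prod>i = 0..<m. nrm (A $$ (i, p i))) \<le> (\<Prod>i = 0..<m. C)"
    using p a by (intro prod_mono) (auto simp: nrm_nonneg)
  then show "nrm (signof p * (\<Prod>i = 0..<m. A $$ (i, p i))) \<le> C ^ m" by (simp add: nrm_mult nrm_prod)
qed (use C in simp)

lemma nrm_prod_diff_le:
  assumes "finite S" "1 \<le> C" "\<And>i. i \<in> S \<Longrightarrow> nrm (f i) \<le> C" "\<And>i. i \<in> S \<Longrightarrow> nrm (g i) \<le> C"
    "\<And>i. i \<in> S \<Longrightarrow> nrm (f i - g i) \<le> d" "0 \<le> d"
  shows "nrm ((\<Prod>i\<in>S. f i) - (\<Prod>i\<in>S. g i)) \<le> d * C ^ card S"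
  using assms(1,3,4,5)
proof (induction S rule: finite_induct)
  case empty
  then show ?case
    using assms by simp
next
  case (insert x S)
  have C0: "0 \<le> C" and C1: "1 \<le> C ^ card S" using assms(2) by (auto simp: one_le_power)
  have "(\<Prod>i\<in>insert x S. f i) - (\<Prod>i\<in>insert x S. g i) =
      f x * ((\<Prod>i\<in>S. f i) - (\<Prod>i\<in>S. g i)) + (f x - g x) * (\<Prod>i\<in>S. g i)"
    using insert(1,2) by (simp add: algebra_simps)
  moreover have "nrm (f x * ((\<Prod>i\<in>S. f i) - (\<Prod>i\<in>S. g i))) \<le> C * (d * C ^ card S)"
    using insert by (intro nrm_mult_le) auto
  moreover have "nrm ((f x - g x) * (\<Prod>i\<in>S. g i)) \<le> d * C ^ card S"
  proof (intro nrm_mult_le)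
    have "(\<Prod>i\<in>S. nrm (g i)) \<le> (\<Prod>i\<in>S. C)"
      using insert by (intro prod_mono) (auto simp: nrm_nonneg)
    then show "nrm (\<Prod>i\<in>S. g i) \<le> C ^ card S" by (simp add: nrm_prod)
  qed (use insert in auto)
  moreover have "d * C ^ card S \<le> C * (d * C ^ card S)"
    using assms(2,6) C1 mult_right_mono[of 1 C "d * C ^ card S"] by simp
  ultimately show ?case
    using insert(1,2) by (simp add: mult_ac nrm_add_le)
qed

lemma nrm_det_diff_le:
  assumes A: "A \<in> carrier_mat m m" and B: "B \<in> carrier_mat m m" and C: "1 \<le> C" "0 \<le> d"
    and a: "\<And>i l. i < m \<Longrightarrow> l < m \<Longrightarrow> nrm (A $$ (i, l)) \<le> C" "\<And>i l. i < m \<Longrightarrow> l < m \<Longrightarrow> nrm (B $$ (i, l)) \<le> C"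
      "\<And>i l. i < m \<Longrightarrow> l < m \<Longrightarrow> nrm (A $$ (i, l) - B $$ (i, l)) \<le> d"
  shows "nrm (det A - det B) \<le> d * C ^ m"
  unfolding det_def'[OF A] det_def'[OF B] sum_subtractf[symmetric] right_diff_distrib[symmetric]
proof (intro nrm_sum_le)
  fix p :: "nat \<Rightarrow> nat" assume "p \<in> {p. p permutes {0..<m}}"
  then have p: "p i < m" if "i < m" for i using permutes_in_image[of p "{0..<m}" i] that by auto
  have "nrm ((\<Prod>i = 0..<m. A $$ (i, p i)) - (\<Prod>i = 0..<m. B $$ (i, p i))) \<le> d * C ^ card {0..<m}"
    using p a C by (intro nrm_prod_diff_le) auto
  then show "nrm (signof p * ((\<Prod>i = 0..<m. A $$ (i, p i)) - (\<Prod>i = 0..<m. B $$ (i, p i)))) \<le> d * C ^ m"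
    by (simp add: nrm_mult)
qed (use C in simp)

text \<open>The lower right block of h is invertible over the integers, its inverse being the
  corresponding block of the inverse of h. Its determinant is thus a unit, and the minor is
  multiplied by the norm of this unit.\<close>

lemma minor_scale:
  assumes h: "h \<in> maxcompact nrm star n" and y: "y \<in> carrier_mat (2 * n + 1) (2 * n + 1)" and j: "j \<le> 2 * n + 1"
    and supp: "\<And>a b. a < j \<Longrightarrow> b < 2 * n + 1 - j \<Longrightarrow> h $$ (2 * n + 1 - j + a, b) = 0"
  shows "nrm (lower_right_minor j (act star h y)) = nrm (lower_right_minor j y)"
proof -
  let ?N = "2 * n + 1"
  note hD = maxcompactD[OF h]
  obtain h' where h': "h' \<in> maxcompact nrm star n" "h * h' = 1\<^sub>m ?N"
    using maxcompact_inverse[OF h] by blast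
  note h'D = maxcompactD[OF h'(1)]
  define H where "H = block_of (?N - j) (?N - j) j j h"
  define H' where "H' = block_of (?N - j) (?N - j) j j h'"
  have H: "H \<in> carrier_mat j j" "H' \<in> carrier_mat j j" by (simp_all add: H_def H'_def)
  have "H * H' = block_of (?N - j) (?N - j) j j (h * h')"
    unfolding H_def H'_def using j by (intro block_of_mult[OF hD(1) h'D(1) j j, symmetric] supp) auto
  also have "\<dots> = 1\<^sub>m j" unfolding h'(2) using j by (intro eq_matI) auto
  finally have "det H * det H' = 1" using det_mult[OF H] by (simp add: det_one)
  then have "nrm (det H) * nrm (det H') = 1" using nrm_mult[of "det H" "det H'"] by simp
  moreover have "nrm (det H) \<le> 1 ^ j" "nrm (det H') \<le> 1 ^ j"
    using hD(3) h'D(3) j by (auto simp: H_def H'_def intro!: nrm_det_le simp del: power_one)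
  ultimately have dH: "nrm (det H) = 1"
    using nrm_nonneg[of "det H"] mult_left_le[of "nrm (det H')" "nrm (det H)"] by simp
  have "lower_right_minor j (act star h y) = det (H * block_of (?N - j) (?N - j) j j y * ctrans star H)"
    using lower_right_minor_block[OF act_carrier[OF hD(1) y]] block_of_congruence[OF hD(1) y j j supp]
    by (simp add: act_def H_def)
  also have "\<dots> = det H * lower_right_minor j y * star (det H)"
    using H det_mult[of "H * block_of (?N - j) (?N - j) j j y" j "ctrans star H"] det_mult[OF H(1), of "block_of (?N - j) (?N - j) j j y"]
      ctrans_carrier[OF H(1), of star] det_ctrans[OF H(1)] lower_right_minor_block[OF y, of j] by simp
  finally show ?thesis
    using dH by (simp add: nrm_mult)
qed

end

section \<open>Block determinants and Schur complements\<close>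

lemma mult_index_sum:
  "A \<in> carrier_mat r m \<Longrightarrow> B \<in> carrier_mat m c \<Longrightarrow> a < r \<Longrightarrow> b < c \<Longrightarrow>
    (A * B) $$ (a, b) = (\<Sum>l\<in>{0..<m}. A $$ (a, l) * B $$ (l, b))"
  by (auto simp: scalar_prod_def intro!: sum.cong)

lemma four_block_of:
  assumes "Y \<in> carrier_mat (m + r) (m + r)"
  shows "Y = four_block_mat (block_of 0 0 m m Y) (block_of 0 m m r Y) (block_of m 0 r m Y) (block_of m m r r Y)"
  using assms by (intro eq_matI) auto

lemma mat_sub_add_cancel:
  fixes P :: "'b::ab_group_add mat"
  shows "P \<in> carrier_mat r c \<Longrightarrow> X \<in> carrier_mat r c \<Longrightarrow> P - X + X = P"
  by (intro eq_matI) auto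

lemma det_dim2:
  fixes A :: "'b::idom mat"
  assumes A: "A \<in> carrier_mat 2 2"
  shows "det A = A $$ (0, 0) * A $$ (1, 1) - A $$ (0, 1) * A $$ (1, 0)"
proof -
  define a b c d where "a = block_of 0 0 1 1 A" and "b = block_of 0 1 1 1 A" and "c = block_of 1 0 1 1 A" and "d = block_of 1 1 1 1 A"
  have cr: "a \<in> carrier_mat 1 1" "b \<in> carrier_mat 1 1" "c \<in> carrier_mat 1 1" "d \<in> carrier_mat 1 1"
    by (simp_all add: a_def b_def c_def d_def)
  have A4: "A = four_block_mat a b c d"
    unfolding a_def b_def c_def d_def using A by (intro four_block_of) (simp add: numeral_2_eq_2)
  have pr: "(x * y) $$ (0, 0) = x $$ (0, 0) * y $$ (0, 0)" if "x \<in> carrier_mat 1 1" "y \<in> carrier_mat 1 1" for x y :: "'b mat"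
    using mult_index_sum[OF that, of 0 0] by simp
  have "c * d = d * c" using cr pr by auto
  then have "det A = det (a * d - b * c)" unfolding A4 by (rule det_four_block_mat[OF cr])
  also have "\<dots> = (a * d - b * c) $$ (0, 0)" by (rule det_single) (use cr in auto)
  also have "\<dots> = (a * d) $$ (0, 0) - (b * c) $$ (0, 0)" using cr by (intro index_minus_mat(1)) auto
  also have "\<dots> = A $$ (0, 0) * A $$ (1, 1) - A $$ (0, 1) * A $$ (1, 0)"
    unfolding pr[OF cr(1,4)] pr[OF cr(2,3)] by (simp add: a_def b_def c_def d_def)
  finally show ?thesis .
qed

lemma det_schur:
  fixes P :: "'b::field mat"
  assumes P: "P \<in> carrier_mat m m" and Q: "Q \<in> carrier_mat m r" and R: "R \<in> carrier_mat r m"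
    and D: "D \<in> carrier_mat r r" and E: "E \<in> carrier_mat r r" and ED: "E * D = 1\<^sub>m r"
  shows "det (four_block_mat P Q R D) = det (P - Q * E * R) * det D"
proof -
  have QE: "Q * E \<in> carrier_mat m r" and S: "P - Q * E * R \<in> carrier_mat m m" using P Q R E by auto
  have "four_block_mat (1\<^sub>m m) (Q * E) (0\<^sub>m r m) (1\<^sub>m r) * four_block_mat (P - Q * E * R) (0\<^sub>m m r) R D =
      four_block_mat (1\<^sub>m m * (P - Q * E * R) + Q * E * R) (1\<^sub>m m * 0\<^sub>m m r + Q * E * D)
        (0\<^sub>m r m * (P - Q * E * R) + 1\<^sub>m r * R) (0\<^sub>m r m * 0\<^sub>m m r + 1\<^sub>m r * D)"
    by (rule mult_four_block_mat; (fact | rule one_carrier_mat zero_carrier_mat))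
  also have "1\<^sub>m m * (P - Q * E * R) + Q * E * R = P"
    unfolding left_mult_one_mat[OF S] by (rule mat_sub_add_cancel[OF P]) (use QE R in auto)
  also have "1\<^sub>m m * 0\<^sub>m m r + Q * E * D = Q" using Q E D ED assoc_mult_mat[OF Q E D] by simp
  also have "0\<^sub>m r m * (P - Q * E * R) + 1\<^sub>m r * R = R"
    using R by (simp add: left_mult_zero_mat[OF S])
  also have "0\<^sub>m r m * 0\<^sub>m m r + 1\<^sub>m r * D = D" using D by simp
  finally have eq: "four_block_mat P Q R D =
      four_block_mat (1\<^sub>m m) (Q * E) (0\<^sub>m r m) (1\<^sub>m r) * four_block_mat (P - Q * E * R) (0\<^sub>m m r) R D" ..
  have "det (four_block_mat P Q R D) =
      det (four_block_mat (1\<^sub>m m) (Q * E) (0\<^sub>m r m) (1\<^sub>m r)) *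
      det (four_block_mat (P - Q * E * R) (0\<^sub>m m r) R D)"
    unfolding eq by (rule det_mult[of _ "m + r"]) (use QE S R D in auto)
  also have "det (four_block_mat (1\<^sub>m m) (Q * E) (0\<^sub>m r m) (1\<^sub>m r)) = 1"
    using det_four_block_mat_lower_left_zero[of "1\<^sub>m m" m "Q * E" r "0\<^sub>m r m" "1\<^sub>m r"] QE by (simp add: det_one)
  also have "det (four_block_mat (P - Q * E * R) (0\<^sub>m m r) R D) = det (P - Q * E * R) * det D"
    using det_four_block_mat_upper_right_zero[OF S refl R D] .
  finally show ?thesis
    by simp
qed

lemma ex_inverse_mat:
  fixes D :: "'b::field mat"
  assumes D: "D \<in> carrier_mat r r" and d: "det D \<noteq> 0"
  obtains E where "E \<in> carrier_mat r r" "E * D = 1\<^sub>m r" "D * E = 1\<^sub>m r"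
proof
  let ?E = "inverse (det D) \<cdot>\<^sub>m adj_mat D"
  note a = adj_mat[OF D]
  show "?E \<in> carrier_mat r r" using a by simp
  have sm: "inverse d \<cdot>\<^sub>m (d \<cdot>\<^sub>m 1\<^sub>m r) = 1\<^sub>m r" if "d \<noteq> 0" for d :: 'b
    using that by (intro eq_matI) auto
  show "?E * D = 1\<^sub>m r"
    unfolding mult_smult_assoc_mat[OF a(1) D] a(3) using sm d .
  show "D * ?E = 1\<^sub>m r"
    unfolding mult_smult_distrib[OF D a(1)] a(2) using sm d .
qed

lemma lower_right_minor_0: "lower_right_minor 0 y = 1" by (simp add: lower_right_minor_def det_def)

context unramified_quadratic_extension begin

lemma unitary_index:
  assumes g: "g \<in> carrier_mat (2 * n + 1) (2 * n + 1)" and ab: "a < 2 * n + 1" "b < 2 * n + 1"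
  shows "(ctrans star g * jmat n * g) $$ (a, b) = (\<Sum>c\<in>{0..<2 * n + 1}. star (g $$ (c, a)) * g $$ (2 * n - c, b))"
proof -
  have j: "(jmat n :: 'a mat) \<in> carrier_mat (2 * n + 1) (2 * n + 1)" by (rule jmat_carrier)
  note c = ctrans_carrier[OF g, of star]
  have "ctrans star g * jmat n * g = ctrans star g * (jmat n * g)" by (rule assoc_mult_mat[OF c j g])
  then have "(ctrans star g * jmat n * g) $$ (a, b) = (\<Sum>l\<in>{0..<2 * n + 1}. ctrans star g $$ (a, l) * (jmat n * g) $$ (l, b))"
    using mult_index_sum[OF c mult_carrier_mat[OF j g] ab] by simp
  also have "\<dots> = (\<Sum>c\<in>{0..<2 * n + 1}. star (g $$ (c, a)) * g $$ (2 * n - c, b))"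
    using g ab jmat_mult_index[OF g] by (intro sum.cong) auto
  finally show ?thesis .
qed

section \<open>Elements of K for the short simple roots\<close>

definition perm_mat :: "nat \<Rightarrow> (nat \<Rightarrow> nat) \<Rightarrow> 'a mat" where
  "perm_mat n f = mat (2 * n + 1) (2 * n + 1) (\<lambda>(a, b). if b = f a then 1 else 0)"

text \<open>An involution of the indices that commutes with the reversal \<open>2 * n - a\<close>
  preserves the antidiagonal form.\<close>

lemma perm_mat_maxcompact:
  assumes f: "\<And>a. a \<le> 2 * n \<Longrightarrow> f a \<le> 2 * n" "\<And>a. a \<le> 2 * n \<Longrightarrow> f (f a) = a"
    "\<And>a. a \<le> 2 * n \<Longrightarrow> f (2 * n - a) = 2 * n - f a"
  shows "perm_mat n f \<in> maxcompact nrm star n"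
proof (rule maxcompactI)
  show c: "perm_mat n f \<in> carrier_mat (2 * n + 1) (2 * n + 1)" by (simp add: perm_mat_def)
  show "ctrans star (perm_mat n f) * jmat n * perm_mat n f = jmat n"
  proof (rule eq_matI)
    fix a b assume "a < dim_row (jmat n :: 'a mat)" "b < dim_col (jmat n :: 'a mat)"
    then have ab: "a < 2 * n + 1" "b < 2 * n + 1" "a \<le> 2 * n" by auto
    have "(ctrans star (perm_mat n f) * jmat n * perm_mat n f) $$ (a, b) =
        (\<Sum>c\<in>{0..<2 * n + 1}. star (perm_mat n f $$ (c, a)) * perm_mat n f $$ (2 * n - c, b))"
      by (rule unitary_index[OF c ab(1,2)])
    also have "\<dots> = (\<Sum>c\<in>{0..<2 * n + 1}. if c = f a then perm_mat n f $$ (2 * n - c, b) else 0)"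
    proof (intro sum.cong refl)
      fix c assume "c \<in> {0..<2 * n + 1}"
      then have "a = f c \<longleftrightarrow> c = f a" "c \<le> 2 * n" using f(2)[of c] f(2)[of a] ab by auto
      then show "star (perm_mat n f $$ (c, a)) * perm_mat n f $$ (2 * n - c, b) =
          (if c = f a then perm_mat n f $$ (2 * n - c, b) else 0)"
        using ab by (simp add: perm_mat_def)
    qed
    also have "\<dots> = perm_mat n f $$ (2 * n - f a, b)" using f(1)[OF ab(3)] by (simp add: sum.delta')
    also have "\<dots> = jmat n $$ (a, b)"
      using ab f(1)[of a] f(3)[of "f a"] f(2)[of a] by (auto simp: perm_mat_def jmat_def)
    finally show "(ctrans star (perm_mat n f) * jmat n * perm_mat n f) $$ (a, b) = jmat n $$ (a, b)" .
  qed (auto simp: perm_mat_def)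
qed (auto simp: perm_mat_def)

lemma mult_perm_mat_index:
  assumes A: "A \<in> carrier_mat (2 * n + 1) (2 * n + 1)" and ab: "a < 2 * n + 1" "b < 2 * n + 1"
    and f: "\<And>a. a \<le> 2 * n \<Longrightarrow> f a \<le> 2 * n" "\<And>a. a \<le> 2 * n \<Longrightarrow> f (f a) = a"
  shows "(A * perm_mat n f) $$ (a, b) = A $$ (a, f b)"
proof -
  have "(A * perm_mat n f) $$ (a, b) = (\<Sum>c\<in>{0..<2 * n + 1}. A $$ (a, c) * perm_mat n f $$ (c, b))"
    using A ab by (intro mult_index_sum) (auto simp: perm_mat_def)
  also have "\<dots> = (\<Sum>c\<in>{0..<2 * n + 1}. if c = f b then A $$ (a, c) else 0)"
  proof (intro sum.cong refl)
    fix c assume "c \<in> {0..<2 * n + 1}"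
    then have "b = f c \<longleftrightarrow> c = f b" "c \<le> 2 * n" using f(2)[of c] f(2)[of b] ab by auto
    then show "A $$ (a, c) * perm_mat n f $$ (c, b) = (if c = f b then A $$ (a, c) else 0)"
      using ab by (simp add: perm_mat_def)
  qed
  also have "\<dots> = A $$ (a, f b)" using f(1)[of b] ab by (simp add: sum.delta')
  finally show ?thesis .
qed

text \<open>The entries u and \<open>- star u\<close> are mirror images in the antidiagonal; the
  second one compensates the first in the unitarity equation.\<close>

definition shear2 :: "nat \<Rightarrow> nat \<Rightarrow> 'a \<Rightarrow> 'a mat" where
  "shear2 r s u = mat (r + s + 2) (r + s + 2) (\<lambda>(a, b). if a = b then 1
     else if a = Suc r \<and> b = r then u else if a = Suc s \<and> b = s then - star u else 0)"

lemma shear2_maxcompact: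
  assumes n: "2 * n = r + s + 1" and rs: "Suc s < r" and u: "nrm u \<le> 1"
  shows "shear2 r s u \<in> maxcompact nrm star n"
proof (rule maxcompactI)
  let ?g = "shear2 r s u"
  have N: "2 * n + 1 = r + s + 2" using n by simp
  show c: "?g \<in> carrier_mat (2 * n + 1) (2 * n + 1)" unfolding N by (simp add: shear2_def)
  show "ctrans star ?g * jmat n * ?g = jmat n"
  proof (rule eq_matI)
    fix a b assume "a < dim_row (jmat n :: 'a mat)" "b < dim_col (jmat n :: 'a mat)"
    then have ab: "a < 2 * n + 1" "b < 2 * n + 1" by auto
    then have ab': "a < r + s + 2" "b < r + s + 2" using N by auto
    define X where "X c = ?g $$ (2 * n - c, b)" for c
    have "(ctrans star ?g * jmat n * ?g) $$ (a, b) = (\<Sum>c\<in>{0..<2 * n + 1}. star (?g $$ (c, a)) * X c)"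
      unfolding X_def by (rule unitary_index[OF c ab])
    also have "\<dots> = (\<Sum>c\<in>{0..<r + s + 2}. (if c = a then X c else 0) +
        (if c = Suc r then (if a = r then star u * X c else 0) else 0) +
        (if c = Suc s then (if a = s then - u * X c else 0) else 0))"
      unfolding N
    proof (intro sum.cong refl)
      fix c assume "c \<in> {0..<r + s + 2}"
      then have "star (?g $$ (c, a)) = (if c = a then 1 else if c = Suc r \<and> a = r then star u else if c = Suc s \<and> a = s then - u else 0)"
        using ab' by (simp add: shear2_def)
      then show "star (?g $$ (c, a)) * X c = (if c = a then X c else 0) +
        (if c = Suc r then (if a = r then star u * X c else 0) else 0) +
        (if c = Suc s then (if a = s then - u * X c else 0) else 0)"
        using rs by (cases "c = a"; cases "a = r"; cases "a = s") auto
    qed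
    also have "\<dots> = X a + (if a = r then star u * X (Suc r) else 0) + (if a = s then - u * X (Suc s) else 0)"
      unfolding sum.distrib using ab' rs by (simp add: sum.delta')
    also have "\<dots> = (if a + b = r + s + 1 then 1 else 0)"
    proof -
      consider "a = r" | "a = s" | "a \<noteq> r" "a \<noteq> s"
        by blast
      then show ?thesis
      proof cases
        case 1
        have "2 * n - r = Suc s" "2 * n - Suc r = s" using n by auto
        then have "X a = (if Suc s = b then 1 else if b = s then - star u else 0)" "X (Suc r) = (if s = b then 1 else 0)"
          unfolding X_def 1 using ab' rs by (simp_all add: shear2_def)
        then show ?thesis
          using 1 rs by auto
      next
        case 2
        have "2 * n - s = Suc r" "2 * n - Suc s = r" using n by auto
        then have "X a = (if Suc r = b then 1 else if b = r then u else 0)" "X (Suc s) = (if r = b then 1 else 0)"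
          unfolding X_def 2 using ab' rs by (simp_all add: shear2_def)
        then show ?thesis
          using 2 rs by auto
      next
        case 3
        have "2 * n - a \<noteq> Suc r" "2 * n - a \<noteq> Suc s" "2 * n - a < r + s + 2"
          using 3 n ab by auto
        then have "X a = (if 2 * n - a = b then 1 else 0)" unfolding X_def using ab' by (simp add: shear2_def)
        moreover have "2 * n - a = b \<longleftrightarrow> a + b = r + s + 1" using n ab by auto
        ultimately show ?thesis
          using 3 by simp
      qed
    qed
    also have "\<dots> = jmat n $$ (a, b)" using ab n by (simp add: jmat_def)
    finally show "(ctrans star ?g * jmat n * ?g) $$ (a, b) = jmat n $$ (a, b)" .
  qed (use c in auto)
  show "nrm (?g $$ (a, b)) \<le> 1" if "a < 2 * n + 1" "b < 2 * n + 1" for a b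
    using that u unfolding N by (simp add: shear2_def)
qed

definition swap2 :: "nat \<Rightarrow> nat \<Rightarrow> nat \<Rightarrow> nat" where
  "swap2 r s a = (if a = r then Suc r else if a = Suc r then r else if a = s then Suc s else if a = Suc s then s else a)"

lemma swap2:
  assumes n: "2 * n = r + s + 1" and rs: "Suc s < r"
  shows "a \<le> 2 * n \<Longrightarrow> swap2 r s a \<le> 2 * n" "swap2 r s (swap2 r s a) = a"
    "a \<le> 2 * n \<Longrightarrow> swap2 r s (2 * n - a) = 2 * n - swap2 r s a"
proof -
  show "a \<le> 2 * n \<Longrightarrow> swap2 r s a \<le> 2 * n" "swap2 r s (swap2 r s a) = a"
    using rs unfolding n swap2_def by auto
  assume a: "a \<le> 2 * n"
  consider "a = r" | "a = Suc r" | "a = s" | "a = Suc s" | "a \<notin> {r, Suc r, s, Suc s}"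
    by blast
  then show "swap2 r s (2 * n - a) = 2 * n - swap2 r s a"
  proof cases
    case 5
    then have "2 * n - a \<notin> {r, Suc r, s, Suc s}" using n a by auto
    then show ?thesis
      using 5 by (simp add: swap2_def)
  qed (use n rs in \<open>auto simp: swap2_def\<close>)
qed

text \<open>The top one of the last i rows carries the vector x in two adjacent columns. For a line
  \<open>(1, uf * u)\<close> the shear has parameter \<open>uf * u\<close>, and a permutation in K
  exchanges the two columns afterwards.\<close>

definition elt2 :: "nat \<Rightarrow> nat \<Rightarrow> 'a \<times> 'a \<Rightarrow> 'a mat" where
  "elt2 n i x = (if snd x = 1 then shear2 (2 * n - i) (i - 1) (fst x)
     else shear2 (2 * n - i) (i - 1) (snd x) * perm_mat n (swap2 (2 * n - i) (i - 1)))"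

lemma elt2:
  assumes i: "1 \<le> i" "i < n" and x: "x \<in> lines2 N"
  shows "elt2 n i x \<in> maxcompact nrm star n"
    "\<And>j a b. 1 \<le> j \<Longrightarrow> j \<le> n \<Longrightarrow> j \<noteq> i \<Longrightarrow> a < j \<Longrightarrow> b < 2 * n + 1 - j \<Longrightarrow> elt2 n i x $$ (2 * n + 1 - j + a, b) = 0"
    "\<And>a b. a < i \<Longrightarrow> b < 2 * n + 1 \<Longrightarrow> elt2 n i x $$ (2 * n + 1 - i + a, b) =
       (if a = 0 then if b = 2 * n - i then fst x else if b = 2 * n - i + 1 then snd x else 0
        else if b = 2 * n + 1 - i + a then 1 else 0)"
proof -
  define r s where "r = 2 * n - i" and "s = i - 1"
  have rs: "2 * n = r + s + 1" "Suc s < r" "Suc s < n" "n < r" "i = Suc s" using i by (auto simp: r_def s_def)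
  have N2: "2 * n + 1 = r + s + 2" using rs by simp
  have el: "elt2 n i x = (if snd x = 1 then shear2 r s (fst x) else shear2 r s (snd x) * perm_mat n (swap2 r s))"
    by (simp add: elt2_def r_def s_def)
  have x1: "nrm (fst x) \<le> 1" "nrm (snd x) \<le> 1"
    using x lines2_primitive[of N] by (auto simp: primitive2_def)
  have x2: "fst x = 1" if "snd x \<noteq> 1" using x that by (auto simp: lines2_def)
  note sw = swap2[OF rs(1,2)]
  have perm: "perm_mat n (swap2 r s) \<in> maxcompact nrm star n" using sw by (intro perm_mat_maxcompact)
  note sh = shear2_maxcompact[OF rs(1,2)]
  show "elt2 n i x \<in> maxcompact nrm star n"
    unfolding el using sh[OF x1(1)] maxcompact_mult[OF sh[OF x1(2)] perm] by simp
  have idx: "(shear2 r s u * perm_mat n (swap2 r s)) $$ (a, b) = shear2 r s u $$ (a, swap2 r s b)"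
    if "a < r + s + 2" "b < r + s + 2" for u a b
    by (rule mult_perm_mat_index) (use that sw N2 in \<open>auto simp: shear2_def\<close>)
  \<comment> \<open>Minors of order at most n involve only rows of index above n. The mirrored entry
    of the shear and the mirrored transposition lie in rows of smaller index, so they do not
    show.\<close>
  have row: "elt2 n i x $$ (a, b) = (if a = Suc r then if b = r then fst x else if b = Suc r then snd x else 0
      else if a = r \<and> snd x \<noteq> 1 then if b = Suc r then 1 else 0 else if b = a then 1 else 0)"
    if ab: "n < a" "a < r + s + 2" "b < r + s + 2" for a b
  proof (cases "snd x = 1")
    case True
    then show ?thesis
      using ab rs(2,3) by (simp add: el shear2_def)
  next
    case False
    have "swap2 r s b < r + s + 2" using sw(1)[of b] ab N2 by simp
    moreover have "elt2 n i x $$ (a, b) = shear2 r s (snd x) $$ (a, swap2 r s b)"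
      using False idx[OF ab(2,3)] by (simp add: el)
    ultimately have "elt2 n i x $$ (a, b) = (if a = swap2 r s b then 1 else if a = Suc r \<and> swap2 r s b = r then snd x else 0)"
      using ab rs(3) by (simp add: shear2_def)
    also have "\<dots> = (if a = Suc r then if b = r then fst x else if b = Suc r then snd x else 0
      else if a = r \<and> snd x \<noteq> 1 then if b = Suc r then 1 else 0 else if b = a then 1 else 0)"
      using False x2 ab(1) rs(2,3,4) by (auto simp: swap2_def)
    finally show ?thesis .
  qed
  show "elt2 n i x $$ (2 * n + 1 - j + a, b) = 0"
    if j: "1 \<le> j" "j \<le> n" "j \<noteq> i" "a < j" "b < 2 * n + 1 - j" for j a b
  proof -
    define l where "l = 2 * n + 1 - j + a"
    have l: "n < l" "l < r + s + 2" "b < r + s + 2" "b < l" "\<not> (l = Suc r \<and> b = r)"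
      using j N2 rs by (auto simp: l_def)
    then show ?thesis
      unfolding l_def[symmetric] row[OF l(1-3)] by auto
  qed
  show "elt2 n i x $$ (2 * n + 1 - i + a, b) =
       (if a = 0 then if b = 2 * n - i then fst x else if b = 2 * n - i + 1 then snd x else 0
        else if b = 2 * n + 1 - i + a then 1 else 0)" if a: "a < i" "b < 2 * n + 1" for a b
  proof -
    have "2 * n + 1 - i + a = Suc r + a" "2 * n - i = r" using rs by (auto simp: r_def)
    then show ?thesis
      using row[of "Suc r + a" b] a rs N2 by auto
  qed
qed

text \<open>H keeps the block D and replaces the rows above it by the single combination E.
  Eliminating D leaves the Schur complement evaluated at E, times \<open>det D\<close>.\<close>

lemma det_row_congruence:
  assumes E: "E \<in> carrier_mat 1 m" and P: "P \<in> carrier_mat m m" and Q: "Q \<in> carrier_mat m r" and R: "R \<in> carrier_mat r m"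
    and D: "D \<in> carrier_mat r r" and F: "F \<in> carrier_mat r r" and FD: "F * D = 1\<^sub>m r"
    and H: "H = four_block_mat E (0\<^sub>m 1 r) (0\<^sub>m r m) (1\<^sub>m r)"
  shows "det (H * four_block_mat P Q R D * ctrans star H) =
    (E * (P - Q * F * R) * ctrans star E) $$ (0, 0) * det D"
proof -
  have Es: "ctrans star E \<in> carrier_mat m 1" by (rule ctrans_carrier[OF E])
  have cH: "ctrans star H = four_block_mat (ctrans star E) (0\<^sub>m m r) (0\<^sub>m r 1) (1\<^sub>m r)"
    unfolding H using E by (intro eq_matI) (auto split: if_splits)
  have "H * four_block_mat P Q R D = four_block_mat (E * P + 0\<^sub>m 1 r * R) (E * Q + 0\<^sub>m 1 r * D)
      (0\<^sub>m r m * P + 1\<^sub>m r * R) (0\<^sub>m r m * Q + 1\<^sub>m r * D)"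
    unfolding H by (rule mult_four_block_mat; (fact | rule one_carrier_mat zero_carrier_mat))
  also have "\<dots> = four_block_mat (E * P) (E * Q) R D" using E P Q R D by simp
  finally have 1: "H * four_block_mat P Q R D = four_block_mat (E * P) (E * Q) R D" .
  have EPc: "E * P \<in> carrier_mat 1 m" "E * Q \<in> carrier_mat 1 r" "E * P * ctrans star E \<in> carrier_mat 1 1" "R * ctrans star E \<in> carrier_mat r 1"
    using mult_carrier_mat[OF E P] mult_carrier_mat[OF E Q] mult_carrier_mat[OF R Es]
      mult_carrier_mat[OF mult_carrier_mat[OF E P] Es] by auto
  have "four_block_mat (E * P) (E * Q) R D * ctrans star H =
      four_block_mat (E * P * ctrans star E + E * Q * 0\<^sub>m r 1) (E * P * 0\<^sub>m m r + E * Q * 1\<^sub>m r)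
        (R * ctrans star E + D * 0\<^sub>m r 1) (R * 0\<^sub>m m r + D * 1\<^sub>m r)"
    unfolding cH by (rule mult_four_block_mat; (fact | rule one_carrier_mat zero_carrier_mat))
  also have "\<dots> = four_block_mat (E * P * ctrans star E) (E * Q) (R * ctrans star E) D"
  proof -
    have "E * Q * 0\<^sub>m r 1 = 0\<^sub>m 1 1" "E * P * 0\<^sub>m m r = 0\<^sub>m 1 r" "D * 0\<^sub>m r 1 = 0\<^sub>m r 1" "R * 0\<^sub>m m r = 0\<^sub>m r r"
      by (rule right_mult_zero_mat; fact)+
    then show ?thesis
      using EPc R D by (simp add: right_mult_one_mat[OF EPc(2)] right_mult_one_mat[OF D] del: One_nat_def)
  qed
  finally have 2: "H * four_block_mat P Q R D * ctrans star H =
      four_block_mat (E * P * ctrans star E) (E * Q) (R * ctrans star E) D"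
    unfolding 1 .
  have S: "Q * F * R \<in> carrier_mat m m" using Q F R by auto
  have "E * Q * F * (R * ctrans star E) = E * (Q * F * R) * ctrans star E"
    by (smt (verit) mult_carrier_mat Q F assoc_mult_mat E R Es)
  then have "E * P * ctrans star E - E * Q * F * (R * ctrans star E) = E * (P - Q * F * R) * ctrans star E"
    unfolding mult_minus_distrib_mat[OF E P S] minus_mult_distrib_mat[OF EPc(1) mult_carrier_mat[OF E S] Es] by simp
  then have "det (H * four_block_mat P Q R D * ctrans star H) =
      det (E * (P - Q * F * R) * ctrans star E) * det D"
    unfolding 2 using det_schur[OF EPc(3,2,4) D F FD] by simp
  also have "E * (P - Q * F * R) * ctrans star E \<in> carrier_mat 1 1"
    by (rule mult_carrier_mat[OF mult_carrier_mat[OF E minus_carrier_mat[OF S]] Es])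
  then have "det (E * (P - Q * F * R) * ctrans star E) = (E * (P - Q * F * R) * ctrans star E) $$ (0, 0)"
    by (rule det_single)
  finally show ?thesis .
qed

lemma herm2_le:
  assumes "nrm a \<le> C" "nrm b \<le> C" "nrm c \<le> C" "x \<in> primitive2"
  shows "nrm (herm2 a b c x) \<le> C"
proof -
  have x: "nrm (fst x) \<le> 1" "nrm (snd x) \<le> 1" using assms(4) by (auto simp: primitive2_def)
  have "nrm (a * nm (fst x)) \<le> C * 1" "nrm (c * nm (snd x)) \<le> C * 1"
    using x assms by (auto intro!: nrm_mult_le simp: nrm_nm power_le_one nrm_nonneg simp del: mult_1_right)
  moreover have "nrm (b * fst x * star (snd x)) \<le> C * 1 * 1" using x assms by (intro nrm_mult_le) auto
  then have "nrm (tr (b * fst x * star (snd x))) \<le> C" using nrm_tr[of "b * fst x * star (snd x)"] by simp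
  ultimately show ?thesis
    unfolding herm2_def by (intro nrm_add_le) auto
qed

text \<open>Among the last i rows of the element only the top one is nontrivial, and it meets two
  columns. The moving minor is therefore a binary hermitian form in x, namely \<open>det D\<close>
  times the Schur complement of the block D of order i - 1 in the block of order i + 1. The
  determinant formula for Schur complements shows that its discriminant is the product of the two
  neighbouring minors.\<close>

lemma rank_one_linear:
  fixes y :: "'a mat" and i n :: nat
  defines "\<Delta> \<equiv> \<lambda>x. lower_right_minor i (act star (elt2 n i x) y)"
  assumes i: "1 \<le> i" "i < n" and y: "y \<in> carrier_mat (2 * n + 1) (2 * n + 1)" and yh: "ctrans star y = y"
    and d: "lower_right_minor (i - 1) y \<noteq> 0" "lower_right_minor (i + 1) y \<noteq> 0"
  shows "\<exists>\<beta> e. 2 * \<beta> + int e = val (lower_right_minor (i - 1) y) + val (lower_right_minor (i + 1) y) \<and>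
    (\<forall>N\<ge>1. (\<forall>x\<in>lines2 N. nrm (\<Delta> x) \<le> real q powi (- \<beta>)) \<and>
      (\<forall>j<N. int (card {x \<in> lines2 N. nrm (\<Delta> x) = real q powi (- (\<beta> + int j))}) = count2 e N j))"
proof -
  define M where "M = 2 * n + 1"
  define r where "r = i - 1"
  have ir: "i = Suc r" "i + 1 = 2 + r" and rM: "2 + r \<le> M" "i \<le> M" using i by (auto simp: r_def M_def)
  have yc: "y \<in> carrier_mat M M" using y by (simp add: M_def)
  define Y where "Y = block_of (M - (2 + r)) (M - (2 + r)) (2 + r) (2 + r) y"
  define P where "P = block_of 0 0 2 2 Y"
  define Q where "Q = block_of 0 2 2 r Y"
  define R where "R = block_of 2 0 r 2 Y"
  define D where "D = block_of 2 2 r r Y"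
  have Yc: "Y \<in> carrier_mat (2 + r) (2 + r)" by (simp add: Y_def)
  have Yb: "Y = four_block_mat P Q R D" unfolding P_def Q_def R_def D_def by (rule four_block_of[OF Yc])
  have c: "P \<in> carrier_mat 2 2" "Q \<in> carrier_mat 2 r" "R \<in> carrier_mat r 2" "D \<in> carrier_mat r r"
    by (auto simp: P_def Q_def R_def D_def)
  have Yh: "ctrans star Y = Y"
    unfolding Y_def using block_of_ctrans[OF yc, of "M - (2 + r)" "2 + r" "M - (2 + r)" "2 + r"] rM yh by simp
  have h: "ctrans star P = P" "ctrans star Q = R" "ctrans star D = D"
    unfolding P_def Q_def R_def D_def using block_of_ctrans[OF Yc, of 0 2 0 2] block_of_ctrans[OF Yc, of 2 r 0 2]
      block_of_ctrans[OF Yc, of 2 r 2 r] Yh by auto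
  have "D = block_of (M - r) (M - r) r r y"
  proof -
    have "Suc (Suc (M + a - Suc (Suc r))) = M + a - r" for a using rM by simp
    then show ?thesis
      unfolding D_def Y_def using rM by (intro eq_matI) simp_all
  qed
  then have dD: "det D = lower_right_minor (i - 1) y" using lower_right_minor_block[OF yc, of r] ir by simp
  have dY: "det Y = lower_right_minor (i + 1) y"
    using lower_right_minor_block[OF yc, of "2 + r"] ir by (simp add: Y_def)
  obtain F where F: "F \<in> carrier_mat r r" "F * D = 1\<^sub>m r" "D * F = 1\<^sub>m r"
    using ex_inverse_mat[OF c(4)] dD d(1) by metis
  have Fs: "ctrans star F \<in> carrier_mat r r" by (rule ctrans_carrier[OF F(1)])
  have "ctrans star F * D = ctrans star (D * F)" using ctrans_mult[OF c(4) F(1)] h(3) by simp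
  then have "ctrans star F * D * F = F" using F by simp
  then have Fh: "ctrans star F = F" using assoc_mult_mat[OF Fs c(4) F(1)] F Fs by simp
  define A where "A = P - Q * F * R"
  have QFR: "Q * F * R \<in> carrier_mat 2 2" using c F by auto
  have Ac: "A \<in> carrier_mat 2 2" using c QFR by (auto simp: A_def)
  have "ctrans star (Q * F * R) = ctrans star R * ctrans star (Q * F)" by (rule ctrans_mult) (use c F in auto)
  also have "ctrans star (Q * F) = F * R" using ctrans_mult[OF c(2) F(1)] Fh h(2) by simp
  also have "ctrans star R = Q" using h(2) ctrans_ctrans by metis
  finally have "ctrans star (Q * F * R) = Q * F * R" using assoc_mult_mat[OF c(2) F(1) c(3)] by simp
  then have Ah: "star (A $$ (a, b)) = A $$ (b, a)" if "a < 2" "b < 2" for a b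
  proof -
    have "star (P $$ (a, b)) = P $$ (b, a)" "star ((Q * F * R) $$ (a, b)) = (Q * F * R) $$ (b, a)"
      using \<open>ctrans star (Q * F * R) = Q * F * R\<close> h(1) ctrans_index[of b P a star] ctrans_index[of b "Q * F * R" a star] that c QFR by auto
    moreover have "A $$ (a, b) = P $$ (a, b) - (Q * F * R) $$ (a, b)" "A $$ (b, a) = P $$ (b, a) - (Q * F * R) $$ (b, a)"
      unfolding A_def using that QFR by (auto intro!: index_minus_mat(1))
    ultimately show ?thesis
      by (simp add: star_diff)
  qed
  define \<delta> where "\<delta> = det D"
  have "ctrans star D = D \<Longrightarrow> star \<delta> = \<delta>"
    using det_ctrans[OF c(4)] by (simp add: \<delta>_def)
  then have \<delta>s: "star \<delta> = \<delta>" and \<delta>0: "\<delta> \<noteq> 0"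
    using h(3) d(1) dD by (auto simp: \<delta>_def)
  define a b e where "a = \<delta> * A $$ (0, 0)" and "b = \<delta> * A $$ (0, 1)" and "e = \<delta> * A $$ (1, 1)"
  have ak: "a \<in> k" "e \<in> k"
    unfolding star_fixed_iff[symmetric] a_def e_def using Ah[of 0 0] Ah[of 1 1] by (simp_all add: star_mult \<delta>s)
  have A10: "\<delta> * A $$ (1, 0) = star b"
    unfolding b_def using Ah[of 0 1] by (simp add: star_mult \<delta>s)
  have disc: "a * e - nm b = lower_right_minor (i - 1) y * lower_right_minor (i + 1) y"
  proof -
    have "lower_right_minor (i + 1) y = det A * \<delta>"
      unfolding dY[symmetric] \<delta>_def A_def by (subst Yb) (rule det_schur[OF c F(1,2)])
    also have "det A = A $$ (0, 0) * A $$ (1, 1) - A $$ (0, 1) * A $$ (1, 0)" by (rule det_dim2[OF Ac])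
    finally have l: "lower_right_minor (i + 1) y = (A $$ (0, 0) * A $$ (1, 1) - A $$ (0, 1) * A $$ (1, 0)) * \<delta>" .
    have "\<delta> * lower_right_minor (i + 1) y = a * e - b * (\<delta> * A $$ (1, 0))"
      unfolding a_def b_def e_def l by (simp add: algebra_simps)
    then show ?thesis
      unfolding A10 by (simp only: nm_def dD[symmetric] \<delta>_def[symmetric])
  qed
  have val: "\<Delta> x = herm2 a b e x" if x: "x \<in> lines2 N" for x N
  proof -
    note el = elt2[OF i x]
    have hc: "elt2 n i x \<in> carrier_mat M M" using maxcompactD(1)[OF el(1)] by (simp add: M_def)
    define E where "E = mat 1 2 (\<lambda>(a, b). if b = 0 then fst x else snd x)"
    have Ec: "E \<in> carrier_mat 1 2" by (simp add: E_def)
    define H where "H = block_of (M - i) (M - (2 + r)) i (2 + r) (elt2 n i x)"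
    have Hb: "H = four_block_mat E (0\<^sub>m 1 r) (0\<^sub>m r 2) (1\<^sub>m r)"
    proof (rule eq_matI)
      fix s t assume "s < dim_row (four_block_mat E (0\<^sub>m 1 r) (0\<^sub>m r 2) (1\<^sub>m r))" "t < dim_col (four_block_mat E (0\<^sub>m 1 r) (0\<^sub>m r 2) (1\<^sub>m r))"
      then have st: "s < i" "t < 2 + r" using Ec ir by auto
      have "H $$ (s, t) = elt2 n i x $$ (2 * n + 1 - i + s, M - (2 + r) + t)"
        using st by (simp add: H_def M_def)
      also have "\<dots> = (if s = 0 then if t = 0 then fst x else if t = 1 then snd x else 0 else if t = s + 1 then 1 else 0)"
      proof -
        have e: "M - (2 + r) + t = 2 * n - i + t" "2 * n - i + t < 2 * n + 1"
          using st ir i by (auto simp: M_def)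
        have "2 * n - i + t = 2 * n + 1 - i + s \<longleftrightarrow> t = s + 1" using i by auto
        then show ?thesis
          unfolding e(1) el(3)[OF st(1) e(2)] by simp
      qed
      finally show "H $$ (s, t) = four_block_mat E (0\<^sub>m 1 r) (0\<^sub>m r 2) (1\<^sub>m r) $$ (s, t)"
        using st ir Ec by (auto simp: E_def)
    qed (use Ec ir in \<open>auto simp: H_def\<close>)
    have supp: "elt2 n i x $$ (M - i + s, t) = 0" if "s < i" "t < M - (2 + r)" for s t
      using el(3)[of s t] that ir rM by (auto simp: M_def)
    have "\<Delta> x = det (H * Y * ctrans star H)"
      using lower_right_minor_block[OF act_carrier[OF hc yc], of i] block_of_congruence[OF hc yc rM(2,1) supp]
      by (simp add: act_def H_def Y_def \<Delta>_def)
    also have "\<dots> = (E * A * ctrans star E) $$ (0, 0) * \<delta>"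
      unfolding Yb A_def \<delta>_def by (rule det_row_congruence[OF Ec c F(1,2) Hb])
    also have "(E * A * ctrans star E) $$ (0, 0) = fst x * A $$ (0, 0) * star (fst x) + snd x * A $$ (1, 0) * star (fst x)
        + (fst x * A $$ (0, 1) * star (snd x) + snd x * A $$ (1, 1) * star (snd x))"
      using mult_index_sum[OF mult_carrier_mat[OF Ec Ac] ctrans_carrier[OF Ec], of 0 0] mult_index_sum[OF Ec Ac, of 0 0] mult_index_sum[OF Ec Ac, of 0 1] Ec
      by (simp add: E_def numeral_2_eq_2 algebra_simps)
    finally have "\<Delta> x = a * nm (fst x) + (b * fst x * star (snd x) + (\<delta> * A $$ (1, 0)) * snd x * star (fst x)) + e * nm (snd x)"
      by (simp add: a_def b_def e_def nm_def algebra_simps)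
    then show ?thesis
      unfolding A10 by (simp add: herm2_def tr_def star_mult algebra_simps)
  qed
  have nz: "a * e - nm b \<noteq> 0" unfolding disc using d by simp
  obtain \<beta> f where law: "herm2_law a b e \<beta> f"
    using ex_herm2_law[OF ak nz] by blast
  have "val (a * e - nm b) = 2 * \<beta> + int f" using law by (intro val_eqI) (simp only: herm2_law_def)
  then have "2 * \<beta> + int f = val (lower_right_minor (i - 1) y) + val (lower_right_minor (i + 1) y)"
    unfolding disc using val_mult[OF d] by simp
  moreover have "nrm (\<Delta> x) \<le> real q powi (- \<beta>)" if "x \<in> lines2 N" for x N
    unfolding val[OF that] using law that lines2_primitive[of N] by (intro herm2_le) (auto simp: herm2_law_def)
  moreover have "int (card {x \<in> lines2 N. nrm (\<Delta> x) = real q powi (- (\<beta> + int j))}) = count2 f N j"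
    if "1 \<le> N" "j < N" for N j
  proof -
    have "{x \<in> lines2 N. nrm (\<Delta> x) = real q powi (- (\<beta> + int j))} =
        {x \<in> lines2 N. nrm (herm2 a b e x) = real q powi (- (\<beta> + int j))}"
      using val by auto
    then show ?thesis
      using law that unfolding herm2_law_def by simp
  qed
  ultimately show ?thesis
    by blast
qed

end

subsection \<open>Hermitian matrices as involutions\<close>

text \<open>A rank factorization read off the row echelon form \<open>G = P * E\<close>: V consists
  of the nonzero rows of G, and U of the corresponding columns of the inverse Q of P. Conjugation by
  P turns the involution into an upper triangular matrix whose diagonal exhibits the rank r in the
  characteristic polynomial.\<close>

lemma idempotent_factorization:
  fixes E :: "'b::field mat"
  assumes E: "E \<in> carrier_mat N N" and EE: "E * E = E"
  obtains r U V where "r \<le> N" "U \<in> carrier_mat N r" "V \<in> carrier_mat r N" "E = U * V" "V * U = 1\<^sub>m r"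
    "char_poly (1\<^sub>m N - 2 \<cdot>\<^sub>m E) = [:1, 1:] ^ r * [:- 1, 1:] ^ (N - r)"
proof -
  define G where "G = gauss_jordan_single E"
  note gj = gauss_jordan_single[OF E G_def[symmetric]]
  have G: "G \<in> carrier_mat N N" "row_echelon_form G" by (fact gj)+
  obtain P Q where PQ: "G = P * E" "P \<in> carrier_mat N N" "Q \<in> carrier_mat N N" "P * Q = 1\<^sub>m N" "Q * P = 1\<^sub>m N"
    using gj(4) by blast
  obtain f where "pivot_fun G f N"
    using G by (auto simp: row_echelon_form_def)
  note piv = pivot_funD[OF carrier_matD(1)[OF G(1)] this]
  define r where "r = (LEAST i. i = N \<or> f i = N)"
  have rN: "r \<le> N" unfolding r_def by (rule Least_le) simp
  have small: "f i < N" if "i < r" for i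
    using not_less_Least[of i "\<lambda>i. i = N \<or> f i = N"] that piv(1)[of i] rN by (fold r_def) force
  have fN: "f (r + i) = N" if "r + i < N" for i
    using that
  proof (induction i)
    case 0
    then show ?case
      using LeastI[of "\<lambda>i. i = N \<or> f i = N" N] by (fold r_def) simp
  next
    case (Suc i)
    then show ?case
      using piv(3)[of "r + i"] piv(1)[of "r + Suc i"] by simp
  qed
  have zero: "G $$ (i, l) = 0" if "r \<le> i" "i < N" "l < N" for i l
    using piv(2)[of i l] fN[of "i - r"] that by simp
  define U where "U = block_of 0 0 N r Q"
  define V where "V = block_of 0 0 r N G"
  \<comment> \<open>R selects the pivot columns, on which V is the identity, so it is a right
    inverse of V; L is a left inverse of U. Cancelling both in
    \<open>U * (V * U) * V = U * V\<close> shows that \<open>V * U\<close> is the identity.\<close>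
  define R where "R = mat N r (\<lambda>(a, b). if a = f b then 1 else 0 :: 'b)"
  define L where "L = block_of 0 0 r N P"
  have c: "U \<in> carrier_mat N r" "V \<in> carrier_mat r N" "R \<in> carrier_mat N r" "L \<in> carrier_mat r N"
    by (simp_all add: U_def V_def R_def L_def)
  have "E = Q * P * E" unfolding PQ(5) using E by simp
  also have "\<dots> = Q * G" unfolding PQ(1) by (rule assoc_mult_mat[OF PQ(3,2) E])
  also have "\<dots> = U * V"
  proof (rule eq_matI)
    fix a b assume "a < dim_row (U * V)" "b < dim_col (U * V)"
    then have ab: "a < N" "b < N" using c by auto
    have "(Q * G) $$ (a, b) = (\<Sum>l\<in>{0..<N}. Q $$ (a, l) * G $$ (l, b))"
      by (rule mult_index_sum[OF PQ(3) G(1) ab])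
    also have "\<dots> = (\<Sum>l\<in>{0..<r}. Q $$ (a, l) * G $$ (l, b))"
      using rN zero ab by (intro sum.mono_neutral_right) auto
    also have "\<dots> = (U * V) $$ (a, b)"
      unfolding mult_index_sum[OF c(1,2) ab] using ab rN by (intro sum.cong) (auto simp: U_def V_def)
    finally show "(Q * G) $$ (a, b) = (U * V) $$ (a, b)" .
  qed (use c PQ G in auto)
  finally have EUV: "E = U * V" .
  have VR: "V * R = 1\<^sub>m r"
  proof (rule eq_matI)
    fix a b assume "a < dim_row (1\<^sub>m r :: 'b mat)" "b < dim_col (1\<^sub>m r :: 'b mat)"
    then have ab: "a < r" "b < r" by auto
    have "(V * R) $$ (a, b) = (\<Sum>l\<in>{0..<N}. if l = f b then G $$ (a, l) else 0)"
      unfolding mult_index_sum[OF c(2,3) ab] using ab by (intro sum.cong) (auto simp: V_def R_def)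
    also have "\<dots> = G $$ (a, f b)" using small[OF ab(2)] by (simp add: sum.delta')
    also have "\<dots> = (1\<^sub>m r :: 'b mat) $$ (a, b)"
      using piv(4)[of b] piv(5)[of b a] small[OF ab(2)] ab rN by (cases "a = b") auto
    finally show "(V * R) $$ (a, b) = (1\<^sub>m r :: 'b mat) $$ (a, b)" .
  qed (use c in auto)
  have LU: "L * U = 1\<^sub>m r"
  proof (rule eq_matI)
    fix a b assume "a < dim_row (1\<^sub>m r :: 'b mat)" "b < dim_col (1\<^sub>m r :: 'b mat)"
    then have ab: "a < r" "b < r" by auto
    have "(L * U) $$ (a, b) = (\<Sum>l\<in>{0..<N}. P $$ (a, l) * Q $$ (l, b))"
      unfolding mult_index_sum[OF c(4,1) ab] using ab by (intro sum.cong) (auto simp: L_def U_def)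
    also have "\<dots> = (P * Q) $$ (a, b)" using ab rN by (intro mult_index_sum[OF PQ(2,3), symmetric]) auto
    finally show "(L * U) $$ (a, b) = (1\<^sub>m r :: 'b mat) $$ (a, b)" unfolding PQ(4) using ab rN by simp
  qed (use c in auto)
  have VUc: "V * U \<in> carrier_mat r r" using c by auto
  have VU: "V * U = 1\<^sub>m r"
  proof -
    have "U * (V * U) * V = E * E"
      unfolding EUV using c VUc by (simp add: assoc_mult_mat[of _ N r _ r _ N] assoc_mult_mat[of _ N r _ N _ N] assoc_mult_mat[of _ r N _ r _ N])
    then have e: "U * (V * U) * V = U * V" using EE EUV by simp
    have "L * (U * X * V) * R = X" if X: "X \<in> carrier_mat r r" for X
    proof -
      have UX: "U * X \<in> carrier_mat N r" using c X by auto
      have "L * (U * X * V) = L * (U * X) * V" by (rule assoc_mult_mat[OF c(4) UX c(2), symmetric])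
      also have "L * (U * X) = X" unfolding assoc_mult_mat[OF c(4,1) X, symmetric] LU using X by simp
      finally have "L * (U * X * V) = X * V" .
      then show ?thesis
        using assoc_mult_mat[OF X c(2,3)] VR X by simp
    qed
    from this[OF VUc] this[OF one_carrier_mat] have "L * (U * (V * U) * V) * R = V * U" "L * (U * 1\<^sub>m r * V) * R = 1\<^sub>m r"
      by blast+
    then show ?thesis
      unfolding e right_mult_one_mat[OF c(1)] by simp
  qed
  define A where "A = 1\<^sub>m N - 2 \<cdot>\<^sub>m E"
  define B where "B = P * A * Q"
  have AB: "A \<in> carrier_mat N N" "B \<in> carrier_mat N N" using E PQ by (auto simp: A_def B_def)
  have AQ: "A * Q \<in> carrier_mat N N" by (rule mult_carrier_mat[OF AB(1) PQ(3)])
  have "Q * B = Q * (P * (A * Q))" unfolding B_def by (simp only: assoc_mult_mat[OF PQ(2) AB(1) PQ(3)])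
  also have "\<dots> = A * Q"
    unfolding assoc_mult_mat[OF PQ(3,2) AQ, symmetric] PQ(5) by (rule left_mult_one_mat[OF AQ])
  finally have "Q * B * P = A * (Q * P)" using assoc_mult_mat[OF AB(1) PQ(3,2)] by simp
  then have A_eq: "A = Q * B * P" unfolding PQ(5) using AB by simp
  have "similar_mat_wit A B Q P" unfolding similar_mat_wit_def Let_def using AB PQ A_eq by auto
  then have sim: "char_poly A = char_poly B" by (intro char_poly_similar) (auto simp: similar_mat_def)
  have Bi: "B $$ (i, j) = (if i = j then 1 else 0) - 2 * (G * Q) $$ (i, j)" if "i < N" "j < N" for i j
  proof -
    have "P * A = P * 1\<^sub>m N - P * (2 \<cdot>\<^sub>m E)"
      unfolding A_def using PQ E by (intro mult_minus_distrib_mat) auto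
    also have "\<dots> = P - 2 \<cdot>\<^sub>m G" using PQ E mult_smult_distrib[OF PQ(2) E, of 2] by simp
    finally have "B = (P - 2 \<cdot>\<^sub>m G) * Q" by (simp add: B_def)
    also have "\<dots> = P * Q - 2 \<cdot>\<^sub>m G * Q"
      using PQ(2,3) G by (intro minus_mult_distrib_mat) auto
    also have "\<dots> = 1\<^sub>m N - 2 \<cdot>\<^sub>m (G * Q)"
      unfolding PQ(4) mult_smult_assoc_mat[OF G(1) PQ(3)] ..
    finally have "B = 1\<^sub>m N - 2 \<cdot>\<^sub>m (G * Q)" .
    then show ?thesis
      using that carrier_matD[OF G(1)] carrier_matD[OF PQ(3)] by simp
  qed
  have GQ: "(G * Q) $$ (i, j) = (if r \<le> i then 0 else if i = j then 1 else 0)" if ij: "i < N" "j < N" "r \<le> i \<or> j < r" for i j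
  proof (cases "r \<le> i")
    case True
    then show ?thesis
      unfolding mult_index_sum[OF G(1) PQ(3) ij(1,2)] using zero ij by simp
  next
    case False
    then have ij': "i < r" "j < r" using ij by auto
    have "(G * Q) $$ (i, j) = (V * U) $$ (i, j)"
      unfolding mult_index_sum[OF G(1) PQ(3) ij(1,2)] mult_index_sum[OF c(2,1) ij'] using ij'
      by (intro sum.cong) (auto simp: U_def V_def)
    then show ?thesis
      unfolding VU using ij' by simp
  qed
  have "upper_triangular B"
  proof (rule upper_triangularI)
    fix i j assume "j < i" "i < dim_row B"
    then have ij: "i < N" "j < N" "r \<le> i \<or> j < r" "i \<noteq> j" using AB by auto
    then show "B $$ (i, j) = 0" using Bi[OF ij(1,2)] GQ[OF ij(1-3)] by simp
  qed
  then have "char_poly B = (\<Prod>a\<leftarrow>diag_mat B. [:- a, 1:])"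
    using char_poly_upper_triangular[OF AB(2)] by simp
  also have "\<dots> = (\<Prod>i\<leftarrow>[0..<N]. [:- (B $$ (i, i)), 1:])"
    using AB by (simp add: diag_mat_def comp_def)
  also have "\<dots> = (\<Prod>i\<in>{0..<N}. [:- (B $$ (i, i)), 1:])"
    using prod.distinct_set_conv_list[of "[0..<N]" "\<lambda>i. [:- (B $$ (i, i)), 1:]"] by simp
  also have "\<dots> = (\<Prod>i\<in>{0..<r}. [:- (B $$ (i, i)), 1:]) * (\<Prod>i\<in>{r..<N}. [:- (B $$ (i, i)), 1:])"
    using rN by (simp add: prod.atLeastLessThan_concat)
  also have "(\<Prod>i\<in>{0..<r}. [:- (B $$ (i, i)), 1:]) = (\<Prod>i\<in>{0..<r}. [:1, 1:])"
    using Bi GQ rN by (intro prod.cong) auto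
  also have "(\<Prod>i\<in>{r..<N}. [:- (B $$ (i, i)), 1:]) = (\<Prod>i\<in>{r..<N}. [:- 1, 1:])"
    using Bi GQ rN by (intro prod.cong) auto
  finally have "char_poly A = [:1, 1:] ^ r * [:- 1, 1:] ^ (N - r)" unfolding sim by simp
  then show thesis
    using that[OF rN c(1,2) EUV VU] by (simp add: A_def)
qed

text \<open>The multiplicities of the root -1 on both sides are r and n.\<close>

lemma involution_rank_unique:
  fixes n r :: nat
  assumes eq: "[:1, 1:] ^ r * [:- 1, 1:] ^ m = [:- 1, 0, 1:] ^ n * [:- 1, 1 :: 'b::field_char_0:]"
  shows "r = n"
proof -
  have "[:- 1, 0, 1 :: 'b:] = [:1, 1:] * [:- 1, 1:]" by simp
  then have "[:1, 1:] ^ r * [:- 1, 1:] ^ m = [:1, 1:] ^ n * [:- 1, 1 :: 'b:] ^ (n + 1)"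
    using eq by (simp add: power_mult_distrib mult_ac del: mult_pCons_left mult_pCons_right)
  moreover have "order (- 1) ([:1, 1:] ^ i * [:- 1, 1 :: 'b:] ^ j) = i" for i j
  proof -
    have "order (- 1) ([:- 1, 1 :: 'b:] ^ j) = 0" by (rule order_0I) simp
    then show ?thesis
      using order_power_n_n[of "- 1 :: 'b" i] by (simp add: order_mult)
  qed
  ultimately show ?thesis
    by metis
qed

context unramified_quadratic_extension begin

lemma hermitian_spaceD:
  assumes "x \<in> hermitian_space star n"
  shows "x \<in> carrier_mat (2 * n + 1) (2 * n + 1)" "ctrans star x = x" "x * jmat n * x = jmat n"
    "char_poly (x * jmat n) = [:- 1, 0, 1:] ^ n * [:- 1, 1:]"
  using assms unitaryD[of x n] by (auto simp: hermitian_space_def)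

lemma ctrans_diff:
  "A \<in> carrier_mat r c \<Longrightarrow> B \<in> carrier_mat r c \<Longrightarrow> ctrans star (A - B) = ctrans star A - ctrans star B"
  by (rule eq_matI) (auto simp: star_diff)

lemma ctrans_smult: "a \<in> k \<Longrightarrow> ctrans star (a \<cdot>\<^sub>m A) = a \<cdot>\<^sub>m ctrans star A"
  by (rule eq_matI) (auto simp: star_mult star_fixes)

text \<open>\<open>A = x * jmat n\<close> is an involution, and half of the identity minus A is the
  projection E onto its eigenspace for -1, of dimension n by the characteristic polynomial. E is
  self-adjoint for the form, so it is the orthogonal projection determined by a basis U of the
  eigenspace and the inverse C of its Gram matrix S.\<close>

lemma hermitian_space_decomposition:
  assumes x: "x \<in> hermitian_space star n"
  obtains U S C where "U \<in> carrier_mat (2 * n + 1) n" "S \<in> carrier_mat n n" "C \<in> carrier_mat n n"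
    "S = ctrans star U * jmat n * U" "S * C = 1\<^sub>m n" "C * S = 1\<^sub>m n"
    "x = jmat n - 2 \<cdot>\<^sub>m (U * C * ctrans star U)"
proof -
  define N where "N = 2 * n + 1"
  define J where "J = (jmat n :: 'a mat)"
  note xD = hermitian_spaceD[OF x, folded N_def J_def]
  have J: "J \<in> carrier_mat N N" "J * J = 1\<^sub>m N" "ctrans star J = J"
    using jmat_carrier[of n] jmat_jmat[of n] by (auto simp: J_def N_def)
  note assoc = assoc_mult_mat[of _ N N _ N _ N]
  define A where "A = x * J"
  have A: "A \<in> carrier_mat N N" using xD J by (auto simp: A_def)
  have "A * A = (x * J * x) * J" unfolding A_def using xD(1) J(1) by (simp add: assoc)
  then have AA: "A * A = 1\<^sub>m N"
    unfolding xD(3) J(2) .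
  define E where "E = (1 / 2) \<cdot>\<^sub>m (1\<^sub>m N - A)"
  have E: "E \<in> carrier_mat N N" using A by (auto simp: E_def)
  have AE: "A = 1\<^sub>m N - 2 \<cdot>\<^sub>m E"
    unfolding E_def using A by (intro eq_matI) (auto simp: diff_divide_distrib)
  have dA: "(1\<^sub>m N - A) * (1\<^sub>m N - A) = 2 \<cdot>\<^sub>m (1\<^sub>m N - A)"
  proof -
    have cA: "1\<^sub>m N - A \<in> carrier_mat N N" using A by auto
    have "(1\<^sub>m N - A) * (1\<^sub>m N - A) = 1\<^sub>m N * (1\<^sub>m N - A) - A * (1\<^sub>m N - A)"
      using A cA by (intro minus_mult_distrib_mat) auto
    also have "A * (1\<^sub>m N - A) = A * 1\<^sub>m N - A * A" using A by (intro mult_minus_distrib_mat) auto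
    also have "1\<^sub>m N * (1\<^sub>m N - A) - (A * 1\<^sub>m N - A * A) = 2 \<cdot>\<^sub>m (1\<^sub>m N - A)"
      unfolding AA using A cA by (intro eq_matI) auto
    finally show ?thesis .
  qed
  have "E * E = (1 / 2) \<cdot>\<^sub>m ((1 / 2) \<cdot>\<^sub>m ((1\<^sub>m N - A) * (1\<^sub>m N - A)))"
    unfolding E_def using A by (subst mult_smult_assoc_mat[of _ N N _ N]; (subst mult_smult_distrib[of _ N N _ N])?) auto
  then have EE: "E * E = E" unfolding dA E_def using A by (auto intro!: eq_matI)
  obtain r U V where fac: "r \<le> N" "U \<in> carrier_mat N r" "V \<in> carrier_mat r N" "E = U * V" "V * U = 1\<^sub>m r"
    "char_poly (1\<^sub>m N - 2 \<cdot>\<^sub>m E) = [:1, 1:] ^ r * [:- 1, 1:] ^ (N - r)"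
    using idempotent_factorization[OF E EE] by blast
  have "[:1, 1:] ^ r * [:- 1, 1:] ^ (2 * n + 1 - r) = [:- 1, 0, 1:] ^ n * [:- 1, 1 :: 'a:]"
    using fac(6) xD(4) unfolding AE[symmetric] by (simp only: A_def N_def)
  then have "r = n" by (rule involution_rank_unique)
  note fac = fac[unfolded this]
  define Us Vs where "Us = ctrans star U" and "Vs = ctrans star V"
  have sc: "Us \<in> carrier_mat n N" "Vs \<in> carrier_mat N n"
    using fac by (auto simp: Us_def Vs_def intro: ctrans_carrier)
  define Es where "Es = ctrans star E"
  have Es: "Es \<in> carrier_mat N N" "Es = Vs * Us"
    using ctrans_carrier[OF E, of star] ctrans_mult[OF fac(2,3)] by (simp_all add: Es_def Us_def Vs_def fac(4)[symmetric])
  \<comment> \<open>Self-adjointness of E with respect to the form J, a consequence of x being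
    hermitian.\<close>
  have JE: "J * E = Es * J"
  proof -
    have mc: "1\<^sub>m N - J * x \<in> carrier_mat N N" "1\<^sub>m N - A \<in> carrier_mat N N"
      by (rule minus_carrier_mat[OF mult_carrier_mat[OF J(1) xD(1)]] minus_carrier_mat[OF A])+
    have "A * J = x * (J * J)" unfolding A_def using xD J by (simp add: assoc)
    then have xAJ: "A * J = x" unfolding J(2) using xD by simp
    have "ctrans star A = J * x" unfolding A_def using ctrans_mult[OF xD(1) J(1)] J(3) xD(2) by simp
    moreover have "ctrans star (1\<^sub>m N - A) = ctrans star (1\<^sub>m N) - ctrans star A"
      using A by (intro ctrans_diff) auto
    ultimately have "Es = (1 / 2) \<cdot>\<^sub>m (1\<^sub>m N - J * x)"
      unfolding Es_def E_def by (subst ctrans_smult) (auto intro: k_divide k_1 k_numeral)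
    then have "Es * J = (1 / 2) \<cdot>\<^sub>m ((1\<^sub>m N - J * x) * J)"
      using mult_smult_assoc_mat[OF mc(1) J(1), of "1 / 2"] by simp
    also have "(1\<^sub>m N - J * x) * J = 1\<^sub>m N * J - J * x * J"
      using J xD by (intro minus_mult_distrib_mat) auto
    also have "\<dots> = J * 1\<^sub>m N - J * A" unfolding A_def using J xD by (simp add: assoc)
    also have "\<dots> = J * (1\<^sub>m N - A)" using J A by (intro mult_minus_distrib_mat[symmetric]) auto
    also have "(1 / 2) \<cdot>\<^sub>m (J * (1\<^sub>m N - A)) = J * E"
      unfolding E_def by (rule mult_smult_distrib[OF J(1) mc(2), symmetric])
    finally show ?thesis ..
  qed
  define S where "S = Us * J * U"
  define C where "C = V * J * Vs"
  have SC: "S \<in> carrier_mat n n" "C \<in> carrier_mat n n" "Us * J \<in> carrier_mat n N" "V * J \<in> carrier_mat n N" "J * Vs \<in> carrier_mat N n"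
    using fac sc J by (auto simp: S_def C_def)
  have EU: "Us * Es = Us"
  proof -
    have "E * U = U * (V * U)" unfolding fac(4) by (rule assoc_mult_mat[OF fac(2,3,2)])
    then have "E * U = U" unfolding fac(5) using fac(2) by simp
    then show ?thesis
      using ctrans_mult[OF E fac(2)] by (simp add: Us_def Es_def)
  qed
  have SV: "S * V = Us * J" by (smt (verit) S_def assoc_mult_mat SC fac sc J E JE Es EU)
  have "S * C = S * (V * (J * Vs))" unfolding C_def by (simp only: assoc_mult_mat[OF fac(3) J(1) sc(2)])
  also have "\<dots> = Us * J * (J * Vs)"
    unfolding SV[symmetric] by (rule assoc_mult_mat[OF SC(1) fac(3) SC(5), symmetric])
  also have "\<dots> = Us * (J * (J * Vs))" by (rule assoc_mult_mat[OF sc(1) J(1) SC(5)])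
  also have "J * (J * Vs) = Vs" unfolding assoc_mult_mat[OF J(1,1) sc(2), symmetric] J(2) using sc by simp
  also have "Us * Vs = ctrans star (V * U)"
    unfolding Us_def Vs_def by (rule ctrans_mult[OF fac(3,2), symmetric])
  finally have SC1: "S * C = 1\<^sub>m n" unfolding fac(5) by simp
  then have CS1: "C * S = 1\<^sub>m n" using mat_mult_left_right_inverse[OF SC(1,2)] by blast
  have "V = C * S * V" unfolding CS1 using fac by simp
  also have "\<dots> = C * (Us * J)" unfolding SV[symmetric] by (rule assoc_mult_mat[OF SC(2,1) fac(3)])
  finally have V: "V = C * (Us * J)" .
  have CU: "C * Us \<in> carrier_mat n N" "U * (C * Us) \<in> carrier_mat N N" using SC sc fac by auto
  have "E * J = U * (V * J)" unfolding fac(4) by (rule assoc_mult_mat[OF fac(2,3) J(1)])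
  also have "V * J = C * (Us * J * J)" unfolding V by (rule assoc_mult_mat[OF SC(2,3) J(1)])
  also have "Us * J * J = Us" unfolding assoc_mult_mat[OF sc(1) J(1,1)] J(2) using sc by simp
  finally have EJ: "E * J = U * C * Us"
    unfolding assoc_mult_mat[OF fac(2) SC(2) sc(1)] .
  have "x = A * J" unfolding A_def assoc_mult_mat[OF xD(1) J(1,1)] J(2) using xD by simp
  also have "\<dots> = 1\<^sub>m N * J - 2 \<cdot>\<^sub>m E * J"
    unfolding AE using E J by (intro minus_mult_distrib_mat) auto
  also have "\<dots> = J - 2 \<cdot>\<^sub>m (U * C * Us)"
    unfolding mult_smult_assoc_mat[OF E J(1)] EJ using J by simp
  finally have xeq: "x = J - 2 \<cdot>\<^sub>m (U * C * Us)" .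
  show thesis
    by (rule that[OF _ SC(1,2) _ SC1 CS1]) (use fac(2) xeq in \<open>simp_all add: S_def Us_def J_def N_def\<close>)
qed


text \<open>The determinants of the matrices obtained from \<open>W\<close> by adding a row \<open>v\<close> on top form a linear
  function \<open>v \<mapsto> \<Sum>l. v l * \<xi> l\<close>; the Gram determinant of \<open>W\<close> is the dual Gram value of \<open>\<xi>\<close>.\<close>

lemma complementary_vector:
  assumes S: "S \<in> carrier_mat (Suc m) (Suc m)" and C: "C \<in> carrier_mat (Suc m) (Suc m)"
    and SC: "S * C = 1\<^sub>m (Suc m)" and Sh: "ctrans star S = S"
    and W: "W \<in> carrier_mat m (Suc m)" and nz: "det (W * C * ctrans star W) \<noteq> 0"
  obtains \<xi> where "\<xi> \<in> carrier_mat (Suc m) 1" "W * \<xi> = 0\<^sub>m m 1"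
    "\<And>v. det (mat (Suc m) (Suc m) (\<lambda>(a, b). if a = 0 then v b else W $$ (a - 1, b))) = (\<Sum>l\<in>{0..<Suc m}. v l * \<xi> $$ (l, 0))"
    "(ctrans star \<xi> * S * \<xi>) $$ (0, 0) = det S * det (W * C * ctrans star W)"
proof -
  let ?n = "Suc m"
  define Ws where "Ws = ctrans star W"
  have Ws: "Ws \<in> carrier_mat ?n m" unfolding Ws_def by (rule ctrans_carrier[OF W])
  define E where "E = W * C * Ws"
  have E: "E \<in> carrier_mat m m" using W C Ws by (auto simp: E_def)
  have CS: "C * S = 1\<^sub>m ?n"
    using mat_mult_left_right_inverse[OF S C SC] .
  define Cs where "Cs = ctrans star C"
  have Csc: "Cs \<in> carrier_mat ?n ?n" unfolding Cs_def by (rule ctrans_carrier[OF C])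
  have "Cs * S = 1\<^sub>m ?n" using ctrans_mult[OF S C] SC Sh by (simp add: Cs_def)
  then have "Cs * S * C = C" using C by simp
  then have Ch: "Cs = C" unfolding assoc_mult_mat[OF Csc S C] SC using Csc by simp
  have nz': "det E \<noteq> 0" using nz by (simp add: E_def Ws_def)
  obtain F where F: "F \<in> carrier_mat m m" "F * E = 1\<^sub>m m" "E * F = 1\<^sub>m m"
    using ex_inverse_mat[OF E nz'] by metis
  \<comment> \<open>A right inverse of W whose columns are orthogonal, with respect to S, to the
    kernel of W. Together with a kernel vector it forms a basis in which S becomes block
    diagonal.\<close>
  define Y where "Y = C * Ws * F"
  have CW: "C * Ws \<in> carrier_mat ?n m" using C Ws by auto
  have Y: "Y \<in> carrier_mat ?n m" using CW F by (auto simp: Y_def)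
  have "W * Y = W * (C * Ws) * F" unfolding Y_def by (rule assoc_mult_mat[OF W CW F(1), symmetric])
  also have "W * (C * Ws) = E" unfolding E_def by (rule assoc_mult_mat[OF W C Ws, symmetric])
  finally have WY: "W * Y = 1\<^sub>m m"
    unfolding F(3) .
  define M where "M v = mat ?n ?n (\<lambda>(a, b). if a = 0 then v b else W $$ (a - 1, b))" for v
  have M: "M v \<in> carrier_mat ?n ?n" for v by (simp add: M_def)
  have "det (M (\<lambda>_. 0)) = 0" using laplace_expansion_row[OF M, of 0] by (simp add: M_def)
  then obtain z where z: "z \<in> carrier_vec ?n" "z \<noteq> 0\<^sub>v ?n" "M (\<lambda>_. 0) *\<^sub>v z = 0\<^sub>v ?n"
    using det_0_iff_vec_prod_zero_field[OF M] by blast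
  have Wz: "(\<Sum>l\<in>{0..<?n}. W $$ (a, l) * z $ l) = 0" if "a < m" for a
  proof -
    have "(M (\<lambda>_. 0) *\<^sub>v z) $ Suc a = (\<Sum>l\<in>{0..<?n}. W $$ (a, l) * z $ l)"
      using that z(1) by (auto simp: M_def scalar_prod_def intro!: sum.cong)
    then show ?thesis
      unfolding z(3) using that by simp
  qed
  define Z where "Z = mat ?n 1 (\<lambda>(a, b). z $ a)"
  have Zc: "Z \<in> carrier_mat ?n 1" by (simp add: Z_def)
  have WZ: "W * Z = 0\<^sub>m m 1"
  proof (rule eq_matI)
    fix a b assume "a < dim_row (0\<^sub>m m 1 :: 'a mat)" "b < dim_col (0\<^sub>m m 1 :: 'a mat)"
    then show "(W * Z) $$ (a, b) = 0\<^sub>m m 1 $$ (a, b)"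
      using mult_index_sum[OF W Zc, of a b] Wz[of a] by (simp add: Z_def)
  qed (use W Zc in auto)
  define B where "B = mat ?n ?n (\<lambda>(a, b). if b = 0 then z $ a else Y $$ (a, b - 1))"
  have B: "B \<in> carrier_mat ?n ?n" by (simp add: B_def)
  define dB where "dB = det B"
  \<comment> \<open>Multiplication by B makes the bordered matrix upper triangular: its top left
    entry is the product of v with the kernel vector, and the other diagonal entries are 1.\<close>
  have MB: "det (M v) * dB = (\<Sum>l\<in>{0..<?n}. v l * z $ l)" for v
  proof -
    define T where "T = M v * B"
    have T: "T \<in> carrier_mat ?n ?n" using mult_carrier_mat[OF M B] by (simp add: T_def)
    have Tidx: "T $$ (a, b) = (\<Sum>l\<in>{0..<?n}. M v $$ (a, l) * B $$ (l, b))" if "a < ?n" "b < ?n" for a b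
      unfolding T_def by (rule mult_index_sum[OF M B that])
    have T00: "T $$ (0, 0) = (\<Sum>l\<in>{0..<?n}. v l * z $ l)"
      unfolding Tidx[OF zero_less_Suc zero_less_Suc] by (intro sum.cong) (auto simp: M_def B_def)
    have T10: "T $$ (Suc a, 0) = 0" if "a < m" for a using that Tidx Wz by (auto simp: M_def B_def)
    have T11: "T $$ (Suc a, Suc b) = (if a = b then 1 else 0)" if "a < m" "b < m" for a b
    proof -
      have "T $$ (Suc a, Suc b) = (\<Sum>l\<in>{0..<?n}. W $$ (a, l) * Y $$ (l, b))"
        using that by (subst Tidx) (auto simp: M_def B_def intro!: sum.cong)
      also have "\<dots> = (W * Y) $$ (a, b)" by (rule mult_index_sum[OF W Y that, symmetric])
      finally show ?thesis
        unfolding WY using that by simp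
    qed
    have "upper_triangular T"
    proof (rule upper_triangularI)
      fix i j assume ij: "j < i" "i < dim_row T"
      then obtain a where a: "i = Suc a" "a < m" using T by (cases i) auto
      then show "T $$ (i, j) = 0" using T10 T11 ij by (cases j) auto
    qed
    then have "det T = (\<Prod>i\<in>{0..<?n}. T $$ (i, i))"
      using det_upper_triangular[OF _ T] T by (simp add: prod_list_diag_prod)
    also have "\<dots> = T $$ (0, 0) * (\<Prod>i\<in>{0..<m}. T $$ (Suc i, Suc i))"
      by (simp add: prod.atLeast0_lessThan_Suc_shift comp_def del: prod.op_ivl_Suc)
    also have "(\<Prod>i\<in>{0..<m}. T $$ (Suc i, Suc i)) = 1" using T11 by (intro prod.neutral) auto
    finally show ?thesis
      unfolding T_def det_mult[OF M B] dB_def T00[unfolded T_def] by simp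
  qed
  obtain l0 where l0: "l0 < ?n" "z $ l0 \<noteq> 0"
    using z(1,2) by (metis carrier_vecD eq_vecI index_zero_vec)
  have dB0: "dB \<noteq> 0"
  proof
    assume "dB = 0"
    then have "(\<Sum>l\<in>{0..<?n}. (if l = l0 then 1 else 0) * z $ l) = 0"
      using MB[of "\<lambda>l. if l = l0 then 1 else 0"] by simp
    then show False
      using l0 by (simp add: if_distrib[of "\<lambda>x. x * _"] sum.delta' del: sum.op_ivl_Suc cong: if_cong)
  qed
  define \<xi> where "\<xi> = inverse dB \<cdot>\<^sub>m Z"
  have \<xi>: "\<xi> \<in> carrier_mat ?n 1" using Zc by (simp add: \<xi>_def)
  have 1: "W * \<xi> = 0\<^sub>m m 1"
    unfolding \<xi>_def mult_smult_distrib[OF W Zc] WZ by (intro eq_matI) auto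
  have 2: "det (M v) = (\<Sum>l\<in>{0..<?n}. v l * \<xi> $$ (l, 0))" for v
  proof -
    have "(\<Sum>l\<in>{0..<?n}. v l * \<xi> $$ (l, 0)) = (\<Sum>l\<in>{0..<?n}. inverse dB * (v l * z $ l))"
      using Zc by (intro sum.cong) (auto simp: \<xi>_def Z_def)
    also have "\<dots> = inverse dB * (det (M v) * dB)"
      unfolding MB by (simp add: sum_distrib_left del: sum.op_ivl_Suc)
    finally show ?thesis
      using dB0 by simp
  qed
  define Zs Ys where "Zs = ctrans star Z" and "Ys = ctrans star Y"
  have sc: "Zs \<in> carrier_mat 1 ?n" "Ys \<in> carrier_mat m ?n"
    unfolding Zs_def Ys_def by (rule ctrans_carrier[OF Zc] ctrans_carrier[OF Y])+
  have SY: "S * Y = Ws * F"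
    by (smt (verit) Y_def assoc_mult_mat C Ws F S mult_carrier_mat SC left_mult_one_mat)
  have ZSY: "Zs * (S * Y) = 0\<^sub>m 1 m"
  proof -
    have "Zs * (Ws * F) = Zs * Ws * F" by (rule assoc_mult_mat[OF sc(1) Ws F(1), symmetric])
    also have "Zs * Ws = ctrans star (W * Z)"
      unfolding Zs_def Ws_def by (rule ctrans_mult[OF W Zc, symmetric])
    also have "\<dots> = 0\<^sub>m 1 m" unfolding WZ by (intro eq_matI) auto
    finally show ?thesis
      unfolding SY using left_mult_zero_mat[OF F(1), of 1] by simp
  qed
  have YSY: "Ys * (S * Y) = F"
  proof -
    have "Ys * (Ws * F) = Ys * Ws * F" by (rule assoc_mult_mat[OF sc(2) Ws F(1), symmetric])
    also have "Ys * Ws = ctrans star (W * Y)" unfolding Ys_def Ws_def by (rule ctrans_mult[OF W Y, symmetric])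
    finally show ?thesis
      unfolding SY WY using left_mult_one_mat[OF F(1)] by simp
  qed
  have YSZ: "Ys * (S * Z) = 0\<^sub>m m 1"
  proof -
    have "ctrans star (Zs * (S * Y)) = ctrans star (S * Y) * Z"
      using ctrans_mult[OF sc(1) mult_carrier_mat[OF S Y]] by (simp add: Zs_def)
    also have "ctrans star (S * Y) = Ys * S" using ctrans_mult[OF S Y] Sh by (simp add: Ys_def)
    also have "Ys * S * Z = Ys * (S * Z)" by (rule assoc_mult_mat[OF sc(2) S Zc])
    finally have "Ys * (S * Z) = ctrans star (0\<^sub>m 1 m)" unfolding ZSY by simp
    also have "\<dots> = 0\<^sub>m m 1" by (intro eq_matI) auto
    finally show ?thesis .
  qed
  define w where "w = (Zs * (S * Z)) $$ (0, 0)"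
  define Bs where "Bs = ctrans star B"
  have Bs: "Bs \<in> carrier_mat ?n ?n" unfolding Bs_def by (rule ctrans_carrier[OF B])
  have SB: "S * B \<in> carrier_mat ?n ?n" using S B by auto
  have SBidx: "(S * B) $$ (a, b) = (if b = 0 then (S * Z) $$ (a, 0) else (S * Y) $$ (a, b - 1))" if "a < ?n" "b < ?n" for a b
  proof (cases b)
    case 0
    then show ?thesis
      using that mult_index_sum[OF S B that] mult_index_sum[OF S Zc that(1), of 0] by (auto simp: B_def Z_def intro!: sum.cong)
  next
    case (Suc b')
    then show ?thesis
      using that mult_index_sum[OF S B that] mult_index_sum[OF S Y that(1), of b'] by (auto simp: B_def intro!: sum.cong)
  qed
  have BSB: "Bs * (S * B) = four_block_mat (mat 1 1 (\<lambda>_. w)) (0\<^sub>m 1 m) (0\<^sub>m m 1) F"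
  proof (rule eq_matI)
    fix a b assume "a < dim_row (four_block_mat (mat 1 1 (\<lambda>_. w)) (0\<^sub>m 1 m) (0\<^sub>m m 1) F)"
      "b < dim_col (four_block_mat (mat 1 1 (\<lambda>_. w)) (0\<^sub>m 1 m) (0\<^sub>m m 1) F)"
    then have ab: "a < ?n" "b < ?n" using F by auto
    define R where "R = (if b = 0 then S * Z else S * Y)"
    define b' where "b' = b - 1"
    have eq1: "(Bs * (S * B)) $$ (a, b) = (\<Sum>l\<in>{0..<?n}. star (B $$ (l, a)) * R $$ (l, b'))"
      unfolding mult_index_sum[OF Bs SB ab] using ab SBidx B by (intro sum.cong) (auto simp: Bs_def R_def b'_def)
    have Rc: "R \<in> carrier_mat ?n (if b = 0 then 1 else m)" using S Zc Y by (auto simp: R_def)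
    have b'c: "b' < (if b = 0 then 1 else m)" using ab by (auto simp: b'_def)
    have eq2: "(\<Sum>l\<in>{0..<?n}. star (B $$ (l, a)) * R $$ (l, b')) = (if a = 0 then (Zs * R) $$ (0, b') else (Ys * R) $$ (a - 1, b'))"
    proof (cases a)
      case 0
      then show ?thesis
        using mult_index_sum[OF sc(1) Rc _ b'c, of 0] ab Zc by (auto simp: B_def Zs_def Z_def intro!: sum.cong)
    next
      case (Suc a')
      then show ?thesis
        using mult_index_sum[OF sc(2) Rc _ b'c, of a'] ab Y by (auto simp: B_def Ys_def intro!: sum.cong)
    qed
    have eq3: "(if a = 0 then (Zs * R) $$ (0, b') else (Ys * R) $$ (a - 1, b')) =
        four_block_mat (mat 1 1 (\<lambda>_. w)) (0\<^sub>m 1 m) (0\<^sub>m m 1) F $$ (a, b)"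
      using ab F(1) ZSY YSY YSZ by (auto simp: R_def b'_def w_def)
    show "(Bs * (S * B)) $$ (a, b) = four_block_mat (mat 1 1 (\<lambda>_. w)) (0\<^sub>m 1 m) (0\<^sub>m m 1) F $$ (a, b)"
      unfolding eq1 eq2 eq3 ..
  qed (use Bs SB F B S in auto)
  \<comment> \<open>The determinant of the Gram matrix in the basis B is computed twice; the
    comparison expresses w through \<open>det S\<close>, \<open>det E\<close> and
    \<open>dB\<close>.\<close>
  have "det (Bs * (S * B)) = w * det F"
    unfolding BSB using det_four_block_mat_lower_left_zero[of "mat 1 1 (\<lambda>_. w)" 1 "0\<^sub>m 1 m" m "0\<^sub>m m 1" F] F(1)
      det_single[of "mat 1 1 (\<lambda>_. w)"] by simp
  moreover have "det (Bs * (S * B)) = star dB * (det S * dB)"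
    using det_mult[OF Bs SB] det_mult[OF S B] det_ctrans[OF B] by (simp add: Bs_def dB_def)
  moreover have "det F * det E = 1" using det_mult[OF F(1) E] F(2) by (simp add: det_one)
  ultimately have FE: "det F * det E = 1"
    and wF: "w * det F = star dB * (det S * dB)"
    by auto
  have "w = w * det F * det E" using FE by (simp add: mult.assoc)
  then have w: "w = star dB * dB * det S * det E" unfolding wF by (simp add: ac_simps)
  have "ctrans star \<xi> = inverse (star dB) \<cdot>\<^sub>m Zs"
    using Zc by (intro eq_matI) (auto simp: \<xi>_def Zs_def star_mult star_inverse)
  then have "ctrans star \<xi> * S * \<xi> = inverse (star dB) \<cdot>\<^sub>m (inverse dB \<cdot>\<^sub>m (Zs * S * Z))"
    using mult_smult_assoc_mat[OF sc(1) S, of "inverse (star dB)"] mult_smult_distrib[OF mult_carrier_mat[OF sc(1) S] Zc, of "inverse dB"]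
      mult_smult_assoc_mat[OF mult_carrier_mat[OF sc(1) S] \<xi>, of "inverse (star dB)"] by (simp add: \<xi>_def)
  moreover have "Zs * S * Z = Zs * (S * Z)" by (rule assoc_mult_mat[OF sc(1) S Zc])
  moreover have "(inverse (star dB) \<cdot>\<^sub>m (inverse dB \<cdot>\<^sub>m (Zs * (S * Z)))) $$ (0, 0) = inverse (star dB) * (inverse dB * w)"
    using sc Zc by (simp add: w_def)
  ultimately have "(ctrans star \<xi> * S * \<xi>) $$ (0, 0) = inverse (star dB) * (inverse dB * w)" by simp
  also have "\<dots> = det S * det E" unfolding w using dB0 by (simp add: field_simps)
  finally have 3: "(ctrans star \<xi> * S * \<xi>) $$ (0, 0) = det S * det (W * C * ctrans star W)"
    by (simp add: E_def Ws_def)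
  show thesis
    using that[OF \<xi> 1 2[unfolded M_def] 3] .
qed

section \<open>Elements of K for the long simple root\<close>

definition shear3 :: "nat \<Rightarrow> 'a \<Rightarrow> 'a \<Rightarrow> 'a mat" where
  "shear3 s b t = mat (2 * s + 3) (2 * s + 3) (\<lambda>(i, l). if i = l then 1 else if i = Suc s \<and> l = s then - star b
     else if i = Suc (Suc s) \<and> l = s then t else if i = Suc (Suc s) \<and> l = Suc s then b else 0)"

lemma shear3_maxcompact:
  assumes bt: "nrm b \<le> 1" "nrm t \<le> 1" "tr t + nm b = 0"
  shows "shear3 s b t \<in> maxcompact nrm star (Suc s)"
proof (rule maxcompactI)
  let ?g = "shear3 s b t"
  have N: "2 * Suc s + 1 = 2 * s + 3" by simp
  show c: "?g \<in> carrier_mat (2 * Suc s + 1) (2 * Suc s + 1)" unfolding N by (simp add: shear3_def)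
  have rel: "t + b * star b + star t = 0" using bt(3) by (simp add: tr_def nm_def algebra_simps)
  show "ctrans star ?g * jmat (Suc s) * ?g = jmat (Suc s)"
  proof (rule eq_matI)
    fix i l assume "i < dim_row (jmat (Suc s) :: 'a mat)" "l < dim_col (jmat (Suc s) :: 'a mat)"
    then have il: "i < 2 * Suc s + 1" "l < 2 * Suc s + 1" and il': "i < 2 * s + 3" "l < 2 * s + 3" by auto
    define X where "X c = ?g $$ (2 * Suc s - c, l)" for c
    have "(ctrans star ?g * jmat (Suc s) * ?g) $$ (i, l) = (\<Sum>c\<in>{0..<2 * s + 3}. star (?g $$ (c, i)) * X c)"
      unfolding X_def N[symmetric] by (rule unitary_index[OF c il])
    also have "\<dots> = (\<Sum>c\<in>{0..<2 * s + 3}. (if c = i then X c else 0) +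
        (if c = Suc s then (if i = s then - b * X c else 0) else 0) +
        (if c = Suc (Suc s) then (if i = s then star t * X c else if i = Suc s then star b * X c else 0) else 0))"
    proof (intro sum.cong refl)
      fix c assume "c \<in> {0..<2 * s + 3}"
      then have "star (?g $$ (c, i)) = (if c = i then 1 else if c = Suc s \<and> i = s then - b
          else if c = Suc (Suc s) \<and> i = s then star t else if c = Suc (Suc s) \<and> i = Suc s then star b else 0)"
        using il' by (simp add: shear3_def)
      then show "star (?g $$ (c, i)) * X c = (if c = i then X c else 0) +
        (if c = Suc s then (if i = s then - b * X c else 0) else 0) +
        (if c = Suc (Suc s) then (if i = s then star t * X c else if i = Suc s then star b * X c else 0) else 0)"
        by (cases "c = i"; cases "i = s"; cases "i = Suc s") auto
    qed
    also have "\<dots> = X i + (if i = s then - b * X (Suc s) else 0) + (if i = s then star t * X (Suc (Suc s)) else if i = Suc s then star b * X (Suc (Suc s)) else 0)"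
      unfolding sum.distrib using il' by (simp add: sum.delta')
    also have "\<dots> = (if i + l = 2 * Suc s then 1 else 0)"
    proof -
      have X2: "X (Suc (Suc s)) = (if l = s then 1 else 0)"
        unfolding X_def using il' by (simp add: shear3_def)
      have X1: "X (Suc s) = (if l = Suc s then 1 else if l = s then - star b else 0)"
        unfolding X_def using il' by (simp add: shear3_def)
      consider "i = s" | "i = Suc s" | "i \<noteq> s" "i \<noteq> Suc s"
        by blast
      then show ?thesis
      proof cases
        case 1
        have "2 * Suc s - s = Suc (Suc s)" by simp
        then have "X i = (if l = Suc (Suc s) then 1 else if l = s then t else if l = Suc s then b else 0)"
          unfolding X_def 1 using il' by (simp add: shear3_def)
        then show ?thesis
          unfolding X1 X2 using 1 rel by auto
      next
        case 2
        then show ?thesis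
          unfolding 2 X1 X2 by auto
      next
        case 3
        have "2 * Suc s - i \<noteq> Suc s" "2 * Suc s - i \<noteq> Suc (Suc s)" "2 * Suc s - i < 2 * s + 3"
          using 3 il by auto
        then have "X i = (if 2 * Suc s - i = l then 1 else 0)"
          unfolding X_def using il' by (simp add: shear3_def)
        moreover have "2 * Suc s - i = l \<longleftrightarrow> i + l = 2 * Suc s" using il by auto
        ultimately show ?thesis
          using 3 by simp
      qed
    qed
    also have "\<dots> = jmat (Suc s) $$ (i, l)" using il by (simp add: jmat_def)
    finally show "(ctrans star ?g * jmat (Suc s) * ?g) $$ (i, l) = jmat (Suc s) $$ (i, l)" .
  qed (use c in auto)
  show "nrm (?g $$ (i, l)) \<le> 1" if "i < 2 * Suc s + 1" "l < 2 * Suc s + 1" for i l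
    using that bt unfolding N by (simp add: shear3_def)
qed

definition swap3 :: "nat \<Rightarrow> nat \<Rightarrow> nat" where
  "swap3 s a = (if a = s then Suc (Suc s) else if a = Suc (Suc s) then s else a)"

lemma swap3:
  shows "a \<le> 2 * Suc s \<Longrightarrow> swap3 s a \<le> 2 * Suc s" "swap3 s (swap3 s a) = a"
    "a \<le> 2 * Suc s \<Longrightarrow> swap3 s (2 * Suc s - a) = 2 * Suc s - swap3 s a"
  by (auto simp: swap3_def)

text \<open>The top one of the last n rows carries x in the three middle columns; it is the isotropy
  of x that allows such a row in a unitary matrix. When the last coordinate is not 1, the first one
  is, and a permutation in K exchanges the outer columns of a shear.\<close>

definition elt3 :: "nat \<Rightarrow> 'a \<times> 'a \<times> 'a \<Rightarrow> 'a mat" where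
  "elt3 s x = (case x of (a, b, c) \<Rightarrow> if c = 1 then shear3 s b a else shear3 s b c * perm_mat (Suc s) (swap3 s))"

lemma lines3_cases:
  assumes "(x1, x2, x3) \<in> lines3 N"
  shows "nrm x1 \<le> 1" "nrm x2 \<le> 1" "nrm x3 \<le> 1" "x3 \<noteq> 1 \<Longrightarrow> x1 = 1"
    "x3 = 1 \<Longrightarrow> tr x1 + nm x2 = 0" "x1 = 1 \<Longrightarrow> tr x3 + nm x2 = 0"
proof -
  have "(x1, x2, x3) \<in> isotropic3" using assms lines3_isotropic by blast
  then show "nrm x1 \<le> 1" "nrm x2 \<le> 1" "nrm x3 \<le> 1" "x3 = 1 \<Longrightarrow> tr x1 + nm x2 = 0" "x1 = 1 \<Longrightarrow> tr x3 + nm x2 = 0"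
    by (auto simp: isotropic3_def herm3_def tr_def add.commute)
  show "x3 \<noteq> 1 \<Longrightarrow> x1 = 1" using assms by (auto simp: lines3_def)
qed

lemma elt3:
  assumes x: "(x1, x2, x3) \<in> lines3 N"
  shows "elt3 s (x1, x2, x3) \<in> maxcompact nrm star (Suc s)"
    "\<And>j a b. j \<le> s \<Longrightarrow> a < j \<Longrightarrow> b < 2 * s + 3 - j \<Longrightarrow> elt3 s (x1, x2, x3) $$ (2 * s + 3 - j + a, b) = 0"
    "\<And>a b. a < Suc s \<Longrightarrow> b < 2 * s + 3 \<Longrightarrow> elt3 s (x1, x2, x3) $$ (Suc (Suc s) + a, b) =
       (if a = 0 then if b = s then x1 else if b = Suc s then x2 else if b = Suc (Suc s) then x3 else 0
        else if b = Suc (Suc s) + a then 1 else 0)"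
proof -
  note xc = lines3_cases[OF x]
  have N2: "2 * Suc s + 1 = 2 * s + 3" by simp
  have el: "elt3 s (x1, x2, x3) = (if x3 = 1 then shear3 s x2 x1 else shear3 s x2 x3 * perm_mat (Suc s) (swap3 s))"
    by (simp add: elt3_def)
  have perm: "perm_mat (Suc s) (swap3 s) \<in> maxcompact nrm star (Suc s)"
    using swap3 by (intro perm_mat_maxcompact)
  show "elt3 s (x1, x2, x3) \<in> maxcompact nrm star (Suc s)"
    unfolding el using shear3_maxcompact[of x2 x1 s] maxcompact_mult[OF shear3_maxcompact[of x2 x3 s] perm] xc by simp
  have idx: "(shear3 s u v * perm_mat (Suc s) (swap3 s)) $$ (a, b) = shear3 s u v $$ (a, swap3 s b)"
    if "a < 2 * s + 3" "b < 2 * s + 3" for u v a b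
    by (rule mult_perm_mat_index) (use that swap3 N2 in \<open>auto simp: shear3_def\<close>)
  have row: "elt3 s (x1, x2, x3) $$ (a, b) = (if a = Suc (Suc s) then if b = s then x1 else if b = Suc s then x2 else if b = Suc (Suc s) then x3 else 0
        else if b = a then 1 else 0)" if ab: "Suc s < a" "a < 2 * s + 3" "b < 2 * s + 3" for a b
  proof (cases "x3 = 1")
    case True
    then show ?thesis
      using ab True unfolding el by (simp add: shear3_def)
  next
    case False
    have "swap3 s b < 2 * s + 3" using swap3(1)[of b s] ab N2 by simp
    moreover have "elt3 s (x1, x2, x3) $$ (a, b) = shear3 s x2 x3 $$ (a, swap3 s b)"
      using False idx[OF ab(2,3)] by (simp add: el)
    ultimately have "elt3 s (x1, x2, x3) $$ (a, b) = (if a = swap3 s b then 1 else if a = Suc (Suc s) \<and> swap3 s b = s then x3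
        else if a = Suc (Suc s) \<and> swap3 s b = Suc s then x2 else 0)"
      using ab by (simp add: shear3_def)
    then show ?thesis
      using False xc(4) ab(1) by (auto simp: swap3_def)
  qed
  show "elt3 s (x1, x2, x3) $$ (2 * s + 3 - j + a, b) = 0" if j: "j \<le> s" "a < j" "b < 2 * s + 3 - j" for j a b
  proof -
    define l where "l = 2 * s + 3 - j + a"
    have l: "Suc s < l" "l < 2 * s + 3" "b < 2 * s + 3" "b < l" "l \<noteq> Suc (Suc s)"
      using j by (auto simp: l_def)
    then show ?thesis
      unfolding l_def[symmetric] row[OF l(1-3)] by auto
  qed
  show "elt3 s (x1, x2, x3) $$ (Suc (Suc s) + a, b) =
       (if a = 0 then if b = s then x1 else if b = Suc s then x2 else if b = Suc (Suc s) then x3 else 0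
        else if b = Suc (Suc s) + a then 1 else 0)" if a: "a < Suc s" "b < 2 * s + 3" for a b
    using row[of "Suc (Suc s) + a" b] a by auto
qed

section \<open>The last minor as the norm of a linear form\<close>

lemma lin3_le:
  assumes "nrm m1 \<le> C" "nrm m2 \<le> C" "nrm m3 \<le> C" "x \<in> isotropic3"
  shows "nrm (lin3 (m1, m2, m3) x) \<le> C"
proof -
  obtain a b c where x: "x = (a, b, c)" "nrm a \<le> 1" "nrm b \<le> 1" "nrm c \<le> 1"
    using assms(4) by (auto simp: isotropic3_def)
  have "nrm (a * m1) \<le> 1 * C" "nrm (b * m2) \<le> 1 * C" "nrm (c * m3) \<le> 1 * C"
    using x assms by (intro nrm_mult_le; simp)+
  then show ?thesis
    unfolding x(1) lin3_def by (auto intro!: nrm_add_le)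
qed

text \<open>In the last r rows and columns, with r at most n, every index sum exceeds
  \<open>2 * n\<close>. The block of \<open>jmat n\<close> is therefore 0, and only the projection
  part of the decomposition contributes.\<close>

lemma lower_block_decomposition:
  assumes V: "V \<in> carrier_mat (2 * n + 1) n" and C: "C \<in> carrier_mat n n" and r: "r \<le> n"
  shows "lower_right_minor r (jmat n - 2 \<cdot>\<^sub>m (V * C * ctrans star V)) =
    (- 2) ^ r * det (block_of (2 * n + 1 - r) 0 r n V * C * ctrans star (block_of (2 * n + 1 - r) 0 r n V))"
proof -
  define N where "N = 2 * n + 1"
  have V': "V \<in> carrier_mat N n" using V by (simp add: N_def)
  define W where "W = block_of (N - r) 0 r n V"
  have W: "W \<in> carrier_mat r n" by (simp add: W_def)
  have Vs: "ctrans star V \<in> carrier_mat n N" and Ws: "ctrans star W \<in> carrier_mat n r"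
    by (rule ctrans_carrier[OF V'] ctrans_carrier[OF W])+
  have VC: "V * C \<in> carrier_mat N n" and WC: "W * C \<in> carrier_mat r n" using V' W C by auto
  define G where "G = V * C * ctrans star V"
  have G: "G \<in> carrier_mat N N" unfolding G_def by (rule mult_carrier_mat[OF VC Vs])
  have J: "(jmat n :: 'a mat) \<in> carrier_mat N N" unfolding N_def by (rule jmat_carrier)
  have y: "jmat n - 2 \<cdot>\<^sub>m G \<in> carrier_mat N N" using G by auto
  have rN: "r \<le> N" using r by (simp add: N_def)
  have Gidx: "G $$ (N - r + a, N - r + b) = (W * C * ctrans star W) $$ (a, b)" if ab: "a < r" "b < r" for a b
  proof -
    have ab': "N - r + a < N" "N - r + b < N" using ab rN by auto
    have "G $$ (N - r + a, N - r + b) = (\<Sum>l\<in>{0..<n}. (\<Sum>i\<in>{0..<n}. V $$ (N - r + a, i) * C $$ (i, l)) * star (V $$ (N - r + b, l)))"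
      unfolding G_def mult_index_sum[OF VC Vs ab'] using ab' V' mult_index_sum[OF V' C ab'(1)] by (intro sum.cong) auto
    also have "\<dots> = (\<Sum>l\<in>{0..<n}. (\<Sum>i\<in>{0..<n}. W $$ (a, i) * C $$ (i, l)) * star (W $$ (b, l)))"
      using ab by (intro sum.cong arg_cong2[of _ _ _ _ "(*)"]) (auto simp: W_def)
    also have "\<dots> = (W * C * ctrans star W) $$ (a, b)"
      unfolding mult_index_sum[OF WC Ws ab] using ab W mult_index_sum[OF W C ab(1)] by (intro sum.cong) auto
    finally show ?thesis .
  qed
  have Jidx: "(jmat n :: 'a mat) $$ (N - r + a, N - r + b) = 0" if ab: "a < r" "b < r" for a b
    using ab r by (simp add: jmat_def N_def)
  have "block_of (N - r) (N - r) r r (jmat n - 2 \<cdot>\<^sub>m G) = (- 2) \<cdot>\<^sub>m (W * C * ctrans star W)"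
    using W rN G Gidx Jidx by auto
  then show ?thesis
    using lower_right_minor_block[OF y, of r] W det_smult[of "- 2" "W * C * ctrans star W"]
    by (simp add: G_def W_def N_def)
qed

text \<open>Put \<open>V = g * U\<close>. The minor of order n for an element h of K acting on
  \<open>act star g x\<close> is \<open>(- 2) ^ n * det C\<close> times the norm of the determinant
  of the last n rows of \<open>h * V\<close>. For \<open>h = elt3 s z\<close> only the top row
  depends on z, so this determinant is a linear form in z with coefficients the middle entries of
  \<open>V * \<xi>\<close>. The entries further down vanish because \<open>W * \<xi> = 0\<close>;
  hence the Gram value of \<open>\<xi>\<close> is \<open>herm3\<close> of these coefficients, which
  relates it to the minor of order s.\<close>

lemma rank_one_symplectic:
  fixes g x U S C :: "'a mat" and n s :: nat
  defines "D \<equiv> \<lambda>z. lower_right_minor n (act star (elt3 s z) (act star g x))"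
  assumes U: "U \<in> carrier_mat (2 * n + 1) n" and S: "S \<in> carrier_mat n n" and C: "C \<in> carrier_mat n n"
    and SU: "S = ctrans star U * jmat n * U" and SC: "S * C = 1\<^sub>m n"
    and x: "x = jmat n - 2 \<cdot>\<^sub>m (U * C * ctrans star U)" and n: "n = Suc s"
    and g: "g \<in> maxcompact nrm star n" and d: "lower_right_minor s (act star g x) \<noteq> 0"
  shows "\<exists>\<beta> e. \<beta> + int e = val (lower_right_minor s (act star g x)) \<and>
    (\<forall>N\<ge>1. (\<forall>z\<in>lines3 N. nrm (D z) \<le> real q powi (- \<beta>) \<and>
        (D z \<noteq> 0 \<longrightarrow>
          (\<exists>i. nrm (D z) = real q powi (- (\<beta> + 2 * i))))) \<and>
      (\<forall>j<N. int (card {z \<in> lines3 N. nrm (D z) = real q powi (- (\<beta> + 2 * int j))}) = count3 e N j))"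
proof -
  define M where "M = 2 * n + 1"
  have Msn: "M = 2 * s + 3" "M - n = Suc (Suc s)" "M - s = Suc (Suc (Suc s))" by (auto simp: M_def n)
  define J where "J = (jmat n :: 'a mat)"
  have J: "J \<in> carrier_mat M M" unfolding J_def M_def by (rule jmat_carrier)
  note U' = U[folded M_def]
  have actV: "act star h x = jmat n - 2 \<cdot>\<^sub>m ((h * U) * C * ctrans star (h * U))" if h: "h \<in> maxcompact nrm star n" for h
  proof -
    note hD = maxcompactD[OF h, folded M_def J_def]
    have hs: "ctrans star h \<in> carrier_mat M M" and Us: "ctrans star U \<in> carrier_mat n M"
      by (rule ctrans_carrier[OF hD(1)] ctrans_carrier[OF U'])+
    have UC: "U * C \<in> carrier_mat M n" and G: "U * C * ctrans star U \<in> carrier_mat M M"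
      using U' C Us by auto
    have "h * x = h * J - h * (2 \<cdot>\<^sub>m (U * C * ctrans star U))"
      unfolding x J_def[symmetric] by (rule mult_minus_distrib_mat[OF hD(1) J]) (use G in auto)
    also have "h * (2 \<cdot>\<^sub>m (U * C * ctrans star U)) = 2 \<cdot>\<^sub>m (h * (U * C * ctrans star U))"
      by (rule mult_smult_distrib[OF hD(1) G])
    finally have "act star h x = (h * J - 2 \<cdot>\<^sub>m (h * (U * C * ctrans star U))) * ctrans star h"
      by (simp add: act_def)
    also have "\<dots> = h * J * ctrans star h - 2 \<cdot>\<^sub>m (h * (U * C * ctrans star U)) * ctrans star h"
      by (rule minus_mult_distrib_mat[OF mult_carrier_mat[OF hD(1) J] _ hs]) (use mult_carrier_mat[OF hD(1) G] in auto)
    also have "h * J * ctrans star h = J" using unitaryI(2)[OF maxcompactD(1,2)[OF h]] by (simp add: J_def)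
    also have "2 \<cdot>\<^sub>m (h * (U * C * ctrans star U)) * ctrans star h = 2 \<cdot>\<^sub>m (h * (U * C * ctrans star U) * ctrans star h)"
      by (rule mult_smult_assoc_mat[OF mult_carrier_mat[OF hD(1) G] hs])
    also have "h * (U * C * ctrans star U) * ctrans star h = h * (U * C) * ctrans star U * ctrans star h"
      by (simp only: assoc_mult_mat[OF hD(1) UC Us])
    also have "\<dots> = h * (U * C) * (ctrans star U * ctrans star h)"
      by (rule assoc_mult_mat[OF mult_carrier_mat[OF hD(1) UC] Us hs])
    also have "ctrans star U * ctrans star h = ctrans star (h * U)"
      by (rule ctrans_mult[OF hD(1) U', symmetric])
    also have "h * (U * C) = h * U * C" by (rule assoc_mult_mat[OF hD(1) U' C, symmetric])
    finally show ?thesis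
      by (simp add: J_def)
  qed
  note gD = maxcompactD[OF g, folded M_def J_def]
  define V where "V = g * U"
  have V: "V \<in> carrier_mat M n" unfolding V_def by (rule mult_carrier_mat[OF gD(1) U'])
  have SV: "S = ctrans star V * J * V"
    by (smt (verit) ctrans_carrier gD U' V_def ctrans_mult assoc_mult_mat mult_carrier_mat J SU J_def)
  have Vs: "ctrans star V \<in> carrier_mat n M" by (rule ctrans_carrier[OF V])
  have Sh: "ctrans star S = S"
  proof -
    have "ctrans star S = ctrans star V * ctrans star (ctrans star V * J)"
      unfolding SV by (rule ctrans_mult[OF mult_carrier_mat[OF Vs J] V])
    also have "ctrans star (ctrans star V * J) = J * V" using ctrans_mult[OF Vs J] by (simp add: J_def)
    also have "ctrans star V * (J * V) = S" unfolding SV by (rule assoc_mult_mat[OF Vs J V, symmetric])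
    finally show ?thesis .
  qed
  define W where "W = block_of (M - s) 0 s n V"
  have W: "W \<in> carrier_mat s (Suc s)" by (simp add: W_def n)
  have ds: "lower_right_minor s (act star g x) = (- 2) ^ s * det (W * C * ctrans star W)"
    unfolding actV[OF g] using lower_block_decomposition[OF V[unfolded V_def M_def] C, of s] n by (simp add: V_def W_def M_def)
  then have nz: "det (W * C * ctrans star W) \<noteq> 0" using d by auto
  obtain \<xi> where \<xi>: "\<xi> \<in> carrier_mat (Suc s) 1" "W * \<xi> = 0\<^sub>m s 1"
    "\<And>v. det (mat (Suc s) (Suc s) (\<lambda>(a, b). if a = 0 then v b else W $$ (a - 1, b))) = (\<Sum>l\<in>{0..<Suc s}. v l * \<xi> $$ (l, 0))"
    "(ctrans star \<xi> * S * \<xi>) $$ (0, 0) = det S * det (W * C * ctrans star W)"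
  proof (rule complementary_vector[OF S[unfolded n] C[unfolded n] SC[unfolded n] Sh W nz], goal_cases)
    case (1 \<xi>)
    then show ?case
      by (intro 1(1))
  qed
  have \<xi>n: "\<xi> \<in> carrier_mat n 1" using \<xi>(1) by (simp add: n)
  define v where "v c = (\<Sum>l\<in>{0..<Suc s}. V $$ (c, l) * \<xi> $$ (l, 0))" for c
  have v0: "v c = 0" if "Suc (Suc s) < c" "c < M" for c
  proof -
    define a where "a = c - Suc (Suc (Suc s))"
    have a: "a < s" "c = M - s + a" using that by (auto simp: a_def Msn)
    have "v c = (W * \<xi>) $$ (a, 0)"
      using mult_index_sum[OF W \<xi>(1) a(1), of 0] a by (auto simp: v_def W_def n intro!: sum.cong)
    then show ?thesis
      unfolding \<xi>(2) using a by simp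
  qed
  define m1 m2 m3 where "m1 = v s" and "m2 = v (Suc s)" and "m3 = v (Suc (Suc s))"
  have h3: "herm3 (m1, m2, m3) = (ctrans star \<xi> * S * \<xi>) $$ (0, 0)"
  proof -
    define X where "X = V * \<xi>"
    have X: "X \<in> carrier_mat M 1" unfolding X_def by (rule mult_carrier_mat[OF V \<xi>n])
    have Xi: "X $$ (c, 0) = v c" if "c < M" for c
      using mult_index_sum[OF V \<xi>n that, of 0] by (simp add: X_def v_def n)
    have \<xi>s: "ctrans star \<xi> \<in> carrier_mat 1 n" by (rule ctrans_carrier[OF \<xi>n])
    have "ctrans star \<xi> * S * \<xi> = ctrans star \<xi> * (ctrans star V * (J * V)) * \<xi>"
      unfolding SV by (simp only: assoc_mult_mat[OF Vs J V])
    also have "\<dots> = ctrans star \<xi> * ctrans star V * (J * V) * \<xi>"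
      by (simp only: assoc_mult_mat[OF \<xi>s Vs mult_carrier_mat[OF J V]])
    also have "\<dots> = ctrans star \<xi> * ctrans star V * (J * V * \<xi>)"
      by (rule assoc_mult_mat[OF mult_carrier_mat[OF \<xi>s Vs] mult_carrier_mat[OF J V] \<xi>n])
    also have "J * V * \<xi> = J * X" unfolding X_def by (rule assoc_mult_mat[OF J V \<xi>n])
    also have "ctrans star \<xi> * ctrans star V = ctrans star X"
      unfolding X_def by (rule ctrans_mult[OF V \<xi>n, symmetric])
    finally have "(ctrans star \<xi> * S * \<xi>) $$ (0, 0) = (\<Sum>c\<in>{0..<M}. ctrans star X $$ (0, c) * (J * X) $$ (c, 0))"
      using mult_index_sum[OF ctrans_carrier[OF X] mult_carrier_mat[OF J X], of 0 0] by simp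
    also have "\<dots> = (\<Sum>c\<in>{0..<M}. star (v c) * v (2 * n - c))"
    proof (intro sum.cong refl)
      fix c assume "c \<in> {0..<M}"
      then have c: "c < M" "2 * n - c < M" by (auto simp: M_def)
      show "ctrans star X $$ (0, c) * (J * X) $$ (c, 0) = star (v c) * v (2 * n - c)"
        using c X Xi jmat_mult_index[OF X[unfolded M_def], of c 0] by (simp add: J_def M_def)
    qed
    also have "\<dots> = (\<Sum>c\<in>{s, Suc s, Suc (Suc s)}. star (v c) * v (2 * n - c))"
    proof (rule sum.mono_neutral_right)
      show "\<forall>c\<in>{0..<M} - {s, Suc s, Suc (Suc s)}. star (v c) * v (2 * n - c) = 0"
      proof
        fix c assume c: "c \<in> {0..<M} - {s, Suc s, Suc (Suc s)}"
        show "star (v c) * v (2 * n - c) = 0"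
        proof (cases "c < s")
          case True
          then show ?thesis
            using v0[of "2 * n - c"] by (simp add: n Msn)
        next
          case False
          then show ?thesis
            using v0[of c] c by simp
        qed
      qed
    qed (auto simp: Msn)
    also have "\<dots> = star m1 * m3 + (star m2 * m2 + star m3 * m1)" by (auto simp: n m1_def m2_def m3_def)
    finally show ?thesis
      by (simp add: herm3_def tr_def nm_def star_mult algebra_simps)
  qed
  have detSC: "det S * det C = 1" using det_mult[OF S C] SC by (simp add: det_one)
  then have dC0: "det C \<noteq> 0" by auto
  have n2: "nrm ((- 2) ^ i) = 1" for i by (simp add: nrm_power)
  have dn: "nrm (D (x1, x2, x3)) = nrm (det C) * nrm (lin3 (m1, m2, m3) (x1, x2, x3)) ^ 2"
    if z: "(x1, x2, x3) \<in> lines3 N" for x1 x2 x3 N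
  proof -
    define h where "h = elt3 s (x1, x2, x3)"
    note el = elt3[OF z, where s = s]
    have h: "h \<in> maxcompact nrm star n" using el(1) by (simp add: h_def n)
    note hD = maxcompactD[OF h, folded M_def J_def]
    have xc: "x \<in> carrier_mat M M"
      unfolding x by (rule minus_carrier_mat) (use mult_carrier_mat[OF mult_carrier_mat[OF U' C] ctrans_carrier[OF U', of star]] in \<open>auto simp: M_def\<close>)
    have "act star h (act star g x) = act star (h * g) x" using act_mult[OF hD(1) gD(1) xc] by simp
    also have "\<dots> = jmat n - 2 \<cdot>\<^sub>m (h * V * C * ctrans star (h * V))"
      unfolding V_def using actV[OF maxcompact_mult[OF h g]] assoc_mult_mat[OF hD(1) gD(1) U'] by simp
    finally have a1: "act star h (act star g x) = jmat n - 2 \<cdot>\<^sub>m (h * V * C * ctrans star (h * V))" .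
    define L where "L = block_of (M - n) 0 n n (h * V)"
    have L: "L \<in> carrier_mat n n" by (simp add: L_def)
    have hV: "h * V \<in> carrier_mat (2 * n + 1) n" using hD V by (auto simp: M_def)
    have "lower_right_minor n (act star h (act star g x)) = (- 2) ^ n * det (L * C * ctrans star L)"
      unfolding a1 using lower_block_decomposition[OF hV C, of n] by (simp add: L_def M_def)
    also have "det (L * C * ctrans star L) = det L * det C * star (det L)"
      using det_mult[OF mult_carrier_mat[OF L C] ctrans_carrier[OF L]] det_mult[OF L C] det_ctrans[OF L] by simp
    finally have e1: "nrm (lower_right_minor n (act star h (act star g x))) = nrm (det C) * nrm (det L) ^ 2"
      using n2 by (simp add: nrm_mult power2_eq_square)
    define w where "w l = x1 * V $$ (s, l) + x2 * V $$ (Suc s, l) + x3 * V $$ (Suc (Suc s), l)" for l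
    have "L = mat (Suc s) (Suc s) (\<lambda>(a, b). if a = 0 then w b else W $$ (a - 1, b))"
    proof (rule eq_matI)
      fix a b assume "a < dim_row (mat (Suc s) (Suc s) (\<lambda>(a, b). if a = 0 then w b else W $$ (a - 1, b)))"
        "b < dim_col (mat (Suc s) (Suc s) (\<lambda>(a, b). if a = 0 then w b else W $$ (a - 1, b)))"
      then have ab: "a < Suc s" "b < Suc s" by auto
      have r: "Suc (Suc s) + a < M" "b < n" using ab by (auto simp: Msn n)
      have "L $$ (a, b) = (\<Sum>c\<in>{0..<M}. h $$ (Suc (Suc s) + a, c) * V $$ (c, b))"
        using ab mult_index_sum[OF hD(1) V r] by (simp add: L_def Msn n)
      also have "\<dots> = (if a = 0 then w b else W $$ (a - 1, b))"
      proof (cases "a = 0")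
        case True
        have "(\<Sum>c\<in>{0..<M}. h $$ (Suc (Suc s) + a, c) * V $$ (c, b)) =
            (\<Sum>c\<in>{0..<M}. (if c = s then x1 * V $$ (c, b) else 0) + (if c = Suc s then x2 * V $$ (c, b) else 0) + (if c = Suc (Suc s) then x3 * V $$ (c, b) else 0))"
          using el(3)[OF ab(1)] True by (intro sum.cong) (auto simp: h_def Msn)
        also have "\<dots> = w b" unfolding sum.distrib by (simp add: sum.delta' Msn w_def)
        finally show ?thesis
          using True by simp
      next
        case False
        have "(\<Sum>c\<in>{0..<M}. h $$ (Suc (Suc s) + a, c) * V $$ (c, b)) = (\<Sum>c\<in>{0..<M}. if c = Suc (Suc s) + a then V $$ (c, b) else 0)"
          using el(3)[OF ab(1)] False by (intro sum.cong) (auto simp: h_def Msn)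
        also have "\<dots> = V $$ (Suc (Suc s) + a, b)" using r by (simp add: sum.delta')
        also have "\<dots> = W $$ (a - 1, b)" using False ab by (simp add: W_def Msn n)
        finally show ?thesis
          using False by simp
      qed
      finally show "L $$ (a, b) = mat (Suc s) (Suc s) (\<lambda>(a, b). if a = 0 then w b else W $$ (a - 1, b)) $$ (a, b)"
        using ab by simp
    qed (auto simp: L_def n)
    then have "det L = (\<Sum>l\<in>{0..<Suc s}. w l * \<xi> $$ (l, 0))" using \<xi>(3) by simp
    also have "\<dots> = x1 * m1 + x2 * m2 + x3 * m3"
      unfolding w_def m1_def m2_def m3_def v_def sum_distrib_left distrib_right sum.distrib by (simp add: mult.assoc)
    finally have "det L = lin3 (m1, m2, m3) (x1, x2, x3)" by (simp add: lin3_def)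
    then show ?thesis
      using e1 by (simp add: h_def D_def)
  qed
  have nzh: "herm3 (m1, m2, m3) \<noteq> 0" unfolding h3 \<xi>(4) using nz detSC by auto
  obtain \<gamma> e where law: "lin3_law (m1, m2, m3) \<gamma> e"
    using ex_lin3_law[OF nzh] by blast
  define \<sigma> where "\<sigma> = val (det C)"
  have nC: "nrm (det C) = real q powi (- \<sigma>)" unfolding \<sigma>_def by (rule nrm_val[OF dC0])
  have q0: "real q \<noteq> 0" using q_ge_2 by simp
  \<comment> \<open>A norm has twice the valuation of its argument, which explains the steps of
    length 2 in the valuations of the last minor.\<close>
  have dn_iff: "nrm (det C) * X ^ 2 = real q powi (- (\<sigma> + 2 * \<gamma> + 2 * i)) \<longleftrightarrow> X = real q powi (- (\<gamma> + i))" if "X \<ge> 0" for X i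
  proof -
    have "real q powi (- (\<sigma> + 2 * \<gamma> + 2 * i)) = nrm (det C) * (real q powi (- (\<gamma> + i))) ^ 2"
      unfolding nC power2_eq_square q_powi_add[symmetric] by (simp add: algebra_simps)
    then show ?thesis
      using that dC0 nrm_eq_0[of "det C"] by (simp add: power2_eq_iff_nonneg)
  qed
  have "nrm (lower_right_minor s (act star g x)) = nrm (det C) * nrm (herm3 (m1, m2, m3))"
  proof -
    have "nrm (det C) * nrm (det S) = 1" using detSC nrm_mult[of "det S" "det C"] by (simp add: mult.commute)
    then show ?thesis
      unfolding h3 \<xi>(4) ds nrm_mult n2 by (simp add: mult.assoc[symmetric])
  qed
  also have "\<dots> = real q powi (- (\<sigma> + 2 * \<gamma> + int e))"
    using law unfolding lin3_law_def nC by (simp add: q_powi_add[symmetric] algebra_simps)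
  finally have "\<sigma> + 2 * \<gamma> + int e = val (lower_right_minor s (act star g x))"
    by (intro val_eqI[symmetric])
  moreover have "nrm (D z) \<le> real q powi (- (\<sigma> + 2 * \<gamma>)) \<and>
      (D z \<noteq> 0 \<longrightarrow>
          (\<exists>i. nrm (D z) = real q powi (- (\<sigma> + 2 * \<gamma> + 2 * i))))"
    if z: "z \<in> lines3 N" for z N
  proof -
    obtain x1 x2 x3 where z3: "z = (x1, x2, x3)"
      by (cases z)
    note dz = dn[OF z[unfolded z3]]
    have b: "nrm (lin3 (m1, m2, m3) (x1, x2, x3)) \<le> real q powi (- \<gamma>)"
      using law z lines3_isotropic unfolding z3 lin3_law_def by (intro lin3_le) auto
    have "nrm (det C) * nrm (lin3 (m1, m2, m3) (x1, x2, x3)) ^ 2 \<le> nrm (det C) * (real q powi (- \<gamma>)) ^ 2"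
      using b by (intro mult_left_mono power_mono) (auto simp: nrm_nonneg)
    also have "\<dots> = real q powi (- (\<sigma> + 2 * \<gamma>))"
      using dn_iff[of "real q powi (- \<gamma>)" 0] q_ge_2 by simp
    finally have le: "nrm (D z) \<le> real q powi (- (\<sigma> + 2 * \<gamma>))"
      unfolding z3 dz .
    have "\<exists>i. nrm (D z) = real q powi (- (\<sigma> + 2 * \<gamma> + 2 * i))"
      if "D z \<noteq> 0"
    proof -
      have "nrm (D z) \<noteq> 0" using that nrm_eq_0 by blast
      then have "lin3 (m1, m2, m3) (x1, x2, x3) \<noteq> 0" unfolding z3 dz by auto
      then obtain i where "nrm (lin3 (m1, m2, m3) (x1, x2, x3)) = real q powi (- i)" using ex_nrm_eq by blast
      then have "nrm (lin3 (m1, m2, m3) (x1, x2, x3)) = real q powi (- (\<gamma> + (i - \<gamma>)))" by simp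
      then show ?thesis
        unfolding z3 dz using dn_iff[OF nrm_nonneg] by blast
    qed
    then show ?thesis
      using le by blast
  qed
  moreover have "int (card {z \<in> lines3 N. nrm (D z) = real q powi (- (\<sigma> + 2 * \<gamma> + 2 * int j))}) = count3 e N j"
    if "1 \<le> N" "j < N" for N j
  proof -
    have "{z \<in> lines3 N. nrm (D z) = real q powi (- (\<sigma> + 2 * \<gamma> + 2 * int j))} =
        {z \<in> lines3 N. nrm (lin3 (m1, m2, m3) z) = real q powi (- (\<gamma> + int j))}"
    proof (intro Collect_cong conj_cong refl)
      fix z assume z: "z \<in> lines3 N"
      obtain x1 x2 x3 where z3: "z = (x1, x2, x3)"
        by (cases z)
      show "nrm (D z) = real q powi (- (\<sigma> + 2 * \<gamma> + 2 * int j)) \<longleftrightarrow>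
          nrm (lin3 (m1, m2, m3) z) = real q powi (- (\<gamma> + int j))"
        unfolding z3 dn[OF z[unfolded z3]] by (rule dn_iff[OF nrm_nonneg])
    qed
    then show ?thesis
      using law that unfolding lin3_law_def by simp
  qed
  ultimately show ?thesis
    by blast
qed

end

subsection \<open>Fibers of the valuation map on the maximal compact subgroup\<close>

text \<open>The components of t are the differences of the valuations of successive minors, so
  \<open>psum t i\<close> recovers the valuation of the i-th minor.\<close>

definition psum :: "(nat \<Rightarrow> int) \<Rightarrow> nat \<Rightarrow> int" where
  "psum t i = (\<Sum>j\<in>{1..i}. t j)"

definition lattice_cone :: "nat \<Rightarrow> nat \<Rightarrow> (nat \<Rightarrow> int) set" where
  "lattice_cone n B = {t. (\<forall>i. i \<notin> {1..n} \<longrightarrow> t i = 0) \<and> (\<forall>i\<in>{1..n}. - int B \<le> psum t i)}"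

lemma mat_dist_le_iff:
  "mat_dist nrm n g h \<le> d \<longleftrightarrow> (\<forall>i<2 * n + 1. \<forall>l<2 * n + 1. nrm (g $$ (i, l) - h $$ (i, l)) \<le> d)"
  unfolding mat_dist_def by (subst Max_le_iff) auto

locale spherical_setting = unramified_quadratic_extension p q k star nrm uf
  for p q :: nat and k :: "'a::field_char_0 set" and star :: "'a \<Rightarrow> 'a" and nrm :: "'a \<Rightarrow> real" and uf :: 'a +
  fixes n :: nat and dk :: "'a mat measure" and x :: "'a mat"
  assumes n_ge_1: "n \<ge> 1" and haar: "normalized_Haar nrm star n dk" and x_space: "x \<in> hermitian_space star n"
begin

abbreviation K where "K \<equiv> maxcompact nrm star n"

definition minor :: "nat \<Rightarrow> 'a mat \<Rightarrow> 'a" where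
  "minor i g = lower_right_minor i (act star g x)"

definition fiber :: "(nat \<Rightarrow> int) \<Rightarrow> 'a mat set" where
  "fiber t = {g \<in> K. \<forall>i\<in>{1..n}. nrm (minor i g) = real q powi (- psum t i)}"

lemmas x_carrier = hermitian_spaceD(1)[OF x_space] and x_hermitian = hermitian_spaceD(2)[OF x_space]

lemma nrm_le_mat_dist: "i < 2 * n + 1 \<Longrightarrow> l < 2 * n + 1 \<Longrightarrow> nrm (g $$ (i, l) - h $$ (i, l)) \<le> mat_dist nrm n g h"
  using mat_dist_le_iff[of nrm n g h "mat_dist nrm n g h"] by blast

lemma mat_dist_nonneg: "0 \<le> mat_dist nrm n g h"
  using nrm_le_mat_dist[of 0 0 g h] nrm_nonneg[of "g $$ (0, 0) - h $$ (0, 0)"] by simp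

lemma Metric_space_K: "Metric_space K (mat_dist nrm n)"
proof
  show "mat_dist nrm n g h = mat_dist nrm n h g" for g h by (simp add: mat_dist_def nrm_minus_commute)
  show "mat_dist nrm n g h = 0 \<longleftrightarrow> g = h" if gh: "g \<in> K" "h \<in> K" for g h
  proof
    assume "mat_dist nrm n g h = 0"
    then have "nrm (g $$ (i, l) - h $$ (i, l)) \<le> 0" if "i < 2 * n + 1" "l < 2 * n + 1" for i l
      using nrm_le_mat_dist[OF that, of g h] by simp
    then have e: "g $$ (i, l) = h $$ (i, l)" if "i < 2 * n + 1" "l < 2 * n + 1" for i l
      using that nrm_nonneg[of "g $$ (i, l) - h $$ (i, l)"] nrm_eq_0[of "g $$ (i, l) - h $$ (i, l)"] by force
    show "g = h" by (rule eq_matI) (use e maxcompactD(1)[OF gh(1)] maxcompactD(1)[OF gh(2)] in auto)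
  next
    assume "g = h"
    then have "mat_dist nrm n g h \<le> 0" by (simp add: mat_dist_le_iff)
    then show "mat_dist nrm n g h = 0" using mat_dist_nonneg[of g h] by simp
  qed
  show "mat_dist nrm n g h' \<le> mat_dist nrm n g h + mat_dist nrm n h h'" for g h h'
    unfolding mat_dist_le_iff
  proof (intro allI impI)
    fix i l assume il: "i < 2 * n + 1" "l < 2 * n + 1"
    have "g $$ (i, l) - h' $$ (i, l) = (g $$ (i, l) - h $$ (i, l)) + (h $$ (i, l) - h' $$ (i, l))" by simp
    then have "nrm (g $$ (i, l) - h' $$ (i, l)) \<le> max (nrm (g $$ (i, l) - h $$ (i, l))) (nrm (h $$ (i, l) - h' $$ (i, l)))"
      using nrm_add by metis
    then show "nrm (g $$ (i, l) - h' $$ (i, l)) \<le> mat_dist nrm n g h + mat_dist nrm n h h'"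
      using nrm_le_mat_dist[OF il, of g h] nrm_le_mat_dist[OF il, of h h'] mat_dist_nonneg[of g h] mat_dist_nonneg[of h h'] by linarith
  qed
qed (rule mat_dist_nonneg)

lemma haarD:
  shows "space dk = K" "sets dk = sigma_sets K {U. openin (Metric_space.mtopology K (mat_dist nrm n)) U}"
    "emeasure dk K = 1" "g \<in> K \<Longrightarrow> A \<in> sets dk \<Longrightarrow> emeasure dk ((\<lambda>h. g * h) ` A) = emeasure dk A"
  using haar by (auto simp: normalized_Haar_def Let_def)

lemma open_in_sets:
  assumes "A \<subseteq> K" "\<And>g. g \<in> A \<Longrightarrow> \<exists>e>0. \<forall>h\<in>K. mat_dist nrm n g h < e \<longrightarrow> h \<in> A"
  shows "A \<in> sets dk"
proof -
  have "openin (Metric_space.mtopology K (mat_dist nrm n)) A"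
    unfolding Metric_space.openin_mtopology[OF Metric_space_K] Metric_space.mball_def[OF Metric_space_K]
  proof (intro conjI allI impI assms(1))
    fix g assume "g \<in> A"
    then obtain e where "e > 0" "\<forall>h\<in>K. mat_dist nrm n g h < e \<longrightarrow> h \<in> A"
      using assms(2) by blast
    then show "\<exists>r>0. {y. g \<in> K \<and> y \<in> K \<and> mat_dist nrm n g y < r} \<subseteq> A"
      by (intro exI[of _ e]) auto
  qed
  then show ?thesis
    unfolding haarD(2) by (intro sigma_sets.Basic) simp
qed

text \<open>Minors of \<open>act star g x\<close> are polynomials in integral entries and their
  conjugates, with coefficients depending on x. They are therefore bounded and Lipschitz on K, and
  by the ultrametric inequality their absolute values are locally constant where they do not
  vanish.\<close>

lemma minor_bound: "\<exists>B. \<forall>g\<in>K. \<forall>i\<le>n. nrm (minor i g) \<le> real q powi (int B)"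
  and minor_close: "g \<in> K \<Longrightarrow> i \<le> n \<Longrightarrow> minor i g \<noteq> 0 \<Longrightarrow>
    \<exists>e>0. \<forall>h\<in>K. mat_dist nrm n g h < e \<longrightarrow> nrm (minor i h) = nrm (minor i g)"
proof -
  let ?N = "2 * n + 1"
  define C where "C = Max (insert 1 ((\<lambda>(i, l). nrm (x $$ (i, l))) ` ({..<?N} \<times> {..<?N})))"
  have C1: "1 \<le> C" unfolding C_def by (rule Max_ge) auto
  have Cx: "nrm (x $$ (a, b)) \<le> C" if "a < ?N" "b < ?N" for a b
    unfolding C_def by (rule Max_ge) (use that in auto)
  note xc = x_carrier
  have cs: "nrm (ctrans star h $$ (a, b)) \<le> d" if "h \<in> carrier_mat ?N ?N" "\<And>a b. a < ?N \<Longrightarrow> b < ?N \<Longrightarrow> nrm (h $$ (a, b)) \<le> d"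
      "a < ?N" "b < ?N" for h d a b
    using that by (auto simp: nrm_star)
  have tri: "nrm ((A * x * ctrans star D) $$ (a, b)) \<le> u * C * v"
    if A: "A \<in> carrier_mat ?N ?N" "\<And>a b. a < ?N \<Longrightarrow> b < ?N \<Longrightarrow> nrm (A $$ (a, b)) \<le> u"
      and D: "D \<in> carrier_mat ?N ?N" "\<And>a b. a < ?N \<Longrightarrow> b < ?N \<Longrightarrow> nrm (D $$ (a, b)) \<le> v"
      and uv: "0 \<le> u" "0 \<le> v" "a < ?N" "b < ?N" for A D u v a b
  proof -
    have 1: "nrm ((A * x) $$ (c, d)) \<le> u * C" if "c < ?N" "d < ?N" for c d
      using nrm_mult_mat_le[OF A(1) xc uv(1) _ A(2) Cx that] C1 by simp
    show ?thesis
      using nrm_mult_mat_le[OF mult_carrier_mat[OF A(1) xc] ctrans_carrier[OF D(1)] _ uv(2) 1 cs[OF D] uv(3,4)] C1 uv by simp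
  qed
  have ac: "act star g x \<in> carrier_mat ?N ?N" if "g \<in> K" for g
    by (rule act_carrier[OF maxcompactD(1)[OF that] xc])
  have aC: "nrm (act star g x $$ (a, b)) \<le> C" if "g \<in> K" "a < ?N" "b < ?N" for g a b
    using tri[of g 1 g 1 a b] maxcompactD[OF that(1)] that by (simp add: act_def)
  have ad: "nrm (act star g x $$ (a, b) - act star h x $$ (a, b)) \<le> mat_dist nrm n g h * C"
    if gh: "g \<in> K" "h \<in> K" and ab: "a < ?N" "b < ?N" for g h a b
  proof -
    note gD = maxcompactD[OF gh(1)] and hD = maxcompactD[OF gh(2)]
    have dc: "g - h \<in> carrier_mat ?N ?N" using gD hD by (intro minus_carrier_mat)
    have de: "nrm ((g - h) $$ (c, d)) \<le> mat_dist nrm n g h" if "c < ?N" "d < ?N" for c d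
      using nrm_le_mat_dist[OF that, of g h] that gD(1) hD(1) by auto
    have gx: "g * x \<in> carrier_mat ?N ?N" and hx: "h * x \<in> carrier_mat ?N ?N"
      and gs: "ctrans star g \<in> carrier_mat ?N ?N" and hs: "ctrans star h \<in> carrier_mat ?N ?N"
      using gD(1) hD(1) xc ctrans_carrier by auto
    have "(g - h) * x * ctrans star g = g * x * ctrans star g - h * x * ctrans star g"
      unfolding minus_mult_distrib_mat[OF gD(1) hD(1) xc] minus_mult_distrib_mat[OF gx hx gs] ..
    moreover have "h * x * ctrans star (g - h) = h * x * ctrans star g - h * x * ctrans star h"
      unfolding ctrans_diff[OF gD(1) hD(1)] mult_minus_distrib_mat[OF hx gs hs] ..
    ultimately have "act star g x $$ (a, b) - act star h x $$ (a, b) =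
        ((g - h) * x * ctrans star g) $$ (a, b) + (h * x * ctrans star (g - h)) $$ (a, b)"
      using ab carrier_matD[OF mult_carrier_mat[OF gx gs]] carrier_matD[OF mult_carrier_mat[OF hx gs]] carrier_matD[OF mult_carrier_mat[OF hx hs]]
      by (simp add: act_def)
    moreover have "nrm (((g - h) * x * ctrans star g) $$ (a, b)) \<le> mat_dist nrm n g h * C * 1"
      using gD mat_dist_nonneg by (intro tri[OF dc de] ab) auto
    moreover have "nrm ((h * x * ctrans star (g - h)) $$ (a, b)) \<le> 1 * C * mat_dist nrm n g h"
      using hD mat_dist_nonneg by (intro tri[OF _ _ dc de] ab) auto
    ultimately show ?thesis
      by (metis mult.commute mult_1 nrm_add_le)
  qed
  have mb: "minor i g = det (block_of (?N - i) (?N - i) i i (act star g x))" if "g \<in> K" for g i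
    unfolding minor_def by (rule lower_right_minor_block[OF ac[OF that]])
  obtain B where B: "C ^ n < real q ^ B"
    using real_arch_pow[of "real q" "C ^ n"] q_ge_2 by auto
  have "nrm (minor i g) \<le> real q powi (int B)" if g: "g \<in> K" and i: "i \<le> n" for g i
  proof -
    have "nrm (minor i g) \<le> C ^ i" unfolding mb[OF g] by (rule nrm_det_le) (use C1 i aC[OF g] in auto)
    also have "\<dots> \<le> C ^ n" using C1 i by (intro power_increasing) auto
    finally show ?thesis
      using B by simp
  qed
  then show "\<exists>B. \<forall>g\<in>K. \<forall>i\<le>n. nrm (minor i g) \<le> real q powi (int B)"
    by blast
  assume g: "g \<in> K" and i: "i \<le> n" and nz: "minor i g \<noteq> 0"
  define e where "e = nrm (minor i g) / (C * C ^ i)"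
  have "e > 0" using nrm_pos[OF nz] C1 by (simp add: e_def)
  moreover have "nrm (minor i h) = nrm (minor i g)" if h: "h \<in> K" and d: "mat_dist nrm n g h < e" for h
  proof -
    have "nrm (minor i g - minor i h) \<le> mat_dist nrm n g h * C * C ^ i"
      unfolding mb[OF g] mb[OF h]
      by (rule nrm_det_diff_le) (use C1 i aC[OF g] aC[OF h] ad[OF g h] mat_dist_nonneg in auto)
    moreover have "mat_dist nrm n g h * C * C ^ i < nrm (minor i g)"
      using d C1 by (simp add: e_def pos_less_divide_eq mult.assoc)
    ultimately show ?thesis
      using nrm_eq_of_close by blast
  qed
  ultimately show "\<exists>e>0. \<forall>h\<in>K. mat_dist nrm n g h < e \<longrightarrow> nrm (minor i h) = nrm (minor i g)"
    by blast
qed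

lemma fiber_subset: "fiber t \<subseteq> K" by (auto simp: fiber_def)

lemma fiber_minor_nz: "g \<in> fiber t \<Longrightarrow> i \<in> {1..n} \<Longrightarrow> minor i g \<noteq> 0"
  using q_ge_2 by (force simp: fiber_def)

lemma fiber_open:
  assumes "g \<in> fiber t" shows "\<exists>e>0. \<forall>h\<in>K. mat_dist nrm n g h < e \<longrightarrow> h \<in> fiber t"
proof -
  have g: "g \<in> K" using assms fiber_subset by blast
  have "\<forall>i\<in>{1..n}. \<exists>e>0. \<forall>h\<in>K. mat_dist nrm n g h < e \<longrightarrow> nrm (minor i h) = nrm (minor i g)"
    using minor_close[OF g] fiber_minor_nz[OF assms] by auto
  then obtain e where e: "\<And>i. i \<in> {1..n} \<Longrightarrow> 0 < e i"
      "\<And>i h. i \<in> {1..n} \<Longrightarrow> h \<in> K \<Longrightarrow> mat_dist nrm n g h < e i \<Longrightarrow> nrm (minor i h) = nrm (minor i g)"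
    by (metis (no_types))
  have ne: "e ` {1..n} \<noteq> {}" using n_ge_1 by auto
  show ?thesis
  proof (intro exI conjI ballI impI)
    show "0 < Min (e ` {1..n})" using e(1) ne by (subst Min_gr_iff) auto
    show "h \<in> fiber t" if h: "h \<in> K" "mat_dist nrm n g h < Min (e ` {1..n})" for h
    proof -
      have "mat_dist nrm n g h < e i" if "i \<in> {1..n}" for i
        using h(2) that ne by (subst (asm) Min_gr_iff) auto
      then show ?thesis
        using e(2)[OF _ h(1)] assms h(1) by (simp add: fiber_def)
    qed
  qed
qed

lemma translate_open:
  assumes h: "h \<in> K" and g: "g \<in> K" "h * g \<in> fiber t"
  shows "\<exists>e>0. \<forall>g'\<in>K. mat_dist nrm n g g' < e \<longrightarrow> h * g' \<in> fiber t"
proof -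
  obtain e where e: "e > 0" "\<And>h'. h' \<in> K \<Longrightarrow> mat_dist nrm n (h * g) h' < e \<Longrightarrow> h' \<in> fiber t"
    using fiber_open[OF g(2)] by blast
  have "mat_dist nrm n (h * g) (h * g') \<le> mat_dist nrm n g g'" if g': "g' \<in> K" for g'
    unfolding mat_dist_le_iff
  proof (intro allI impI)
    fix i l assume il: "i < 2 * n + 1" "l < 2 * n + 1"
    note hD = maxcompactD[OF h] and gD = maxcompactD[OF g(1)] and g'D = maxcompactD[OF g']
    have "(h * g) $$ (i, l) - (h * g') $$ (i, l) = (h * (g - g')) $$ (i, l)"
      unfolding mult_minus_distrib_mat[OF hD(1) gD(1) g'D(1)]
      using il carrier_matD[OF mult_carrier_mat[OF hD(1) gD(1)]] carrier_matD[OF mult_carrier_mat[OF hD(1) g'D(1)]] by simp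
    also have "nrm \<dots> \<le> 1 * mat_dist nrm n g g'"
    proof (rule nrm_mult_mat_le[OF hD(1) minus_carrier_mat[OF g'D(1)]])
      show "nrm ((g - g') $$ (a, b)) \<le> mat_dist nrm n g g'" if "a < 2 * n + 1" "b < 2 * n + 1" for a b
        using nrm_le_mat_dist[OF that, of g g'] that gD(1) g'D(1) by auto
    qed (use hD(3) il mat_dist_nonneg in auto)
    finally show "nrm ((h * g) $$ (i, l) - (h * g') $$ (i, l)) \<le> mat_dist nrm n g g'" by simp
  qed
  then show ?thesis
    using e maxcompact_mult[OF h] by (meson le_less_trans)
qed

lemma translate_sets: "h \<in> K \<Longrightarrow> {g \<in> K. h * g \<in> fiber t} \<in> sets dk"
  using translate_open by (intro open_in_sets) auto

lemma fiber_sets: "fiber t \<in> sets dk" using fiber_subset fiber_open by (intro open_in_sets) auto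

text \<open>Invariance of the measure is given for images under left multiplication. The preimage of
  the fiber is mapped onto the fiber because h is invertible in K.\<close>

lemma measure_translate:
  assumes h: "h \<in> K" shows "measure dk {g \<in> K. h * g \<in> fiber t} = measure dk (fiber t)"
proof -
  obtain h' where h': "h' \<in> K" "h * h' = 1\<^sub>m (2 * n + 1)"
    using maxcompact_inverse[OF h] by blast
  have "(\<lambda>g. h * g) ` {g \<in> K. h * g \<in> fiber t} = fiber t"
  proof (intro equalityI subsetI)
    fix g assume g: "g \<in> fiber t"
    then have gK: "g \<in> K" using fiber_subset by blast
    have "h * (h' * g) = g"
      using assoc_mult_mat[OF maxcompactD(1)[OF h] maxcompactD(1)[OF h'(1)] maxcompactD(1)[OF gK]] h'(2)
        left_mult_one_mat[OF maxcompactD(1)[OF gK]] by simp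
    moreover have "h' * g \<in> K" by (rule maxcompact_mult[OF h'(1) gK])
    ultimately show "g \<in> (\<lambda>g. h * g) ` {g \<in> K. h * g \<in> fiber t}"
      using g by (intro image_eqI[of _ _ "h' * g"]) auto
  qed auto
  then show ?thesis
    using haarD(4)[OF h translate_sets[OF h, of t]] by (simp add: measure_def)
qed

lemma finite_measure_dk: "finite_measure dk" by (rule finite_measureI) (simp add: haarD)

text \<open>A finite form of Fubini: summing the equal measures of translates amounts to integrating
  the number of translates of g that lie in the fiber.\<close>

lemma fiber_average:
  assumes R: "finite R" "\<And>z. z \<in> R \<Longrightarrow> h z \<in> K"
  shows "integrable dk (\<lambda>g. real (card {z \<in> R. h z * g \<in> fiber t}))"
    "(\<integral>g. real (card {z \<in> R. h z * g \<in> fiber t}) \<partial>dk) = real (card R) * measure dk (fiber t)"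
proof -
  interpret finite_measure dk
    by (rule finite_measure_dk)
  let ?A = "\<lambda>z. {g \<in> K. h z * g \<in> fiber t}"
  have eq: "real (card {z \<in> R. h z * g \<in> fiber t}) = (\<Sum>z\<in>R. indicat_real (?A z) g)" if "g \<in> space dk" for g
    using that haarD R by (auto simp: indicator_def Int_def)
  have int: "integrable dk (indicat_real (?A z))" if "z \<in> R" for z
    using translate_sets[OF R(2)[OF that]] by (simp add: integrable_indicator_iff less_top[symmetric])
  have "integrable dk (\<lambda>g. \<Sum>z\<in>R. indicat_real (?A z) g)"
    using int by (intro Bochner_Integration.integrable_sum)
  then show "integrable dk (\<lambda>g. real (card {z \<in> R. h z * g \<in> fiber t}))"
    using eq by (subst Bochner_Integration.integrable_cong[OF refl eq])
  have "(\<integral>g. real (card {z \<in> R. h z * g \<in> fiber t}) \<partial>dk) = (\<integral>g. (\<Sum>z\<in>R. indicat_real (?A z) g) \<partial>dk)"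
    using eq by (intro Bochner_Integration.integral_cong) auto
  also have "\<dots> = (\<Sum>z\<in>R. \<integral>g. indicat_real (?A z) g \<partial>dk)"
    using int by (intro Bochner_Integration.integral_sum)
  also have "\<dots> = (\<Sum>z\<in>R. measure dk (fiber t))"
  proof (intro sum.cong refl)
    fix z assume z: "z \<in> R"
    have "?A z \<inter> space dk = ?A z" by (auto simp: haarD)
    then show "(\<integral>g. indicat_real (?A z) g \<partial>dk) = measure dk (fiber t)"
      using measure_translate[OF R(2)[OF z], of t] by (simp only: Bochner_Integration.integral_indicator)
  qed
  finally show "(\<integral>g. real (card {z \<in> R. h z * g \<in> fiber t}) \<partial>dk) = real (card R) * measure dk (fiber t)"
    by simp
qed

lemma fiber_cone: "\<exists>B. \<forall>t. fiber t \<noteq> {} \<longrightarrow> (\<forall>i\<in>{1..n}. - int B \<le> psum t i)"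
proof -
  obtain B where B: "\<And>g i. g \<in> K \<Longrightarrow> i \<le> n \<Longrightarrow> nrm (minor i g) \<le> real q powi (int B)"
    using minor_bound by blast
  have "- int B \<le> psum t i" if "g \<in> fiber t" "i \<in> {1..n}" for g t i
  proof -
    have "nrm (minor i g) = real q powi (- psum t i)" "g \<in> K" using that by (auto simp: fiber_def)
    then have "real q powi (- psum t i) \<le> real q powi (int B)" using B[of g i] that(2) by simp
    then show ?thesis
      unfolding q_powi_le_iff by simp
  qed
  then show ?thesis
    by blast
qed

end

section \<open>Simple reflections along lines of exponents\<close>

definition simple_root :: "nat \<Rightarrow> nat \<Rightarrow> nat \<Rightarrow> int" where
  "simple_root n i = (if i < n then (\<lambda>l. unit_vec_int i l - unit_vec_int (i + 1) l) else (\<lambda>l. 2 * unit_vec_int i l))"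

definition simple_refl :: "nat \<Rightarrow> nat \<Rightarrow> (nat \<Rightarrow> int) \<Rightarrow> nat \<Rightarrow> int" where
  "simple_refl n i t = (if i < n then t(i := t (i + 1), i + 1 := t i) else t(i := - t i))"

text \<open>The pairing of t with the coroot of the simple root. On the line of all t plus l times
  the simple root, the reflection sends l to \<open>- coroot n i t - l\<close>.\<close>

definition coroot :: "nat \<Rightarrow> nat \<Rightarrow> (nat \<Rightarrow> int) \<Rightarrow> int" where
  "coroot n i t = (if i < n then t i - t (i + 1) else t i)"

lemma simple_refl_line: "simple_refl n i t = (\<lambda>l. t l - coroot n i t * simple_root n i l)"
  by (auto simp: simple_refl_def simple_root_def coroot_def unit_vec_int_def fun_eq_iff)

lemma psum_add: "psum (\<lambda>l. t l + u l) i = psum t i + psum u i" by (simp add: psum_def sum.distrib)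

lemma psum_scale: "psum (\<lambda>l. c * t l) i = c * psum t i" by (simp add: psum_def sum_distrib_left)

lemma psum_diff: "psum (\<lambda>l. t l - u l) i = psum t i - psum u i" by (simp add: psum_def sum_subtractf)

lemma psum_0 [simp]: "psum t 0 = 0" by (simp add: psum_def)

lemma psum_Suc: "psum t (Suc i) = psum t i + t (Suc i)" by (simp add: psum_def)

lemma psum_unit_vec: "1 \<le> i \<Longrightarrow> psum (unit_vec_int i) j = (if i \<le> j then 1 else 0)"
  by (simp add: psum_def unit_vec_int_def)

text \<open>Translation by a simple root changes the valuation of exactly one minor, which is why
  the averaging may vary a single minor.\<close>

lemma psum_simple_root:
  assumes "1 \<le> i" "i \<le> n" "j \<le> n"
  shows "psum (simple_root n i) j = (if j = i then if i < n then 1 else 2 else 0)"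
  using assms by (auto simp: simple_root_def psum_diff psum_scale psum_unit_vec)

text \<open>Extending P by 0 gives h with \<open>f m + f (m - 1) = h m - h (m - 1) / q\<close>. The
  weighted sum telescopes to \<open>h m\<close> because h vanishes below \<open>\<beta>\<close>. The
  coefficients of h are palindromic on the interval from \<open>\<beta>\<close> to
  \<open>\<beta> + e\<close>, and l and l' are symmetric about its centre. The values of f are known
  below \<open>\<beta> + N\<close> only, which forces the bounds on l and l'.\<close>

lemma (in unramified_quadratic_extension) line_symmetry:
  fixes f :: "int \<Rightarrow> real" and \<beta> l l' :: int and e N L :: nat and G P :: "nat \<Rightarrow> real"
  assumes zero: "\<And>l. l < \<beta> \<Longrightarrow> f l = 0" and gen: "\<And>j. j < N \<Longrightarrow> f (\<beta> + int j) = A * G j"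
    and pal: "G 0 = P 0" "\<And>j. G (Suc j) + G j = P (Suc j) - P j / real q"
    and sym: "\<And>j. j \<le> e \<Longrightarrow> P (e - j) = P j" "\<And>j. e < j \<Longrightarrow> P j = 0"
    and l: "l + l' = 2 * \<beta> + int e" "l < \<beta> + int N" "l' < \<beta> + int N" "l - int L < \<beta>" "l' - int L < \<beta>"
  shows "(\<Sum>j<L. (1 / real q) ^ j * (f (l - int j) + f (l - int (Suc j)))) =
    (\<Sum>j<L. (1 / real q) ^ j * (f (l' - int j) + f (l' - int (Suc j))))"
proof -
  define h where "h m = (if m < \<beta> then 0 else A * P (nat (m - \<beta>)))" for m
  have h: "f m + f (m - 1) = h m - h (m - 1) / real q" if "m < \<beta> + int N" for m
  proof (cases "m \<le> \<beta>")
    case True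
    then show ?thesis
      using zero[of m] zero[of "m - 1"] gen[of 0] pal(1) that by (auto simp: h_def)
  next
    case False
    define j where "j = nat (m - \<beta> - 1)"
    have m: "m = \<beta> + int (Suc j)" "m - 1 = \<beta> + int j" using False by (auto simp: j_def)
    then have "f m + f (m - 1) = A * (G (Suc j) + G j)"
      using gen[of j] gen[of "Suc j"] that by (simp add: algebra_simps)
    moreover have "h m = A * P (Suc j)" "h (m - 1) = A * P j"
    proof -
      have "nat (m - \<beta>) = Suc j" "nat (m - 1 - \<beta>) = j" using m by linarith+
      then show "h m = A * P (Suc j)" "h (m - 1) = A * P j" using False by (auto simp: h_def)
    qed
    ultimately show ?thesis
      unfolding pal(2) by (simp add: algebra_simps)
  qed
  have tel: "(\<Sum>j<L'. (1 / real q) ^ j * (f (m - int j) + f (m - int (Suc j)))) = h m - (1 / real q) ^ L' * h (m - int L')"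
    if "m < \<beta> + int N" for m L'
  proof (induction L')
    case (Suc L')
    have e: "f (m - int L') + f (m - int (Suc L')) = h (m - int L') - h (m - int (Suc L')) / real q"
      using h[of "m - int L'"] that by (simp add: algebra_simps)
    show ?case
      unfolding sum.lessThan_Suc Suc.IH e by (simp add: algebra_simps)
  qed simp
  have S: "(\<Sum>j<L. (1 / real q) ^ j * (f (m - int j) + f (m - int (Suc j)))) = h m"
    if "m < \<beta> + int N" "m - int L < \<beta>" for m
    using tel[OF that(1), of L] that(2) by (simp add: h_def)
  have hh: "h m = h m'" if "m + m' = 2 * \<beta> + int e" "m < \<beta>" for m m'
    using that sym by (auto simp: h_def)
  have "h l = h l'"
  proof (cases "l < \<beta> \<or> l' < \<beta>")
    case True
    then show ?thesis
      using hh[of l l'] hh[of l' l] l(1) by (auto simp: add.commute)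
  next
    case False
    then have "nat (l' - \<beta>) \<le> e" "nat (l - \<beta>) = e - nat (l' - \<beta>)"
      using l(1) by linarith+
    then show ?thesis
      using sym(1) False by (simp add: h_def)
  qed
  then show ?thesis
    using S l by simp
qed

section \<open>Symmetry of the coefficients by averaging over K\<close>

context spherical_setting begin

text \<open>Although \<open>\<beta>\<close> and e vary with g, the sum
  \<open>2 * \<beta> + e\<close> is always l', so \<open>line_symmetry\<close> applies to the counts
  of every g with the same pair 0 and l'. Integration over K transfers the symmetry to the measures.
  The bound B keeps \<open>\<beta>\<close> away from minus infinity and thus allows N and L to be
  independent of g.\<close>

lemma reflection_core:
  fixes R :: "'b set" and h :: "'b \<Rightarrow> 'a mat" and T :: "int \<Rightarrow> nat \<Rightarrow> int" and G P :: "nat \<Rightarrow> nat \<Rightarrow> real"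
  defines "cnt \<equiv> \<lambda>g l. card {z \<in> R. h z * g \<in> fiber (T l)}"
  assumes R: "finite R" "R \<noteq> {}" "\<And>z. z \<in> R \<Longrightarrow> h z \<in> K" and \<rho>: "\<rho> \<noteq> 0"
    and B: "\<And>l. fiber (T l) \<noteq> {} \<Longrightarrow> - int B \<le> l"
    and NL: "0 < N" "int B < int N" "l' + int B < int N" "int B < int L" "l' + int B < int L"
    and pal: "\<And>e. G e 0 = P e 0" "\<And>e. P e 0 \<noteq> 0" "\<And>e j. G e (Suc j) + G e j = P e (Suc j) - P e j / real q"
    and sym: "\<And>e j. j \<le> e \<Longrightarrow> P e (e - j) = P e j" "\<And>e j. e < j \<Longrightarrow> P e j = 0"
    and A: "A \<noteq> 0"
    and data: "\<And>g. g \<in> K \<Longrightarrow> (\<forall>l. cnt g l = 0) \<or>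
      (\<exists>\<beta> e. 2 * \<beta> + int e = l' \<and> (\<forall>l<\<beta>. cnt g l = 0) \<and> (\<forall>j<N. \<rho> ^ j * real (cnt g (\<beta> + int j)) = A * G e j))"
  defines "F \<equiv> \<lambda>l. \<rho> powi l * measure dk (fiber (T l))"
  shows "(\<Sum>j<L. (1 / real q) ^ j * (F (0 - int j) + F (0 - int (Suc j)))) =
    (\<Sum>j<L. (1 / real q) ^ j * (F (l' - int j) + F (l' - int (Suc j))))"
proof -
  define f where "f g l = \<rho> powi l * real (cnt g l)" for g l
  define S where "S \<phi> l = (\<Sum>j<L. (1 / real q) ^ j * (\<phi> (l - int j) + \<phi> (l - int (Suc j))))" for \<phi> :: "int \<Rightarrow> real" and l
  have f: "integrable dk (\<lambda>g. f g l)" "(\<integral>g. f g l \<partial>dk) = real (card R) * F l" for l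
    using fiber_average[OF R(1,3), where t = "T l"] by (auto simp: f_def F_def cnt_def)
  have int: "(\<integral>g. S (f g) l \<partial>dk) = real (card R) * S F l" for l
    by (auto simp: S_def f sum_distrib_left algebra_simps)
  have "S (f g) 0 = S (f g) l'" if g: "g \<in> K" for g
    using data[OF g]
  proof (elim disjE exE conjE)
    assume "\<forall>l. cnt g l = 0"
    then show ?thesis
      by (simp add: S_def f_def)
  next
    fix \<beta> e assume e: "2 * \<beta> + int e = l'" and z: "\<forall>l<\<beta>. cnt g l = 0"
      and c: "\<forall>j<N. \<rho> ^ j * real (cnt g (\<beta> + int j)) = A * G e j"
    \<comment> \<open>The leading coefficient of the palindrome is nonzero, so some translate of g
      lies in the fiber at \<open>\<beta>\<close>, and the cone bounds \<open>\<beta>\<close> from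
      below.\<close>
    have "cnt g \<beta> \<noteq> 0"
    proof
      assume "cnt g \<beta> = 0"
      then have "A * G e 0 = 0" using c[rule_format, OF NL(1)] by simp
      then show False
        using A pal(1,2)[of e] by simp
    qed
    then have "fiber (T \<beta>) \<noteq> {}" by (auto simp: cnt_def)
    then have \<beta>: "- int B \<le> \<beta>" by (rule B)
    show ?thesis
      unfolding S_def
    proof (rule line_symmetry[where \<beta> = \<beta> and e = e and N = N and G = "G e" and P = "P e" and A = "\<rho> powi \<beta> * A"])
      show "f g (\<beta> + int j) = \<rho> powi \<beta> * A * G e j" if "j < N" for j
        using c[rule_format, OF that] \<rho> by (simp add: f_def power_int_add mult.assoc)
    qed (use z pal sym e \<beta> NL in \<open>auto simp: f_def\<close>)
  qed
  then have "(\<integral>g. S (f g) 0 \<partial>dk) = (\<integral>g. S (f g) l' \<partial>dk)"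
    by (intro Bochner_Integration.integral_cong) (auto simp: haarD)
  then have "S F 0 = S F l'" using int R(1,2) by simp
  then show ?thesis
    by (simp add: S_def)
qed

lemma lines_nonempty:
  assumes "N \<ge> 1" shows "lines2 N \<noteq> {}" "lines3 N \<noteq> {}"
proof -
  have "(1, 0) \<in> primitive2" "(1, 0, 0) \<in> isotropic3"
    by (auto simp: primitive2_def isotropic3_def herm3_def tr_def nm_def)
  then show "lines2 N \<noteq> {}" "lines3 N \<noteq> {}" using lines2_ex lines3_ex assms by blast+
qed

lemma minor_mult: "h \<in> K \<Longrightarrow> g \<in> K \<Longrightarrow> minor j (h * g) = lower_right_minor j (act star h (act star g x))"
  unfolding minor_def using act_mult[OF maxcompactD(1) maxcompactD(1) x_carrier] by simp

text \<open>All translates of g have the same minors in absolute value except for the i-th. If those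
  of g fit t, the counts along the root line are level counts of the i-th minor, with levels spaced
  by d; otherwise they all vanish. In the coordinate l, the relation between b, e and the
  neighbouring minors becomes \<open>2 * \<beta> + e = - coroot n i t\<close>.\<close>

lemma line_data:
  fixes R :: "'b set" and h :: "'b \<Rightarrow> 'a mat" and t :: "nat \<Rightarrow> int" and count :: "nat \<Rightarrow> nat \<Rightarrow> int" and i :: nat and g :: "'a mat"
  defines "d \<equiv> if i < n then 1 else 2 :: int"
  defines "cnt \<equiv> \<lambda>l. card {z \<in> R. h z * g \<in> fiber (\<lambda>j. t j + l * simple_root n i j)}"
  assumes i: "1 \<le> i" "i \<le> n" and g: "g \<in> K" and h: "\<And>z. z \<in> R \<Longrightarrow> h z \<in> K"
    and other: "\<And>z j. z \<in> R \<Longrightarrow> j \<in> {1..n} \<Longrightarrow> j \<noteq> i \<Longrightarrow> nrm (minor j (h z * g)) = nrm (minor j g)"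
    and law: "(\<And>j. j \<le> n \<Longrightarrow> j \<noteq> i \<Longrightarrow> minor j g \<noteq> 0) \<Longrightarrow> \<exists>b e.
      2 * b + d * int e = val (minor (i - 1) g) + val (minor (if i < n then i + 1 else i - 1) g) \<and>
      (\<forall>z\<in>R. nrm (minor i (h z * g)) \<le> real q powi (- b) \<and>
        (minor i (h z * g) \<noteq> 0 \<longrightarrow> (\<exists>m. nrm (minor i (h z * g)) = real q powi (- (b + d * m))))) \<and>
      (\<forall>j<N. int (card {z \<in> R. nrm (minor i (h z * g)) = real q powi (- (b + d * int j))}) = count e j)"
    and count: "\<And>e j. j < N \<Longrightarrow> \<rho> ^ j * real_of_int (count e j) = A * G e j"
  shows "(\<forall>l. cnt l = 0) \<or> (\<exists>\<beta> e. 2 * \<beta> + int e = - coroot n i t \<and> (\<forall>l<\<beta>. cnt l = 0) \<and>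
    (\<forall>j<N. \<rho> ^ j * real (cnt (\<beta> + int j)) = A * G e j))"
proof -
  have mem: "h z * g \<in> fiber (\<lambda>j. t j + l * simple_root n i j) \<longleftrightarrow>
      (\<forall>j\<in>{1..n} - {i}. nrm (minor j g) = real q powi (- psum t j)) \<and> nrm (minor i (h z * g)) = real q powi (- (psum t i + d * l))"
    if z: "z \<in> R" for z l
    using i maxcompact_mult[OF h[OF z] g] other[OF z] unfolding fiber_def
    by (auto simp: psum_add psum_scale psum_simple_root d_def Ball_def mult.commute)
  show ?thesis
  proof (cases "\<forall>j\<in>{1..n} - {i}. nrm (minor j g) = real q powi (- psum t j)")
    case False
    then have e: "{z \<in> R. h z * g \<in> fiber (\<lambda>j. t j + l * simple_root n i j)} = {}" for l
      using mem by blast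
    show ?thesis
      unfolding cnt_def e by simp
  next
    case True
    then have cnt: "cnt l = card {z \<in> R. nrm (minor i (h z * g)) = real q powi (- (psum t i + d * l))}" for l
      using mem unfolding cnt_def by (intro arg_cong[of _ _ card]) blast
    have v: "minor j g \<noteq> 0" "val (minor j g) = psum t j" if "j \<le> n" "j \<noteq> i" for j
    proof -
      have "nrm (minor j g) = real q powi (- psum t j)"
        using True that by (cases "j = 0") (auto simp: minor_def lower_right_minor_0)
      moreover have "real q powi (- psum t j) \<noteq> 0" using q_ge_2 by simp
      ultimately show "minor j g \<noteq> 0" "val (minor j g) = psum t j" using val_eqI by (metis nrm_0)+
    qed
    obtain b e where b: "2 * b + d * int e = val (minor (i - 1) g) + val (minor (if i < n then i + 1 else i - 1) g)"
      "\<And>z. z \<in> R \<Longrightarrow> nrm (minor i (h z * g)) \<le> real q powi (- b)"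
      "\<And>z. z \<in> R \<Longrightarrow> minor i (h z * g) \<noteq> 0 \<Longrightarrow> \<exists>m. nrm (minor i (h z * g)) = real q powi (- (b + d * m))"
      "\<And>j. j < N \<Longrightarrow> int (card {z \<in> R. nrm (minor i (h z * g)) = real q powi (- (b + d * int j))}) = count e j"
      using law[OF v(1)] by blast
    have cnt0: "cnt l = 0" if "\<And>z. z \<in> R \<Longrightarrow> nrm (minor i (h z * g)) \<noteq> real q powi (- (psum t i + d * l))" for l
      using that unfolding cnt by (metis (mono_tags, lifting) card.empty empty_Collect_eq)
    show ?thesis
    proof (cases "d dvd b - psum t i")
      \<comment> \<open>This occurs only for the long root: the valuations of the last minor have a
        fixed parity, and the line through t may consist of exponents of the other parity.\<close>
      case False
      have "cnt l = 0" for l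
      proof (rule cnt0)
        fix z assume z: "z \<in> R"
        show "nrm (minor i (h z * g)) \<noteq> real q powi (- (psum t i + d * l))"
        proof
          assume eq: "nrm (minor i (h z * g)) = real q powi (- (psum t i + d * l))"
          moreover have "real q powi (- (psum t i + d * l)) \<noteq> 0" using q_ge_2 by simp
          ultimately have "minor i (h z * g) \<noteq> 0" by auto
          then obtain m where "real q powi (- (psum t i + d * l)) = real q powi (- (b + d * m))"
            using b(3)[OF z] eq by auto
          then have "b - psum t i = d * (l - m)" unfolding q_powi_eq_iff by (simp add: algebra_simps)
          then show False
            using False by simp
        qed
      qed
      then show ?thesis
        by blast
    next
      case True
      then obtain \<beta> where \<beta>: "b = psum t i + d * \<beta>"
        by (metis add_diff_cancel_left' diff_add_cancel add.commute dvdE)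
      have "2 * \<beta> + int e = - coroot n i t"
        using b(1) \<beta> i psum_Suc[of t "i - 1"] psum_Suc[of t i] v(2)[of "i - 1"] v(2)[of "i + 1"]
        by (cases "i < n") (auto simp: d_def coroot_def)
      moreover have "cnt l = 0" if "l < \<beta>" for l
      proof (rule cnt0)
        have "d * l < d * \<beta>" using that by (simp add: d_def)
        then have "\<not> real q powi (- (psum t i + d * l)) \<le> real q powi (- b)"
          using \<beta> unfolding q_powi_le_iff by simp
        then show "nrm (minor i (h z * g)) \<noteq> real q powi (- (psum t i + d * l))" if "z \<in> R" for z
          using b(2)[OF that] by auto
      qed
      moreover have "\<rho> ^ j * real (cnt (\<beta> + int j)) = A * G e j" if "j < N" for j
      proof -
        have e: "psum t i + d * (\<beta> + int j) = b + d * int j" by (simp add: \<beta> algebra_simps)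
        have "int (cnt (\<beta> + int j)) = count e j" unfolding cnt e by (rule b(4)[OF that])
        then show ?thesis
          using count[OF that, of e] by (metis of_int_of_nat_eq)
      qed
      ultimately show ?thesis
        by blast
    qed
  qed
qed

lemma line_data_linear:
  fixes t :: "nat \<Rightarrow> int"
  assumes i: "1 \<le> i" "i < n" and N: "1 \<le> N" and g: "g \<in> K"
  defines "cnt \<equiv> \<lambda>l. card {z \<in> lines2 N. elt2 n i z * g \<in> fiber (\<lambda>j. t j + l * simple_root n i j)}"
  shows "(\<forall>l. cnt l = 0) \<or> (\<exists>\<beta> e. 2 * \<beta> + int e = - coroot n i t \<and> (\<forall>l<\<beta>. cnt l = 0) \<and>
    (\<forall>j<N. (- real q) ^ j * real (cnt (\<beta> + int j)) = real q ^ (2 * (N - 1)) * gen (real q ^ 2) e j))"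
  unfolding cnt_def
proof (rule line_data[where count = "\<lambda>e j. count2 e N j"])
  note gD = maxcompactD[OF g]
  have y: "act star g x \<in> carrier_mat (2 * n + 1) (2 * n + 1)" "ctrans star (act star g x) = act star g x"
    by (rule act_carrier[OF gD(1) x_carrier] ctrans_act[OF gD(1) x_carrier x_hermitian])+
  have mz: "minor j (elt2 n i z * g) = lower_right_minor j (act star (elt2 n i z) (act star g x))" if "z \<in> lines2 N" for z j
    by (rule minor_mult[OF elt2(1)[OF i that] g])
  show "nrm (minor j (elt2 n i z * g)) = nrm (minor j g)" if z: "z \<in> lines2 N" and j: "j \<in> {1..n}" "j \<noteq> i" for z j
    unfolding mz[OF z] minor_def[of j g]
    by (rule minor_scale[OF elt2(1)[OF i z] y(1)]) (use elt2(2)[OF i z] j in auto)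
  assume nz: "\<And>j. j \<le> n \<Longrightarrow> j \<noteq> i \<Longrightarrow> minor j g \<noteq> 0"
  obtain b e where b: "2 * b + int e = val (minor (i - 1) g) + val (minor (i + 1) g)"
    "\<And>z. z \<in> lines2 N \<Longrightarrow> nrm (minor i (elt2 n i z * g)) \<le> real q powi (- b)"
    "\<And>j. j < N \<Longrightarrow> int (card {z \<in> lines2 N. nrm (minor i (elt2 n i z * g)) = real q powi (- (b + int j))}) = count2 e N j"
    using rank_one_linear[OF i y] nz[of "i - 1"] nz[of "i + 1"] i N mz
    unfolding minor_def[of _ g] by (auto cong: conj_cong)
  have "\<exists>m. nrm a = real q powi (- (b + m))" if "a \<noteq> 0" for a
    using ex_nrm_eq[OF that] by (metis add.commute diff_add_cancel)
  then show "\<exists>b e. 2 * b + (if i < n then 1 else 2) * int e = val (minor (i - 1) g) + val (minor (if i < n then i + 1 else i - 1) g) \<and>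
      (\<forall>z\<in>lines2 N. nrm (minor i (elt2 n i z * g)) \<le> real q powi (- b) \<and>
        (minor i (elt2 n i z * g) \<noteq> 0 \<longrightarrow> (\<exists>m. nrm (minor i (elt2 n i z * g)) = real q powi (- (b + (if i < n then 1 else 2) * m))))) \<and>
      (\<forall>j<N. int (card {z \<in> lines2 N. nrm (minor i (elt2 n i z * g)) = real q powi (- (b + (if i < n then 1 else 2) * int j))}) = count2 e N j)"
    using i b by (intro exI[of _ b] exI[of _ e]) simp
qed (use i g elt2(1)[OF i] count2_gen in auto)

lemma line_data_symplectic:
  fixes t :: "nat \<Rightarrow> int"
  assumes s: "n = Suc s" and N: "1 \<le> N" and g: "g \<in> K"
  defines "cnt \<equiv> \<lambda>l. card {z \<in> lines3 N. elt3 s z * g \<in> fiber (\<lambda>j. t j + l * simple_root n n j)}"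
  shows "(\<forall>l. cnt l = 0) \<or> (\<exists>\<beta> e. 2 * \<beta> + int e = - coroot n n t \<and> (\<forall>l<\<beta>. cnt l = 0) \<and>
    (\<forall>j<N. (- (real q ^ 2)) ^ j * real (cnt (\<beta> + int j)) = real q ^ (3 * (N - 1)) * gen (real q ^ 3) e j))"
  unfolding cnt_def
proof (rule line_data[where count = "\<lambda>e j. count3 e N j"])
  have y: "act star g x \<in> carrier_mat (2 * n + 1) (2 * n + 1)"
    by (rule act_carrier[OF maxcompactD(1)[OF g] x_carrier])
  show eK: "elt3 s z \<in> K" if "z \<in> lines3 N" for z
    using elt3(1)[where s = s] that unfolding s by (cases z) blast
  have mz: "minor j (elt3 s z * g) = lower_right_minor j (act star (elt3 s z) (act star g x))" if "z \<in> lines3 N" for z j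
    by (rule minor_mult[OF eK[OF that] g])
  show "nrm (minor j (elt3 s z * g)) = nrm (minor j g)" if z: "z \<in> lines3 N" and j: "j \<in> {1..n}" "j \<noteq> n" for z j
    unfolding mz[OF z] minor_def[of j g]
  proof (rule minor_scale[OF eK[OF z] y])
    obtain x1 x2 x3 where zz: "z = (x1, x2, x3)"
      by (cases z)
    have "2 * n + 1 = 2 * s + 3" "j \<le> s" using s j by auto
    then show "elt3 s z $$ (2 * n + 1 - j + a, b) = 0" if "a < j" "b < 2 * n + 1 - j" for a b
      using elt3(2)[OF z[unfolded zz], where s = s] that unfolding zz by metis
  qed (use j in auto)
  assume "\<And>j. j \<le> n \<Longrightarrow> j \<noteq> n \<Longrightarrow> minor j g \<noteq> 0"
  then have nz: "lower_right_minor s (act star g x) \<noteq> 0" using s by (simp add: minor_def)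
  obtain U S C where U: "U \<in> carrier_mat (2 * n + 1) n" "S \<in> carrier_mat n n" "C \<in> carrier_mat n n"
    "S = ctrans star U * jmat n * U" "S * C = 1\<^sub>m n" "x = jmat n - 2 \<cdot>\<^sub>m (U * C * ctrans star U)"
    by (metis hermitian_space_decomposition x_space)
  obtain b e where b: "b + int e = val (minor s g)"
    "\<And>z. z \<in> lines3 N \<Longrightarrow> nrm (minor n (elt3 s z * g)) \<le> real q powi (- b)"
    "\<And>z. z \<in> lines3 N \<Longrightarrow> minor n (elt3 s z * g) \<noteq> 0 \<Longrightarrow> \<exists>m. nrm (minor n (elt3 s z * g)) = real q powi (- (b + 2 * m))"
    "\<And>j. j < N \<Longrightarrow> int (card {z \<in> lines3 N. nrm (minor n (elt3 s z * g)) = real q powi (- (b + 2 * int j))}) = count3 e N j"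
    using rank_one_symplectic[OF U s g nz] N mz unfolding minor_def[of _ g] by (auto cong: conj_cong)
  then show "\<exists>b e. 2 * b + (if n < n then 1 else 2) * int e = val (minor (n - 1) g) + val (minor (if n < n then n + 1 else n - 1) g) \<and>
      (\<forall>z\<in>lines3 N. nrm (minor n (elt3 s z * g)) \<le> real q powi (- b) \<and>
        (minor n (elt3 s z * g) \<noteq> 0 \<longrightarrow> (\<exists>m. nrm (minor n (elt3 s z * g)) = real q powi (- (b + (if n < n then 1 else 2) * m))))) \<and>
      (\<forall>j<N. int (card {z \<in> lines3 N. nrm (minor n (elt3 s z * g)) = real q powi (- (b + (if n < n then 1 else 2) * int j))}) = count3 e N j)"
    by (intro exI[of _ b] exI[of _ e]) (simp add: s)
qed (use n_ge_1 g count3_gen in auto)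

text \<open>On \<open>fiber t\<close> the integrand is \<open>\<kappa> t * q powr pairing n t z\<close>; the factors \<open>\<kappa>\<close> come from the constant terms
  of \<open>s_of_z\<close>.\<close>

definition \<kappa> :: "(nat \<Rightarrow> int) \<Rightarrow> complex" where
  "\<kappa> t = (\<Prod>i\<in>{1..n}. (if i < n then - of_nat q else - \<i> * of_nat q) powi psum t i)"

text \<open>A fiber depends only on the components of t in \<open>{1..n}\<close>. Setting the
  coefficient to 0 for all other extensions of these components makes a sum over all functions count
  each fiber once.\<close>

definition coef :: "(nat \<Rightarrow> int) \<Rightarrow> complex" where
  "coef t = (if \<forall>i. i \<notin> {1..n} \<longrightarrow> t i = 0 then \<kappa> t * measure dk (fiber t) else 0)"

lemma coef_cone: "\<exists>B. \<forall>t. t \<notin> lattice_cone n B \<longrightarrow> coef t = 0"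
proof -
  obtain B where B: "\<And>t. fiber t \<noteq> {} \<Longrightarrow> (\<forall>i\<in>{1..n}. - int B \<le> psum t i)"
    using fiber_cone by blast
  have "coef t = 0" if "t \<notin> lattice_cone n B" for t
  proof (cases "fiber t = {}")
    case False
    then show ?thesis
      using B[OF False] that unfolding coef_def lattice_cone_def by auto
  qed (simp add: coef_def)
  then show ?thesis
    by blast
qed

lemma simple_root_support: "1 \<le> i \<Longrightarrow> i \<le> n \<Longrightarrow> l \<notin> {1..n} \<Longrightarrow> simple_root n i l = 0"
  by (auto simp: simple_root_def unit_vec_int_def)

text \<open>For the long root the last partial sum moves by 2, and the square of
  \<open>- \<i> * q\<close> is - q^2. These are the signs under which the counts in dimensions two
  and three become \<open>gen\<close>.\<close>

lemma \<kappa>_line: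
  assumes i: "1 \<le> i" "i \<le> n"
  shows "\<kappa> (\<lambda>j. t j + l * simple_root n i j) = \<kappa> t * (if i < n then - of_nat q else - (of_nat q ^ 2)) powi l"
proof -
  let ?a = "\<lambda>j. if j < n then - of_nat q else - \<i> * of_nat q :: complex"
  have a0: "?a j \<noteq> 0" for j using q_ge_2 by auto
  have "\<kappa> (\<lambda>j. t j + l * simple_root n i j) = (\<Prod>j\<in>{1..n}. ?a j powi psum t j * (if j = i then ?a i powi (l * (if i < n then 1 else 2)) else 1))"
    unfolding \<kappa>_def
    by (intro prod.cong refl) (use i a0 in \<open>auto simp: psum_add psum_scale psum_simple_root power_int_add\<close>)
  also have "\<dots> = \<kappa> t * ?a i powi (l * (if i < n then 1 else 2))"
    unfolding \<kappa>_def prod.distrib using i by (simp add: prod.delta)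
  also have "?a i powi (l * (if i < n then 1 else 2)) = (if i < n then - of_nat q else - (of_nat q ^ 2)) powi l"
  proof (cases "i < n")
    case False
    have "?a i powi (l * 2) = (?a i powi 2) powi l" unfolding mult.commute[of l] by (rule power_int_mult)
    also have "?a i powi 2 = - (of_nat q ^ 2)" using False by (simp add: power_mult_distrib)
    finally show ?thesis
      using False by simp
  qed simp
  finally show ?thesis .
qed

text \<open>Let T be translation by the simple root. Both sides are truncations of the geometric
  series for the inverse of 1 - T / q applied to (1 + T) \<open>coef\<close>, at t and at its
  reflection. Since the coefficients vanish far back on the line, all long truncations
  agree.\<close>

lemma coef_reflection:
  assumes i: "1 \<le> i" "i \<le> n" and t: "\<And>l. l \<notin> {1..n} \<Longrightarrow> t l = 0"
  shows "\<exists>L0. \<forall>L\<ge>L0. (\<Sum>j<L. (1 / of_nat q) ^ j * (coef (\<lambda>l. t l - int j * simple_root n i l) + coef (\<lambda>l. t l - int (Suc j) * simple_root n i l))) =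
    (\<Sum>j<L. (1 / of_nat q) ^ j * (coef (\<lambda>l. simple_refl n i t l - int j * simple_root n i l) +
      coef (\<lambda>l. simple_refl n i t l - int (Suc j) * simple_root n i l)))"
proof -
  define T where "T = (\<lambda>l j. t j + l * simple_root n i j)"
  define l' where "l' = - coroot n i t"
  define \<rho> where "\<rho> = (if i < n then - real q else - (real q ^ 2))"
  define F where "F l = \<rho> powi l * measure dk (fiber (T l))" for l
  have \<rho>: "\<rho> \<noteq> 0" using q_ge_2 by (simp add: \<rho>_def)
  obtain B0 where B0: "\<And>t. fiber t \<noteq> {} \<Longrightarrow> (\<forall>i\<in>{1..n}. - int B0 \<le> psum t i)"
    using fiber_cone by blast
  define B where "B = nat (int B0 + \<bar>psum t i\<bar>)"
  have B: "- int B \<le> l" if "fiber (T l) \<noteq> {}" for l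
  proof -
    have "- int B0 \<le> psum t i + l * (if i < n then 1 else 2)"
    proof -
      have "- int B0 \<le> psum (T l) i" using B0[OF that] by (rule bspec) (use i in simp)
      also have "psum (T l) i = psum t i + l * (if i < n then 1 else 2)"
        using i by (simp add: T_def psum_add psum_scale psum_simple_root)
      finally show ?thesis .
    qed
    then show ?thesis
      by (auto simp: B_def split: if_splits)
  qed
  \<comment> \<open>The level exceeds the distance from the least possible \<open>\<beta>\<close> to
    both 0 and l', uniformly in g.\<close>
  define N where "N = Suc (B + nat \<bar>l'\<bar>)"
  have core: "(\<Sum>j<L. (1 / real q) ^ j * (F (0 - int j) + F (0 - int (Suc j)))) =
      (\<Sum>j<L. (1 / real q) ^ j * (F (l' - int j) + F (l' - int (Suc j))))" if L: "L \<ge> N" for L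
  proof (cases "i < n")
    case True
    show ?thesis
      unfolding F_def
    proof (rule reflection_core[where R = "lines2 N" and h = "elt2 n i" and N = N and B = B and G = "gen (real q ^ 2)" and P = "palin (real q ^ 2)"
          and A = "real q ^ (2 * (N - 1))"])
      show "palin (real q ^ 2) e 0 \<noteq> 0" for e using q_ge_2 by (auto simp: palin_def power2_eq_square)
      show "(\<forall>l. card {z \<in> lines2 N. elt2 n i z * g \<in> fiber (T l)} = 0) \<or>
        (\<exists>\<beta> e. 2 * \<beta> + int e = l' \<and> (\<forall>l<\<beta>. card {z \<in> lines2 N. elt2 n i z * g \<in> fiber (T l)} = 0) \<and>
          (\<forall>j<N. \<rho> ^ j * real (card {z \<in> lines2 N. elt2 n i z * g \<in> fiber (T (\<beta> + int j))}) = real q ^ (2 * (N - 1)) * gen (real q ^ 2) e j))"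
        if "g \<in> K" for g
        using line_data_linear[OF i(1) True _ that, of N t] True by (simp add: \<rho>_def T_def l'_def N_def)
    qed (use True i \<rho> B L q_ge_2 elt2(1)[of i n] finite_lines2 lines_nonempty(1)[of N] gen_palin palin_sym in \<open>auto simp: N_def palin_def\<close>)
  next
    case False
    then have ni: "i = n" using i by simp
    obtain s where s: "n = Suc s"
      using n_ge_1 by (cases n) auto
    have eK: "elt3 s z \<in> K" if "z \<in> lines3 N" for z
      using elt3(1)[where s = s] that unfolding s by (cases z) blast
    show ?thesis
      unfolding F_def
    proof (rule reflection_core[where R = "lines3 N" and h = "elt3 s" and N = N and B = B and G = "gen (real q ^ 3)" and P = "palin (real q ^ 3)"
          and A = "real q ^ (3 * (N - 1))"])
      show "palin (real q ^ 3) e 0 \<noteq> 0" for e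
        using q_ge_2 power_strict_increasing[of 1 3 "real q"] by (auto simp: palin_def)
      show "(\<forall>l. card {z \<in> lines3 N. elt3 s z * g \<in> fiber (T l)} = 0) \<or>
        (\<exists>\<beta> e. 2 * \<beta> + int e = l' \<and> (\<forall>l<\<beta>. card {z \<in> lines3 N. elt3 s z * g \<in> fiber (T l)} = 0) \<and>
          (\<forall>j<N. \<rho> ^ j * real (card {z \<in> lines3 N. elt3 s z * g \<in> fiber (T (\<beta> + int j))}) = real q ^ (3 * (N - 1)) * gen (real q ^ 3) e j))"
        if "g \<in> K" for g
        using line_data_symplectic[OF s _ that, of N t] False by (simp add: \<rho>_def T_def l'_def N_def ni)
    qed (use \<rho> B L q_ge_2 eK finite_lines3 lines_nonempty(2)[of N] gen_palin palin_sym in \<open>auto simp: N_def palin_def\<close>)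
  qed
  have coefT: "coef (T l) = \<kappa> t * of_real (F l)" for l
    using t simple_root_support i \<kappa>_line by (auto simp: T_def \<rho>_def coef_def F_def)
  have T0: "(\<lambda>l. t l - int j * simple_root n i l) = T (0 - int j)" for j by (simp add: T_def)
  have T1: "(\<lambda>l. simple_refl n i t l - int j * simple_root n i l) = T (l' - int j)" for j
    by (simp add: T_def simple_refl_line l'_def algebra_simps)
  have S: "(\<Sum>j<L. (1 / of_nat q) ^ j * (coef (T (m - int j)) + coef (T (m - int (Suc j))))) =
      \<kappa> t * of_real (\<Sum>j<L. (1 / real q) ^ j * (F (m - int j) + F (m - int (Suc j))))" for m L
    unfolding coefT by (simp add: sum_distrib_left algebra_simps)
  show ?thesis
    unfolding T0 T1 S using core by (intro exI[of _ N] allI impI) (simp only:)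
qed

end

subsection \<open>Difference operators attached to positive roots\<close>

text \<open>The operator 1 + c T with T the translation by \<open>\<beta>\<close>. On the series
  with coefficients f it is multiplication by 1 plus c times the monomial of
  \<open>\<beta>\<close>.\<close>

definition tw :: "complex \<Rightarrow> (nat \<Rightarrow> int) \<Rightarrow> ((nat \<Rightarrow> int) \<Rightarrow> complex) \<Rightarrow> (nat \<Rightarrow> int) \<Rightarrow> complex" where
  "tw c \<beta> f = (\<lambda>t. f t + c * f (\<lambda>l. t l - \<beta> l))"

definition tws :: "complex \<Rightarrow> (nat \<Rightarrow> int) set \<Rightarrow> ((nat \<Rightarrow> int) \<Rightarrow> complex) \<Rightarrow> (nat \<Rightarrow> int) \<Rightarrow> complex" where
  "tws c S f = Finite_Set.fold (tw c) f S"

lemma tw_commute: "tw c \<beta> (tw d \<gamma> f) = tw d \<gamma> (tw c \<beta> f)"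
  by (rule ext) (simp add: tw_def algebra_simps diff_diff_eq diff_right_commute)

interpretation tw: comp_fun_commute "tw c" for c
  by unfold_locales (auto simp: tw_commute comp_def)

lemma tws_empty [simp]: "tws c {} f = f" by (simp add: tws_def)

lemma tws_insert: "finite S \<Longrightarrow> \<beta> \<notin> S \<Longrightarrow> tws c (insert \<beta> S) f = tw c \<beta> (tws c S f)"
  by (simp add: tws_def)

lemma tws_tw: "finite S \<Longrightarrow> tws c S (tw d \<gamma> f) = tw d \<gamma> (tws c S f)"
  by (induction S rule: finite_induct) (auto simp: tws_insert tw_commute[of c])

lemma tw_diff: "tw c \<beta> (\<lambda>t. f t - g t) = (\<lambda>t. tw c \<beta> f t - tw c \<beta> g t)"
  by (rule ext) (simp add: tw_def algebra_simps)

lemma tws_diff: "finite S \<Longrightarrow> tws c S (\<lambda>t. f t - g t) = (\<lambda>t. tws c S f t - tws c S g t)"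
  by (induction S rule: finite_induct) (auto simp: tws_insert tw_diff)

lemma tws_comp:
  assumes \<sigma>: "\<And>t u. \<sigma> (\<lambda>l. t l - u l) = (\<lambda>l. \<sigma> t l - \<sigma> u l)" "inj \<sigma>" and S: "finite S"
  shows "tws c S (\<lambda>t. f (\<sigma> t)) = (\<lambda>t. tws c (\<sigma> ` S) f (\<sigma> t))"
  using S
proof (induction S rule: finite_induct)
  case (insert \<beta> S)
  have "\<sigma> \<beta> \<notin> \<sigma> ` S" using insert(2) \<sigma>(2) by (auto dest: injD)
  then have "tws c (\<sigma> ` insert \<beta> S) f = tw c (\<sigma> \<beta>) (tws c (\<sigma> ` S) f)"
    using insert(1) by (simp add: tws_insert)
  then show ?case
    unfolding tws_insert[OF insert(1,2)] insert.IH by (simp add: tw_def \<sigma>(1))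
qed simp

definition csupp :: "nat \<Rightarrow> ((nat \<Rightarrow> int) \<Rightarrow> complex) \<Rightarrow> bool" where
  "csupp n f \<longleftrightarrow> (\<exists>B. \<forall>t. t \<notin> lattice_cone n B \<longrightarrow> f t = 0)"

text \<open>These conditions ensure that translation by \<open>\<beta>\<close> maps cones into
  themselves and that repeated translation by \<open>- \<beta>\<close> leaves every cone.\<close>

definition positive :: "nat \<Rightarrow> (nat \<Rightarrow> int) \<Rightarrow> bool" where
  "positive n \<beta> \<longleftrightarrow> (\<forall>i. i \<notin> {1..n} \<longrightarrow> \<beta> i = 0) \<and> (\<forall>i\<in>{1..n}. 0 \<le> psum \<beta> i) \<and> (\<exists>i\<in>{1..n}. 0 < psum \<beta> i)"

lemma cone_add_positive:
  assumes "positive n \<beta>" "(\<lambda>l. t l - int j * \<beta> l) \<in> lattice_cone n B" shows "t \<in> lattice_cone n B"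
proof -
  have "- int B \<le> psum t i" if "i \<in> {1..n}" for i
  proof -
    have "- int B \<le> psum t i - int j * psum \<beta> i" "0 \<le> int j * psum \<beta> i"
      using assms that by (auto simp: lattice_cone_def positive_def psum_diff psum_scale)
    then show ?thesis
      by linarith
  qed
  then show ?thesis
    using assms by (auto simp: lattice_cone_def positive_def)
qed

lemma cone_leave:
  assumes "positive n \<beta>" shows "\<exists>L. \<forall>j\<ge>L. (\<lambda>l. t l - int j * \<beta> l) \<notin> lattice_cone n B"
proof -
  obtain i where i: "i \<in> {1..n}" "0 < psum \<beta> i"
    using assms by (auto simp: positive_def)
  have "(\<lambda>l. t l - int j * \<beta> l) \<notin> lattice_cone n B" if "j \<ge> nat (psum t i + int B + 1)" for j
  proof
    assume "(\<lambda>l. t l - int j * \<beta> l) \<in> lattice_cone n B"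
    then have "- int B \<le> psum t i - int j * psum \<beta> i"
      using i by (auto simp: lattice_cone_def psum_diff psum_scale)
    moreover have "int j * 1 \<le> int j * psum \<beta> i" using i(2) by (intro mult_left_mono) auto
    ultimately show False
      using that by linarith
  qed
  then show ?thesis
    by blast
qed

lemma csupp_tw: "csupp n f \<Longrightarrow> positive n \<beta> \<Longrightarrow> csupp n (tw c \<beta> f)"
proof -
  assume f: "csupp n f" and \<beta>: "positive n \<beta>"
  then obtain B where B: "\<And>t. t \<notin> lattice_cone n B \<Longrightarrow> f t = 0"
    by (auto simp: csupp_def)
  have "tw c \<beta> f t = 0" if "t \<notin> lattice_cone n B" for t
    using B[OF that] B[of "\<lambda>l. t l - \<beta> l"] cone_add_positive[OF \<beta>, of t 1 B] that by (auto simp: tw_def)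
  then show ?thesis
    by (auto simp: csupp_def)
qed

lemma csupp_tws: "finite S \<Longrightarrow> csupp n f \<Longrightarrow> (\<And>\<beta>. \<beta> \<in> S \<Longrightarrow> positive n \<beta>) \<Longrightarrow> csupp n (tws c S f)"
  by (induction S rule: finite_induct) (auto simp: tws_insert csupp_tw)

text \<open>The geometric series inverting 1 - a T. For f supported in a cone the index set is
  finite, but it depends on t, so \<open>geom_eq\<close> compares it with all sufficiently long
  truncations.\<close>

definition geom :: "complex \<Rightarrow> (nat \<Rightarrow> int) \<Rightarrow> ((nat \<Rightarrow> int) \<Rightarrow> complex) \<Rightarrow> (nat \<Rightarrow> int) \<Rightarrow> complex" where
  "geom a \<beta> f t = (\<Sum>j\<in>{j. f (\<lambda>l. t l - int j * \<beta> l) \<noteq> 0}. a ^ j * f (\<lambda>l. t l - int j * \<beta> l))"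

lemma geom_eq:
  assumes f: "csupp n f" and \<beta>: "positive n \<beta>"
  shows "\<exists>L0. \<forall>L\<ge>L0. geom a \<beta> f t = (\<Sum>j<L. a ^ j * f (\<lambda>l. t l - int j * \<beta> l))"
proof -
  obtain B where B: "\<And>t. t \<notin> lattice_cone n B \<Longrightarrow> f t = 0"
    using f by (auto simp: csupp_def)
  obtain L0 where L0: "\<And>j. j \<ge> L0 \<Longrightarrow> f (\<lambda>l. t l - int j * \<beta> l) = 0"
    using cone_leave[OF \<beta>, of t B] B by blast
  have "geom a \<beta> f t = (\<Sum>j<L. a ^ j * f (\<lambda>l. t l - int j * \<beta> l))" if "L \<ge> L0" for L
    unfolding geom_def
  proof (rule sum.mono_neutral_left)
    show "{j. f (\<lambda>l. t l - int j * \<beta> l) \<noteq> 0} \<subseteq> {..<L}"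
      using L0 that by (metis (mono_tags, lifting) lessThan_iff linorder_not_less mem_Collect_eq order_trans subsetI)
  qed auto
  then show ?thesis
    by blast
qed

lemma csupp_geom:
  assumes f: "csupp n f" and \<beta>: "positive n \<beta>" shows "csupp n (geom a \<beta> f)"
proof -
  obtain B where B: "\<And>t. t \<notin> lattice_cone n B \<Longrightarrow> f t = 0"
    using f by (auto simp: csupp_def)
  have "geom a \<beta> f t = 0" if "t \<notin> lattice_cone n B" for t
  proof -
    have "f (\<lambda>l. t l - int j * \<beta> l) = 0" for j
      using B cone_add_positive[OF \<beta>] that by blast
    then show ?thesis
      by (simp add: geom_def)
  qed
  then show ?thesis
    by (auto simp: csupp_def)
qed

lemma tw_geom:
  assumes f: "csupp n f" and \<beta>: "positive n \<beta>" shows "tw (- a) \<beta> (geom a \<beta> f) = f"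
proof
  fix t
  obtain L1 where L1: "\<And>L. L \<ge> L1 \<Longrightarrow> geom a \<beta> f t = (\<Sum>j<L. a ^ j * f (\<lambda>l. t l - int j * \<beta> l))"
    using geom_eq[OF assms, of a t] by blast
  obtain L2 where L2: "\<And>L. L \<ge> L2 \<Longrightarrow> geom a \<beta> f (\<lambda>l. t l - \<beta> l) = (\<Sum>j<L. a ^ j * f (\<lambda>l. t l - \<beta> l - int j * \<beta> l))"
    using geom_eq[OF assms, of a "\<lambda>l. t l - \<beta> l"] by blast
  define L where "L = max L1 L2"
  have "geom a \<beta> f t = f t + (\<Sum>j<L. a ^ Suc j * f (\<lambda>l. t l - int (Suc j) * \<beta> l))"
  proof -
    have "geom a \<beta> f t = (\<Sum>j<Suc L. a ^ j * f (\<lambda>l. t l - int j * \<beta> l))"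
      by (rule L1) (simp add: L_def)
    then show ?thesis
      unfolding sum.lessThan_Suc_shift by simp
  qed
  also have "(\<Sum>j<L. a ^ Suc j * f (\<lambda>l. t l - int (Suc j) * \<beta> l)) = a * geom a \<beta> f (\<lambda>l. t l - \<beta> l)"
    using L2[of L] by (simp add: L_def sum_distrib_left algebra_simps)
  finally show "tw (- a) \<beta> (geom a \<beta> f) t = f t" by (simp add: tw_def)
qed

lemma tws_solve:
  assumes "finite S" "\<And>\<beta>. \<beta> \<in> S \<Longrightarrow> positive n \<beta>" "csupp n f"
  shows "\<exists>F. csupp n F \<and> tws (- a) S F = f"
  using assms
proof (induction S rule: finite_induct)
  case (insert \<beta> S)
  then obtain F where F: "csupp n F" "tws (- a) S F = f" by auto
  have \<beta>: "positive n \<beta>" using insert by simp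
  have "tws (- a) (insert \<beta> S) (geom a \<beta> F) = f"
    using insert(1,2) F tw_geom[OF F(1) \<beta>, of a] by (simp add: tws_insert tws_tw[symmetric])
  then show ?case
    using csupp_geom[OF F(1) \<beta>] by blast
qed auto

text \<open>A function killed by 1 + c T is geometric along the line in direction
  \<open>\<beta>\<close>, so it vanishes at t as soon as it vanishes at one point behind t.\<close>

lemma tw_injective:
  assumes "tw c \<beta> f = (\<lambda>_. 0)" "\<exists>j. f (\<lambda>l. t l - int j * \<beta> l) = 0"
  shows "f t = 0"
proof -
  have f: "f t = - c * f (\<lambda>l. t l - \<beta> l)" for t
    using fun_cong[OF assms(1), of t] by (simp add: tw_def eq_neg_iff_add_eq_0)
  have it: "f t = (- c) ^ j * f (\<lambda>l. t l - int j * \<beta> l)" for j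
  proof (induction j)
    case (Suc j)
    have "f (\<lambda>l. t l - int j * \<beta> l) = - c * f (\<lambda>l. t l - int (Suc j) * \<beta> l)"
      using f[of "\<lambda>l. t l - int j * \<beta> l"] by (simp add: algebra_simps)
    then show ?case
      using Suc by simp
  qed simp
  obtain j where "f (\<lambda>l. t l - int j * \<beta> l) = 0"
    using assms(2) by blast
  then show ?thesis
    using it[of j] by simp
qed

lemma tw_injective_csupp:
  assumes "csupp n f" "csupp n g" "positive n \<beta>" "tw c \<beta> f = tw c \<beta> g" shows "f = g"
proof
  fix t
  obtain B B' where B: "\<And>t. t \<notin> lattice_cone n B \<Longrightarrow> f t = 0" "\<And>t. t \<notin> lattice_cone n B' \<Longrightarrow> g t = 0"
    using assms(1,2) by (auto simp: csupp_def)
  obtain L L' where L: "\<And>j. j \<ge> L \<Longrightarrow> (\<lambda>l. t l - int j * \<beta> l) \<notin> lattice_cone n B" "\<And>j. j \<ge> L' \<Longrightarrow> (\<lambda>l. t l - int j * \<beta> l) \<notin> lattice_cone n B'"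
    using cone_leave[OF assms(3), of t] by meson
  have "f t - g t = 0"
  proof (rule tw_injective[of c \<beta> "\<lambda>t. f t - g t" t])
    show "tw c \<beta> (\<lambda>t. f t - g t) = (\<lambda>_. 0)" unfolding tw_diff assms(4) by simp
    show "\<exists>j. f (\<lambda>l. t l - int j * \<beta> l) - g (\<lambda>l. t l - int j * \<beta> l) = 0"
      using B(1)[OF L(1), of "max L L'"] B(2)[OF L(2), of "max L L'"] by (intro exI[of _ "max L L'"]) simp
  qed
  then show "f t = g t" by simp
qed

text \<open>Functions vanishing outside the union of a cone and its mirror image are still separated by the
  operators attached to roots which stay positive under the reflection.\<close>

lemma tws_injective:
  assumes "finite S" "\<And>\<beta>. \<beta> \<in> S \<Longrightarrow> positive n \<beta> \<and> positive n (\<sigma> \<beta>)"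
    and \<sigma>: "\<And>t u j. \<sigma> (\<lambda>l. t l - j * u l) = (\<lambda>l. \<sigma> t l - j * \<sigma> u l)"
    and "tws c S f = (\<lambda>_. 0)" "\<And>t. f t \<noteq> 0 \<Longrightarrow> t \<in> lattice_cone n B \<or> \<sigma> t \<in> lattice_cone n B"
  shows "f = (\<lambda>_. 0)"
  using assms(1,2,4,5)
proof (induction S arbitrary: f rule: finite_induct)
  case (insert \<beta> S)
  have \<beta>: "positive n \<beta>" "positive n (\<sigma> \<beta>)" using insert by auto
  have "tw c \<beta> f = (\<lambda>_. 0)"
  proof (rule insert.IH)
    show "tws c S (tw c \<beta> f) = (\<lambda>_. 0)" using insert by (simp add: tws_insert tws_tw)
    fix t assume "tw c \<beta> f t \<noteq> 0"
    then have "f t \<noteq> 0 \<or> f (\<lambda>l. t l - 1 * \<beta> l) \<noteq> 0" by (auto simp: tw_def)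
    then show "t \<in> lattice_cone n B \<or> \<sigma> t \<in> lattice_cone n B"
      using insert.prems(3)[of t] insert.prems(3)[of "\<lambda>l. t l - 1 * \<beta> l"] cone_add_positive[OF \<beta>(1), of t 1 B]
        cone_add_positive[OF \<beta>(2), of "\<sigma> t" 1 B] \<sigma>[of t 1 \<beta>] by auto
  qed (use insert in auto)
  moreover have "\<exists>j. f (\<lambda>l. t l - int j * \<beta> l) = 0" for t
  proof -
    obtain L L' where L: "\<And>j. j \<ge> L \<Longrightarrow> (\<lambda>l. t l - int j * \<beta> l) \<notin> lattice_cone n B" "\<And>j. j \<ge> L' \<Longrightarrow> (\<lambda>l. \<sigma> t l - int j * \<sigma> \<beta> l) \<notin> lattice_cone n B"
      using cone_leave[OF \<beta>(1), of t] cone_leave[OF \<beta>(2), of "\<sigma> t"] by meson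
    have "f (\<lambda>l. t l - int (max L L') * \<beta> l) = 0"
      using insert.prems(3)[of "\<lambda>l. t l - int (max L L') * \<beta> l"] L[of "max L L'"] \<sigma> by auto
    then show ?thesis ..
  qed
  ultimately show ?case
    using tw_injective by blast
qed auto

section \<open>Action of the simple reflections on the positive roots\<close>

lemma simple_refl_diff: "simple_refl n i (\<lambda>l. t l - j * u l) = (\<lambda>l. simple_refl n i t l - j * simple_refl n i u l)"
  by (auto simp: simple_refl_def fun_eq_iff)

lemma simple_refl_involution [simp]: "simple_refl n i (simple_refl n i t) = t"
  by (auto simp: simple_refl_def fun_eq_iff)

lemma inj_simple_refl: "inj (simple_refl n i)" by (metis injI simple_refl_involution)

lemma simple_refl_simple_root: "simple_refl n i (simple_root n i) = (\<lambda>l. - simple_root n i l)"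
  by (auto simp: simple_refl_def simple_root_def unit_vec_int_def fun_eq_iff)

lemma finite_pos_roots: "finite (pos_roots n)"
proof -
  let ?I = "{1..n} \<times> {1..n}"
  have "pos_roots n \<subseteq> (\<lambda>(i, j) l. unit_vec_int i l + unit_vec_int j l) ` ?I \<union>
      (\<lambda>(i, j) l. unit_vec_int i l - unit_vec_int j l) ` ?I \<union> (\<lambda>i l. 2 * unit_vec_int i l) ` {1..n}"
    unfolding pos_roots_def by fastforce
  then show ?thesis
    by (rule finite_subset) auto
qed

lemma pos_roots_cases:
  assumes "\<beta> \<in> pos_roots n"
  obtains (plus) a b where "1 \<le> a" "a < b" "b \<le> n" "\<beta> = (\<lambda>l. unit_vec_int a l + unit_vec_int b l)"
  | (minus) a b where "1 \<le> a" "a < b" "b \<le> n" "\<beta> = (\<lambda>l. unit_vec_int a l - unit_vec_int b l)"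
  | (long) a where "1 \<le> a" "a \<le> n" "\<beta> = (\<lambda>l. 2 * unit_vec_int a l)"
  using assms unfolding pos_roots_def by blast

lemma pos_rootsI:
  "1 \<le> a \<Longrightarrow> a < b \<Longrightarrow> b \<le> n \<Longrightarrow> (\<lambda>l. unit_vec_int a l + unit_vec_int b l) \<in> pos_roots n"
  "1 \<le> a \<Longrightarrow> a < b \<Longrightarrow> b \<le> n \<Longrightarrow> (\<lambda>l. unit_vec_int a l - unit_vec_int b l) \<in> pos_roots n"
  "1 \<le> a \<Longrightarrow> a \<le> n \<Longrightarrow> (\<lambda>l. 2 * unit_vec_int a l) \<in> pos_roots n"
  unfolding pos_roots_def by blast+

lemma unit_vec_int_apply: "unit_vec_int i l = (if l = i then 1 else 0)" by (simp add: unit_vec_int_def)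

lemma positive_pos_roots:
  assumes "\<beta> \<in> pos_roots n" shows "positive n \<beta>"
  using assms
proof (cases rule: pos_roots_cases)
  case (plus a b)
  have "psum \<beta> i = psum (unit_vec_int a) i + psum (unit_vec_int b) i" for i
    unfolding plus(4) by (rule psum_add)
  then show ?thesis
    using plus(1-3) unfolding positive_def by (auto simp: plus(4) psum_unit_vec unit_vec_int_apply intro!: bexI[of _ a])
next
  case (minus a b)
  have "psum \<beta> i = psum (unit_vec_int a) i - psum (unit_vec_int b) i" for i
    unfolding minus(4) by (rule psum_diff)
  then show ?thesis
    using minus(1-3) unfolding positive_def by (auto simp: minus(4) psum_unit_vec unit_vec_int_apply intro!: bexI[of _ a])
next
  case (long a)
  have "psum \<beta> i = 2 * psum (unit_vec_int a) i" for i unfolding long(3) by (rule psum_scale)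
  then show ?thesis
    using long(1-2) unfolding positive_def by (auto simp: long(3) psum_unit_vec unit_vec_int_apply intro!: bexI[of _ a])
qed

lemma simple_root_pos_root: "1 \<le> i \<Longrightarrow> i \<le> n \<Longrightarrow> simple_root n i \<in> pos_roots n"
  using pos_rootsI(2)[of i "i + 1" n] pos_rootsI(3)[of i n] by (auto simp: simple_root_def)

lemma simple_refl_pos_root:
  assumes i: "1 \<le> i" "i \<le> n" and \<beta>: "\<beta> \<in> pos_roots n" "\<beta> \<noteq> simple_root n i"
  shows "simple_refl n i \<beta> \<in> pos_roots n"
proof (cases "i < n")
  case True
  define \<tau> where "\<tau> a = (if a = i then i + 1 else if a = i + 1 then i else a)" for a
  have u: "simple_refl n i (\<lambda>l. c * unit_vec_int a l + d * unit_vec_int b l) = (\<lambda>l. c * unit_vec_int (\<tau> a) l + d * unit_vec_int (\<tau> b) l)" for a b c d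
    using True by (auto simp: simple_refl_def \<tau>_def unit_vec_int_def fun_eq_iff)
  have \<tau>: "1 \<le> \<tau> a" "\<tau> a \<le> n" if "1 \<le> a" "a \<le> n" for a
    using that True i by (auto simp: \<tau>_def)
  have lt: "\<tau> a < \<tau> b" if "a < b" "a \<noteq> i \<or> b \<noteq> i + 1" for a b
    using that by (auto simp: \<tau>_def)
  show ?thesis
    using \<beta>(1)
  proof (cases rule: pos_roots_cases)
    case (plus a b)
    show ?thesis
    proof (cases "a = i \<and> b = i + 1")
      case True
      then have "simple_refl n i \<beta> = \<beta>"
        using u[of 1 a 1 b] by (auto simp: plus(4) \<tau>_def add.commute)
      then show ?thesis
        using \<beta>(1) by simp
    next
      case False
      then show ?thesis
        using pos_rootsI(1)[of "\<tau> a" "\<tau> b" n] u[of 1 a 1 b] \<tau>[of a] \<tau>[of b] lt[of a b] plus by simp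
    qed
  next
    case (minus a b)
    then have "a \<noteq> i \<or> b \<noteq> i + 1" using \<beta>(2) True by (auto simp: simple_root_def)
    then show ?thesis
      using pos_rootsI(2)[of "\<tau> a" "\<tau> b" n] u[of 1 a "- 1" b] \<tau>[of a] \<tau>[of b] lt[of a b] minus by simp
  next
    case (long a)
    then show ?thesis
      using pos_rootsI(3)[of "\<tau> a" n] u[of 2 a 0 a] \<tau>[of a] by simp
  qed
next
  case False
  then have ni: "i = n" using i by simp
  have u: "simple_refl n i (\<lambda>l. c * unit_vec_int a l + d * unit_vec_int b l) =
      (\<lambda>l. (if a = n then - c else c) * unit_vec_int a l + (if b = n then - d else d) * unit_vec_int b l)" for a b c d
    using ni by (auto simp: simple_refl_def unit_vec_int_def fun_eq_iff)
  show ?thesis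
    using \<beta>(1)
  proof (cases rule: pos_roots_cases)
    case (plus a b)
    then show ?thesis
      using pos_rootsI(1,2)[of a b n] u[of 1 a 1 b] by auto
  next
    case (minus a b)
    then show ?thesis
      using pos_rootsI(1,2)[of a b n] u[of 1 a "- 1" b] by auto
  next
    case (long a)
    then have "a \<noteq> n" using \<beta>(2) by (auto simp: simple_root_def ni)
    then show ?thesis
      using pos_rootsI(3)[of a n] u[of 2 a 0 a] long by simp
  qed
qed

text \<open>If the image of a positive root were the simple root, the root would be its negative and
  would have a negative partial sum. The reverse inclusion follows because the reflection is an
  involution.\<close>

lemma simple_refl_image_pos_roots:
  assumes i: "1 \<le> i" "i \<le> n"
  defines "S \<equiv> pos_roots n - {simple_root n i}"
  shows "simple_refl n i ` S = S"
proof -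
  have "simple_refl n i \<beta> \<in> S" if \<beta>: "\<beta> \<in> S" for \<beta>
  proof -
    have "simple_refl n i \<beta> \<noteq> simple_root n i"
    proof
      assume "simple_refl n i \<beta> = simple_root n i"
      then have "\<beta> = (\<lambda>l. - 1 * simple_root n i l)"
        using simple_refl_involution[of n i \<beta>] by (simp add: simple_refl_simple_root)
      then have "psum \<beta> j = - psum (simple_root n i) j" for j
        using psum_scale[of "- 1" "simple_root n i" j] by simp
      then have "psum \<beta> i < 0" using i psum_simple_root[of i n i] by simp
      moreover have "\<forall>j\<in>{1..n}. 0 \<le> psum \<beta> j"
        using positive_pos_roots[of \<beta> n] \<beta> by (simp add: S_def positive_def)
      ultimately show False
        using i by (auto dest!: bspec[of _ _ i])
    qed
    then show ?thesis
      using simple_refl_pos_root[OF i] \<beta> by (simp add: S_def)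
  qed
  then show ?thesis
    by (metis (no_types, lifting) image_eqI simple_refl_involution subsetI subset_antisym image_subsetI)
qed

text \<open>The operator of the simple root is cancelled while everything still lies in a cone. This
  leaves identity \<open>D\<close>, a product over the other positive roots with H in place of c.
  The reflection permutes these roots and fixes H, so the remaining operators kill the difference of
  F and its reflection. They are injective on its support because these roots stay positive under
  the reflection.\<close>

lemma weyl_symmetry:
  assumes c: "csupp n c" and F: "csupp n F" "tws (- a) (pos_roots n) F = tws 1 (pos_roots n) c" and i: "1 \<le> i" "i \<le> n"
    and inv: "\<And>t. (\<And>l. l \<notin> {1..n} \<Longrightarrow> t l = 0) \<Longrightarrow> \<exists>L0. \<forall>L\<ge>L0.
      (\<Sum>j<L. a ^ j * (c (\<lambda>l. t l - int j * simple_root n i l) + c (\<lambda>l. t l - int (Suc j) * simple_root n i l))) =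
      (\<Sum>j<L. a ^ j * (c (\<lambda>l. simple_refl n i t l - int j * simple_root n i l) + c (\<lambda>l. simple_refl n i t l - int (Suc j) * simple_root n i l)))"
  shows "F (simple_refl n i t) = F t"
proof -
  define \<alpha> where "\<alpha> = simple_root n i"
  define \<sigma> where "\<sigma> = simple_refl n i"
  define S where "S = pos_roots n - {\<alpha>}"
  have S: "finite S" "\<alpha> \<notin> S" "pos_roots n = insert \<alpha> S"
    using finite_pos_roots simple_root_pos_root[OF i] by (auto simp: S_def \<alpha>_def)
  have \<alpha>: "positive n \<alpha>" and Sp: "\<And>\<beta>. \<beta> \<in> S \<Longrightarrow> positive n \<beta>"
    using positive_pos_roots S(3) by auto
  have \<sigma>S: "\<sigma> ` S = S"
    unfolding \<sigma>_def S_def \<alpha>_def by (rule simple_refl_image_pos_roots[OF i])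
  define f where "f = tw 1 \<alpha> c"
  define H where "H = geom a \<alpha> f"
  have f: "csupp n f" unfolding f_def by (rule csupp_tw[OF c \<alpha>])
  have H: "csupp n H" "tw (- a) \<alpha> H = f"
    unfolding H_def using csupp_geom[OF f \<alpha>] tw_geom[OF f \<alpha>] by auto
  have supp: "g t = 0" if g: "csupp n g" and t: "l \<notin> {1..n}" "t l \<noteq> 0" for g t l
    using t g by (auto simp: lattice_cone_def csupp_def)
  have \<sigma>0: "\<sigma> t l = t l" if "l \<notin> {1..n}" for t l
    using that i by (auto simp: \<sigma>_def simple_refl_def)
  have H\<sigma>: "H (\<sigma> t) = H t" for t
  proof (cases "\<exists>l. l \<notin> {1..n} \<and> t l \<noteq> 0")
    case True
    then show ?thesis
      using supp[OF H(1)] \<sigma>0 by metis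
  next
    case False
    have fs: "f (\<lambda>l. t l - int j * \<alpha> l) = c (\<lambda>l. t l - int j * simple_root n i l) + c (\<lambda>l. t l - int (Suc j) * simple_root n i l)" for t j
      by (simp add: f_def tw_def \<alpha>_def algebra_simps)
    obtain L0 where L0: "\<And>L. L \<ge> L0 \<Longrightarrow> (\<Sum>j<L. a ^ j * f (\<lambda>l. t l - int j * \<alpha> l)) = (\<Sum>j<L. a ^ j * f (\<lambda>l. \<sigma> t l - int j * \<alpha> l))"
      using inv[of t] False unfolding fs \<sigma>_def by blast
    obtain L1 where L1: "\<And>L. L \<ge> L1 \<Longrightarrow> H t = (\<Sum>j<L. a ^ j * f (\<lambda>l. t l - int j * \<alpha> l))"
      using geom_eq[OF f \<alpha>, of a t] unfolding H_def by blast
    obtain L2 where L2: "\<And>L. L \<ge> L2 \<Longrightarrow> H (\<sigma> t) = (\<Sum>j<L. a ^ j * f (\<lambda>l. \<sigma> t l - int j * \<alpha> l))"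
      using geom_eq[OF f \<alpha>, of a "\<sigma> t"] unfolding H_def by blast
    show ?thesis
      using L0[of "max L0 (max L1 L2)"] L1[of "max L0 (max L1 L2)"] L2[of "max L0 (max L1 L2)"] by simp
  qed
  have "tw (- a) \<alpha> (tws (- a) S F) = tw (- a) \<alpha> (tws 1 S H)"
    by (metis F S tws_insert tws_tw H f_def)
  from tw_injective_csupp[OF csupp_tws[OF S(1) F(1) Sp] csupp_tws[OF S(1) H(1) Sp] \<alpha> this]
  have D: "tws (- a) S F = tws 1 S H" by simp
  have comp: "tws b S (\<lambda>t. g (\<sigma> t)) = (\<lambda>t. tws b S g (\<sigma> t))" for b g
  proof -
    have d: "\<sigma> (\<lambda>l. t l - u l) = (\<lambda>l. \<sigma> t l - \<sigma> u l)" for t u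
      using simple_refl_diff[of n i t 1 u] by (simp add: \<sigma>_def)
    have inj: "inj \<sigma>" unfolding \<sigma>_def by (rule inj_simple_refl)
    show ?thesis
      using tws_comp[where \<sigma> = \<sigma>, OF d inj S(1), of b g] unfolding \<sigma>S .
  qed
  have "tws (- a) S (\<lambda>t. F (\<sigma> t)) = tws (- a) S F"
  proof -
    have "tws (- a) S (\<lambda>t. F (\<sigma> t)) = (\<lambda>t. tws (- a) S F (\<sigma> t))" by (rule comp)
    also have "\<dots> = (\<lambda>t. tws 1 S H (\<sigma> t))" by (simp only: D)
    also have "\<dots> = tws 1 S (\<lambda>t. H (\<sigma> t))" by (rule comp[symmetric])
    also have "\<dots> = tws (- a) S F" by (simp only: H\<sigma> D)
    finally show ?thesis .
  qed
  then have 0: "tws (- a) S (\<lambda>t. F (\<sigma> t) - F t) = (\<lambda>_. 0)"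
    unfolding tws_diff[OF S(1)] by simp
  obtain B where B: "\<And>t. t \<notin> lattice_cone n B \<Longrightarrow> F t = 0"
    using F(1) by (auto simp: csupp_def)
  have "(\<lambda>t. F (\<sigma> t) - F t) = (\<lambda>_. 0)"
  proof (rule tws_injective[OF S(1) _ _ 0])
    show "positive n \<beta> \<and> positive n (\<sigma> \<beta>)" if "\<beta> \<in> S" for \<beta>
      using that Sp \<sigma>S by blast
    show "\<sigma> (\<lambda>l. t l - j * u l) = (\<lambda>l. \<sigma> t l - j * \<sigma> u l)" for t u j
      unfolding \<sigma>_def by (rule simple_refl_diff)
    show "t \<in> lattice_cone n B \<or> \<sigma> t \<in> lattice_cone n B" if "F (\<sigma> t) - F t \<noteq> 0" for t
      using B[of t] B[of "\<sigma> t"] that by (cases "t \<in> lattice_cone n B") auto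
  qed
  then show ?thesis
    unfolding \<sigma>_def by (metis eq_iff_diff_eq_0)
qed

subsection \<open>Laurent polynomials invariant under signed permutations\<close>

lemma simple_refl_transpose: "i < n \<Longrightarrow> simple_refl n i t = t \<circ> Transposition.transpose i (i + 1)"
  by (auto simp: simple_refl_def fun_eq_iff Transposition.transpose_def)

definition negate_on :: "nat set \<Rightarrow> (nat \<Rightarrow> int) \<Rightarrow> nat \<Rightarrow> int" where
  "negate_on A t = (\<lambda>l. if l \<in> A then - t l else t l)"

context
  fixes n :: nat and F :: "(nat \<Rightarrow> int) \<Rightarrow> complex"
  assumes n: "1 \<le> n" and inv: "\<And>i t. 1 \<le> i \<Longrightarrow> i \<le> n \<Longrightarrow> F (simple_refl n i t) = F t"
begin

text \<open>A transposition of distant places is a conjugate of a shorter one by an adjacent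
  transposition.\<close>

lemma invariant_transpose_less: "1 \<le> a \<Longrightarrow> a < b \<Longrightarrow> b \<le> n \<Longrightarrow> F ((t :: nat \<Rightarrow> int) \<circ> Transposition.transpose a b) = F t"
proof (induction b arbitrary: t)
  case (Suc b)
  show ?case
  proof (cases "a = b")
    case True
    have "b < n" "1 \<le> b" using Suc.prems True by auto
    then have "F (t \<circ> Transposition.transpose b (b + 1)) = F t"
      using inv[of b t] unfolding simple_refl_transpose[OF \<open>b < n\<close>] by simp
    then show ?thesis
      by (simp only: True Suc_eq_plus1)
  next
    case False
    define r where "r = Transposition.transpose b (Suc b)"
    have b: "b < n" "1 \<le> b" "a < b" "b \<le> n" using Suc.prems False by auto
    have r: "F (u \<circ> r) = F u" for u :: "nat \<Rightarrow> int"
      using inv[of b u] b unfolding simple_refl_transpose[OF b(1)] r_def by simp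
    have e: "t \<circ> Transposition.transpose a (Suc b) = (t \<circ> r) \<circ> Transposition.transpose a b \<circ> r"
      using b by (auto simp: fun_eq_iff r_def Transposition.transpose_def)
    show ?thesis
      unfolding e r Suc.IH[OF Suc.prems(1) b(3,4)] ..
  qed
qed simp

lemma invariant_transpose: "a \<in> {1..n} \<Longrightarrow> b \<in> {1..n} \<Longrightarrow> F ((t :: nat \<Rightarrow> int) \<circ> Transposition.transpose a b) = F t"
  using invariant_transpose_less[of a b t] invariant_transpose_less[of b a t]
  by (cases a b rule: linorder_cases) (auto simp: transpose_commute)

lemma invariant_permutes:
  assumes "\<sigma> permutes {1..n}" shows "F ((t :: nat \<Rightarrow> int) \<circ> \<sigma>) = F t"
  using assms finite_atLeastAtMost
proof (induction \<sigma> arbitrary: t rule: permutes_induct)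
  case (swap a b p)
  show ?case
    unfolding comp_assoc[symmetric] swap.IH by (rule invariant_transpose[OF swap(1,2)])
qed auto

text \<open>Every change of one sign is conjugate, under a transposition, to that of the last
  coordinate, which is the reflection in the long simple root.\<close>

lemma invariant_negate: "A \<subseteq> {1..n} \<Longrightarrow> F (negate_on A t) = F t"
proof -
  assume A: "A \<subseteq> {1..n}"
  have one: "F (t(i := - t i)) = F t" if i: "i \<in> {1..n}" for i t
  proof -
    let ?r = "Transposition.transpose i n"
    have "t(i := - t i) = simple_refl n n (t \<circ> ?r) \<circ> ?r"
      by (auto simp: simple_refl_def fun_eq_iff Transposition.transpose_def)
    moreover have "n \<in> {1..n}" using n by simp
    ultimately show ?thesis
      using invariant_transpose[OF i, of n] inv[OF n order_refl] by metis
  qed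
  show ?thesis
    using finite_subset[OF A finite_atLeastAtMost] A
  proof (induction A arbitrary: t rule: finite_induct)
    case empty
    then show ?case
      by (simp add: negate_on_def)
  next
    case (insert i A)
    have "negate_on (insert i A) t = negate_on A (t(i := - t i))"
      using insert by (auto simp: negate_on_def fun_eq_iff)
    then show ?case
      using insert one by simp
  qed
qed

text \<open>The cone bounds the first coordinate from below. By invariance, plus or minus any
  coordinate can be moved to the first place, which bounds all coordinates on both sides.\<close>

lemma invariant_finite_support:
  assumes "csupp n F" shows "finite {t. F t \<noteq> 0}"
proof -
  obtain B where B: "\<And>t. t \<notin> lattice_cone n B \<Longrightarrow> F t = 0"
    using assms by (auto simp: csupp_def)
  have 1: "- int B \<le> t 1" "\<And>l. l \<notin> {1..n} \<Longrightarrow> t l = 0" if "F t \<noteq> 0" for t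
  proof -
    have "t \<in> lattice_cone n B" using B that by blast
    moreover have "psum t 1 = t 1" by (simp add: psum_def)
    ultimately show "- int B \<le> t 1" "\<And>l. l \<notin> {1..n} \<Longrightarrow> t l = 0"
      using n by (force simp: lattice_cone_def)+
  qed
  have "t i \<in> {- int B..int B}" if t: "F t \<noteq> 0" and i: "i \<in> {1..n}" for t i
  proof -
    have "F (t \<circ> Transposition.transpose i 1) \<noteq> 0" "F (negate_on {i} t \<circ> Transposition.transpose i 1) \<noteq> 0"
      using i invariant_transpose invariant_negate t by auto
    from 1(1)[OF this(1)] 1(1)[OF this(2)] show ?thesis
      by (simp add: negate_on_def)
  qed
  then have "{t. F t \<noteq> 0} \<subseteq> {t. \<forall>i. (i \<in> {1..n} \<longrightarrow> t i \<in> {- int B..int B}) \<and> (i \<notin> {1..n} \<longrightarrow> t i = 0)}"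
    using 1(2) by blast
  moreover have "finite {t. \<forall>i. (i \<in> {1..n} \<longrightarrow> t i \<in> {- int B..int B}) \<and> (i \<notin> {1..n} \<longrightarrow> t i = 0)}"
    by (rule finite_set_of_finite_funs) auto
  ultimately show ?thesis
    by (rule finite_subset)
qed

end

definition laurent :: "nat \<Rightarrow> nat \<Rightarrow> ((nat \<Rightarrow> int) \<Rightarrow> complex) \<Rightarrow> (nat \<Rightarrow> complex) \<Rightarrow> complex" where
  "laurent q n F z = (\<Sum>t\<in>{t. F t \<noteq> 0}. F t * of_nat q powr pairing n t z)"

lemma pairing_signed_perm:
  assumes \<sigma>: "\<sigma> permutes {1..n}" and \<epsilon>: "\<forall>i\<in>{1..n}. \<epsilon> i \<in> {1, -1 :: complex}"
  shows "pairing n t (\<lambda>i. if i \<in> {1..n} then \<epsilon> i * z (\<sigma> i) else z i) =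
    pairing n (negate_on {i \<in> {1..n}. \<epsilon> i = - 1} t \<circ> inv_into UNIV \<sigma>) z"
proof -
  let ?t = "negate_on {i \<in> {1..n}. \<epsilon> i = - 1} t \<circ> inv_into UNIV \<sigma>"
  have "pairing n ?t z = (\<Sum>i\<in>{1..n}. of_int (?t (\<sigma> i)) * z (\<sigma> i))"
    unfolding pairing_def using sum.permute[OF \<sigma>, of "\<lambda>i. of_int (?t i) * z i"] by (simp add: comp_def)
  also have "\<dots> = (\<Sum>i\<in>{1..n}. of_int (t i) * (\<epsilon> i * z (\<sigma> i)))"
    using \<epsilon> permutes_inverses[OF \<sigma>] by (intro sum.cong) (auto simp: negate_on_def)
  also have "\<dots> = pairing n t (\<lambda>i. if i \<in> {1..n} then \<epsilon> i * z (\<sigma> i) else z i)"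
    unfolding pairing_def by (intro sum.cong) auto
  finally show ?thesis ..
qed

text \<open>A signed permutation of z is transferred to the exponents through the pairing. There it
  permutes the finite support and preserves the coefficients, so it merely reorders the sum.\<close>

lemma W_invariant_laurent:
  assumes n: "1 \<le> n" and inv: "\<And>i t. 1 \<le> i \<Longrightarrow> i \<le> n \<Longrightarrow> F (simple_refl n i t) = F t" and F: "csupp n F"
  shows "W_invariant n (laurent q n F)"
  unfolding W_invariant_def
proof (intro ballI allI)
  fix w z assume "w \<in> signed_perms n"
  then obtain \<sigma> \<epsilon> where \<sigma>: "\<sigma> permutes {1..n}" and \<epsilon>: "\<forall>i\<in>{1..n}. \<epsilon> i \<in> {1, -1 :: complex}"
    and w: "w = (\<lambda>z i. if i \<in> {1..n} then \<epsilon> i * z (\<sigma> i) else z i)"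
    unfolding signed_perms_def by blast
  define A where "A = {i \<in> {1..n}. \<epsilon> i = - 1}"
  define h where "h t = negate_on A t \<circ> inv_into UNIV \<sigma>" for t
  let ?S = "{t. F t \<noteq> 0}"
  have A: "A \<subseteq> {1..n}" by (auto simp: A_def)
  have Fh: "F (h t) = F t" for t
    using invariant_permutes[OF n inv permutes_inv[OF \<sigma>], of "negate_on A t"] invariant_negate[OF n inv A, of t]
    by (simp add: h_def comp_def)
  have inj: "inj h"
  proof (rule injI)
    fix t u assume "h t = h u"
    then have "h t \<circ> \<sigma> = h u \<circ> \<sigma>" by simp
    then have "negate_on A t = negate_on A u"
      using permutes_inverses[OF \<sigma>] by (simp add: h_def fun_eq_iff)
    then have "negate_on A (negate_on A t) = negate_on A (negate_on A u)" by simp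
    moreover have "negate_on A (negate_on A v) = v" for v by (auto simp: negate_on_def fun_eq_iff)
    ultimately show "t = u" by simp
  qed
  have "h ` ?S = ?S"
  proof (rule endo_inj_surj)
    show "finite ?S" by (rule invariant_finite_support[OF n inv F])
  qed (use Fh inj in \<open>auto simp: inj_on_def inj_def\<close>)
  then have "laurent q n F z = (\<Sum>t\<in>h ` ?S. F t * of_nat q powr pairing n t z)"
    by (simp add: laurent_def)
  also have "\<dots> = (\<Sum>t\<in>?S. F (h t) * of_nat q powr pairing n (h t) z)"
    using inj by (subst sum.reindex) (auto simp: inj_on_def inj_def)
  also have "\<dots> = (\<Sum>t\<in>?S. F t * of_nat q powr pairing n (h t) z)" by (simp only: Fh)
  also have "\<dots> = laurent q n F (w z)"
    unfolding laurent_def w h_def A_def pairing_signed_perm[OF \<sigma> \<epsilon>] ..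
  finally show "laurent q n F (w z) = laurent q n F z" ..
qed

section \<open>The ring of Laurent polynomials and rational continuation\<close>

lemma powr_of_nat_exp: "1 \<le> q \<Longrightarrow> (of_nat q :: complex) powr w = exp (of_real (ln (real q)) * w)"
  by (simp add: powr_def Ln_of_nat mult.commute)

lemma pairing_cong: "(\<And>i. i \<in> {1..n} \<Longrightarrow> z i = z' i) \<Longrightarrow> pairing n t z = pairing n t z'"
  by (simp add: pairing_def)

lemma pairing_add: "pairing n (\<lambda>l. t l + u l) z = pairing n t z + pairing n u z"
  by (simp add: pairing_def distrib_right sum.distrib)

lemma laurent_ringE:
  assumes "P \<in> laurent_ring q n"
  obtains S c where "finite S" "P = (\<lambda>z. \<Sum>t\<in>S. c t * (of_nat q :: complex) powr pairing n t z)"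
  using assms unfolding laurent_ring_def by blast

lemma laurent_ring_monomial: "(\<lambda>z. c * (of_nat q :: complex) powr pairing n t z) \<in> laurent_ring q n"
  unfolding laurent_ring_def by (rule CollectI, rule exI[of _ "{t}"], rule exI[of _ "\<lambda>_. c"]) simp

lemma laurent_ring_add:
  assumes "P \<in> laurent_ring q n" "Q \<in> laurent_ring q n" shows "(\<lambda>z. P z + Q z) \<in> laurent_ring q n"
proof -
  obtain S c where P: "finite S" "P = (\<lambda>z. \<Sum>t\<in>S. c t * (of_nat q :: complex) powr pairing n t z)"
    by (rule laurent_ringE[OF assms(1)])
  obtain S' c' where Q: "finite S'" "Q = (\<lambda>z. \<Sum>t\<in>S'. c' t * (of_nat q :: complex) powr pairing n t z)"
    by (rule laurent_ringE[OF assms(2)])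
  define d where "d t = (if t \<in> S then c t else 0) + (if t \<in> S' then c' t else 0)" for t
  have "P z + Q z = (\<Sum>t\<in>S \<union> S'. d t * (of_nat q :: complex) powr pairing n t z)" for z
  proof -
    have "P z = (\<Sum>t\<in>S \<union> S'. (if t \<in> S then c t else 0) * (of_nat q :: complex) powr pairing n t z)"
      unfolding P(2) using P(1) Q(1) by (intro sum.mono_neutral_cong_left) auto
    moreover have "Q z = (\<Sum>t\<in>S \<union> S'. (if t \<in> S' then c' t else 0) * (of_nat q :: complex) powr pairing n t z)"
      unfolding Q(2) using P(1) Q(1) by (intro sum.mono_neutral_cong_left) auto
    ultimately show ?thesis
      by (simp add: d_def distrib_right sum.distrib)
  qed
  then show ?thesis
    unfolding laurent_ring_def using P(1) Q(1) by blast
qed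

lemma laurent_ring_sum:
  assumes "finite A" "\<And>i. i \<in> A \<Longrightarrow> P i \<in> laurent_ring q n" shows "(\<lambda>z. \<Sum>i\<in>A. P i z) \<in> laurent_ring q n"
  using assms
proof (induction A rule: finite_induct)
  case empty
  show ?case
    using laurent_ring_monomial[of 0] by simp
next
  case (insert a A)
  then show ?case
    using laurent_ring_add[of "P a" q n "\<lambda>z. \<Sum>i\<in>A. P i z"] by simp
qed

lemma laurent_ring_const: "1 \<le> q \<Longrightarrow> (\<lambda>z. c) \<in> laurent_ring q n"
  using laurent_ring_monomial[of c q n "\<lambda>_. 0"] by (simp add: pairing_def)

lemma laurent_ring_mult:
  assumes "1 \<le> q" "P \<in> laurent_ring q n" "Q \<in> laurent_ring q n" shows "(\<lambda>z. P z * Q z) \<in> laurent_ring q n"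
proof -
  obtain S c where P: "finite S" "P = (\<lambda>z. \<Sum>t\<in>S. c t * (of_nat q :: complex) powr pairing n t z)"
    by (rule laurent_ringE[OF assms(2)])
  obtain S' c' where Q: "finite S'" "Q = (\<lambda>z. \<Sum>t\<in>S'. c' t * (of_nat q :: complex) powr pairing n t z)"
    by (rule laurent_ringE[OF assms(3)])
  have "P z * Q z = (\<Sum>(t, u)\<in>S \<times> S'. (c t * c' u) * (of_nat q :: complex) powr pairing n (\<lambda>l. t l + u l) z)" for z
    unfolding P(2) Q(2) sum_product sum.cartesian_product pairing_add powr_add
    by (intro sum.cong) (auto simp: mult_ac)
  moreover have "(\<lambda>z. \<Sum>(t, u)\<in>S \<times> S'. (c t * c' u) * (of_nat q :: complex) powr pairing n (\<lambda>l. t l + u l) z) \<in> laurent_ring q n"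
    using P(1) Q(1) laurent_ring_sum[of "S \<times> S'" "\<lambda>(t, u) z. (c t * c' u) * (of_nat q :: complex) powr pairing n (\<lambda>l. t l + u l) z" q n]
      laurent_ring_monomial by (auto simp: case_prod_unfold)
  ultimately show ?thesis
    by simp
qed

lemma laurent_ring_prod:
  assumes "1 \<le> q" "finite A" "\<And>i. i \<in> A \<Longrightarrow> P i \<in> laurent_ring q n" shows "(\<lambda>z. \<Prod>i\<in>A. P i z) \<in> laurent_ring q n"
  using assms(2,3)
proof (induction A rule: finite_induct)
  case empty
  show ?case
    using laurent_ring_const[OF assms(1), of 1] by simp
next
  case (insert a A)
  then show ?case
    using laurent_ring_mult[OF assms(1), of "P a" n "\<lambda>z. \<Prod>i\<in>A. P i z"] by simp
qed

lemma laurent_ring_laurent: "finite {t. F t \<noteq> 0} \<Longrightarrow> laurent q n F \<in> laurent_ring q n"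
  unfolding laurent_ring_def laurent_def by blast

lemma laurent_ring_depends:
  assumes "P \<in> laurent_ring q n" "\<And>i. i \<in> {1..n} \<Longrightarrow> z i = z' i" shows "P z = P z'"
  using assms(1) pairing_cong[of n z z'] assms(2) by (auto elim!: laurent_ringE)

lemma laurent_ring_line_holomorphic:
  assumes "1 \<le> q" "P \<in> laurent_ring q n" "\<And>i. (\<lambda>w. z w i) holomorphic_on UNIV"
  shows "(\<lambda>w. P (z w)) holomorphic_on UNIV"
proof -
  obtain S c where P: "P = (\<lambda>z. \<Sum>t\<in>S. c t * (of_nat q :: complex) powr pairing n t z)"
    by (rule laurent_ringE[OF assms(2)])
  show ?thesis
    unfolding P powr_of_nat_exp[OF assms(1)] pairing_def by (intro holomorphic_intros assms(3))
qed

lemma laurent_ring_holomorphic_n: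
  assumes q: "1 \<le> q" and P: "P \<in> laurent_ring q n" shows "holomorphic_n n P"
  unfolding holomorphic_n_def depends_on_first_def
proof (intro conjI allI ballI impI)
  show "P z = P z'" if "\<forall>i\<in>{1..n}. z i = z' i" for z z'
    using laurent_ring_depends[OF P] that by blast
  obtain S c where P': "P = (\<lambda>z. \<Sum>t\<in>S. c t * (of_nat q :: complex) powr pairing n t z)"
    by (rule laurent_ringE[OF P])
  show "continuous_on UNIV P"
    unfolding P' powr_of_nat_exp[OF q] pairing_def by (intro continuous_intros continuous_on_product_coordinates)
  show "(\<lambda>w. P (z(i := w))) holomorphic_on UNIV" for z i
  proof (rule laurent_ring_line_holomorphic[OF q P])
    show "(\<lambda>w. (z(i := w)) j) holomorphic_on UNIV" for j by (cases "j = i") auto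
  qed
qed

text \<open>The translate of a half-space along the diagonal covers everything, so one complex variable suffices
  for the identity theorem.\<close>

lemma laurent_ring_identity:
  assumes q: "1 \<le> q" and P: "P \<in> laurent_ring q n" and 0: "\<And>s. (\<forall>i\<in>{1..n}. Re (s i) \<ge> 0) \<Longrightarrow> P s = 0"
  shows "P s = 0"
proof -
  define f where "f w = P (\<lambda>i. s i + w)" for w
  define R where "R = (\<Sum>i\<in>{1..n}. \<bar>Re (s i)\<bar>)"
  have f: "f holomorphic_on UNIV"
    unfolding f_def by (rule laurent_ring_line_holomorphic[OF q P]) (intro holomorphic_intros)
  have f0: "f w = 0" if "w \<in> {w. Re w > R}" for w
  proof -
    have "\<bar>Re (s i)\<bar> \<le> R" if "i \<in> {1..n}" for i
      unfolding R_def using that by (intro member_le_sum) auto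
    then show ?thesis
      unfolding f_def using that by (intro 0) force
  qed
  have "f 0 = 0"
  proof (rule analytic_continuation_open[of "{w. Re w > R}" UNIV f "\<lambda>_. 0"])
    show "open {w. Re w > R}" by (rule open_halfspace_Re_gt)
    show "{w. Re w > R} \<noteq> {}" by (auto intro!: exI[of _ "of_real (R + 1)"])
  qed (use f f0 in auto)
  then show ?thesis
    by (simp add: f_def)
qed

text \<open>For two fractions continuing the same integral, the cross products agree where all real
  parts are nonnegative, hence everywhere by the identity theorem. The definite description is
  therefore met by any such fraction whose denominator does not vanish at s.\<close>

lemma spherical_function_eqI:
  assumes q: "1 \<le> q" and c: "continued_by q n (spherical_integral nrm star n dk x) P Q" and Q: "Q s \<noteq> 0"
  shows "spherical_function q nrm star n dk x s = P s / Q s"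
  unfolding spherical_function_def
proof (rule the_equality)
  show "\<exists>P' Q'. continued_by q n (spherical_integral nrm star n dk x) P' Q' \<and> Q' s \<noteq> 0 \<and> P s / Q s = P' s / Q' s"
    using c Q by blast
  fix v assume "\<exists>P' Q'. continued_by q n (spherical_integral nrm star n dk x) P' Q' \<and> Q' s \<noteq> 0 \<and> v = P' s / Q' s"
  then obtain P' Q' where c': "continued_by q n (spherical_integral nrm star n dk x) P' Q'" and Q': "Q' s \<noteq> 0" and v: "v = P' s / Q' s"
    by blast
  note cD = c[unfolded continued_by_def] and c'D = c'[unfolded continued_by_def]
  define E where "E s = P s * Q' s + (- 1) * (P' s * Q s)" for s
  have "E \<in> laurent_ring q n"
    unfolding E_def using cD c'D by (intro laurent_ring_add laurent_ring_mult laurent_ring_const q) auto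
  then have "E s = 0"
  proof (rule laurent_ring_identity[OF q])
    fix s :: "nat \<Rightarrow> complex" assume "\<forall>i\<in>{1..n}. Re (s i) \<ge> 0"
    then have "P s = Q s * spherical_integral nrm star n dk x s" "P' s = Q' s * spherical_integral nrm star n dk x s"
      using cD c'D by blast+
    then show "E s = 0" by (simp add: E_def)
  qed
  then show "v = P s / Q s" using Q Q' by (simp add: E_def v field_simps)
qed

text \<open>Reindexing the unconditional sum by the translation turns it into multiplication by the
  monomial of \<open>\<beta>\<close>.\<close>

lemma has_sum_tw:
  assumes f: "((\<lambda>t. f t * (of_nat q :: complex) powr pairing n t z) has_sum S) UNIV"
  shows "((\<lambda>t. tw c \<beta> f t * of_nat q powr pairing n t z) has_sum ((1 + c * of_nat q powr pairing n \<beta> z) * S)) UNIV"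
proof -
  let ?h = "\<lambda>t l. t l - \<beta> l"
  have bij: "bij_betw ?h UNIV UNIV" by (rule bij_betw_byWitness[of _ "\<lambda>t l. t l + \<beta> l"]) auto
  have "((\<lambda>t. f (?h t) * of_nat q powr pairing n (?h t) z) has_sum S) UNIV"
    using f has_sum_reindex_bij_betw[OF bij, of "\<lambda>t. f t * of_nat q powr pairing n t z"] by simp
  then have "((\<lambda>t. (c * of_nat q powr pairing n \<beta> z) * (f (?h t) * of_nat q powr pairing n (?h t) z)) has_sum
      ((c * of_nat q powr pairing n \<beta> z) * S)) UNIV"
    by (rule has_sum_cmult_right)
  moreover have "(c * of_nat q powr pairing n \<beta> z) * (f (?h t) * of_nat q powr pairing n (?h t) z) =
      c * f (?h t) * of_nat q powr pairing n t z" for t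
    using pairing_add[of n "?h t" \<beta> z] by (simp add: powr_add mult_ac)
  ultimately have "((\<lambda>t. c * f (?h t) * of_nat q powr pairing n t z) has_sum ((c * of_nat q powr pairing n \<beta> z) * S)) UNIV"
    by (simp only:)
  from has_sum_add[OF f this] show ?thesis
    by (simp add: tw_def algebra_simps)
qed

lemma has_sum_tws:
  assumes "finite A" "((\<lambda>t. f t * (of_nat q :: complex) powr pairing n t z) has_sum S) UNIV"
  shows "((\<lambda>t. tws c A f t * of_nat q powr pairing n t z) has_sum ((\<Prod>\<beta>\<in>A. 1 + c * of_nat q powr pairing n \<beta> z) * S)) UNIV"
  using assms(1)
proof (induction A rule: finite_induct)
  case (insert \<beta> A)
  from has_sum_tw[OF insert.IH, of c \<beta>] show ?case
    using insert(1,2) by (simp add: tws_insert mult.assoc)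
qed (use assms(2) in simp)

section \<open>The affine change between the variables s and z\<close>

definition z_of_s :: "nat \<Rightarrow> nat \<Rightarrow> (nat \<Rightarrow> complex) \<Rightarrow> nat \<Rightarrow> complex" where
  "z_of_s q n s i = (\<Sum>j\<in>{i..n}. - s j - 1 + (if j < n then of_real pi * \<i> / of_real (ln (real q))
     else of_real pi * \<i> / (2 * of_real (ln (real q)))))"

lemma s_of_z_z_of_s: "i \<in> {1..n} \<Longrightarrow> s_of_z q n (z_of_s q n s) i = s i"
  by (auto simp: s_of_z_def z_of_s_def sum.atLeast_Suc_atMost[of i])

lemma z_of_s_s_of_z: "i \<in> {1..n} \<Longrightarrow> z_of_s q n (s_of_z q n z) i = z i"
proof -
  assume "i \<in> {1..n}"
  then have "i \<le> n" by simp
  then show ?thesis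
  proof (induction rule: inc_induct)
    case (step i)
    then show ?case
      by (simp add: z_of_s_def s_of_z_def sum.atLeast_Suc_atMost[of i])
  qed (simp add: z_of_s_def s_of_z_def)
qed

text \<open>The substitution is affine with integral linear part: it sends the exponent t to the
  negatives of its partial sums. Monomials go to monomials, and the constant terms are absorbed by
  the coefficients. This brings functions of z into the variable s in which the continuation is
  defined.\<close>

lemma laurent_ring_z_of_s:
  assumes "P \<in> laurent_ring q n" shows "(\<lambda>s. P (z_of_s q n s)) \<in> laurent_ring q n"
proof -
  obtain S c where S: "finite S" and P: "P = (\<lambda>z. \<Sum>t\<in>S. c t * (of_nat q :: complex) powr pairing n t z)"
    by (rule laurent_ringE[OF assms])
  define d where "d j = - 1 + (if j < n then of_real pi * \<i> / of_real (ln (real q))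
     else of_real pi * \<i> / (2 * of_real (ln (real q))))" for j
  have "pairing n t (z_of_s q n s) = (\<Sum>j\<in>{1..n}. of_int (psum t j) * d j) + pairing n (\<lambda>j. - psum t j) s" for t s
  proof -
    have "pairing n t (z_of_s q n s) = (\<Sum>i\<in>{1..n}. \<Sum>j\<in>{1..n}. if i \<le> j then of_int (t i) * (d j - s j) else 0)"
      unfolding pairing_def
    proof (intro sum.cong refl)
      fix i assume "i \<in> {1..n}"
      then have e: "{i..n} = {j \<in> {1..n}. i \<le> j}" by auto
      show "of_int (t i) * z_of_s q n s i = (\<Sum>j\<in>{1..n}. if i \<le> j then of_int (t i) * (d j - s j) else 0)"
        unfolding z_of_s_def e sum.inter_filter[OF finite_atLeastAtMost] sum_distrib_left
        by (intro sum.cong) (auto simp: d_def)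
    qed
    also have "\<dots> = (\<Sum>j\<in>{1..n}. \<Sum>i\<in>{1..n}. if i \<le> j then of_int (t i) * (d j - s j) else 0)"
      by (rule sum.swap)
    also have "\<dots> = (\<Sum>j\<in>{1..n}. of_int (psum t j) * (d j - s j))"
    proof (intro sum.cong refl)
      fix j assume "j \<in> {1..n}"
      then have e: "{1..j} = {i \<in> {1..n}. i \<le> j}" by auto
      show "(\<Sum>i\<in>{1..n}. if i \<le> j then of_int (t i) * (d j - s j) else 0) = of_int (psum t j) * (d j - s j)"
        unfolding psum_def e sum.inter_filter[OF finite_atLeastAtMost] of_int_sum sum_distrib_right
        by (intro sum.cong) auto
    qed
    finally show ?thesis
      by (simp add: pairing_def algebra_simps sum_subtractf sum_negf)
  qed
  then have "P (z_of_s q n s) = (\<Sum>t\<in>S. (c t * of_nat q powr (\<Sum>j\<in>{1..n}. of_int (psum t j) * d j)) * of_nat q powr pairing n (\<lambda>j. - psum t j) s)" for s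
    unfolding P by (simp add: powr_add mult.assoc)
  then show ?thesis
    using laurent_ring_sum[OF S, of "\<lambda>t s. (c t * of_nat q powr (\<Sum>j\<in>{1..n}. of_int (psum t j) * d j)) * of_nat q powr pairing n (\<lambda>j. - psum t j) s"]
      laurent_ring_monomial by simp
qed

subsection \<open>The spherical function as a Laurent series\<close>

text \<open>Summation by parts: the valuations of the minors pair with the differences of the
  z-coordinates as the exponent t pairs with z itself.\<close>

lemma abel_summation:
  fixes z :: "nat \<Rightarrow> complex"
  shows "(\<Sum>i\<in>{1..m}. of_int (psum t i) * (z i - z (Suc i))) = (\<Sum>i\<in>{1..m}. of_int (t i) * z i) - of_int (psum t m) * z (Suc m)"
  by (induction m) (simp_all add: psum_Suc algebra_simps)

lemma countable_int_support: "countable {t :: nat \<Rightarrow> int. \<forall>i. i \<notin> {1..n} \<longrightarrow> t i = 0}"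
proof -
  have "{t :: nat \<Rightarrow> int. \<forall>i. i \<notin> {1..n} \<longrightarrow> t i = 0} \<subseteq> (\<lambda>xs i. if i \<in> {1..n} then xs ! i else 0) ` (UNIV :: int list set)"
  proof
    fix t :: "nat \<Rightarrow> int" assume "t \<in> {t. \<forall>i. i \<notin> {1..n} \<longrightarrow> t i = 0}"
    then have "t = (\<lambda>i. if i \<in> {1..n} then map t [0..<Suc n] ! i else 0)"
      by (auto simp: fun_eq_iff simp del: upt_Suc)
    then show "t \<in> (\<lambda>xs i. if i \<in> {1..n} then xs ! i else 0) ` UNIV" by (rule image_eqI) simp
  qed
  then show ?thesis
    by (rule countable_subset) simp
qed

text \<open>Together with countability this enumerates the exponents by the natural numbers, as
  required for integrating a series term by term.\<close>

lemma infinite_int_support: "1 \<le> n \<Longrightarrow> infinite {t :: nat \<Rightarrow> int. \<forall>i. i \<notin> {1..n} \<longrightarrow> t i = 0}"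
proof
  assume n: "1 \<le> n" and fin: "finite {t :: nat \<Rightarrow> int. \<forall>i. i \<notin> {1..n} \<longrightarrow> t i = 0}"
  have "range (\<lambda>(c::int) (i::nat). if i = 1 then c else 0) \<subseteq> {t. \<forall>i. i \<notin> {1..n} \<longrightarrow> t i = 0}"
    using n by auto
  then have "finite (range (\<lambda>(c::int) (i::nat). if i = 1 then c else 0))"
    using fin by (rule finite_subset)
  moreover have "inj (\<lambda>(c::int) (i::nat). if i = 1 then c else 0)" by (rule injI) (metis (no_types))
  ultimately show False
    using finite_imageD infinite_UNIV_int by blast
qed

context spherical_setting begin

definition support :: "(nat \<Rightarrow> int) set" where
  "support = {t. \<forall>i. i \<notin> {1..n} \<longrightarrow> t i = 0}"

definition weight :: "(nat \<Rightarrow> complex) \<Rightarrow> (nat \<Rightarrow> int) \<Rightarrow> complex" where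
  "weight s t = (\<Prod>i\<in>{1..n}. complex_of_real (real q powi (- psum t i)) powr s i)"

lemma ln_q_pos: "0 < ln (real q)" using q_ge_2 by simp

lemma weight_factor: "complex_of_real (real q powi (- m)) powr w = exp (- of_int m * of_real (ln (real q)) * w)"
proof -
  have "real q powi (- m) = exp (of_int (- m) * ln (real q))"
    using q_ge_2 exp_power_int[of "ln (real q)" "- m"] by simp
  then have "complex_of_real (real q powi (- m)) = exp (of_real (of_int (- m) * ln (real q)))"
    by (simp only: exp_of_real)
  moreover have "Ln (exp (of_real (of_int (- m) * ln (real q)))) = of_real (of_int (- m) * ln (real q))"
    by (subst Ln_exp) (auto simp: pi_gt_zero)
  ultimately show ?thesis
    unfolding powr_def by (simp add: mult_ac)
qed

lemma fiber_value: "g \<in> fiber t \<Longrightarrow> (\<Prod>i\<in>{1..n}. complex_of_real (nrm (minor i g)) powr s i) = weight s t"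
  unfolding weight_def fiber_def by (intro prod.cong) auto

text \<open>On nonempty fibers the valuations of the minors are bounded below, so with nonnegative
  real parts each factor is bounded independently of the fiber.\<close>

lemma weight_bound:
  assumes s: "\<forall>i\<in>{1..n}. 0 \<le> Re (s i)"
  shows "\<exists>C. \<forall>t. fiber t \<noteq> {} \<longrightarrow> norm (weight s t) \<le> C"
proof -
  obtain B where B: "\<And>t. fiber t \<noteq> {} \<Longrightarrow> (\<forall>i\<in>{1..n}. - int B \<le> psum t i)"
    using fiber_cone by blast
  have "norm (weight s t) \<le> (\<Prod>i\<in>{1..n}. exp (real B * ln (real q) * Re (s i)))" if t: "fiber t \<noteq> {}" for t
    unfolding weight_def prod_norm[symmetric]
  proof (rule prod_mono, rule conjI)
    fix i assume i: "i \<in> {1..n}"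
    have "norm (complex_of_real (real q powi (- psum t i)) powr s i) = exp (- of_int (psum t i) * ln (real q) * Re (s i))"
      unfolding weight_factor by (simp add: norm_exp_eq_Re)
    also have "\<dots> \<le> exp (real B * ln (real q) * Re (s i))"
    proof -
      have "- int B \<le> psum t i" using B[OF t] i by blast
      then have "- of_int (psum t i) \<le> real B" by linarith
      then have "- of_int (psum t i) * (ln (real q) * Re (s i)) \<le> real B * (ln (real q) * Re (s i))"
        using s i ln_q_pos by (intro mult_right_mono) auto
      then show ?thesis
        by (simp add: mult.assoc)
    qed
    finally show "norm (complex_of_real (real q powi (- psum t i)) powr s i) \<le> exp (real B * ln (real q) * Re (s i))" .
  qed simp
  then show ?thesis
    by blast
qed

lemma fiber_disjoint:
  assumes "t \<in> support" "u \<in> support" "g \<in> fiber t" "g \<in> fiber u" shows "t = u"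
proof -
  have ps: "psum t i = psum u i" if i: "i \<le> n" for i
  proof (cases "i = 0")
    case False
    then have "i \<in> {1..n}" using i by simp
    then have "real q powi (- psum t i) = real q powi (- psum u i)"
      using assms(3,4) unfolding fiber_def by auto
    then show ?thesis
      unfolding q_powi_eq_iff by simp
  qed simp
  have "t i = u i" for i
  proof (cases "i \<in> {1..n}")
    case True
    then have "i = Suc (i - 1)" "i \<le> n" by auto
    then show ?thesis
      using ps[of i] ps[of "i - 1"] psum_Suc[of t "i - 1"] psum_Suc[of u "i - 1"] by simp
  next
    case False
    then show ?thesis
      using assms(1,2) by (simp add: support_def)
  qed
  then show ?thesis
    by blast
qed

lemma domain_fiber: "{g \<in> K. \<forall>i\<in>{1..n}. minor i g \<noteq> 0} = (\<Union>t\<in>support. fiber t)"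
proof (intro equalityI subsetI)
  fix g assume g: "g \<in> {g \<in> K. \<forall>i\<in>{1..n}. minor i g \<noteq> 0}"
  then have "\<forall>i\<in>{1..n}. \<exists>m. nrm (minor i g) = real q powi (- m)" using ex_nrm_eq by blast
  then obtain m where m: "\<And>i. i \<in> {1..n} \<Longrightarrow> nrm (minor i g) = real q powi (- m i)"
    by metis
  define m' where "m' i = (if i = 0 then 0 else m i)" for i
  define t where "t i = (if i \<in> {1..n} then m' i - m' (i - 1) else 0)" for i
  have "psum t i = m' i" if "i \<le> n" for i using that by (induction i) (auto simp: psum_Suc t_def m'_def)
  then have "g \<in> fiber t" using g m by (auto simp: fiber_def m'_def)
  moreover have "t \<in> support" by (simp add: support_def t_def)
  ultimately show "g \<in> (\<Union>t\<in>support. fiber t)" by blast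
next
  fix g assume "g \<in> (\<Union>t\<in>support. fiber t)"
  then show "g \<in> {g \<in> K. \<forall>i\<in>{1..n}. minor i g \<noteq> 0}"
    using fiber_subset fiber_minor_nz by blast
qed

text \<open>The fibers decompose the domain of integration into countably many open sets on which
  the integrand is constant. The weights of the nonempty fibers are bounded and the measures of
  disjoint fibers are summable, so the integral may be taken term by term and the series converges
  absolutely.\<close>

lemma spherical_has_sum:
  assumes s: "\<forall>i\<in>{1..n}. 0 \<le> Re (s i)"
  shows "((\<lambda>t. of_real (measure dk (fiber t)) * weight s t) has_sum spherical_integral nrm star n dk x s) support"
proof -
  interpret finite_measure dk
    by (rule finite_measure_dk)
  define T where "T = from_nat_into support"
  have bij: "bij_betw T UNIV support"
    unfolding T_def support_def by (rule bij_betw_from_nat_into[OF countable_int_support infinite_int_support[OF n_ge_1]])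
  have Ts: "T j \<in> support" for j using bij by (auto simp: bij_betw_def)
  have Tinj: "i = j" if "g \<in> fiber (T i)" "g \<in> fiber (T j)" for g i j
    using fiber_disjoint[OF Ts Ts that] bij by (auto simp: bij_betw_def inj_def)
  obtain C where C: "\<And>t. fiber t \<noteq> {} \<Longrightarrow> norm (weight s t) \<le> C"
    using weight_bound[OF s] by blast
  define f where "f j g = indicat_real (fiber (T j)) g *\<^sub>R weight s (T j)" for j g
  define w where "w j = of_real (measure dk (fiber (T j))) * weight s (T j)" for j
  have int: "integrable dk (f j)" and fw: "(\<integral>g. f j g \<partial>dk) = w j"
    and nf: "(\<integral>g. norm (f j g) \<partial>dk) = measure dk (fiber (T j)) * norm (weight s (T j))" for j
  proof -
    have 1: "integrable dk (indicat_real (fiber (T j)))"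
      using fiber_sets by (simp add: integrable_indicator_iff less_top[symmetric])
    have I: "(\<integral>g. indicat_real (fiber (T j)) g \<partial>dk) = measure dk (fiber (T j))"
      using fiber_subset[of "T j"] haarD(1) by (simp add: Int_absorb2)
    show "integrable dk (f j)" unfolding f_def using 1 by simp
    show "(\<integral>g. f j g \<partial>dk) = w j"
      unfolding f_def w_def using 1 I by (simp add: scaleR_conv_of_real)
    show "(\<integral>g. norm (f j g) \<partial>dk) = measure dk (fiber (T j)) * norm (weight s (T j))"
      unfolding f_def using 1 I by simp
  qed
  have single: "f j g = 0" if "g \<in> fiber (T i)" "j \<noteq> i" for i j g
  proof -
    have "g \<notin> fiber (T j)" using Tinj[OF that(1), of j] that(2) by blast
    then show ?thesis
      by (simp add: f_def)
  qed
  have ptw: "summable (\<lambda>j. norm (f j g))" "(\<Sum>j. f j g) = indicat_real {g \<in> K. \<forall>i\<in>{1..n}. minor i g \<noteq> 0} g *\<^sub>R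
      (\<Prod>i\<in>{1..n}. complex_of_real (nrm (minor i g)) powr s i)" for g
  proof -
    consider i where "g \<in> fiber (T i)" | "\<And>j. g \<notin> fiber (T j)"
      by blast
    then have "summable (\<lambda>j. norm (f j g)) \<and> (\<Sum>j. f j g) = indicat_real {g \<in> K. \<forall>i\<in>{1..n}. minor i g \<noteq> 0} g *\<^sub>R
      (\<Prod>i\<in>{1..n}. complex_of_real (nrm (minor i g)) powr s i)"
    proof cases
      case 1
      have "summable (\<lambda>j. norm (f j g))"
        by (rule summable_finite[of "{i}"]) (use single[OF 1] in auto)
      moreover have "(\<Sum>j. f j g) = f i g"
        using suminf_finite[of "{i}" "\<lambda>j. f j g"] single[OF 1] by simp
      moreover have "g \<in> {g \<in> K. \<forall>i\<in>{1..n}. minor i g \<noteq> 0}"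
        unfolding domain_fiber using 1 Ts by blast
      ultimately show ?thesis
        using 1 fiber_value[OF 1] by (simp add: f_def)
    next
      case 2
      then have f0: "f j g = 0" for j by (simp add: f_def)
      have "g \<notin> {g \<in> K. \<forall>i\<in>{1..n}. minor i g \<noteq> 0}"
        unfolding domain_fiber using 2 bij by (force simp: bij_betw_def)
      then show ?thesis
        unfolding f0 by simp
    qed
    then show "summable (\<lambda>j. norm (f j g))" "(\<Sum>j. f j g) = indicat_real {g \<in> K. \<forall>i\<in>{1..n}. minor i g \<noteq> 0} g *\<^sub>R
      (\<Prod>i\<in>{1..n}. complex_of_real (nrm (minor i g)) powr s i)"
      by auto
  qed
  have "(\<lambda>j. measure dk (fiber (T j))) sums measure dk (\<Union>j. fiber (T j))"
  proof (rule finite_measure_UNION)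
    show "disjoint_family (\<lambda>j. fiber (T j))" unfolding disjoint_family_on_def using Tinj by blast
  qed (use fiber_sets in auto)
  then have sm: "summable (\<lambda>j. \<bar>C\<bar> * measure dk (fiber (T j)))"
    by (intro summable_mult) (rule sums_summable)
  have le: "measure dk (fiber (T j)) * norm (weight s (T j)) \<le> \<bar>C\<bar> * measure dk (fiber (T j))" for j
  proof (cases "fiber (T j) = {}")
    case False
    then show ?thesis
      using C[OF False] by (subst mult.commute) (intro mult_right_mono, auto)
  qed simp
  have ns: "summable (\<lambda>j. measure dk (fiber (T j)) * norm (weight s (T j)))"
    by (rule summable_comparison_test[OF _ sm]) (use le in auto)
  have "w sums (\<integral>g. (\<Sum>j. f j g) \<partial>dk)"
    using sums_integral[of dk f] int ptw(1) ns unfolding fw nf by simp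
  also have "(\<integral>g. (\<Sum>j. f j g) \<partial>dk) = spherical_integral nrm star n dk x s"
    unfolding ptw(2) spherical_integral_def set_lebesgue_integral_def minor_def ..
  finally have "w sums spherical_integral nrm star n dk x s" .
  moreover have "summable (\<lambda>j. norm (w j))" using ns by (simp add: w_def norm_mult)
  ultimately have "(w has_sum spherical_integral nrm star n dk x s) UNIV" by (intro norm_summable_imp_has_sum)
  then show ?thesis
    unfolding w_def using has_sum_reindex_bij_betw[OF bij, of "\<lambda>t. of_real (measure dk (fiber t)) * weight s t"] by simp
qed

text \<open>Up to the constant \<open>\<eta> i\<close>, the product of \<open>ln q\<close> and
  \<open>- s i\<close> is \<open>ln q\<close> times the difference of consecutive z-coordinates. The
  exponentials of these constants are -q and \<open>- \<i> * q\<close>, the bases in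
  \<open>\<kappa>\<close>, and Abel summation collects the rest into the pairing of t with
  z.\<close>

lemma weight_coef:
  assumes z: "\<And>i. i \<in> {1..n} \<Longrightarrow> s i = s_of_z q n z i"
  shows "weight s t = \<kappa> t * of_nat q powr pairing n t z"
proof -
  define L where "L = complex_of_real (ln (real q))"
  have L0: "L \<noteq> 0" using ln_q_pos by (simp add: L_def)
  have eL: "exp L = of_nat q" using q_ge_2 by (simp add: L_def exp_of_real)
  define b where "b i = (if i < n then - of_nat q else - \<i> * of_nat q :: complex)" for i
  define \<eta> where "\<eta> i = L - (if i < n then of_real pi * \<i> else of_real pi * \<i> / 2)" for i
  have b: "b i = exp (\<eta> i)" for i
  proof -
    have e2: "exp (of_real pi * \<i> / 2) = \<i>" using cis_conv_exp[of "pi / 2"] by (simp add: mult.commute)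
    show ?thesis
      by (auto simp: \<eta>_def exp_diff eL b_def e2)
  qed
  \<comment> \<open>Adding a vanishing coordinate after the last one makes the last case of
    \<open>s_of_z\<close> fit the pattern of the others.\<close>
  define z' where "z' i = (if i = Suc n then 0 else z i)" for i
  have fac: "complex_of_real (real q powi (- psum t i)) powr s i = b i powi psum t i * exp (L * (of_int (psum t i) * (z' i - z' (Suc i))))"
    if i: "i \<in> {1..n}" for i
  proof -
    have "L * s i = - L * (z' i - z' (Suc i)) - \<eta> i"
    proof -
      define d where "d = (if i < n then of_real pi * \<i> else of_real pi * \<i> / 2 :: complex)"
      have "s i = - z' i + z' (Suc i) - 1 + d / L"
        using i unfolding z[OF i] s_of_z_def z'_def L_def[symmetric] d_def by (cases "i < n") auto
      moreover have "L * (- u + v - 1 + d / L) = - L * (u - v) - (L - d)" for u v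
        using L0 by (simp add: field_simps)
      ultimately show ?thesis
        by (simp only: \<eta>_def d_def)
    qed
    then have "- of_int (psum t i) * (L * s i) = - of_int (psum t i) * (- L * (z' i - z' (Suc i)) - \<eta> i)"
      by (simp only:)
    then have "- of_int (psum t i) * L * s i = of_int (psum t i) * \<eta> i + L * (of_int (psum t i) * (z' i - z' (Suc i)))"
      by (simp add: algebra_simps)
    then show ?thesis
      unfolding weight_factor L_def[symmetric] b exp_power_int by (simp add: exp_add)
  qed
  have "weight s t = (\<Prod>i\<in>{1..n}. b i powi psum t i) * exp (\<Sum>i\<in>{1..n}. L * (of_int (psum t i) * (z' i - z' (Suc i))))"
    unfolding weight_def using fac by (simp add: exp_sum prod.distrib)
  also have "(\<Sum>i\<in>{1..n}. L * (of_int (psum t i) * (z' i - z' (Suc i)))) = L * pairing n t z"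
    unfolding sum_distrib_left[symmetric] abel_summation by (simp add: z'_def pairing_def)
  also have "exp (L * pairing n t z) = of_nat q powr pairing n t z"
    using q_ge_2 powr_of_nat_exp[of q "pairing n t z"] by (simp add: L_def)
  also have "(\<Prod>i\<in>{1..n}. b i powi psum t i) = \<kappa> t" by (simp add: \<kappa>_def b_def)
  finally show ?thesis .
qed

lemma coef_has_sum:
  assumes s: "\<forall>i\<in>{1..n}. 0 \<le> Re (s i)"
  shows "((\<lambda>t. coef t * of_nat q powr pairing n t (z_of_s q n s)) has_sum spherical_integral nrm star n dk x s) UNIV"
proof -
  have "weight s t = \<kappa> t * of_nat q powr pairing n t (z_of_s q n s)" for t
    by (rule weight_coef) (simp add: s_of_z_z_of_s)
  then have "((\<lambda>t. of_real (measure dk (fiber t)) * (\<kappa> t * of_nat q powr pairing n t (z_of_s q n s))) has_sum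
      spherical_integral nrm star n dk x s) support"
    using spherical_has_sum[OF s] by simp
  then show ?thesis
    by (subst has_sum_cong_neutral[where T = support and g = "\<lambda>t. of_real (measure dk (fiber t)) * (\<kappa> t * of_nat q powr pairing n t (z_of_s q n s))"])
      (auto simp: coef_def support_def mult_ac)
qed

lemma spherical_function_continuation:
  "\<exists>F. generically_equal q n F (\<lambda>z. G_factor q n z * spherical_function q nrm star n dk x (s_of_z q n z)) \<and>
    holomorphic_n n F \<and> W_invariant n F \<and> F \<in> laurent_ring q n"
proof -
  define a where "a = 1 / (of_nat q :: complex)"
  have q1: "1 \<le> q" using q_ge_2 by simp
  have coef: "csupp n coef" using coef_cone by (simp add: csupp_def)
  have pos: "\<And>\<beta>. \<beta> \<in> pos_roots n \<Longrightarrow> positive n \<beta>"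
    by (rule positive_pos_roots)
  obtain F where F: "csupp n F" "tws (- a) (pos_roots n) F = tws 1 (pos_roots n) coef"
    using tws_solve[OF finite_pos_roots pos csupp_tws[OF finite_pos_roots coef pos, where c = 1], where a = a] by blast
  have inv: "F (simple_refl n i t) = F t" if "1 \<le> i" "i \<le> n" for i t
    using weyl_symmetry[OF coef F that] coef_reflection[OF that] unfolding a_def by blast
  have fin: "finite {t. F t \<noteq> 0}" by (rule invariant_finite_support[OF n_ge_1 inv F(1)])
  define E where "E = laurent q n F"
  define M where "M z = (\<Prod>\<beta>\<in>pos_roots n. 1 + 1 * (of_nat q :: complex) powr pairing n \<beta> z)" for z
  define D where "D z = (\<Prod>\<beta>\<in>pos_roots n. 1 + (- a) * (of_nat q :: complex) powr pairing n \<beta> z)" for z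
  have fac: "(\<lambda>z. 1 + c * (of_nat q :: complex) powr pairing n \<beta> z) \<in> laurent_ring q n" for c \<beta>
    by (intro laurent_ring_add laurent_ring_const[OF q1] laurent_ring_monomial)
  have ring: "E \<in> laurent_ring q n" "M \<in> laurent_ring q n" "D \<in> laurent_ring q n"
    unfolding E_def M_def D_def
    by (intro laurent_ring_laurent fin laurent_ring_prod[OF q1] finite_pos_roots fac)+
  \<comment> \<open>The two products have the same coefficients by \<open>F(2)\<close>, and their
    series both converge at this point. Comparing the sums gives the identity without dividing
    series.\<close>
  have key: "D (z_of_s q n s) * E (z_of_s q n s) = M (z_of_s q n s) * spherical_integral nrm star n dk x s"
    if s: "\<forall>i\<in>{1..n}. 0 \<le> Re (s i)" for s
  proof -
    let ?z = "z_of_s q n s"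
    have "((\<lambda>t. F t * of_nat q powr pairing n t ?z) has_sum E ?z) UNIV"
      unfolding E_def laurent_def
      by (subst has_sum_cong_neutral[where T = "{t. F t \<noteq> 0}" and g = "\<lambda>t. F t * of_nat q powr pairing n t ?z"]) (use fin in auto)
    from has_sum_tws[OF finite_pos_roots[of n] this, of "- a"] has_sum_tws[OF finite_pos_roots[of n] coef_has_sum[OF s], of 1]
    show ?thesis
      unfolding F(2) D_def M_def by (rule has_sum_unique)
  qed
  define P where "P s = D (z_of_s q n s) * E (z_of_s q n s)" for s
  define Q where "Q s = M (z_of_s q n s)" for s
  have zs: "R (z_of_s q n (s_of_z q n z)) = R z" if "R \<in> laurent_ring q n" for R z
    by (rule laurent_ring_depends[OF that]) (rule z_of_s_s_of_z)
  have nz: "M (\<lambda>_. 0) \<noteq> 0" "D (\<lambda>_. 0) \<noteq> 0"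
    using q_ge_2 by (auto simp: M_def D_def pairing_def a_def finite_pos_roots)
  have cont: "continued_by q n (spherical_integral nrm star n dk x) P Q"
    unfolding continued_by_def
  proof (intro conjI allI impI)
    show "P \<in> laurent_ring q n" "Q \<in> laurent_ring q n"
      using laurent_ring_z_of_s[OF laurent_ring_mult[OF q1 ring(3,1)]] laurent_ring_z_of_s[OF ring(2)]
      by (simp_all add: P_def[abs_def] Q_def[abs_def])
    show "\<exists>s. Q s \<noteq> 0"
      using nz(1) zs[OF ring(2)] by (auto simp: Q_def intro!: exI[of _ "s_of_z q n (\<lambda>_. 0)"])
  qed (simp add: P_def Q_def key)
  have "generically_equal q n E (\<lambda>z. G_factor q n z * spherical_function q nrm star n dk x (s_of_z q n z))"
    unfolding generically_equal_def
  \<comment> \<open>Where \<open>M\<close> does not vanish, the fraction with denominator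
    \<open>Q\<close> has a value; where \<open>D\<close> does not vanish, \<open>G_factor\<close> is
    a genuine quotient.\<close>
  proof (intro bexI[of _ "\<lambda>z. M z * D z"] conjI allI impI)
    show "\<exists>z. M z * D z \<noteq> 0" using nz by auto
    show "(\<lambda>z. M z * D z) \<in> laurent_ring q n" by (rule laurent_ring_mult[OF q1 ring(2,3)])
    fix z assume z: "M z * D z \<noteq> 0"
    have "spherical_function q nrm star n dk x (s_of_z q n z) = P (s_of_z q n z) / Q (s_of_z q n z)"
      using z by (intro spherical_function_eqI[OF q1 cont]) (simp add: Q_def zs[OF ring(2)])
    also have "\<dots> = D z * E z / M z"
      by (simp add: P_def Q_def zs[OF ring(1)] zs[OF ring(2)] zs[OF ring(3)])
    finally have sph: "spherical_function q nrm star n dk x (s_of_z q n z) = D z * E z / M z" .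
    have "G_factor q n z = M z / D z"
      using q_ge_2 by (simp add: G_factor_def M_def D_def prod_dividef powr_diff a_def)
    then show "E z = G_factor q n z * spherical_function q nrm star n dk x (s_of_z q n z)"
      unfolding sph using z by simp
  qed
  moreover have "W_invariant n E" unfolding E_def by (rule W_invariant_laurent[OF n_ge_1 inv F(1)])
  moreover have "holomorphic_n n E" by (rule laurent_ring_holomorphic_n[OF q1 ring(1)])
  ultimately show ?thesis
    using ring(1) by blast
qed

end

theorem theorem2p8:
  fixes p q n :: nat
    and k :: "'a::field_char_0 set"
    and star :: "'a \<Rightarrow> 'a"
    and nrm :: "'a \<Rightarrow> real"
    and uf :: 'a
    and dk :: "'a mat measure"
    and x :: "'a mat"
  assumes "unramified_quadratic_extension p q k star nrm uf"
    and "n \<ge> 1"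
    and "normalized_Haar nrm star n dk"
    and "x \<in> hermitian_space star n"
  shows "\<exists>F. generically_equal q n F
               (\<lambda>z. G_factor q n z * spherical_function q nrm star n dk x (s_of_z q n z)) \<and>
             holomorphic_n n F \<and> W_invariant n F \<and> F \<in> laurent_ring q n"
proof -
  interpret spherical_setting p q k star nrm uf n dk x
    using assms by (intro spherical_setting.intro spherical_setting_axioms.intro)
  show ?thesis
    by (rule spherical_function_continuation)
qed

end
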